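(* For every $c_1, c_2 \geq 1$ and all positive integers $k < n$ with $k = \log^{\omega(1)}(n)$, there exists an explicit $(k,\epsilon)$-extractor $E : \{0,1\}^n \times \{0,1\}^d \to \{0,1\}^m$ with $$d = O(c_1 c_2 \log n),\qquad k - m = O\left(\frac{k}{\log^{c_2}(n)}\right),\qquad \epsilon = O\left(\frac{1}{\log^{c_1}(n)}\right).$$
   Context: Logarithms are base 2; $k = \log^{\omega(1)}(n)$ means $k$ grows faster than every fixed power of $\log n$. Statistical distance between random variables $\mathsf{X},\mathsf{Y}$ on a finite set $\Omega$ is $\max_{T\subseteq\Omega}|\Pr[\mathsf{X}\in T]-\Pr[\mathsf{Y}\in T]|$; $\epsilon$-close means distance at most $\epsilon$. Min-entropy: $H_\infty(\mathsf{X}) = \min_{x\in\mathrm{supp}(\mathsf{X})}\log_2(1/\Pr[\mathsf{X}=x])$. An $(n,k)$-source is a random variable on $\{0,1\}^n$ with min-entropy at least $k$. A function $E:\{0,1\}^n\times\{0,1\}^d\to\{0,1\}^m$ is a $(k,\epsilon)$-extractor if for every $(n,k)$-source $\mathsf{X}$ and $\mathsf{U}_d$ uniform on $\{0,1\}^d$ independent of $\mathsf{X}$, $E(\mathsf{X},\mathsf{U}_d)$ is $\epsilon$-close to uniform on $\{0,1\}^m$. It is explicit if computable in polynomial time. The $O(\cdot)$ hide absolute constants. *)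

theory Defs
  imports "HOL-Probability.Probability" "HOL-Library.Landau_Symbols"
begin

section \<open>Sources and extractors\<close>

definition bits :: "nat \<Rightarrow> bool list set" where
  "bits n = {xs. length xs = n}"

lemma finite_bits: "finite (bits n)"
  using finite_lists_length_eq[of "UNIV :: bool set" n] by (simp add: bits_def)

lemma bits_nonempty: "bits n \<noteq> {}"
  using Ex_list_of_length[of n] by (auto simp: bits_def)

text \<open>
  A random variable on a finite set enters only through its distribution, so it is
  represented by a pmf whose support lies in that set.
\<close>

definition stat_dist :: "'a set \<Rightarrow> 'a pmf \<Rightarrow> 'a pmf \<Rightarrow> real" where
  "stat_dist \<Omega> X Y =
     Max ((\<lambda>T. \<bar>measure_pmf.prob X T - measure_pmf.prob Y T\<bar>) ` Pow \<Omega>)"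

text \<open>Only meaningful for finitely supported distributions, as \<open>Max\<close> and \<open>Min\<close> are elsewhere here.\<close>

definition min_entropy :: "'a pmf \<Rightarrow> real" where
  "min_entropy X = Min ((\<lambda>x. log 2 (1 / pmf X x)) ` set_pmf X)"

definition is_source :: "nat \<Rightarrow> real \<Rightarrow> bool list pmf \<Rightarrow> bool" where
  "is_source n k X \<longleftrightarrow> set_pmf X \<subseteq> bits n \<and> k \<le> min_entropy X"

definition uniform_bits :: "nat \<Rightarrow> bool list pmf" where
  "uniform_bits m = pmf_of_set (bits m)"

definition is_extractor ::
  "nat \<Rightarrow> nat \<Rightarrow> nat \<Rightarrow> real \<Rightarrow> real \<Rightarrow> (bool list \<Rightarrow> bool list \<Rightarrow> bool list) \<Rightarrow> bool" where
  "is_extractor n d m k \<epsilon> E \<longleftrightarrow>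
     (\<forall>x\<in>bits n. \<forall>s\<in>bits d. E x s \<in> bits m) \<and>
     (\<forall>X. is_source n k X \<longrightarrow>
        stat_dist (bits m)
          (map_pmf (\<lambda>(x, s). E x s) (pair_pmf X (uniform_bits d)))
          (uniform_bits m) \<le> \<epsilon>)"

section \<open>Deterministic multitape Turing machines\<close>

datatype move = MLeft | MStay | MRight

text \<open>
  States, tape symbols and tapes are numbered \<open>{..<states}\<close>, \<open>{..<symbols}\<close>, \<open>{..<tapes}\<close>.
  Symbol 0 is the blank, 1 and 2 are the bits, 3 is a separator; further
  symbols are for the machine's own use. Tape 0 carries the input, tape 1 the output.
\<close>

record turing_machine =
  states :: nat
  symbols :: nat
  tapes :: nat
  start :: nat
  halt :: nat
  delta :: "nat \<Rightarrow> nat list \<Rightarrow> nat \<times> (nat \<times> move) list"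

definition wf_tm :: "turing_machine \<Rightarrow> bool" where
  "wf_tm M \<longleftrightarrow>
     4 \<le> symbols M \<and> 2 \<le> tapes M \<and> start M < states M \<and> halt M < states M \<and>
     (\<forall>q<states M. \<forall>as. length as = tapes M \<longrightarrow> set as \<subseteq> {..<symbols M} \<longrightarrow>
        fst (delta M q as) < states M \<and>
        length (snd (delta M q as)) = tapes M \<and>
        fst ` set (snd (delta M q as)) \<subseteq> {..<symbols M})"

text \<open>A two-way infinite tape together with the head position.\<close>

type_synonym tape = "(int \<Rightarrow> nat) \<times> int"
type_synonym config = "nat \<times> tape list"

definition read_tape :: "tape \<Rightarrow> nat" where
  "read_tape t = fst t (snd t)"

fun move_head :: "move \<Rightarrow> int \<Rightarrow> int" where
  "move_head MLeft h = h - 1"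
| "move_head MStay h = h"
| "move_head MRight h = h + 1"

definition act_tape :: "tape \<Rightarrow> nat \<times> move \<Rightarrow> tape" where
  "act_tape t a = ((fst t)(snd t := fst a), move_head (snd a) (snd t))"

definition tm_step :: "turing_machine \<Rightarrow> config \<Rightarrow> config" where
  "tm_step M c =
     (if fst c = halt M then c
      else let r = delta M (fst c) (map read_tape (snd c))
           in (fst r, map2 act_tape (snd c) (snd r)))"

definition tape_content :: "nat list \<Rightarrow> int \<Rightarrow> nat" where
  "tape_content w i = (if 0 \<le> i \<and> i < int (length w) then w ! nat i else 0)"

definition initial_config :: "turing_machine \<Rightarrow> nat list \<Rightarrow> config" where
  "initial_config M w =
     (start M, (tape_content w, 0) # replicate (tapes M - 1) (tape_content [], 0))"

definition outputs_within :: "turing_machine \<Rightarrow> nat \<Rightarrow> nat list \<Rightarrow> nat list \<Rightarrow> bool" where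
  "outputs_within M t w v \<longleftrightarrow>
     (let c = (tm_step M ^^ t) (initial_config M w)
      in fst c = halt M \<and> fst (snd c ! 1) = tape_content v)"

definition enc_bits :: "bool list \<Rightarrow> nat list" where
  "enc_bits = map (\<lambda>b. if b then 2 else 1)"

text \<open>A tuple of bit strings is written as their concatenation, each one followed by a separator.\<close>

definition enc_tuple :: "bool list list \<Rightarrow> nat list" where
  "enc_tuple xss = concat (map (\<lambda>xs. enc_bits xs @ [3]) xss)"

text \<open>
  One machine and one polynomial bound serve all instances \<open>i \<in> I\<close>; on instance \<open>i\<close>
  the machine is given \<open>inp i\<close> and has to produce \<open>out i\<close>. Halting configurations
  are fixed points of \<open>tm_step\<close>, so halting within the bound is halting at the bound.
\<close>

definition poly_time_computable ::
  "'i set \<Rightarrow> ('i \<Rightarrow> bool list list) \<Rightarrow> ('i \<Rightarrow> bool list) \<Rightarrow> bool" where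
  "poly_time_computable I inp out \<longleftrightarrow>
     (\<exists>M a e. wf_tm M \<and>
        (\<forall>i\<in>I. outputs_within M (a + a * length (enc_tuple (inp i)) ^ e)
                 (enc_tuple (inp i)) (enc_bits (out i))))"

text \<open>
  Explicitness is a property of a family \<open>E n\<close> (\<open>n \<ge> 2\<close>), where \<open>E n\<close> is meant for
  min-entropy \<open>k n\<close> and has seed length \<open>d n\<close>: one polynomial-time algorithm evaluates all members.
  As usual for extractors, the parameters are part of the input: \<open>n\<close> and \<open>d n\<close> as the lengths
  of the source string and the seed, and \<open>k n\<close> in unary, which is shorter than the source
  string when \<open>k n < n\<close>. The entropy bound has to be supplied because an
  arbitrary function \<open>k\<close> need not be computable.
\<close>

definition explicit_family ::
  "(nat \<Rightarrow> nat) \<Rightarrow> (nat \<Rightarrow> nat) \<Rightarrow> (nat \<Rightarrow> bool list \<Rightarrow> bool list \<Rightarrow> bool list) \<Rightarrow> bool" where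
  "explicit_family k d E \<longleftrightarrow>
     poly_time_computable
       {(n, x, s). 2 \<le> n \<and> x \<in> bits n \<and> s \<in> bits (d n)}
       (\<lambda>(n, x, s). [replicate (k n) True, x, s])
       (\<lambda>(n, x, s). E n x s)"

text \<open>\<open>k = log\<^sup>\<omega>\<^sup>(\<^sup>1\<^sup>)(n)\<close>: \<open>k\<close> grows faster than every fixed power of \<open>log n\<close>.\<close>

definition superpolylog :: "(nat \<Rightarrow> nat) \<Rightarrow> bool" where
  "superpolylog k \<longleftrightarrow>
     (\<forall>a::real. (\<lambda>n. log 2 (real n) powr a) \<in> o(\<lambda>n. real (k n)))"

end

theory Submission
  imports Defs "HOL-Computational_Algebra.Computational_Algebra" "HOL-Number_Theory.Cong"
begin

text \<open>
 For every test set the inputs whose output hits it too often are counted; such counts compose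
 without any reference to sources. In one round, the values \<open>f(y), f(y + 1), ...\<close> of the input
 polynomial over the field with \<open>p\<^sup>2\<close> elements form a lossless condenser of rate about \<open>1/2\<close>,
 because modulo \<open>Y\<^sup>p - Y - 1\<close> the shift by one is the Frobenius map. Cut the condensed string at
 \<open>log n\<close> places: at one of the cuts the prefix has almost all of the entropy and the suffix still
 has a polylogarithmic amount, so Trevisan's extractor applied to the prefix, with a seed extracted
 from the suffix, yields an almost uniform row. Merging the rows along a curve (method of
 multiplicities) gives a string of entropy rate \<open>1 - o(1)\<close>, and the same prefix-suffix extraction now
 outputs all but a fraction \<open>1/\<lambda>\<close> of the entropy, \<open>\<lambda>\<close> being about the cube root of \<open>log n\<close>, with a seed
 of length \<open>O(log n)\<close>. After \<open>O(c2)\<close> rounds with fresh seeds, each for a min-entropy smaller by the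
 factor \<open>\<lambda>\<close>, at most \<open>O(k / log\<^sup>c\<^sup>2 n)\<close> bits are lost. All of this is arithmetic on numbers of polynomial
 size with bounded recursion, which a machine evaluates with head positions as counters; the
 finitely many short lengths are served by a table of extractors that exist by counting.
\<close>

section \<open>Counting roots modulo a prime ideal\<close>

text \<open>The condenser evaluates over the field with p^2 elements because the root-counting
  argument needs more points than a degree that exceeds p. A symbol then occupies 2 log p bits and
  carries log p bits of entropy, whence the rate 1/2. Using the shift as Frobenius spares the
  algorithm an irreducible polynomial or a generator: Y^p - Y - 1 occurs in the analysis only, and
  even there its irreducibility is replaced by a prime ideal from Zorn's lemma. At rate 1/2 no fixed
  place splits a string well, since either part may be constant; this forces the many cuts, of which
  an unknown one works, and then the merger. At rate 1 - o(1) a fixed split suffices: a long prefix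
  and a short suffix both keep enough entropy. \<lambda> is a cube root of log n so that relative
  losses of order 1/log n, from the design and from the spacing of the cuts, are O(1/\<lambda>^3).
  They disappear in the fraction 1/\<lambda>^2 of the symbols given up in each row, which in turn
  disappears in the fraction 1/\<lambda> left unextracted by a round.\<close>

definition zideal :: "'a::comm_ring_1 set => bool" where
 "zideal Z \<longleftrightarrow> 0 \<in> Z \<and> (\<forall>x\<in>Z. \<forall>y\<in>Z. x + y \<in> Z) \<and> (\<forall>x\<in>Z. \<forall>r. r * x \<in> Z)"

text \<open>Residue fields depend on \<open>n\<close>, so they are not built as types: elements are
  integers or integer polynomials, and equality in the quotient is membership of the difference in a
  prime ideal.\<close>

definition zprime :: "'a::comm_ring_1 set => bool" where
 "zprime Z \<longleftrightarrow> zideal Z \<and> 1 \<notin> Z \<and> (\<forall>x y. x * y \<in> Z \<longrightarrow> x \<in> Z \<or> y \<in> Z)"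

lemma zidealD:
 assumes "zideal Z"
 shows "0 \<in> Z" "x \<in> Z ==> y \<in> Z ==> x + y \<in> Z" "x \<in> Z ==> r * x \<in> Z" "x \<in> Z ==> x * r \<in> Z"
  "x \<in> Z ==> - x \<in> Z" "x \<in> Z ==> y \<in> Z ==> x - y \<in> Z"
proof -
 show 1: "0 \<in> Z" "x \<in> Z ==> y \<in> Z ==> x + y \<in> Z" "x \<in> Z ==> r * x \<in> Z" for x y r
  using assms by (auto simp: zideal_def)
 show "x \<in> Z ==> x * r \<in> Z" using 1(3)[of x r] by (simp add: mult.commute)
 show 2: "x \<in> Z ==> - x \<in> Z" for x using 1(3)[of x "-1"] by simp
 show "x \<in> Z ==> y \<in> Z ==> x - y \<in> Z" using 1(2)[of x "- y"] 2[of y] by simp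
qed

lemma zprimeD:
 assumes "zprime Z"
 shows "zideal Z" "1 \<notin> Z" "x * y \<in> Z ==> x \<in> Z \<or> y \<in> Z"
 using assms by (auto simp: zprime_def)

lemma zideal_sum: "zideal Z ==> (\<And>x. x \<in> A ==> f x \<in> Z) ==> sum f A \<in> Z"
 by (induction A rule: infinite_finite_induct) (auto intro: zidealD)

lemma zideal_diff_trans: "zideal Z ==> x - y \<in> Z ==> y - z \<in> Z ==> x - z \<in> Z"
 using zidealD(2)[of Z "x - y" "y - z"] by simp

lemma zideal_diff_mult:
 assumes "zideal Z" "x - x' \<in> Z" "y - y' \<in> Z"
 shows "x * y - x' * y' \<in> Z"
proof -
 have "x * y - x' * y' = (x - x') * y + x' * (y - y')" by (simp add: algebra_simps)
 then show ?thesis using assms by (auto intro: zidealD)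
qed

lemma zideal_diff_power: "zideal Z ==> x - x' \<in> Z ==> x ^ n - x' ^ n \<in> Z"
 by (induction n) (auto intro: zideal_diff_mult zidealD)

lemma zideal_diff_prod:
 "zideal Z ==> (\<And>i. i \<in> A ==> f i - g i \<in> Z) ==> prod f A - prod g A \<in> Z"
 by (induction A rule: infinite_finite_induct) (auto intro: zideal_diff_mult zidealD)

lemma zideal_diff_sum:
 "zideal Z ==> (\<And>i. i \<in> A ==> f i - g i \<in> Z) ==> sum f A - sum g A \<in> Z"
 unfolding sum_subtractf[symmetric] by (rule zideal_sum)

lemma zideal_mem_cong: "zideal Z ==> x - y \<in> Z ==> x \<in> Z \<longleftrightarrow> y \<in> Z"
 using zidealD(2)[of Z "x - y" y] zidealD(6)[of Z x "x - y"] by auto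

text \<open>Zeros are divided off one at a time: synthetic division by X - a lowers the degree and
  the multiplicity at \<open>a\<close> by one. At another point b the factor b - a lies outside the
  prime ideal, so it can be cancelled from the Taylor coefficients and the multiplicity there is
  kept.\<close>

lemma root_count_mult:
 fixes R :: "'a::comm_ring_1 poly"
 assumes Z: "zprime Z" and A: "finite A" and sep: "\<And>a b. a \<in> A ==> b \<in> A ==> a \<noteq> b ==> a - b \<notin> Z"
  and roots: "\<And>a k. a \<in> A ==> k < \<mu> a ==> coeff (R \<circ>\<^sub>p [:a, 1:]) k \<in> Z"
  and deg: "degree R < sum \<mu> A"
 shows "coeff R i \<in> Z"
 using roots deg
proof (induction "degree R" arbitrary: R \<mu> i rule: less_induct)
 case less
 have I: "zideal Z" using Z by (rule zprimeD)
 obtain a where a: "a \<in> A" "0 < \<mu> a" using less.prems(2) by (metis gr_implies_not0 gr0I sum.neutral)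
 define c where "c = poly R a"
 define S where "S = synthetic_div R a"
 have c: "c \<in> Z" using less.prems(1)[OF a] by (simp add: c_def coeff_0 flip: poly_0_coeff_0) (simp add: poly_pcompose)
 have R: "R = [:- a, 1:] * S + [:c:]" unfolding c_def S_def by (rule synthetic_div_correct'[symmetric])
 have RS: "R \<circ>\<^sub>p [:b, 1:] = [:b - a, 1:] * (S \<circ>\<^sub>p [:b, 1:]) + [:c:]" for b
 proof -
  have "[:- a, 1:] \<circ>\<^sub>p [:b, 1:] = [:b - a, 1:]" by (simp add: pcompose_pCons)
  then show ?thesis by (subst R) (simp only: pcompose_add pcompose_mult pcompose_const)
 qed
 \<comment> \<open>Taylor coefficients of \<open>R\<close> at \<open>b\<close> in terms of those of
   the quotient; for b = a the first term vanishes and the orders shift by one.\<close>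
 have Rk: "coeff (R \<circ>\<^sub>p [:b, 1:]) k = (b - a) * coeff (S \<circ>\<^sub>p [:b, 1:]) k +
   (if k = 0 then c else coeff (S \<circ>\<^sub>p [:b, 1:]) (k - 1))" for b k
  unfolding RS by (cases k) (auto simp: algebra_simps)
 have SZ: "coeff S j \<in> Z" if "0 < degree R" for j
 proof (rule less.hyps[of S "\<mu>(a := \<mu> a - 1)"])
  have dS: "degree S = degree R - 1" unfolding S_def by (rule degree_synthetic_div)
  then show "degree S < degree R" using that by simp
  have "sum \<mu> A = \<mu> a + sum \<mu> (A - {a})" using A a by (simp add: sum.remove)
  moreover have "sum (\<mu>(a := \<mu> a - 1)) A = \<mu> a - 1 + sum \<mu> (A - {a})"
   using A a by (simp add: sum.remove)
  ultimately show "degree S < sum (\<mu>(a := \<mu> a - 1)) A" using less.prems(2) a(2) dS that by linarith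
  fix b k assume b: "b \<in> A" "k < (\<mu>(a := \<mu> a - 1)) b"
  show "coeff (S \<circ>\<^sub>p [:b, 1:]) k \<in> Z"
  proof (cases "b = a")
   case True
   then have "coeff (R \<circ>\<^sub>p [:a, 1:]) (Suc k) \<in> Z" using b a by (intro less.prems(1)) auto
   then show ?thesis using Rk[of a "Suc k"] True by simp
  next
   case False
   have "k < \<mu> b ==> coeff (S \<circ>\<^sub>p [:b, 1:]) k \<in> Z"
   proof (induction k)
    case 0
    then have "(b - a) * coeff (S \<circ>\<^sub>p [:b, 1:]) 0 + c \<in> Z" using less.prems(1)[OF b(1) 0] Rk[of b 0] by simp
    then have "(b - a) * coeff (S \<circ>\<^sub>p [:b, 1:]) 0 \<in> Z" using zidealD(6)[OF I _ c] by fastforce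
    then show ?case using zprimeD(3)[OF Z] sep[OF b(1) a(1) False] by blast
   next
    case (Suc k)
    then have "(b - a) * coeff (S \<circ>\<^sub>p [:b, 1:]) (Suc k) + coeff (S \<circ>\<^sub>p [:b, 1:]) k \<in> Z"
     using less.prems(1)[OF b(1) Suc.prems] Rk[of b "Suc k"] by simp
    then have "(b - a) * coeff (S \<circ>\<^sub>p [:b, 1:]) (Suc k) \<in> Z"
     using zidealD(6)[OF I, of _ "coeff (S \<circ>\<^sub>p [:b, 1:]) k"] Suc by fastforce
    then show ?case using zprimeD(3)[OF Z] sep[OF b(1) a(1) False] by blast
   qed
   then show ?thesis using b False by simp
  qed
 qed
 show ?case
 proof (cases "degree R = 0")
  case True
  then obtain r where r: "R = [:r:]" by (rule degree_eq_zeroE)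
  then show ?thesis using c zidealD(1)[OF I] by (simp add: c_def coeff_pCons split: nat.splits)
 next
  case False
  then have "coeff S j \<in> Z" for j using SZ by simp
  then show ?thesis using c by (subst R) (auto simp: coeff_pCons split: nat.splits intro: zidealD[OF I])
 qed
qed

lemma root_count:
 fixes R :: "'a::comm_ring_1 poly"
 assumes "zprime Z" "finite A" "\<And>a b. a \<in> A ==> b \<in> A ==> a \<noteq> b ==> a - b \<notin> Z"
  and "\<And>a. a \<in> A ==> poly R a \<in> Z" and "degree R < card A"
 shows "coeff R i \<in> Z"
proof (rule root_count_mult[OF assms(1,2,3), where \<mu> = "%_. 1"])
 show "coeff (R \<circ>\<^sub>p [:a, 1:]) k \<in> Z" if "a \<in> A" "k < 1" for a k
  using assms(4)[OF that(1)] that(2) by (simp flip: poly_0_coeff_0 add: poly_pcompose)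
qed (use assms in auto)

lemma zprime_int: "prime p ==> zprime {x::int. int p dvd x}"
 unfolding zprime_def zideal_def
 by (auto simp: prime_dvd_mult_iff prime_gt_1_nat dest: prime_gt_1_nat)

text \<open>A maximal proper ideal above \<open>I\<close> is prime. Mere existence suffices, as the
  ideal occurs in the analysis and not in the function that is computed.\<close>

lemma exists_zprime:
 assumes I: "zideal I" "1 \<notin> I"
 shows "\<exists>M. I \<subseteq> M \<and> zprime M"
proof -
 define \<A> where "\<A> = {J. zideal J \<and> 1 \<notin> J \<and> I \<subseteq> J}"
 have "\<exists>M\<in>\<A>. \<forall>X\<in>\<A>. M \<subseteq> X \<longrightarrow> X = M"
 proof (rule subset_Zorn_nonempty)
  show "\<A> \<noteq> {}" using I by (auto simp: \<A>_def)
  fix \<C> assume C: "\<C> \<noteq> {}" "subset.chain \<A> \<C>"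
  then have Cs: "\<And>J. J \<in> \<C> ==> zideal J \<and> 1 \<notin> J \<and> I \<subseteq> J"
   and ch: "\<And>J K. J \<in> \<C> ==> K \<in> \<C> ==> J \<subseteq> K \<or> K \<subseteq> J"
   by (auto simp: subset.chain_def \<A>_def subset_chain_def)
  have "zideal (\<Union>\<C>)" unfolding zideal_def
  proof (intro conjI ballI allI)
   show "0 \<in> \<Union>\<C>" using C(1) Cs zidealD(1) by blast
   show "x + y \<in> \<Union>\<C>" if xy: "x \<in> \<Union>\<C>" "y \<in> \<Union>\<C>" for x y
   proof -
    obtain J K where JK: "J \<in> \<C>" "K \<in> \<C>" "x \<in> J" "y \<in> K" using xy by auto
    from ch[OF JK(1,2)] show ?thesis
     using JK Cs zidealD(2)[of K x y] zidealD(2)[of J x y] by blast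
   qed
   show "r * x \<in> \<Union>\<C>" if "x \<in> \<Union>\<C>" for x r using that Cs zidealD(3) by blast
  qed
  then show "\<Union>\<C> \<in> \<A>" using Cs C(1) by (auto simp: \<A>_def)
 qed
 then obtain M where M: "zideal M" "1 \<notin> M" "I \<subseteq> M" "\<And>X. zideal X ==> 1 \<notin> X ==> M \<subseteq> X ==> X = M"
  by (auto simp: \<A>_def)
 have ext: "\<exists>m\<in>M. \<exists>r. m + r * x = 1" if x: "x \<notin> M" for x
 proof (rule ccontr)
  assume n: "\<not> ?thesis"
  define X where "X = {m + r * x |m r. m \<in> M}"
  have "zideal X" unfolding zideal_def
  proof (intro conjI ballI allI)
   show "0 \<in> X" using zidealD(1)[OF M(1)] unfolding X_def by (auto intro!: exI[of _ 0])
   show "u + v \<in> X" if uv: "u \<in> X" "v \<in> X" for u v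
   proof -
    obtain m r m' r' where "u = m + r * x" "v = m' + r' * x" "m \<in> M" "m' \<in> M" using uv unfolding X_def by blast
    then have "u + v = (m + m') + (r + r') * x" "m + m' \<in> M" using zidealD(2)[OF M(1)] by (auto simp: algebra_simps)
    then show ?thesis unfolding X_def by blast
   qed
   show "s * u \<in> X" if u: "u \<in> X" for u s
   proof -
    obtain m r where "u = m + r * x" "m \<in> M" using u unfolding X_def by blast
    then have "s * u = s * m + (s * r) * x" "s * m \<in> M" using zidealD(3)[OF M(1)] by (auto simp: algebra_simps)
    then show ?thesis unfolding X_def by blast
   qed
  qed
  moreover have "1 \<notin> X" using n by (auto simp: X_def)
  moreover have "M \<subseteq> X"
  proof
   fix m assume "m \<in> M"
   then have "m + 0 * x \<in> X" unfolding X_def by blast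
   then show "m \<in> X" by simp
  qed
  ultimately have "X = M" using M(4) by blast
  moreover have "0 + 1 * x \<in> X" using zidealD(1)[OF M(1)] unfolding X_def by blast
  ultimately show False using x by simp
 qed
 have "x \<in> M \<or> y \<in> M" if xy: "x * y \<in> M" for x y
 proof (rule ccontr)
  assume "\<not> ?thesis"
  then obtain m r m' r' where mr: "m \<in> M" "m + r * x = 1" "m' \<in> M" "m' + r' * y = 1" using ext by metis
  have "1 = (m + r * x) * (m' + r' * y)" using mr by simp
  also have "... = m * (m' + r' * y) + r * x * m' + (r * r') * (x * y)" by (simp add: algebra_simps)
  also have "... \<in> M"
   by (rule zidealD(2)[OF M(1) zidealD(2)[OF M(1) zidealD(4)[OF M(1) mr(1)] zidealD(3)[OF M(1) mr(3)]] zidealD(3)[OF M(1) xy]])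
  finally show False using M(2) by simp
 qed
 then show ?thesis using M by (auto simp: zprime_def)
qed

section \<open>A lossless condenser\<close>

subsection \<open>The quadratic extension\<close>

definition nonres :: "nat => nat => bool" where
 "nonres p a \<longleftrightarrow> (\<forall>b::int. \<not> int p dvd b\<^sup>2 - int a)"

text \<open>Horner evaluation at a square root of \<open>a\<close>: the pair (r, s) is the remainder
  r + s X modulo X^2 - a.\<close>

definition redq :: "nat => int poly => int \<times> int" where
 "redq a g = fold_coeffs (%c rs. (c + int a * snd rs, fst rs)) g (0, 0)"

lemma redq_0 [simp]: "redq a 0 = (0, 0)"
 by (simp add: redq_def)

lemma redq_pCons: "redq a (pCons c g) = (c + int a * snd (redq a g), fst (redq a g))"
 by (cases "c = 0 \<and> g = 0") (auto simp: redq_def)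

lemma redq_add: "redq a (f + g) = (fst (redq a f) + fst (redq a g), snd (redq a f) + snd (redq a g))"
 by (induction f g rule: poly_induct2) (auto simp: redq_pCons algebra_simps)

lemma redq_smult: "redq a (smult c f) = (c * fst (redq a f), c * snd (redq a f))"
 by (induction f) (auto simp: redq_pCons algebra_simps)

lemma redq_mult: "redq a (f * g) =
  (fst (redq a f) * fst (redq a g) + int a * (snd (redq a f) * snd (redq a g)),
  fst (redq a f) * snd (redq a g) + snd (redq a f) * fst (redq a g))"
 by (induction f) (auto simp: redq_pCons redq_add redq_smult algebra_simps)

definition quadZ :: "nat => nat => int poly set" where
 "quadZ p a = {g. int p dvd fst (redq a g) \<and> int p dvd snd (redq a g)}"

text \<open>The norm r^2 - a s^2 is multiplicative, and p divides it only if p divides r and s,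
  since otherwise r / s would be a square root of \<open>a\<close> modulo p.\<close>

lemma zprime_quadZ:
 assumes p: "prime p" and a: "nonres p a"
 shows "zprime (quadZ p a)"
 unfolding zprime_def
proof (intro conjI allI impI)
 show "zideal (quadZ p a)"
  unfolding zideal_def quadZ_def by (auto simp: redq_add redq_mult)
 show "1 \<notin> quadZ p a" using prime_gt_1_nat[OF p] by (simp add: quadZ_def one_pCons redq_pCons)
 have pi: "prime (int p)" using p by simp
 fix x y assume xy: "x * y \<in> quadZ p a"
 obtain r s where rs: "redq a x = (r, s)" by (cases "redq a x")
 obtain r' s' where rs': "redq a y = (r', s')" by (cases "redq a y")
 have 1: "int p dvd r * r' + int a * (s * s')" "int p dvd r * s' + s * r'"
  using xy rs rs' by (auto simp: quadZ_def redq_mult)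
 have "(r\<^sup>2 - int a * s\<^sup>2) * (r'\<^sup>2 - int a * s'\<^sup>2) =
   (r * r' + int a * (s * s')) * (r * r' + int a * (s * s')) - int a * (r * s' + s * r') * (r * s' + s * r')"
  by (simp add: algebra_simps power2_eq_square)
 also have "int p dvd ..." using 1 by (intro dvd_diff dvd_mult) auto
 finally have n: "int p dvd r\<^sup>2 - int a * s\<^sup>2 \<or> int p dvd r'\<^sup>2 - int a * s'\<^sup>2"
  using pi by (simp add: prime_dvd_mult_iff)
 have key: "int p dvd r \<and> int p dvd s" if d: "int p dvd r\<^sup>2 - int a * s\<^sup>2" for r s
 proof -
  have "int p dvd s"
  proof (rule ccontr)
   assume "\<not> int p dvd s"
   then have "coprime s (int p)" using prime_imp_coprime[OF pi] by (metis coprime_commute)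
   then obtain t where t: "[s * t = 1] (mod int p)" using cong_solve_coprime_int by blast
   have "(r * t)\<^sup>2 - int a = (r\<^sup>2 - int a * s\<^sup>2) * t\<^sup>2 + int a * ((s * t)\<^sup>2 - 1)"
    by (simp add: algebra_simps power2_eq_square)
   moreover have "int p dvd (s * t)\<^sup>2 - 1"
   proof -
    have "(s * t)\<^sup>2 - 1 = (s * t - 1) * (s * t + 1)" by (simp add: algebra_simps power2_eq_square)
    then show ?thesis using t by (simp add: cong_iff_dvd_diff)
   qed
   ultimately have "int p dvd (r * t)\<^sup>2 - int a" using d by auto
   then show False using a by (auto simp: nonres_def)
  qed
  moreover from this have "int p dvd int a * s\<^sup>2" by (simp add: power2_eq_square)
  then have "int p dvd r\<^sup>2" using d dvd_add[of "int p" "r\<^sup>2 - int a * s\<^sup>2" "int a * s\<^sup>2"] by simp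
  ultimately show ?thesis using pi prime_dvd_power by blast
 qed
 show "x \<in> quadZ p a \<or> y \<in> quadZ p a" using n key[of r s] key[of r' s'] rs rs' unfolding quadZ_def by fastforce
qed

lemma const_quadZ: "[:c:] \<in> quadZ p a \<longleftrightarrow> int p dvd c"
 by (simp add: quadZ_def redq_pCons)

lemma linear_quadZ: "[:u, v:] \<in> quadZ p a \<longleftrightarrow> int p dvd u \<and> int p dvd v"
 by (simp add: quadZ_def redq_pCons)

subsection \<open>Frobenius as a shift\<close>

text \<open>
 Modulo any prime ideal containing \<open>p\<close> and \<open>Y\<^sup>p - Y - 1\<close>, raising to the power \<open>p\<close> is the
 substitution \<open>Y \<mapsto> Y + 1\<close>.
\<close>

definition allp :: "nat => int poly => bool" where
 "allp p f \<longleftrightarrow> (\<forall>i. int p dvd coeff f i)"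

text \<open>The ideal generated by p and the Artin-Schreier polynomial Y^p - Y - 1.\<close>

definition asI :: "nat => int poly set" where
 "asI p = {g. \<exists>h. allp p (g - (monom 1 p - [:1, 1:]) * h)}"

text \<open>If 1 were a multiple of Y^p - Y - 1 modulo p, the highest coefficient of the cofactor
  \<open>h\<close> that is nonzero modulo p would survive in the product with Y^p, because the other
  two terms have lower degree.\<close>

lemma asI_proper:
 assumes p: "prime p"
 shows "1 \<notin> asI p"
proof
 assume "1 \<in> asI p"
 then obtain h where h: "allp p (1 - (monom 1 p - [:1, 1:]) * h)" by (auto simp: asI_def)
 have p2: "2 \<le> p" using p prime_ge_2_nat by blast
 have ce: "coeff ((monom 1 p - [:1, 1:]) * h) i = (if i < p then 0 else coeff h (i - p)) - coeff h i - (if i = 0 then 0 else coeff h (i - 1))" for i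
 proof -
  have "(monom 1 p - [:1, 1:]) * h = monom 1 p * h - h - pCons 0 h" by (simp add: algebra_simps)
  then show ?thesis by (simp add: coeff_monom_mult coeff_pCons split: nat.splits)
 qed
 show False
 proof (cases "allp p h")
  case True
  have "int p dvd coeff (1 - (monom 1 p - [:1, 1:]) * h) 0" using h unfolding allp_def by blast
  then have "int p dvd 1 + coeff h 0" using p2 by (simp add: ce)
  moreover have "int p dvd coeff h 0" using True by (simp add: allp_def)
  ultimately have "int p dvd 1" using dvd_add_left_iff by blast
  then show False using p2 by simp
 next
  case False
  then have ne: "\<exists>d. \<not> int p dvd coeff h d" by (auto simp: allp_def)
  define d where "d = (GREATEST d. \<not> int p dvd coeff h d)"
  have b: "\<forall>d. \<not> int p dvd coeff h d \<longrightarrow> d \<le> degree h" by (metis coeff_eq_0 dvd_0_right not_le_imp_less)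
  have d1: "\<not> int p dvd coeff h d" unfolding d_def using GreatestI_ex_nat[OF ne] b by blast
  have d2: "int p dvd coeff h j" if "d < j" for j
   using Greatest_le_nat[of "%d. \<not> int p dvd coeff h d" j "degree h"] b that unfolding d_def[symmetric] by auto
  have "int p dvd coeff (1 - (monom 1 p - [:1, 1:]) * h) (d + p)" using h unfolding allp_def by blast
  moreover have "coeff (1 - (monom 1 p - [:1, 1:]) * h) (d + p) = - coeff h d + coeff h (d + p) + coeff h (d + p - 1)"
   using p2 by (simp add: ce)
  ultimately have "int p dvd - coeff h d + coeff h (d + p) + coeff h (d + p - 1)" by simp
  moreover have "int p dvd coeff h (d + p)" "int p dvd coeff h (d + p - 1)" using d2 p2 by auto
  ultimately have "int p dvd - coeff h d" by (metis dvd_add_left_iff)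
  then show False using d1 by simp
 qed
qed

lemma allp_add: "allp p f ==> allp p g ==> allp p (f + g)"
 by (simp add: allp_def)

lemma allp_mult: "allp p f ==> allp p (r * f)"
 by (auto simp: allp_def coeff_mult intro!: dvd_sum)

lemma zideal_asI: "zideal (asI p)"
 unfolding zideal_def
proof (intro conjI ballI allI)
 show "0 \<in> asI p" by (auto simp: asI_def allp_def intro!: exI[of _ 0])
next
 fix x y assume "x \<in> asI p" "y \<in> asI p"
 then obtain h h' where "allp p (x - (monom 1 p - [:1, 1:]) * h)" "allp p (y - (monom 1 p - [:1, 1:]) * h')"
  by (auto simp: asI_def)
 from allp_add[OF this] have "allp p (x + y - (monom 1 p - [:1, 1:]) * (h + h'))"
  unfolding distrib_left add_diff_add .
 then show "x + y \<in> asI p" unfolding asI_def by blast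
next
 fix x r assume "x \<in> asI p"
 then obtain h where "allp p (x - (monom 1 p - [:1, 1:]) * h)" by (auto simp: asI_def)
 from allp_mult[OF this, of r] have "allp p (r * x - (monom 1 p - [:1, 1:]) * (r * h))"
  by (simp only: right_diff_distrib mult.left_commute[of r])
 then show "r * x \<in> asI p" unfolding asI_def by blast
qed

locale artin_schreier =
 fixes p :: nat and M :: "int poly set"
 assumes p: "prime p" and M: "zprime M" and IM: "asI p \<subseteq> M"
begin

lemma MI: "zideal M" by (rule zprimeD(1)[OF M])

lemma allp_M: "allp p f ==> f \<in> M"
 using IM by (auto simp: asI_def intro!: exI[of _ 0])

lemma Yp_M: "[:0, 1:] ^ p - [:1, 1:] \<in> M"
proof -
 have "allp p (monom 1 p - [:1, 1:] - (monom 1 p - [:1, 1:]) * 1)" by (simp add: allp_def)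
 then have "monom 1 p - [:1, 1:] \<in> M" using IM unfolding asI_def by blast
 then show ?thesis by (simp add: monom_altdef)
qed

lemma of_nat_mult_M: "p dvd c ==> of_nat c * f \<in> M"
 by (rule allp_M) (simp add: allp_def of_nat_poly)

lemma freshman: "(x + y) ^ p - (x ^ p + y ^ p) \<in> M"
proof -
 have p1: "1 < p" using p prime_gt_1_nat by blast
 have "(x + y) ^ p = (\<Sum>k\<le>p. of_nat (p choose k) * x ^ k * y ^ (p - k))" by (rule binomial_ring)
 also have "{..p} = insert 0 (insert p {1..<p})" using p1 by auto
 finally have "(x + y) ^ p - (x ^ p + y ^ p) = (\<Sum>k\<in>{1..<p}. of_nat (p choose k) * (x ^ k * y ^ (p - k)))"
  using p1 by (simp add: mult.assoc)
 also have "... \<in> M"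
  using p by (intro zideal_sum[OF MI] of_nat_mult_M) (auto intro: dvd_choose_prime)
 finally show ?thesis .
qed

text \<open>Fermat's little theorem modulo \<open>M\<close>, climbing and descending from 0 by the
  freshman's dream.\<close>

lemma frob_const: "[:c:] ^ p - [:c:] \<in> M"
proof (induction c rule: int_induct[where k = 0])
 case base
 show ?case using prime_gt_0_nat[OF p] zidealD(1)[OF MI] by (simp add: power_0_left)
next
 case (step1 i)
 have e: "[:i:] + [:1:] = [:i + 1:]" by simp
 have e1: "[:1:] ^ p = (1::int poly)" by (simp flip: one_pCons)
 have A: "[:i + 1:] ^ p - ([:i:] ^ p + 1) \<in> M" using freshman[of "[:i:]" "[:1:]"] unfolding e e1 .
 have "a - x = (a - (b + 1)) + (b - c)" if "x = c + 1" for a b c x :: "int poly" using that by simp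
 from this[of "[:i + 1:]" "[:i:]"] have "[:i + 1:] ^ p - [:i + 1:] = ([:i + 1:] ^ p - ([:i:] ^ p + 1)) + ([:i:] ^ p - [:i:])"
  by (simp only: one_pCons add_pCons add_0)
 then show ?case using zidealD(2)[OF MI A step1(2)] by metis
next
 case (step2 i)
 have e: "[:i - 1:] + [:1:] = [:i:]" by simp
 have e1: "[:1:] ^ p = (1::int poly)" by (simp flip: one_pCons)
 have A: "[:i:] ^ p - ([:i - 1:] ^ p + 1) \<in> M" using freshman[of "[:i - 1:]" "[:1:]"] unfolding e e1 .
 have "a - x = (b - c) - (b - (a + 1))" if "x = c - 1" for a b c x :: "int poly" using that by simp
 from this[of "[:i - 1:]" "[:i:]"] have "[:i - 1:] ^ p - [:i - 1:] = ([:i:] ^ p - [:i:]) - ([:i:] ^ p - ([:i - 1:] ^ p + 1))"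
  by (simp only: one_pCons diff_pCons diff_0_right)
 then show ?case using zidealD(6)[OF MI step2(2) A] by metis
qed

lemma frob: "f ^ p - f \<circ>\<^sub>p [:1, 1:] \<in> M"
proof (induction f)
 case 0
 show ?case using prime_gt_0_nat[OF p] zidealD(1)[OF MI] by (simp add: power_0_left)
next
 case (pCons c g)
 have e: "pCons c g = [:c:] + [:0, 1:] * g" by simp
 have 1: "pCons c g ^ p - ([:c:] ^ p + ([:0, 1:] * g) ^ p) \<in> M" unfolding e by (rule freshman)
 have "([:0, 1:] * g) ^ p - [:1, 1:] * (g \<circ>\<^sub>p [:1, 1:]) \<in> M"
  unfolding power_mult_distrib by (rule zideal_diff_mult[OF MI Yp_M pCons.IH])
 from zidealD(2)[OF MI frob_const this]
 have 2: "([:c:] ^ p + ([:0, 1:] * g) ^ p) - ([:c:] + [:1, 1:] * (g \<circ>\<^sub>p [:1, 1:])) \<in> M"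
  unfolding add_diff_add .
 show ?case using zideal_diff_trans[OF MI 1 2] by (simp add: pcompose_pCons)
qed

lemma frob_iter: "f ^ (p ^ i) - f \<circ>\<^sub>p [:int i, 1:] \<in> M"
proof (induction i)
 case 0
 show ?case using zidealD(1)[OF MI] by simp
next
 case (Suc i)
 have "f ^ (p ^ Suc i) - (f \<circ>\<^sub>p [:int i, 1:]) ^ p \<in> M"
  using zideal_diff_power[OF MI Suc.IH, of p] by (simp add: power_mult[symmetric] mult.commute)
 from zideal_diff_trans[OF MI this frob]
 show ?case by (simp add: pcompose_assoc[symmetric] pcompose_pCons add.commute)
qed

lemma shift_diff:
 assumes "\<forall>i\<ge>d. int p dvd coeff f i"
 shows "\<forall>i. d \<le> i + 1 \<longrightarrow> int p dvd coeff (f \<circ>\<^sub>p [:1, 1:] - f) i"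
  "d = m + 2 ==> int p dvd coeff (f \<circ>\<^sub>p [:1, 1:] - f) m - int (m + 1) * coeff f (m + 1)"
 using assms
proof (induction f arbitrary: d m)
 case 0
 { case 1 show ?case by simp next case 2 show ?case by simp }
next
 case (pCons c g)
 let ?D = "%f. f \<circ>\<^sub>p [:1, 1:] - (f::int poly)"
 have D: "?D (pCons c g) = pCons 0 (?D g) + ?D g + g" by (simp add: pcompose_pCons algebra_simps)
 { case 1
  have g: "\<forall>i\<ge>d-1. int p dvd coeff g i" using 1[rule_format, of "Suc i" for i] by fastforce
  have IH: "int p dvd coeff (?D g) i" if "d \<le> i + 2" for i using pCons.IH(1)[OF g] that by simp
  show ?case
  proof (intro allI impI)
   fix i assume i: "d \<le> i + 1"
   have "int p dvd coeff (pCons 0 (?D g)) i" using IH[of "i - 1"] i by (auto simp: coeff_pCons split: nat.splits)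
   moreover have "int p dvd coeff (?D g) i" "int p dvd coeff g i" using IH[of i] g i by auto
   ultimately show "int p dvd coeff (?D (pCons c g)) i" unfolding D coeff_add[of "_ + _"] coeff_add[of "pCons _ _"] by (intro dvd_add)
  qed
 next
  case 2
  have g: "\<forall>i\<ge>m+1. int p dvd coeff g i" using 2 by (metis Suc_eq_plus1 Suc_le_mono add_2_eq_Suc' coeff_pCons_Suc)
  have IH1: "int p dvd coeff (?D g) m" using pCons.IH(1)[OF g] by simp
  show ?case
  proof (cases m)
   case 0
   then show ?thesis unfolding D using IH1 by simp
  next
   case (Suc k)
   then have IH2: "int p dvd coeff (?D g) k - int (k + 1) * coeff g (k + 1)" using pCons.IH(2)[of "m + 1" k] g by simp
   have "coeff (?D (pCons c g)) m - int (m + 1) * coeff (pCons c g) (m + 1)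
     = (coeff (?D g) k - int (k + 1) * coeff g (k + 1)) + coeff (?D g) m"
    unfolding D using Suc by (simp add: algebra_simps)
   then show ?thesis using IH1 IH2 by simp
  qed }
qed

text \<open>This replaces the irreducibility of Y^p - Y - 1. With \<open>f\<close> also f(Y + 1),
  congruent to f^p, lies in \<open>M\<close>, and so does their difference, which has smaller degree
  and vanishes modulo p by induction. Its leading coefficient is that of \<open>f\<close> times a
  positive number below p, so the leading coefficient of \<open>f\<close> vanishes too. In the end a
  constant remains, which would be a unit if it were nonzero.\<close>

lemma M_small:
 assumes "f \<in> M" "\<forall>i\<ge>d. int p dvd coeff f i" "d \<le> p"
 shows "allp p f"
 using assms
proof (induction d arbitrary: f)
 case 0
 then show ?case by (simp add: allp_def)
next
 case (Suc d)
 have "int p dvd coeff f d"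
 proof (cases d)
  case 0
  have "allp p (f - [:coeff f 0:])" using Suc.prems(2) 0 by (auto simp: allp_def coeff_pCons split: nat.splits)
  from zidealD(6)[OF MI Suc.prems(1) allp_M[OF this]] have c: "[:coeff f 0:] \<in> M" by simp
  show ?thesis
  proof (rule ccontr)
   assume "\<not> ?thesis"
   then have "coprime (coeff f 0) (int p)" using p 0 prime_imp_coprime[of "int p"] by (metis coprime_commute prime_nat_int_transfer)
   then obtain t where t: "[coeff f 0 * t = 1] (mod int p)" using cong_solve_coprime_int by blast
   then have "allp p ([:coeff f 0:] * [:t:] - 1)"
    by (auto simp: allp_def cong_iff_dvd_diff one_pCons coeff_pCons mult.commute split: nat.splits)
   from allp_M[OF this] zidealD(4)[OF MI c, of "[:t:]"] have "1 \<in> M"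
    using zideal_mem_cong[OF MI] by blast
   then show False using zprimeD(2)[OF M] by simp
  qed
 next
  case (Suc m)
  let ?D = "f \<circ>\<^sub>p [:1, 1:] - f"
  have "f ^ p \<in> M" using Suc.prems(1) zidealD(4)[OF MI] prime_gt_0_nat[OF p] by (metis Suc_pred power_Suc)
  then have "f \<circ>\<^sub>p [:1, 1:] \<in> M" using frob[of f] zideal_mem_cong[OF MI] by blast
  then have "?D \<in> M" using Suc.prems(1) zidealD(6)[OF MI] by blast
  moreover have "\<forall>i\<ge>d. int p dvd coeff ?D i" using shift_diff(1)[OF Suc.prems(2)] by auto
  ultimately have "allp p ?D" using Suc.IH Suc.prems(3) by simp
  moreover have "int p dvd coeff ?D m - int (m + 1) * coeff f (m + 1)"
   using shift_diff(2)[OF Suc.prems(2), of m] Suc by simp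
  ultimately have "int p dvd int (m + 1) * coeff f (m + 1)"
   unfolding allp_def by (metis dvd_diff_right_iff)
  moreover have "\<not> int p dvd int (m + 1)" using Suc Suc.prems(3) by (auto dest: zdvd_imp_le)
  ultimately show ?thesis using p prime_dvd_mult_iff[of "int p"] unfolding Suc by simp
 qed
 then have "int p dvd coeff f i" if "d \<le> i" for i
  using Suc.prems(2) that by (cases "i = d") auto
 then have "\<forall>i\<ge>d. int p dvd coeff f i" by blast
 from Suc.IH[OF Suc.prems(1) this] show ?case using Suc.prems(3) by simp
qed

end

lemma exists_artin_schreier: "prime p ==> \<exists>M. artin_schreier p M"
 using exists_zprime[OF zideal_asI asI_proper, of p] unfolding artin_schreier_def by blast

section \<open>Bit strings and fractions\<close>

abbreviation num :: "bool list => nat" where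
 "num xs \<equiv> horner_sum of_bool 2 xs"

definition nbits :: "nat => nat => bool list" where
 "nbits w v = map (bit v) [0..<w]"

lemma length_nbits [simp]: "length (nbits w v) = w"
 by (simp add: nbits_def)

lemma num_nbits [simp]: "v < 2 ^ w ==> num (nbits w v) = v"
 by (simp add: nbits_def horner_sum_bit_eq_take_bit take_bit_eq_mod)

lemma nbits_num: "nbits (length xs) (num xs) = xs"
 by (auto intro!: nth_equalityI simp: nbits_def bit_horner_sum_bit_iff)

lemma num_less: "num xs < 2 ^ length xs"
 by (rule horner_sum_of_bool_2_less)

lemma num_inj: "length xs = length ys ==> num xs = num ys ==> xs = ys"
 by (metis nbits_num)

lemma bits_iff [simp]: "x \<in> bits n \<longleftrightarrow> length x = n"
 by (simp add: bits_def)

lemma card_bits [simp]: "card (bits n) = 2 ^ n"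
 using card_lists_length_eq[of "UNIV :: bool set" n] by (simp add: bits_def)

lemma finite_bits' [simp]: "finite (bits n)"
 by (rule finite_bits)

definition frc :: "'a set => ('a => bool) => real" where
 "frc S P = card {s \<in> S. P s} / card S"

definition avg :: "'a set => ('a => real) => real" where
 "avg S f = (\<Sum>s\<in>S. f s) / card S"

lemma frc_avg: "finite S ==> frc S P = avg S (%s. of_bool (P s))"
 by (simp add: frc_def avg_def of_bool_def sum.If_cases Int_def)

lemma avg_mono: "(\<And>s. s \<in> S ==> f s \<le> g s) ==> avg S f \<le> avg S g"
 unfolding avg_def by (intro divide_right_mono sum_mono) auto

lemma avg_cong: "(\<And>s. s \<in> S ==> f s = g s) ==> avg S f = avg S g"
 unfolding avg_def by simp

lemma avg_add: "avg S (%s. f s + g s) = avg S f + avg S g"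
 by (simp add: avg_def sum.distrib add_divide_distrib)

lemma avg_diff: "avg S (%s. f s - g s) = avg S f - avg S g"
 by (simp add: avg_def sum_subtractf diff_divide_distrib)

lemma avg_cmult: "avg S (%s. c * f s) = c * avg S f"
 by (simp add: avg_def sum_distrib_left)

lemma avg_const: "finite S ==> S \<noteq> {} ==> avg S (%s. c) = c"
 by (simp add: avg_def)

lemma avg_sum: "avg S (%s. \<Sum>i\<in>I. f i s) = (\<Sum>i\<in>I. avg S (f i))"
 unfolding avg_def by (subst sum.swap) (simp add: sum_divide_distrib)

lemma avg_swap: "avg S (%s. avg T (%t. f s t)) = avg T (%t. avg S (%s. f s t))"
 unfolding avg_def sum_divide_distrib[symmetric] by (subst sum.swap) (simp add: ac_simps)

lemma avg_le_const: "finite S ==> S \<noteq> {} ==> (\<And>s. s \<in> S ==> f s \<le> c) ==> avg S f \<le> c"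
 using avg_mono[of S f "%_. c"] by (simp add: avg_const)

lemma avg_nonneg: "(\<And>s. s \<in> S ==> 0 \<le> f s) ==> 0 \<le> avg S f"
 unfolding avg_def by (intro divide_nonneg_nonneg sum_nonneg) auto

lemma avg_gt_ex:
 assumes "finite S" "S \<noteq> {}" "c < avg S f"
 shows "\<exists>s\<in>S. c < f s"
 using avg_le_const[OF assms(1,2), of f c] assms(3) by (meson leI le_less_trans less_irrefl)

lemma avg_bij: "bij_betw h S T ==> avg T f = avg S (%s. f (h s))"
 unfolding avg_def by (simp add: bij_betw_same_card sum.reindex_bij_betw)

lemma bits_ne [simp]: "bits n \<noteq> {}"
 by (rule bits_nonempty)

lemma bij_append: "bij_betw (%(a, b). a @ b) (bits m \<times> bits n) (bits (m + n))"
 by (rule bij_betwI[where g = "%s. (take m s, drop m s)"]) auto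

lemma avg_prod: "avg (A \<times> B) f = avg A (%a. avg B (%b. f (a, b)))"
 unfolding avg_def sum_divide_distrib[symmetric] by (simp add: sum.cartesian_product card_cartesian_product mult.commute)

lemma avg_append: "avg (bits (m + n)) f = avg (bits m) (%a. avg (bits n) (%b. f (a @ b)))"
 by (subst avg_bij[OF bij_append]) (simp add: avg_prod)

lemma frc_le_1: "finite S ==> frc S P \<le> 1"
 unfolding frc_def by (cases "S = {}") (auto simp: divide_le_eq_1 card_mono card_gt_0_iff)

lemma frc_cong: "(\<And>s. s \<in> S ==> P s \<longleftrightarrow> Q s) ==> frc S P = frc S Q"
 unfolding frc_def by (metis (mono_tags, lifting) Collect_cong)

lemma frc_nonneg: "0 \<le> frc S P"
 by (simp add: frc_def)

lemma frc_append: "frc (bits (m + n)) P = avg (bits m) (%a. frc (bits n) (%b. P (a @ b)))"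
 by (simp add: frc_avg avg_append)

subsection \<open>Condensers and extractors by counting bad inputs\<close>

text \<open>
 The worst source concentrates on the inputs that are bad for a fixed test, so it suffices to
 bound their number; \<open>K\<close> plays the role of \<open>2\<^sup>k \<cdot> eps\<close>. Composition needs no
 probability distributions on the sources.
\<close>

definition bad :: "nat => nat => (bool list => bool list => 'b) => 'b set => real => bool list set" where
 "bad N d E T \<theta> = {x \<in> bits N. \<theta> < frc (bits d) (%s. E x s \<in> T)}"

definition cext :: "nat => nat => nat => real => real => (bool list => bool list => bool list) => bool" where
 "cext N d m K eps E \<longleftrightarrow> (\<forall>T\<subseteq>bits m. real (card (bad N d E T (card T / 2 ^ m + eps))) \<le> K)"

definition ccond :: "nat => nat => nat => real => real => real => (bool list => bool list => bool list) => bool" where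
 "ccond N d M K' K eps C \<longleftrightarrow> (\<forall>B\<subseteq>bits M. real (card B) \<le> K' \<longrightarrow> real (card (bad N d C B eps)) \<le> K)"

lemma finite_bad [simp]: "finite (bad N d E T \<theta>)"
 unfolding bad_def by (rule finite_subset[OF _ finite_bits]) blast

section \<open>Linear systems modulo a prime, digits, and the bound on bad inputs of the
  condenser\<close>

lemma linear_mod_solution:
 fixes L :: "'k => 'e => int"
 assumes p: "1 < (p::nat)" and fin: "finite E" "finite K" and less: "card K < card E"
 shows "\<exists>c. (\<exists>e\<in>E. \<not> int p dvd c e) \<and> (\<forall>k\<in>K. int p dvd (\<Sum>e\<in>E. c e * L k e))"
proof -
 \<comment> \<open>Pigeonhole in place of a dimension count: there are more coefficient vectors than
   value vectors, and two vectors with the same values differ by a nonzero solution.\<close>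
 define D where "D = PiE E (%_. {0..<int p})"
 define \<Phi> where "\<Phi> c = (\<lambda>k\<in>K. (\<Sum>e\<in>E. c e * L k e) mod int p)" for c
 have "\<Phi> ` D \<subseteq> PiE K (%_. {0..<int p})" using p by (auto simp: \<Phi>_def)
 then have "card (\<Phi> ` D) \<le> card (PiE K (%_. {0..<int p}))" using fin by (intro card_mono finite_PiE) auto
 also have "... = p ^ card K" using fin by (simp add: card_PiE)
 also have "... < p ^ card E" using p less by simp
 also have "... = card D" using fin by (simp add: D_def card_PiE)
 finally have "\<not> inj_on \<Phi> D" by (rule pigeonhole)
 then obtain c1 c2 where c: "c1 \<in> D" "c2 \<in> D" "\<Phi> c1 = \<Phi> c2" "c1 \<noteq> c2" by (auto simp: inj_on_def)
 then obtain e where e: "e \<in> E" "c1 e \<noteq> c2 e" unfolding D_def by (metis PiE_ext)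
 have "\<not> int p dvd c1 e - c2 e"
 proof
  assume "int p dvd c1 e - c2 e"
  moreover have "\<bar>c1 e - c2 e\<bar> < int p" using c(1,2) e(1) by (fastforce simp: D_def PiE_iff abs_if)
  ultimately show False using e(2) dvd_imp_le_int[of "c1 e - c2 e" "int p"] by simp
 qed
 moreover have "int p dvd (\<Sum>e\<in>E. (c1 e - c2 e) * L k e)" if "k \<in> K" for k
 proof -
  have "(\<Sum>e\<in>E. c1 e * L k e) mod int p = (\<Sum>e\<in>E. c2 e * L k e) mod int p"
   using c(3) that by (auto simp: \<Phi>_def dest: fun_cong[of _ _ k])
  then show ?thesis by (simp add: mod_eq_dvd_iff left_diff_distrib sum_subtractf)
 qed
 ultimately show ?thesis using e(1) by (intro exI[of _ "%e. c1 e - c2 e"]) auto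
qed

lemma digits_bound: "(\<forall>i<m. e i < p) ==> (\<Sum>i<m. e i * p ^ i) < (p::nat) ^ m"
proof (induction m)
 case (Suc m)
 have "(\<Sum>i<Suc m. e i * p ^ i) < p ^ m + e m * p ^ m" using Suc by simp
 also have "... = (e m + 1) * p ^ m" by simp
 also have "... \<le> p * p ^ m" using Suc.prems by (intro mult_right_mono) auto
 finally show ?case by simp
qed simp

lemma digits_inj:
 "(\<forall>i<m. e i < p) ==> (\<forall>i<m. e' i < p) ==> (\<Sum>i<m. e i * p ^ i) = (\<Sum>i<m. e' i * (p::nat) ^ i) ==> \<forall>i<m. e i = e' i"
proof (induction m)
 case (Suc m)
 have b: "(\<Sum>i<m. e i * p ^ i) < p ^ m" "(\<Sum>i<m. e' i * p ^ i) < p ^ m" using Suc.prems by (auto intro: digits_bound)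
 have q: "p ^ m \<noteq> 0" using Suc.prems(1) by auto
 have "e m = ((\<Sum>i<m. e i * p ^ i) + e m * p ^ m) div p ^ m" using b q by simp
 also have "... = ((\<Sum>i<m. e' i * p ^ i) + e' m * p ^ m) div p ^ m" using Suc.prems(3) by simp
 also have "... = e' m" using b q by simp
 finally have "e m = e' m" .
 have "(\<Sum>i<m. e i * p ^ i) = (\<Sum>i<m. e' i * p ^ i)" using Suc.prems(3) \<open>e m = e' m\<close> by simp
 from Suc.IH[OF _ _ this] have "\<forall>i<m. e i = e' i" using Suc.prems(1,2) by (meson less_SucI)
 then show ?case using \<open>e m = e' m\<close> by (metis less_antisym)
qed simp

lemma redq_sum: "redq a (sum f A) = ((\<Sum>x\<in>A. fst (redq a (f x))), (\<Sum>x\<in>A. snd (redq a (f x))))"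
 by (induction A rule: infinite_finite_induct) (auto simp: redq_add)

lemma degree_prod_le: "degree (\<Prod>i\<in>A. f i :: int poly) \<le> (\<Sum>i\<in>A. degree (f i))"
 by (cases "finite A") (use degree_prod_sum_le[of A f] in \<open>auto simp: o_def\<close>)

text \<open>
 A polynomial \<open>Q\<close> with individual degrees below \<open>p\<close> that vanishes on the targets \<open>B\<close> turns every bad
 \<open>f\<close> into a solution of \<open>Q(f(Y), f(Y+1), ...) = 0\<close>, and by \<open>f(Y + i) = f\<^bsup>p\<^sup>i\<^esup>\<close> into a
 root of a nonzero polynomial of degree below \<open>p\<^sup>m\<close>.
\<close>

lemma condenser_bad_bound:
 fixes t :: "'b => nat => int \<times> int" and F :: "int poly set"
 assumes p: "prime p" and a: "nonres p a" and m: "0 < m" and N: "0 < N" "N \<le> p"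
  and B: "finite B" "2 * card B < p ^ m"
  and Y: "finite Y" "\<And>y y'. y \<in> Y ==> y' \<in> Y ==> int p dvd fst y - fst y' ==> int p dvd snd y - snd y' ==> y = y'"
  and F: "finite F" "\<And>f. f \<in> F ==> degree f < N" "\<And>f g. f \<in> F ==> g \<in> F ==> allp p (f - g) ==> f = g"
  and badF: "\<And>f. f \<in> F ==> N * p * m \<le>
    card {y \<in> Y. \<exists>b\<in>B. \<forall>i<m. f \<circ>\<^sub>p [:fst y + int i, snd y:] - [:fst (t b i), snd (t b i):] \<in> quadZ p a}"
 shows "card F < p ^ m"
proof (rule ccontr)
 assume nF: "\<not> ?thesis"
 have p1: "1 < p" using p prime_gt_1_nat by blast
 define E where "E = PiE {..<m} (%_. {..<p})"
 have finE: "finite E" and cardE: "card E = p ^ m" by (auto simp: E_def card_PiE intro: finite_PiE)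
 have Eb: "e i < p" if "e \<in> E" "i < m" for e i using that by (auto simp: E_def PiE_iff)
 define mon where "mon b e = (\<Prod>i<m. [:fst (t b i), snd (t b i):] ^ e i)" for b and e :: "nat => nat"
 define L where "L k e = (if snd k then snd (redq a (mon (fst k) e)) else fst (redq a (mon (fst k) e)))" for k :: "'b \<times> bool" and e
 \<comment> \<open>An element of the quadratic extension vanishes when both components do, so each
   target costs two conditions over the prime field; hence the factor 2 in the assumption on
   \<open>B\<close>.\<close>
 have "card (B \<times> (UNIV :: bool set)) < card E" using B by (simp add: cardE card_cartesian_product mult.commute)
 then obtain c where c: "\<exists>e\<in>E. \<not> int p dvd c e" "\<forall>k\<in>B \<times> UNIV. int p dvd (\<Sum>e\<in>E. c e * L k e)"
  using linear_mod_solution[OF p1 finE, of "B \<times> UNIV" L] B by auto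
 have van: "(\<Sum>e\<in>E. smult (c e) (mon b e)) \<in> quadZ p a" if "b \<in> B" for b
  using c(2)[rule_format, of "(b, False)"] c(2)[rule_format, of "(b, True)"] that
  by (simp add: quadZ_def redq_sum redq_smult L_def)
 have zp: "zprime (quadZ p a)" by (rule zprime_quadZ[OF p a])
 note zI = zprimeD(1)[OF zp]
 define R where "R f = (\<Sum>e\<in>E. smult (c e) (\<Prod>i<m. (f \<circ>\<^sub>p [:int i, 1:]) ^ e i))" for f
 have allR: "allp p (R f)" if f: "f \<in> F" for f
 proof -
  define A where "A = {y \<in> Y. \<exists>b\<in>B. \<forall>i<m. f \<circ>\<^sub>p [:fst y + int i, snd y:] - [:fst (t b i), snd (t b i):] \<in> quadZ p a}"
  \<comment> \<open>The coefficients become constant polynomials so that \<open>root_count\<close>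
    can be applied over the quadratic extension; \<open>const_quadZ\<close> leads back to
    integers.\<close>
  define Q where "Q = (map_poly (%x. [:x:]) (R f) :: int poly poly)"
  have coeffQ: "coeff Q i = [:coeff (R f) i:]" for i by (simp add: Q_def coeff_map_poly)
  have degt: "degree (\<Prod>i<m. (f \<circ>\<^sub>p [:int i, 1:]) ^ e i) \<le> m * ((p - 1) * (N - 1))" if e: "e \<in> E" for e
  proof -
   have "degree (\<Prod>i<m. (f \<circ>\<^sub>p [:int i, 1:]) ^ e i) \<le> (\<Sum>i<m. degree ((f \<circ>\<^sub>p [:int i, 1:]) ^ e i))"
    by (rule degree_prod_le)
   also have "... \<le> (\<Sum>i<m. (p - 1) * (N - 1))"
   proof (intro sum_mono)
    fix i assume i: "i \<in> {..<m}"
    have "degree ((f \<circ>\<^sub>p [:int i, 1:]) ^ e i) \<le> degree (f \<circ>\<^sub>p [:int i, 1:]) * e i" by (rule degree_power_le)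
    also have "... \<le> (N - 1) * (p - 1)"
     using F(2)[OF f] Eb[OF e, of i] i by (intro mult_mono) (auto simp: degree_pcompose)
    finally show "degree ((f \<circ>\<^sub>p [:int i, 1:]) ^ e i) \<le> (p - 1) * (N - 1)" by (simp add: mult.commute)
   qed
   finally show ?thesis by simp
  qed
  have "degree (R f) \<le> m * ((p - 1) * (N - 1))"
   unfolding R_def
  proof (intro degree_sum_le finE)
   fix e assume "e \<in> E"
   from degt[OF this] show "degree (smult (c e) (\<Prod>i<m. (f \<circ>\<^sub>p [:int i, 1:]) ^ e i)) \<le> m * ((p - 1) * (N - 1))"
    by (rule order_trans[OF degree_smult_le])
  qed
  also have "... < m * (p * N)"
  proof -
   have "(p - 1) * (N - 1) < p * N" using p1 N by (intro mult_strict_mono) auto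
   then show ?thesis using m by simp
  qed
  also have "... \<le> card A" using badF[OF f] by (simp add: A_def ac_simps)
  finally have dA: "degree (R f) < card A" .
  have inj: "inj_on (%y. [:fst y, snd y:]) A" by (auto intro!: inj_onI)
  have "coeff Q i \<in> quadZ p a" for i
  proof (rule root_count[OF zp, where A = "(%y. [:fst y, snd y:]) ` A"])
   show "finite ((%y. [:fst y, snd y:]) ` A)" using Y by (simp add: A_def)
   show "y - y' \<notin> quadZ p a" if "y \<in> (%y. [:fst y, snd y:]) ` A" "y' \<in> (%y. [:fst y, snd y:]) ` A" "y \<noteq> y'" for y y'
    using that Y(2) by (auto simp: linear_quadZ A_def)
   show "degree Q < card ((%y. [:fst y, snd y:]) ` A)"
    using dA degree_le[of "degree (R f)" Q] by (simp add: card_image[OF inj] coeffQ coeff_eq_0)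
   show "poly Q z \<in> quadZ p a" if z: "z \<in> (%y. [:fst y, snd y:]) ` A" for z
   proof -
    obtain y b where y: "z = [:fst y, snd y:]" "b \<in> B"
     "\<forall>i<m. f \<circ>\<^sub>p [:fst y + int i, snd y:] - [:fst (t b i), snd (t b i):] \<in> quadZ p a"
     using z by (auto simp: A_def)
    have sh: "(f \<circ>\<^sub>p [:int i, 1:]) \<circ>\<^sub>p z = f \<circ>\<^sub>p [:fst y + int i, snd y:]" for i
     unfolding y(1) by (simp add: pcompose_assoc[symmetric] pcompose_pCons add.commute)
    have pw: "(g ^ k) \<circ>\<^sub>p z = (g \<circ>\<^sub>p z) ^ k" for g k by (induction k) (simp_all add: pcompose_mult pcompose_1)
    have "poly Q z = R f \<circ>\<^sub>p z" by (simp add: Q_def pcompose_altdef)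
    also have "... = (\<Sum>e\<in>E. smult (c e) (\<Prod>i<m. (f \<circ>\<^sub>p [:fst y + int i, snd y:]) ^ e i))"
     unfolding R_def by (simp add: pcompose_sum pcompose_smult pcompose_prod pw sh)
    finally have e: "poly Q z = (\<Sum>e\<in>E. smult (c e) (\<Prod>i<m. (f \<circ>\<^sub>p [:fst y + int i, snd y:]) ^ e i))" .
    have "poly Q z - (\<Sum>e\<in>E. smult (c e) (mon b e)) \<in> quadZ p a"
     unfolding e
    proof (intro zideal_diff_sum[OF zI])
     fix e
     have "(\<Prod>i<m. (f \<circ>\<^sub>p [:fst y + int i, snd y:]) ^ e i) - mon b e \<in> quadZ p a"
      unfolding mon_def using y(3) by (intro zideal_diff_prod[OF zI] zideal_diff_power[OF zI]) auto
     from zidealD(3)[OF zI this, of "[:c e:]"]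
     show "smult (c e) (\<Prod>i<m. (f \<circ>\<^sub>p [:fst y + int i, snd y:]) ^ e i) - smult (c e) (mon b e) \<in> quadZ p a"
      by (simp add: smult_diff_right)
    qed
    then show ?thesis using van[OF y(2)] zideal_mem_cong[OF zI] by blast
   qed
  qed
  then show ?thesis by (simp add: coeffQ const_quadZ allp_def)
 qed
 obtain M where "artin_schreier p M" using exists_artin_schreier[OF p] by blast
 then interpret artin_schreier p M .
 \<comment> \<open>Putting the power p^i of \<open>f\<close> for the i-th variable turns the
   monomial \<open>e\<close> into the exponent with base-p digits \<open>e\<close>. Digits below p
   make these exponents distinct, so the nonzero coefficient survives.\<close>
 define ex where "ex e = (\<Sum>i<m. e i * p ^ i)" for e :: "nat => nat"
 define Q where "Q = (\<Sum>e\<in>E. monom [:c e:] (ex e))"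
 have degQ: "degree Q < p ^ m"
 proof -
  have "degree Q \<le> p ^ m - 1" unfolding Q_def
  proof (intro degree_sum_le finE order_trans[OF degree_monom_le])
   fix e assume "e \<in> E"
   then have "ex e < p ^ m" unfolding ex_def using Eb by (intro digits_bound) auto
   then show "ex e \<le> p ^ m - 1" by simp
  qed
  then show ?thesis using p1 by (metis Suc_pred' le_imp_less_Suc neq0_conv not_one_less_zero power_eq_0_iff)
 qed
 have rt: "poly Q f \<in> M" if f: "f \<in> F" for f
 proof -
  have e: "poly Q f = (\<Sum>e\<in>E. [:c e:] * (\<Prod>i<m. (f ^ (p ^ i)) ^ e i))"
   unfolding Q_def poly_sum poly_monom ex_def
   by (simp add: power_sum power_mult[symmetric] mult.commute)
  have "poly Q f - R f \<in> M" unfolding e R_def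
  proof (intro zideal_diff_sum[OF MI])
   fix e
   have "(\<Prod>i<m. (f ^ (p ^ i)) ^ e i) - (\<Prod>i<m. (f \<circ>\<^sub>p [:int i, 1:]) ^ e i) \<in> M"
    by (intro zideal_diff_prod[OF MI] zideal_diff_power[OF MI] frob_iter)
   from zidealD(3)[OF MI this, of "[:c e:]"]
   show "[:c e:] * (\<Prod>i<m. (f ^ (p ^ i)) ^ e i) - smult (c e) (\<Prod>i<m. (f \<circ>\<^sub>p [:int i, 1:]) ^ e i) \<in> M"
    by (simp add: right_diff_distrib)
  qed
  then show ?thesis using allp_M[OF allR[OF f]] zideal_mem_cong[OF MI] by blast
 qed
 have sep: "f - g \<notin> M" if "f \<in> F" "g \<in> F" "f \<noteq> g" for f g
 proof
  assume "f - g \<in> M"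
  moreover have "\<forall>i\<ge>N. int p dvd coeff (f - g) i" using F(2)[OF that(1)] F(2)[OF that(2)] by (auto simp: coeff_eq_0)
  ultimately have "allp p (f - g)" using M_small N(2) by blast
  then show False using F(3) that by blast
 qed
 have cQ: "coeff Q i \<in> M" for i
  by (rule root_count[OF M F(1) sep rt]) (use degQ nF in auto)
 obtain e where e: "e \<in> E" "\<not> int p dvd c e" using c(1) by blast
 have "coeff Q (ex e) = (\<Sum>e'\<in>E. if e' = e then [:c e:] else 0)"
  unfolding Q_def coeff_sum
 proof (rule sum.cong)
  fix e' assume e': "e' \<in> E"
  have ee: "e' = e" if eq: "ex e' = ex e"
  proof -
   have "\<forall>i<m. e' i = e i" by (rule digits_inj[of m e' p e]) (use Eb e' e(1) eq in \<open>auto simp: ex_def\<close>)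
   then show ?thesis using PiE_ext[OF e'[unfolded E_def] e(1)[unfolded E_def]] by simp
  qed
  show "coeff (monom [:c e':] (ex e')) (ex e) = (if e' = e then [:c e:] else 0)"
  proof (cases "e' = e")
   case False
   then have "ex e' \<noteq> ex e" using ee by blast
   then show ?thesis using False by simp
  qed simp
 qed simp
 also have "... = [:c e:]" using e finE by simp
 finally have "[:c e:] \<in> M" using cQ by metis
 moreover have "\<forall>i\<ge>1. int p dvd coeff [:c e:] i" by (auto simp: coeff_pCons split: nat.splits)
 ultimately have "allp p [:c e:]" using M_small[of "[:c e:]" 1] p1 by simp
 then show False using e(2) by (auto simp: allp_def dest: spec[of _ 0])
qed

section \<open>The condenser on bit strings\<close>

definition fpoly :: "bool list => int poly" where
 "fpoly x = (\<Sum>j<length x. monom (of_bool (x ! j)) j)"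

definition qmul :: "nat => nat => nat \<times> nat => nat \<times> nat => nat \<times> nat" where
 "qmul p a z z' = ((fst z * fst z' + a * (snd z * snd z')) mod p, (fst z * snd z' + snd z * fst z') mod p)"

primrec qpow :: "nat => nat => nat \<times> nat => nat => nat \<times> nat" where
 "qpow p a z 0 = (1, 0)"
| "qpow p a z (Suc j) = qmul p a z (qpow p a z j)"

definition qeval :: "nat => nat => bool list => nat \<times> nat => nat \<times> nat" where
 "qeval p a x z = ((\<Sum>j<length x. of_bool (x ! j) * fst (qpow p a z j)) mod p,
   (\<Sum>j<length x. of_bool (x ! j) * snd (qpow p a z j)) mod p)"

text \<open>A symbol consists of 2 * w bits, w for each component of a field element. The seed
  supplies the two components of the evaluation point; the shifted first one is left unreduced
  because \<open>qmul\<close> reduces modulo p.\<close>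

definition pv :: "nat => nat => nat => nat => nat => bool list => bool list => bool list" where
 "pv p a b w m x s = map (%t.
   let z = qeval p a x (num (take b s) + t div (2 * w), num (drop b s)); r = t mod (2 * w)
   in if r < w then bit (fst z) r else bit (snd z) (r - w)) [0..<m * (2 * w)]"

lemma length_pv [simp]: "length (pv p a b w m x s) = m * (2 * w)"
 by (simp add: pv_def)

lemma degree_fpoly: "0 < length x ==> degree (fpoly x) < length x"
 unfolding fpoly_def by (rule le_less_trans[of _ "length x - 1"], rule degree_sum_le)
  (auto intro: order_trans[OF degree_monom_le])

lemma coeff_fpoly: "coeff (fpoly x) i = (if i < length x then of_bool (x ! i) else 0)"
 by (auto simp: fpoly_def coeff_sum)

lemma poly_fpoly: "poly (fpoly x) z = (\<Sum>j<length x. of_bool (x ! j) * z ^ j)"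
 by (simp add: fpoly_def poly_sum poly_monom)

lemma fpoly_inj:
 assumes p: "1 < p" and l: "length x = length y" and a: "\<forall>i. int p dvd coeff (fpoly x - fpoly y) i"
 shows "x = y"
proof (rule nth_equalityI[OF l])
 fix i assume i: "i < length x"
 have "int p dvd of_bool (x ! i) - of_bool (y ! i)" using a[rule_format, of i] i l by (simp add: coeff_fpoly)
 then show "x ! i = y ! i" using p by (cases "x ! i"; cases "y ! i") (auto simp: zdvd_not_zless)
qed

lemma pcompose_fpoly: "fpoly x \<circ>\<^sub>p q = (\<Sum>j<length x. smult (of_bool (x ! j)) (q ^ j))"
proof -
 have pw: "([:0, 1:] ^ k) \<circ>\<^sub>p q = q ^ k" for k
  by (induction k) (simp_all add: pcompose_mult pcompose_1 pcompose_pCons)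
 show ?thesis by (simp add: fpoly_def pcompose_sum monom_altdef pcompose_smult pw)
qed

lemma qpow_cong:
 "[fst (redq a ([:int u, int v:] ^ j)) = int (fst (qpow p a (u, v) j))] (mod int p)"
 "[snd (redq a ([:int u, int v:] ^ j)) = int (snd (qpow p a (u, v) j))] (mod int p)"
proof (induction j)
 case 0
 { case 1 show ?case by (simp add: one_pCons redq_pCons) next case 2 show ?case by (simp add: one_pCons redq_pCons) }
next
 case (Suc j)
 have r: "redq a [:int u, int v:] = (int u, int v)" by (simp add: redq_pCons)
 { case 1
  have "[fst (redq a ([:int u, int v:] ^ Suc j)) = int u * int (fst (qpow p a (u, v) j)) + int a * (int v * int (snd (qpow p a (u, v) j)))] (mod int p)"
   unfolding power_Suc redq_mult r fst_conv snd_conv by (intro cong_add cong_mult cong_refl Suc)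
  then show ?case by (simp add: qmul_def zmod_int cong_def)
 next
  case 2
  have "[snd (redq a ([:int u, int v:] ^ Suc j)) = int u * int (snd (qpow p a (u, v) j)) + int v * int (fst (qpow p a (u, v) j))] (mod int p)"
   unfolding power_Suc redq_mult r fst_conv snd_conv by (intro cong_add cong_mult cong_refl Suc)
  then show ?case by (simp add: qmul_def zmod_int cong_def) }
qed

lemma qeval_quadZ:
 "fpoly x \<circ>\<^sub>p [:int u, int v:] - [:int (fst (qeval p a x (u, v))), int (snd (qeval p a x (u, v))):] \<in> quadZ p a"
proof -
 have "[fst (redq a (fpoly x \<circ>\<^sub>p [:int u, int v:])) = (\<Sum>j<length x. of_bool (x ! j) * int (fst (qpow p a (u, v) j)))] (mod int p)"
  "[snd (redq a (fpoly x \<circ>\<^sub>p [:int u, int v:])) = (\<Sum>j<length x. of_bool (x ! j) * int (snd (qpow p a (u, v) j)))] (mod int p)"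
  unfolding pcompose_fpoly redq_sum redq_smult fst_conv snd_conv
  by (intro cong_sum cong_mult cong_refl qpow_cong)+
 then have "[fst (redq a (fpoly x \<circ>\<^sub>p [:int u, int v:])) = int (fst (qeval p a x (u, v)))] (mod int p)"
  "[snd (redq a (fpoly x \<circ>\<^sub>p [:int u, int v:])) = int (snd (qeval p a x (u, v)))] (mod int p)"
  by (simp_all add: qeval_def zmod_int cong_def)
 moreover have "redq a (f - [:s, t:]) = (fst (redq a f) - s, snd (redq a f) - t)" for f s t
 proof -
  have "f - [:s, t:] = f + [:- s, - t:]" by simp
  then show ?thesis by (simp only: redq_add) (simp add: redq_pCons)
 qed
 ultimately show ?thesis by (simp add: quadZ_def cong_iff_dvd_diff)
qed

lemma pv_bad:
 assumes p: "prime p" "nonres p a" and N: "0 < N" "N \<le> p" and m: "0 < m" and bw: "2 ^ b \<le> p" "p \<le> 2 ^ w"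
  and eps: "real (N * p * m) \<le> eps * 2 ^ (2 * b)"
  and B: "B \<subseteq> bits (m * (2 * w))" "2 * card B < p ^ m"
 shows "card (bad N (2 * b) (pv p a b w m) B eps) < p ^ m"
proof -
 let ?X = "bad N (2 * b) (pv p a b w m) B eps"
 have p1: "1 < p" using p prime_gt_1_nat by blast
 have w: "0 < w" using bw(2) p1 by (cases w) auto
 define yy where "yy s = (int (num (take b s)), int (num (drop b s)))" for s
 \<comment> \<open>Reads field elements back from an output string, which turns string targets into
   targets for \<open>condenser_bad_bound\<close>.\<close>
 define t where "t \<beta> i = (int (num (map (%r. \<beta> ! (i * (2 * w) + r)) [0..<w])), int (num (map (%r. \<beta> ! (i * (2 * w) + (w + r))) [0..<w])))" for \<beta> i
 have dec: "t (pv p a b w m x s) i =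
   (int (fst (qeval p a x (num (take b s) + i, num (drop b s)))), int (snd (qeval p a x (num (take b s) + i, num (drop b s)))))"
  if i: "i < m" for x s i
 proof -
  have lt: "i * (2 * w) + r < m * (2 * w)" if "r < 2 * w" for r
  proof -
   have "i * (2 * w) + r < (i + 1) * (2 * w)" using that by simp
   also have "... \<le> m * (2 * w)" using i by (intro mult_right_mono) auto
   finally show ?thesis .
  qed
  have dm: "(i * (2 * w) + r) div (2 * w) = i" "(i * (2 * w) + r) mod (2 * w) = r" if "r < 2 * w" for r
   using that w by auto
  let ?z = "qeval p a x (num (take b s) + i, num (drop b s))"
  have "map (%r. pv p a b w m x s ! (i * (2 * w) + r)) [0..<w] = nbits w (fst ?z)"
   "map (%r. pv p a b w m x s ! (i * (2 * w) + (w + r))) [0..<w] = nbits w (snd ?z)"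
   unfolding pv_def nbits_def using lt dm by (auto simp: Let_def)
  moreover have "fst ?z < 2 ^ w" "snd ?z < 2 ^ w"
   using bw(2) p1 by (auto simp: qeval_def intro: order_less_le_trans[OF mod_less_divisor])
  ultimately show ?thesis by (simp add: t_def)
 qed
 have inj: "inj_on fpoly (bits N)"
 proof (rule inj_onI)
  fix x y assume "x \<in> bits N" "y \<in> bits N" "fpoly x = fpoly y"
  then show "x = y" using fpoly_inj[OF p1, of x y] by simp
 qed
 have injy: "inj_on yy (bits (2 * b))"
 proof (rule inj_onI)
  fix s s' assume s: "s \<in> bits (2 * b)" "s' \<in> bits (2 * b)" "yy s = yy s'"
  then have "take b s = take b s'" "drop b s = drop b s'" by (auto simp: yy_def intro!: num_inj)
  then show "s = s'" by (metis append_take_drop_id)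
 qed
 have sub: "?X \<subseteq> bits N" by (auto simp: bad_def)
 have "card (fpoly ` ?X) < p ^ m"
 proof (rule condenser_bad_bound[OF p m N, where Y = "yy ` bits (2 * b)" and B = B and t = t])
  show "finite B" using B(1) finite_bits finite_subset by blast
  show "2 * card B < p ^ m" by (rule B(2))
  show "y = y'" if y: "y \<in> yy ` bits (2 * b)" "y' \<in> yy ` bits (2 * b)"
   "int p dvd fst y - fst y'" "int p dvd snd y - snd y'" for y y'
  proof -
   obtain s s' where s: "y = yy s" "y' = yy s'" "length s = 2 * b" "length s' = 2 * b" using y(1,2) by auto
   have lt: "num (take b s) < p" "num (take b s') < p" "num (drop b s) < p" "num (drop b s') < p"
    using num_less[of "take b s"] num_less[of "take b s'"] num_less[of "drop b s"] num_less[of "drop b s'"] s bw(1)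
    by (auto intro: order_less_le_trans)
   have "k = k'" if "k < p" "k' < p" "int p dvd int k - int k'" for k k'
    using that by (metis mod_eq_dvd_iff mod_less of_nat_eq_iff zmod_int)
   then show ?thesis using y(3,4) lt s(1,2) by (auto simp: yy_def)
  qed
  show "degree f < N" if "f \<in> fpoly ` ?X" for f
   using that N degree_fpoly by (auto simp: bad_def)
  show "f = g" if fg: "f \<in> fpoly ` ?X" "g \<in> fpoly ` ?X" "allp p (f - g)" for f g
  proof -
   obtain x y where xy: "f = fpoly x" "g = fpoly y" "length x = length y" using fg(1,2) by (auto simp: bad_def)
   then show ?thesis using fpoly_inj[OF p1 xy(3)] fg(3) by (simp add: allp_def)
  qed
  show "N * p * m \<le> card {y \<in> yy ` bits (2 * b). \<exists>\<beta>\<in>B. \<forall>i<m. f \<circ>\<^sub>p [:fst y + int i, snd y:] - [:fst (t \<beta> i), snd (t \<beta> i):] \<in> quadZ p a}"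
   (is "_ \<le> card ?Z") if ff: "f \<in> fpoly ` ?X" for f
  proof -
   obtain x where x: "f = fpoly x" "x \<in> ?X" using ff by blast
   let ?S = "{s \<in> bits (2 * b). pv p a b w m x s \<in> B}"
   have "eps * 2 ^ (2 * b) < card ?S" using x(2) by (simp add: bad_def frc_def field_simps)
   then have "real (N * p * m) \<le> card ?S" using eps by linarith
   then have "N * p * m \<le> card ?S" by linarith
   also have "... = card (yy ` ?S)" by (intro card_image[symmetric] inj_on_subset[OF injy]) auto
   also have "... \<le> card ?Z"
   proof (intro card_mono image_subsetI)
    show "finite ?Z" by (rule finite_subset[of _ "yy ` bits (2 * b)"]) (auto simp del: bits_iff)
    fix s assume s: "s \<in> ?S"
    have "f \<circ>\<^sub>p [:fst (yy s) + int i, snd (yy s):] - [:fst (t (pv p a b w m x s) i), snd (t (pv p a b w m x s) i):] \<in> quadZ p a"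
     if "i < m" for i
     using qeval_quadZ[of x "num (take b s) + i" "num (drop b s)" p a] unfolding dec[OF that] x(1) yy_def by simp
    then show "yy s \<in> ?Z" using s by blast
   qed
   finally show ?thesis .
  qed
 qed auto
 then show ?thesis by (simp add: card_image[OF inj_on_subset[OF inj sub]])
qed

lemma ccond_pv:
 assumes "prime p" "nonres p a" "0 < N" "N \<le> p" "0 < m" "2 ^ b \<le> p" "p \<le> 2 ^ w"
  "real (N * p * m) \<le> eps * 2 ^ (2 * b)" "2 * K' < real p ^ m"
 shows "ccond N (2 * b) (m * (2 * w)) K' (real p ^ m) eps (pv p a b w m)"
 unfolding ccond_def
proof (intro allI impI)
 fix B assume B: "B \<subseteq> bits (m * (2 * w))" "real (card B) \<le> K'"
 have "real (2 * card B) < real (p ^ m)" using B(2) assms(9) by simp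
 then have "2 * card B < p ^ m" by (simp only: of_nat_less_iff)
 from pv_bad[OF assms(1-8) B(1) this] show "real (card (bad N (2 * b) (pv p a b w m) B eps)) \<le> real p ^ m"
  by (metis less_imp_le of_nat_le_iff of_nat_power)
qed

section \<open>Trevisan's extractor\<close>

subsection \<open>The reconstruction argument\<close>

text \<open>A Johnson bound. With signs for truth values, every listed codeword has correlation at
  least 2\<eta> with \<open>G\<close>, so the sum of n of them has correlation at least 2\<eta>n.
  Near orthogonality bounds the second moment of the sum by n + 2\<eta>^2 n^2, and comparing squares
  bounds n.\<close>

lemma list_size_bound:
 fixes \<phi> :: "'x => 'v => bool"
 assumes V: "finite V" "V \<noteq> {}" and X: "finite X" and eta: "0 < \<eta>"
  and pair: "\<And>x y. x \<in> X ==> y \<in> X ==> x \<noteq> y ==>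
   avg V (%v. (if \<phi> x v then 1 else -1) * (if \<phi> y v then 1 else -1)) \<le> 2 * \<eta>\<^sup>2"
 shows "card {x \<in> X. 1/2 + \<eta> < frc V (%v. \<phi> x v = G v)} \<le> 1 / (2 * \<eta>\<^sup>2)"
proof -
 define L where "L = {x \<in> X. 1/2 + \<eta> < frc V (%v. \<phi> x v = G v)}"
 define n where "n = real (card L)"
 have finL: "finite L" using X by (simp add: L_def)
 define s where "s x v = (if \<phi> x v then 1 else -1 :: real)" for x v
 define g where "g v = (if G v then 1 else -1 :: real)" for v
 have ge: "2 * \<eta> \<le> avg V (%v. s x v * g v)" if "x \<in> L" for x
 proof -
  have "avg V (%v. s x v * g v) = avg V (%v. 2 * of_bool (\<phi> x v = G v) - 1)"
   by (intro avg_cong) (auto simp: s_def g_def)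
  also have "... = 2 * frc V (%v. \<phi> x v = G v) - 1"
   using V by (simp add: avg_diff avg_cmult avg_const frc_avg)
  finally show ?thesis using that by (simp add: L_def)
 qed
 define F where "F v = (\<Sum>x\<in>L. s x v)" for v
 define t where "t = avg V (%v. F v * g v)"
 have t: "2 * \<eta> * n \<le> t"
 proof -
  have "2 * \<eta> * n = (\<Sum>x\<in>L. 2 * \<eta>)" by (simp add: n_def)
  also have "... \<le> (\<Sum>x\<in>L. avg V (%v. s x v * g v))" by (intro sum_mono ge)
  also have "... = t" unfolding t_def F_def sum_distrib_right avg_sum ..
  finally show ?thesis .
 qed
 \<comment> \<open>Cauchy-Schwarz as nonnegativity of a mean square, using that \<open>g\<close> has
   square 1.\<close>
 have "0 \<le> avg V (%v. (F v - t * g v)\<^sup>2)" by (intro avg_nonneg) simp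
 also have "... = avg V (%v. (F v)\<^sup>2 - (2 * t) * (F v * g v) + t\<^sup>2 * 1)"
  by (intro avg_cong) (auto simp: g_def power2_eq_square algebra_simps)
 also have "... = avg V (%v. (F v)\<^sup>2) - 2 * t * t + t\<^sup>2"
  unfolding avg_add avg_diff avg_cmult t_def[symmetric] using V by (simp add: avg_const)
 finally have t2: "t\<^sup>2 \<le> avg V (%v. (F v)\<^sup>2)" by (simp add: power2_eq_square)
 have "avg V (%v. (F v)\<^sup>2) = (\<Sum>x\<in>L. \<Sum>y\<in>L. avg V (%v. s x v * s y v))"
  unfolding F_def power2_eq_square sum_product avg_sum ..
 also have "... \<le> (\<Sum>x\<in>L. \<Sum>y\<in>L. (if y = x then 1 else 0) + 2 * \<eta>\<^sup>2)"
 proof (intro sum_mono)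
  fix x y assume xy: "x \<in> L" "y \<in> L"
  show "avg V (%v. s x v * s y v) \<le> (if y = x then 1 else 0) + 2 * \<eta>\<^sup>2"
  proof (cases "y = x")
   case True
   have "avg V (%v. s x v * s x v) = avg V (%v. 1)" by (intro avg_cong) (auto simp: s_def)
   then show ?thesis using True V by (simp add: avg_const)
  next
   case False
   then show ?thesis using pair[of x y] xy by (auto simp: L_def s_def)
  qed
 qed
 also have "... = n + 2 * \<eta>\<^sup>2 * n\<^sup>2"
  using finL by (simp add: sum.distrib n_def power2_eq_square algebra_simps)
 finally have "t\<^sup>2 \<le> n + 2 * \<eta>\<^sup>2 * n\<^sup>2" using t2 by linarith
 moreover have "(2 * \<eta> * n)\<^sup>2 \<le> t\<^sup>2" using t eta by (intro power_mono) (auto simp: n_def)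
 ultimately have "2 * \<eta>\<^sup>2 * n * n \<le> 1 * n" by (simp add: power2_eq_square algebra_simps)
 then have "n \<le> 1 / (2 * \<eta>\<^sup>2)"
 proof (cases "n = 0")
  case False
  then have "0 < n" by (simp add: n_def)
  then have "2 * \<eta>\<^sup>2 * n \<le> 1" using \<open>2 * \<eta>\<^sup>2 * n * n \<le> 1 * n\<close>
   by (simp only: mult_le_cancel_right_pos[OF \<open>0 < n\<close>])
  then show ?thesis using eta by (simp add: field_simps)
 qed (use eta in auto)
 then show ?thesis by (simp add: n_def L_def)
qed

lemma bij_len1: "bits 1 = {[True], [False]}"
 by (auto simp: length_Suc_conv)

lemma avg_singleton [simp]: "avg {a} f = f a"
 by (simp add: avg_def)

lemma avg_half: "avg S (%s. (f s + g s) / 2) = (avg S f + avg S g) / 2"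
 using avg_cmult[of S "1/2" "%s. f s + g s"] by (simp add: avg_add)

lemma avg_bits1: "avg (bits 1) f = (f [True] + f [False]) / 2"
 unfolding avg_def card_bits bij_len1 by simp

text \<open>The positions \<open>pos i a\<close> form the i-th block of the seed. A position shared
  by two blocks has the same index in both, so intersections of blocks are sets of indices.\<close>

locale design =
 fixes \<phi> :: "'x => bool list => bool" and pos :: "nat => nat => nat" and m \<l> D :: nat
 assumes pos_less: "i < m ==> a < \<l> ==> pos i a < D"
  and pos_inj: "i < m ==> j < m ==> a < \<l> ==> a' < \<l> ==> pos i a = pos j a' ==> a = a'"
begin

definition proj :: "nat => bool list => bool list" where
 "proj i y = map (%a. y ! pos i a) [0..<\<l>]"

definition out :: "'x => bool list => bool list" where
 "out x y = map (%i. \<phi> x (proj i y)) [0..<m]"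

definition ovw :: "nat => bool list => bool list => bool list" where
 "ovw i y v = map (%k. if \<exists>a<\<l>. pos i a = k then v ! (THE a. a < \<l> \<and> pos i a = k) else y ! k) [0..<D]"

lemma length_ovw [simp]: "length (ovw i y v) = D"
 by (simp add: ovw_def)

lemma length_out [simp]: "length (out x y) = m"
 by (simp add: out_def)

lemma length_proj [simp]: "length (proj i y) = \<l>"
 by (simp add: proj_def)

lemma the_pos: "i < m ==> a < \<l> ==> (THE a'. a' < \<l> \<and> pos i a' = pos i a) = a"
 using pos_inj by (intro the_equality) auto

lemma ovw_pos: "i < m ==> a < \<l> ==> ovw i y v ! pos i a = v ! a"
 using pos_less[of i a] the_pos[of i a] by (auto simp: ovw_def)

lemma ovw_other: "k < D ==> (\<And>a. a < \<l> ==> pos i a \<noteq> k) ==> ovw i y v ! k = y ! k"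
 by (auto simp: ovw_def)

lemma proj_ovw: "i < m ==> length v = \<l> ==> proj i (ovw i y v) = v"
 by (rule nth_equalityI) (simp_all add: proj_def ovw_pos)

lemma ovw_ovw: "i < m ==> length y = D ==> ovw i (ovw i y v) (proj i y) = y"
proof (rule nth_equalityI)
 fix k assume i: "i < m" "length y = D" and "k < length (ovw i (ovw i y v) (proj i y))"
 then have k: "k < D" by simp
 show "ovw i (ovw i y v) (proj i y) ! k = y ! k"
 proof (cases "\<exists>a<\<l>. pos i a = k")
  case True
  then obtain a where a: "a < \<l>" "pos i a = k" by blast
  then show ?thesis using ovw_pos[OF i(1) a(1)] by (auto simp: proj_def)
 next
  case False
  then show ?thesis using k by (auto simp: ovw_other)
 qed
qed auto

text \<open>Exchanging the bits of block i with \<open>v\<close> is an involution on pairs, so a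
  uniform seed may be drawn as a seed outside the block and an independent \<open>v\<close> inside
  it.\<close>

lemma avg_ovw:
 assumes i: "i < m"
 shows "avg (bits D) f = avg (bits D) (%y. avg (bits \<l>) (%v. f (ovw i y v)))"
proof -
 have bij: "bij_betw (%(y, v). (ovw i y v, proj i y)) (bits D \<times> bits \<l>) (bits D \<times> bits \<l>)"
  by (rule bij_betwI[where g = "%(y, v). (ovw i y v, proj i y)"]) (auto simp: i proj_ovw ovw_ovw)
 have "avg (bits D) f = avg (bits D) (%y. avg (bits \<l>) (%v. f y))" by (simp add: avg_const)
 also have "... = avg (bits D \<times> bits \<l>) (%z. f (fst z))" by (simp add: avg_prod)
 also have "... = avg (bits D \<times> bits \<l>) (%z. f (fst (case z of (y, v) => (ovw i y v, proj i y))))"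
  by (rule avg_bij[OF bij])
 also have "... = avg (bits D) (%y. avg (bits \<l>) (%v. f (ovw i y v)))" by (simp add: avg_prod)
 finally show ?thesis .
qed

definition isec :: "nat => nat => nat list" where
 "isec i j = filter (%a. pos j a = pos i a) [0..<\<l>]"

definition pred :: "bool list set => bool => bool list => bool list => bool" where
 "pred T c \<tau> z = (if z @ [c] @ \<tau> \<in> T then c else \<not> c)"

text \<open>Once the seed outside block i is fixed, an earlier output bit j depends on
  \<open>v\<close> only through the positions common to blocks i and j, so a table of its values is
  enough advice. The tables, not the seed, enter the count of predictors.\<close>

definition gfun :: "bool list set => nat => bool => bool list => (nat \<times> bool list) set => bool list => bool" where
 "gfun T i c \<tau> S v = pred T c \<tau> (map (%j. (j, map ((!) v) (isec i j)) \<in> S) [0..<i])"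

definition sig :: "nat => (nat \<times> bool list) set" where
 "sig i = (SIGMA j:{..<i}. bits (length (isec i j)))"

definition gs :: "bool list set => nat => (bool list => bool) set" where
 "gs T i = (%(c, \<tau>, S). gfun T i c \<tau> S) ` (UNIV \<times> bits (m - Suc i) \<times> Pow (sig i))"

lemma finite_sig: "finite (sig i)"
 unfolding sig_def by (intro finite_SigmaI) auto

lemma finite_gs: "finite (gs T i)"
 unfolding gs_def by (intro finite_imageI finite_cartesian_product) (auto simp: finite_sig simp del: bits_iff)

lemma card_gs:
 fixes \<rho> :: real
 assumes "i < m" "real (\<Sum>j<i. 2 ^ length (isec i j)) \<le> \<rho> * real i" "1 \<le> \<rho>"
 shows "real (card (gs T i)) \<le> 2 powr (\<rho> * m)"
proof -
 have "real (m - i) \<le> \<rho> * real (m - i)" using assms(3) mult_right_mono[of 1 \<rho> "real (m - i)"] by simp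
 then have "real (m - i) + real (\<Sum>j<i. 2 ^ length (isec i j)) \<le> \<rho> * (real (m - i) + real i)"
  using assms(2) by (simp add: distrib_left)
 also have "real (m - i) + real i = real m" using assms(1) by simp
 finally have le: "real (m - i) + real (\<Sum>j<i. 2 ^ length (isec i j)) \<le> \<rho> * real m" .
 have "card (gs T i) \<le> card ((UNIV :: bool set) \<times> bits (m - Suc i) \<times> Pow (sig i))"
  unfolding gs_def by (intro card_image_le finite_cartesian_product) (auto simp: finite_sig simp del: bits_iff)
 also have "... = 2 * 2 ^ (m - Suc i) * 2 ^ card (sig i)"
  by (simp add: card_cartesian_product card_Pow finite_sig)
 also have "card (sig i) = (\<Sum>j<i. 2 ^ length (isec i j))"
  unfolding sig_def by (subst card_SigmaI) auto
 also have "2 * 2 ^ (m - Suc i) = (2::nat) ^ (m - i)" using assms(1) by (metis Suc_diff_Suc power_Suc)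
 finally have "real (card (gs T i)) \<le> 2 ^ (m - i) * 2 ^ (\<Sum>j<i. 2 ^ length (isec i j))"
  by (metis (mono_tags, lifting) of_nat_le_iff of_nat_mult of_nat_numeral of_nat_power)
 also have "... = 2 powr (real (m - i) + real (\<Sum>j<i. 2 ^ length (isec i j)))"
  by (simp add: powr_add powr_realpow del: of_nat_sum)
 also have "... \<le> 2 powr (\<rho> * m)" by (rule powr_mono[OF le]) simp
 finally show ?thesis .
qed

lemma hybrid:
 assumes T: "T \<subseteq> bits m" and b: "card T / 2 ^ m + eps < frc (bits D) (%y. out x y \<in> T)" and m: "0 < m"
 shows "\<exists>i<m. \<exists>G\<in>gs T i. 1/2 + eps / m < frc (bits \<l>) (%v. \<phi> x v = G v)"
proof -
 \<comment> \<open>Hybrids: from position i on the output is replaced by uniform bits, so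
   \<open>h m\<close> is the true frequency and \<open>h 0\<close> the density of the test.\<close>
 define h where "h i = avg (bits D) (%y. avg (bits (m - i)) (%u. of_bool (take i (out x y) @ u \<in> T)))" for i
 have "bits 0 = {[]}" by auto
 then have hm: "h m = frc (bits D) (%y. out x y \<in> T)" by (simp add: h_def frc_avg)
 have "{u \<in> bits m. u \<in> T} = T" using T by auto
 then have h0: "h 0 = card T / 2 ^ m" by (simp add: h_def avg_const frc_avg[symmetric]) (simp add: frc_def)
 have "(\<Sum>i<m. h (Suc i) - h i) = h m - h 0" by (rule sum_lessThan_telescope)
 then have gt: "eps < (\<Sum>i<m. h (Suc i) - h i)" using b hm h0 by simp
 have "\<exists>i<m. eps / m < h (Suc i) - h i"
 proof (rule ccontr)
  assume "\<not> ?thesis"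
  then have "h (Suc i) - h i \<le> eps / m" if "i < m" for i using that by (meson not_less)
  then have "(\<Sum>i<m. h (Suc i) - h i) \<le> (\<Sum>i<m. eps / m)" by (intro sum_mono) simp
  then show False using gt m by simp
 qed
 then obtain i where i: "i < m" "eps / m < h (Suc i) - h i" by blast
 define ch where "ch y \<tau> c = (of_bool (take i (out x y) @ [c] @ \<tau> \<in> T) :: real)" for y \<tau> c
 let ?n = "m - Suc i"
 have hi: "h i = avg (bits D) (%y. avg (bits ?n) (%\<tau>. (ch y \<tau> True + ch y \<tau> False) / 2))"
 proof -
  have "m - i = 1 + ?n" using i(1) by simp
  then have "h i = avg (bits D) (%y. avg (bits 1) (%c. avg (bits ?n) (%\<tau>. of_bool (take i (out x y) @ (c @ \<tau>) \<in> T))))"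
   unfolding h_def by (simp only: avg_append)
  also have "... = avg (bits D) (%y. avg (bits ?n) (%\<tau>. (ch y \<tau> True + ch y \<tau> False) / 2))"
   unfolding avg_bits1 ch_def avg_half by simp
  finally show ?thesis .
 qed
 have hs: "h (Suc i) = avg (bits D) (%y. avg (bits ?n) (%\<tau>. ch y \<tau> (out x y ! i)))"
  unfolding h_def ch_def using i(1) by (simp add: take_Suc_conv_app_nth)
 have "h (Suc i) - h i = avg (bits ?n) (%\<tau>. avg (bits D) (%y. ch y \<tau> (out x y ! i) - (ch y \<tau> True + ch y \<tau> False) / 2))"
  unfolding hs hi avg_diff[symmetric] by (rule avg_swap)
 then obtain \<tau> where \<tau>: "\<tau> \<in> bits ?n" "eps / m < avg (bits D) (%y. ch y \<tau> (out x y ! i) - (ch y \<tau> True + ch y \<tau> False) / 2)"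
  using i(2) avg_gt_ex[of "bits ?n" "eps / m"] by force
 \<comment> \<open>Averaged over the guess \<open>c\<close>, the predictor is right with probability
   1/2 plus the hybrid gap. One of the two guesses is at least that good, and averaging then fixes
   the seed outside the block.\<close>
 define q where "q c y = (of_bool (pred T c \<tau> (take i (out x y)) = out x y ! i) :: real)" for c y
 have "(q True y + q False y) / 2 = 1/2 + (ch y \<tau> (out x y ! i) - (ch y \<tau> True + ch y \<tau> False) / 2)" for y
  by (cases "out x y ! i") (auto simp: q_def ch_def pred_def)
 then have "avg (bits D) (%y. (q True y + q False y) / 2) = avg (bits D) (%y. 1/2 + (ch y \<tau> (out x y ! i) - (ch y \<tau> True + ch y \<tau> False) / 2))"
  by (simp only:)
 also have "... = 1/2 + avg (bits D) (%y. ch y \<tau> (out x y ! i) - (ch y \<tau> True + ch y \<tau> False) / 2)"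
  unfolding avg_add by (simp add: avg_const)
 finally have "avg (bits D) (%y. (q True y + q False y) / 2) = 1/2 + avg (bits D) (%y. ch y \<tau> (out x y ! i) - (ch y \<tau> True + ch y \<tau> False) / 2)" .
 then have "1/2 + eps / m < avg (bits D) (%y. (q True y + q False y) / 2)" using \<tau>(2) by simp
 also have "... = (avg (bits D) (q True) + avg (bits D) (q False)) / 2" by (rule avg_half)
 finally have qq: "1/2 + eps / m < (avg (bits D) (q True) + avg (bits D) (q False)) / 2" .
 have "\<exists>c. 1/2 + eps / m < avg (bits D) (q c)"
 proof (rule ccontr)
  assume "\<not> ?thesis"
  then have "avg (bits D) (q True) \<le> 1/2 + eps / m" "avg (bits D) (q False) \<le> 1/2 + eps / m"
   by (simp_all only: not_ex not_less)
  moreover have "(x + y) / 2 \<le> c" if "x \<le> c" "y \<le> c" for x y c :: real using that by simp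
  ultimately have "(avg (bits D) (q True) + avg (bits D) (q False)) / 2 \<le> 1/2 + eps / m" by blast
  then show False using qq by (meson not_less)
 qed
 then obtain c where "1/2 + eps / m < avg (bits D) (q c)" by blast
 then have "1/2 + eps / m < avg (bits D) (%y. avg (bits \<l>) (%v. q c (ovw i y v)))" by (subst (asm) avg_ovw[OF i(1)])
 then obtain y where y: "y \<in> bits D" "1/2 + eps / m < avg (bits \<l>) (%v. q c (ovw i y v))"
  using avg_gt_ex[of "bits D" "1/2 + eps / m"] by force
 define mix where "mix j v = map (%a. if pos j a = pos i a then v ! a else y ! pos j a) [0..<\<l>]" for j v
 define S where "S = {(j, z). j < i \<and> z \<in> bits (length (isec i j)) \<and> (\<exists>v\<in>bits \<l>. map ((!) v) (isec i j) = z \<and> \<phi> x (mix j v))}"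
 have pm: "proj j (ovw i y v) = mix j v" if "j < i" "v \<in> bits \<l>" for j v
 proof (rule nth_equalityI)
  fix a assume "a < length (proj j (ovw i y v))"
  then have a: "a < \<l>" by simp
  have j: "j < m" using that i(1) by simp
  have "ovw i y v ! pos j a = (if pos j a = pos i a then v ! a else y ! pos j a)"
  proof (cases "pos j a = pos i a")
   case False
   then have "pos i a' \<noteq> pos j a" if "a' < \<l>" for a' using pos_inj[OF i(1) j that a] by auto
   then show ?thesis using False ovw_other pos_less[OF j a] by simp
  qed (simp add: ovw_pos[OF i(1) a])
  then show "proj j (ovw i y v) ! a = mix j v ! a" using a by (simp add: proj_def mix_def)
 qed (simp add: mix_def)
 have Siff: "(j, map ((!) v) (isec i j)) \<in> S \<longleftrightarrow> \<phi> x (mix j v)" if "j < i" "v \<in> bits \<l>" for j v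
 proof -
  have "mix j v' = mix j v" if "map ((!) v') (isec i j) = map ((!) v) (isec i j)" for v'
   using that unfolding mix_def isec_def by auto
  then show ?thesis using that unfolding S_def mem_Collect_eq prod.case by (metis bits_iff length_map)
 qed
 have "S \<subseteq> sig i" by (auto simp: S_def sig_def)
 then have G: "gfun T i c \<tau> S \<in> gs T i" using \<tau>(1) unfolding gs_def by blast
 have "q c (ovw i y v) = of_bool (\<phi> x v = gfun T i c \<tau> S v)" if v: "v \<in> bits \<l>" for v
 proof -
  have "take i (out x (ovw i y v)) = map (%j. (j, map ((!) v) (isec i j)) \<in> S) [0..<i]"
   using i(1) Siff pm v by (auto simp: out_def take_map intro!: nth_equalityI)
  moreover have "out x (ovw i y v) ! i = \<phi> x v" using i(1) v by (simp add: out_def proj_ovw)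
  ultimately show ?thesis by (auto simp: q_def gfun_def)
 qed
 then have "avg (bits \<l>) (%v. q c (ovw i y v)) = frc (bits \<l>) (%v. \<phi> x v = gfun T i c \<tau> S v)"
  unfolding frc_avg[OF finite_bits] by (intro avg_cong)
 then show ?thesis using y(2) G i(1) by metis
qed

text \<open>Union bound over predictors: a bad input agrees noticeably with one of them, and at most
  \<Lambda> inputs do so with a given one. The case m = 0 is separate because of the division by
  m.\<close>

theorem trevisan_bad:
 fixes \<rho> eps \<Lambda> :: real
 assumes T: "T \<subseteq> bits m" and X: "finite X" and \<rho>: "1 \<le> \<rho>"
  and weak: "\<And>i. i < m ==> real (\<Sum>j<i. 2 ^ length (isec i j)) \<le> \<rho> * real i"
  and lst: "\<And>G. card {x \<in> X. 1/2 + eps / m < frc (bits \<l>) (%v. \<phi> x v = G v)} \<le> (\<Lambda>::real)"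
  and eps: "0 \<le> eps"
 shows "card {x \<in> X. card T / 2 ^ m + eps < frc (bits D) (%y. out x y \<in> T)} \<le> m * 2 powr (\<rho> * m) * \<Lambda>"
proof (cases "m = 0")
 case True
 have "bits 0 = {[]}" by auto
 then have "T = {} \<or> T = {[]}" using T True by auto
 moreover have "out x y = []" for x y using True length_out[of x y] by (metis length_0_conv)
 ultimately have "frc (bits D) (%y. out x y \<in> T) \<le> card T / 2 ^ m" for x
 proof (elim disjE)
  assume "T = {[]}"
  then show ?thesis using frc_le_1[of "bits D" "%y. out x y \<in> T"] True by simp
 qed (simp add: frc_def)
 then have "frc (bits D) (%y. out x y \<in> T) \<le> card T / 2 ^ m + eps" for x
  using eps by (meson add_increasing2 order_trans order_refl)
 then have e: "{x \<in> X. card T / 2 ^ m + eps < frc (bits D) (%y. out x y \<in> T)} = {}"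
  by (auto simp: not_less)
 show ?thesis unfolding e using True by simp
next
 case False
 define A where "A G = {x \<in> X. 1/2 + eps / m < frc (bits \<l>) (%v. \<phi> x v = G v)}" for G
 have \<Lambda>: "0 \<le> \<Lambda>" using lst[of undefined] by (meson of_nat_0_le_iff order_trans)
 let ?bad = "{x \<in> X. card T / 2 ^ m + eps < frc (bits D) (%y. out x y \<in> T)}"
 have "?bad \<subseteq> (\<Union>i<m. \<Union>G\<in>gs T i. A G)" using hybrid[OF T] False by (fastforce simp: A_def)
 then have "card ?bad \<le> card (\<Union>i<m. \<Union>G\<in>gs T i. A G)"
  using X by (intro card_mono finite_UN_I finite_gs) (auto simp: A_def)
 also have "... \<le> (\<Sum>i<m. card (\<Union>G\<in>gs T i. A G))" by (rule card_UN_le) simp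
 also have "... \<le> (\<Sum>i<m. \<Sum>G\<in>gs T i. card (A G))" by (intro sum_mono card_UN_le finite_gs)
 finally have "real (card ?bad) \<le> (\<Sum>i<m. \<Sum>G\<in>gs T i. real (card (A G)))"
  by (metis (mono_tags, lifting) of_nat_le_iff of_nat_sum sum.cong)
 also have "... \<le> (\<Sum>i<m. \<Sum>G\<in>gs T i. \<Lambda>)" using lst by (intro sum_mono) (auto simp: A_def)
 also have "... \<le> (\<Sum>i<m. 2 powr (\<rho> * m) * \<Lambda>)"
  using card_gs weak \<rho> \<Lambda> by (intro sum_mono) (auto intro!: mult_right_mono simp del: of_nat_sum)
 finally show ?thesis by simp
qed

end

section \<open>A merger by the method of multiplicities\<close>

text \<open>
 Polynomials in \<open>R\<close> variables are coefficient functions on exponent lists of length \<open>R\<close>;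
 \<open>hm \<beta> e a\<close> is the Hasse derivative of order \<open>\<beta>\<close> of the monomial with exponents \<open>e\<close> at \<open>a\<close>.
\<close>

fun hm :: "nat list => nat list => 'a::comm_ring_1 list => 'a" where
 "hm (b # bs) (e # es) (a # as) = of_nat (e choose b) * a ^ (e - b) * hm bs es as"
| "hm _ _ _ = 1"

definition lst :: "nat => nat => nat list set" where
 "lst R h = {e. length e = R \<and> set e \<subseteq> {..<h}}"

lemma finite_lst [simp]: "finite (lst R h)"
 unfolding lst_def using finite_lists_length_eq[of "{..<h}" R] by (simp add: conj_commute)

lemma card_lst: "card (lst R h) = h ^ R"
 unfolding lst_def using card_lists_length_eq[of "{..<h}" R] by (simp add: conj_commute)

lemma lst_0: "lst 0 h = {[]}"
 by (auto simp: lst_def)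

lemma lst_Suc: "lst (Suc R) h = (%(x, xs). x # xs) ` ({..<h} \<times> lst R h)"
 by (force simp: lst_def length_Suc_conv)

lemma sum_lst_Suc: "(\<Sum>e\<in>lst (Suc R) h. f e) = (\<Sum>x<h. \<Sum>e\<in>lst R h. f (x # e))"
 unfolding lst_Suc by (subst sum.reindex) (auto simp: inj_on_def sum.cartesian_product split_def)

definition low :: "nat => nat => nat list set" where
 "low R s = {\<beta>. length \<beta> = R \<and> sum_list \<beta> < s}"

lemma low_subset: "low R s \<subseteq> lst R s"
 by (auto simp: low_def lst_def dest: member_le_sum_list)

lemma finite_low [simp]: "finite (low R s)"
 using low_subset finite_lst by (rule finite_subset)

text \<open>Pascal's rule: either the first entry is 0 or it can be lowered by one.\<close>

lemma card_low: "card (low R s) \<le> 2 ^ (R + s)"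
proof (induction R arbitrary: s)
 case 0
 have "low 0 s \<subseteq> {[]}" by (auto simp: low_def)
 then have "card (low 0 s) \<le> card {[]::nat list}" by (intro card_mono) auto
 then show ?case by (simp add: order_trans[OF _ one_le_power])
next
 case (Suc R)
 show ?case
 proof (induction s)
  case 0
  then show ?case by (simp add: low_def)
 next
  case (Suc s)
  have "low (Suc R) (Suc s) \<subseteq> (%\<beta>. 0 # \<beta>) ` low R (Suc s) \<union> (%\<beta>. Suc (hd \<beta>) # tl \<beta>) ` low (Suc R) s"
  proof
   fix \<beta> assume b: "\<beta> \<in> low (Suc R) (Suc s)"
   then obtain x xs where x: "\<beta> = x # xs" "length xs = R" "x + sum_list xs < Suc s" by (auto simp: low_def length_Suc_conv)
   show "\<beta> \<in> (%\<beta>. 0 # \<beta>) ` low R (Suc s) \<union> (%\<beta>. Suc (hd \<beta>) # tl \<beta>) ` low (Suc R) s"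
   proof (cases x)
    case 0
    then show ?thesis using x by (auto simp: low_def)
   next
    case (Suc y)
    then have "y # xs \<in> low (Suc R) s" "\<beta> = Suc (hd (y # xs)) # tl (y # xs)" using x by (auto simp: low_def)
    then show ?thesis by blast
   qed
  qed
  then have "card (low (Suc R) (Suc s)) \<le> card ((%\<beta>. 0 # \<beta>) ` low R (Suc s) \<union> (%\<beta>. Suc (hd \<beta>) # tl \<beta>) ` low (Suc R) s)"
   by (intro card_mono) auto
  also have "... \<le> card ((%\<beta>. 0 # \<beta>) ` low R (Suc s)) + card ((%\<beta>. Suc (hd \<beta>) # tl \<beta>) ` low (Suc R) s)"
   by (rule card_Un_le)
  also have "... \<le> card (low R (Suc s)) + card (low (Suc R) s)" by (intro add_mono card_image_le) auto
  also have "... \<le> 2 ^ (R + Suc s) + 2 ^ (Suc R + s)" using Suc.IH \<open>\<And>s. card (low R s) \<le> 2 ^ (R + s)\<close> by (intro add_mono)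
  also have "... = 2 ^ (Suc R + Suc s)" by simp
  finally show ?case .
 qed
qed

subsection \<open>Taylor expansion\<close>

fun bprod :: "nat list => nat list => nat" where
 "bprod (b # bs) (g # gs) = ((b + g) choose b) * bprod bs gs"
| "bprod _ _ = 1"

fun vpow :: "'a::comm_ring_1 list => nat list => 'a" where
 "vpow (v # vs) (g # gs) = v ^ g * vpow vs gs"
| "vpow _ _ = 1"

text \<open>The binomial theorem combined with \<open>choose_mult\<close>. Hasse derivatives have
  binomials where ordinary ones have factorials, so the expansion involves no division and survives
  reduction modulo p.\<close>

lemma hasse_taylor1:
 fixes a v :: "'a::comm_ring_1"
 assumes "e < h"
 shows "of_nat (e choose b) * (a + v) ^ (e - b) =
  (\<Sum>g<h. of_nat ((b + g) choose b) * v ^ g * (of_nat (e choose (b + g)) * a ^ (e - (b + g))))"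
proof (cases "b \<le> e")
 case False
 then show ?thesis by (simp add: binomial_eq_0)
next
 case True
 have "(a + v) ^ (e - b) = (\<Sum>g\<le>e - b. of_nat ((e - b) choose g) * v ^ g * a ^ (e - b - g))"
  by (subst add.commute) (rule binomial_ring)
 then have "of_nat (e choose b) * (a + v) ^ (e - b) = (\<Sum>g\<le>e - b. of_nat ((e choose b) * ((e - b) choose g)) * v ^ g * a ^ (e - b - g))"
  by (simp add: sum_distrib_left mult.assoc)
 also have "... = (\<Sum>g\<le>e - b. of_nat ((b + g) choose b) * v ^ g * (of_nat (e choose (b + g)) * a ^ (e - (b + g))))"
 proof (intro sum.cong refl)
  fix g assume g: "g \<in> {..e - b}"
  have "(e choose (b + g)) * ((b + g) choose b) = (e choose b) * ((e - b) choose g)"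
   using choose_mult[of b "b + g" e] g True by simp
  then have "of_nat ((e choose b) * ((e - b) choose g)) = (of_nat (e choose (b + g)) * of_nat ((b + g) choose b) :: 'a)"
   by (metis of_nat_mult)
  then show "of_nat ((e choose b) * ((e - b) choose g)) * v ^ g * a ^ (e - b - g) =
   of_nat ((b + g) choose b) * v ^ g * (of_nat (e choose (b + g)) * a ^ (e - (b + g)))"
   by (simp add: ac_simps)
 qed
 also have "... = (\<Sum>g<h. of_nat ((b + g) choose b) * v ^ g * (of_nat (e choose (b + g)) * a ^ (e - (b + g))))"
 proof (intro sum.mono_neutral_left ballI)
  fix i assume "i \<in> {..<h} - {..e - b}"
  then have "e < b + i" by auto
  then show "of_nat (b + i choose b) * v ^ i * (of_nat (e choose (b + i)) * a ^ (e - (b + i))) = 0"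
   by (simp add: binomial_eq_0)
 qed (use assms in auto)
 finally show ?thesis .
qed

lemma hasse_taylor:
 fixes a v :: "'a::comm_ring_1 list"
 assumes "length \<beta> = R" "e \<in> lst R h" "length a = R" "length v = R"
 shows "hm \<beta> e (map2 (+) a v) = (\<Sum>g\<in>lst R h. of_nat (bprod \<beta> g) * vpow v g * hm (map2 (+) \<beta> g) e a)"
 using assms
proof (induction R arbitrary: \<beta> e a v)
 case 0
 then show ?case by (simp add: lst_0)
next
 case (Suc R)
 obtain b \<beta>' where \<beta>: "\<beta> = b # \<beta>'" "length \<beta>' = R" using Suc.prems(1) by (auto simp: length_Suc_conv)
 obtain x a' where a: "a = x # a'" "length a' = R" using Suc.prems(3) by (auto simp: length_Suc_conv)
 obtain y v' where v: "v = y # v'" "length v' = R" using Suc.prems(4) by (auto simp: length_Suc_conv)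
 obtain k e' where e: "e = k # e'" "k < h" "e' \<in> lst R h" using Suc.prems(2) by (auto simp: lst_Suc)
 have "hm \<beta> e (map2 (+) a v) = (of_nat (k choose b) * (x + y) ^ (k - b)) * hm \<beta>' e' (map2 (+) a' v')"
  by (simp add: \<beta> a v e)
 also have "... = (\<Sum>g<h. of_nat ((b + g) choose b) * y ^ g * (of_nat (k choose (b + g)) * x ^ (k - (b + g)))) *
   (\<Sum>g\<in>lst R h. of_nat (bprod \<beta>' g) * vpow v' g * hm (map2 (+) \<beta>' g) e' a')"
  by (simp only: hasse_taylor1[OF e(2)] Suc.IH[OF \<beta>(2) e(3) a(2) v(2)])
 also have "... = (\<Sum>g\<in>lst (Suc R) h. of_nat (bprod \<beta> g) * vpow v g * hm (map2 (+) \<beta> g) e a)"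
  unfolding sum_lst_Suc sum_product by (intro sum.cong refl) (simp add: \<beta> a v e ac_simps)
 finally show ?case .
qed

subsection \<open>Schwartz-Zippel with multiplicities\<close>

definition dq :: "nat => nat => (nat list => int) => nat list => int list => int" where
 "dq R h c \<beta> a = (\<Sum>e\<in>lst R h. c e * hm \<beta> e a)"

lemma hm_int_poly_coeff:
 "coeff ((\<Sum>k<h. monom (C k) k) \<circ>\<^sub>p [:x, 1:]) i = (\<Sum>k<h. C k * (int (k choose i) * x ^ (k - i)))"
proof -
 have pw: "monom (C k) k \<circ>\<^sub>p [:x, 1:] = smult (C k) ([:x, 1:] ^ k)" for k
 proof -
  have "([:0, 1:] ^ k) \<circ>\<^sub>p [:x, 1:] = [:x, 1:] ^ k"
   by (induction k) (simp_all add: pcompose_mult pcompose_1 pcompose_pCons)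
  then show ?thesis by (simp add: monom_altdef pcompose_smult)
 qed
 have co: "coeff ([:x, 1:] ^ k) i = int (k choose i) * x ^ (k - i)" for k
  using degree_power_le[of "[:x, 1:]" k]
  by (cases "i \<le> k") (auto simp: coeff_linear_poly_power binomial_eq_0 coeff_eq_0)
 show ?thesis by (simp add: pcompose_sum pw coeff_sum co)
qed

lemma dvd_pcompose_linear:
 "(\<And>i. q dvd coeff D i) ==> (q::int) dvd coeff (D \<circ>\<^sub>p [:x, 1:]) j"
proof (induction D arbitrary: j)
 case (pCons c D)
 have c: "q dvd c" using pCons.prems[of 0] by simp
 have "q dvd coeff D i" for i using pCons.prems[of "Suc i"] by simp
 then have "q dvd coeff (D \<circ>\<^sub>p [:x, 1:]) i" for i using pCons.IH by blast
 then show ?case using c by (auto simp: pcompose_pCons coeff_pCons split: nat.splits)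
qed simp

text \<open>The sum runs over the multiplicity of the zero at \<open>a\<close>, counted as the number of orders \<open>\<mu>\<close> up to which all derivatives vanish.\<close>

lemma schwartz_zippel_mult:
 fixes S :: "int set" and c :: "nat list => int"
 assumes p: "prime p" and S: "finite S" "\<And>x y. x \<in> S ==> y \<in> S ==> int p dvd x - y ==> x = y"
  and c: "\<exists>e\<in>lst R h. \<not> int p dvd c e" and h: "0 < h"
 shows "\<exists>\<mu>. (\<forall>a. length a = R \<and> set a \<subseteq> S \<longrightarrow> (\<exists>\<beta>. length \<beta> = R \<and> sum_list \<beta> \<le> \<mu> a \<and> \<not> int p dvd dq R h c \<beta> a)) \<and>
   (\<Sum>a\<in>{a. length a = R \<and> set a \<subseteq> S}. \<mu> a) * card S \<le> (h - 1) * R * card S ^ R"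
 using c
proof (induction R arbitrary: c)
 case 0
 then show ?case by (intro exI[of _ "%_. 0"]) (auto simp: lst_0 dq_def)
next
 case (Suc R)
 let ?L = "%R. {a. length a = R \<and> set a \<subseteq> S}"
 have finL: "finite (?L R)" for R using finite_lists_length_eq[OF S(1), of R] by (simp add: conj_commute)
 have cardL: "card (?L R) = card S ^ R" for R using card_lists_length_eq[OF S(1), of R] by (simp add: conj_commute)
 obtain k0 e0 where ke: "k0 < h" "e0 \<in> lst R h" "\<not> int p dvd c (k0 # e0)" using Suc.prems by (auto simp: lst_Suc)
 \<comment> \<open>The highest power of the first variable whose coefficient, a polynomial in the
   other variables, is nonzero modulo p; the induction hypothesis is applied to this
   coefficient.\<close>
 define k where "k = Max {k. k < h \<and> (\<exists>e\<in>lst R h. \<not> int p dvd c (k # e))}"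
 have "k \<in> {k. k < h \<and> (\<exists>e\<in>lst R h. \<not> int p dvd c (k # e))}" unfolding k_def by (rule Max_in) (use ke in auto)
 then have k: "k < h" "\<exists>e\<in>lst R h. \<not> int p dvd c (k # e)" by auto
 have kmax: "int p dvd c (k' # e)" if "k < k'" "k' < h" "e \<in> lst R h" for k' e
  using that Max_ge[of "{k. k < h \<and> (\<exists>e\<in>lst R h. \<not> int p dvd c (k # e))}" k'] unfolding k_def[symmetric] by auto
 obtain \<nu> where \<nu>: "\<And>a. a \<in> ?L R ==> \<exists>\<beta>. length \<beta> = R \<and> sum_list \<beta> \<le> \<nu> a \<and> \<not> int p dvd dq R h (%e. c (k # e)) \<beta> a"
  "(\<Sum>a\<in>?L R. \<nu> a) * card S \<le> (h - 1) * R * card S ^ R"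
  using Suc.IH[OF k(2)] by blast
 \<comment> \<open>A derivative in the other variables that makes this coefficient nonzero at
   \<open>a\<close>; what is left is univariate of degree k modulo p.\<close>
 define al where "al a = (SOME \<beta>. length \<beta> = R \<and> sum_list \<beta> \<le> \<nu> a \<and> \<not> int p dvd dq R h (%e. c (k # e)) \<beta> a)" for a
 have al: "length (al a) = R" "sum_list (al a) \<le> \<nu> a" "\<not> int p dvd dq R h (%e. c (k # e)) (al a) a" if "a \<in> ?L R" for a
  using someI_ex[OF \<nu>(1)[OF that]] unfolding al_def by auto
 define P where "P a = (\<Sum>j<h. monom (dq R h (%e. c (j # e)) (al a) a) j)" for a
 have coP: "coeff (P a) j = (if j < h then dq R h (%e. c (j # e)) (al a) a else 0)" for a j
  by (auto simp: P_def coeff_sum)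
 have dqS: "dq (Suc R) h c (b # al a) (x # a) = coeff (P a \<circ>\<^sub>p [:x, 1:]) b" for b x a
  unfolding dq_def P_def hm_int_poly_coeff sum_lst_Suc by (simp add: sum_distrib_left sum_distrib_right ac_simps)
 define kp where "kp a x = (LEAST b. \<not> int p dvd coeff (P a \<circ>\<^sub>p [:x, 1:]) b)" for a x
 have ex: "\<exists>b. \<not> int p dvd coeff (P a \<circ>\<^sub>p [:x, 1:]) b" if a: "a \<in> ?L R" for a x
 proof (rule ccontr)
  assume "\<not> ?thesis"
  then have all: "coeff (P a \<circ>\<^sub>p [:x, 1:]) b \<in> {z. int p dvd z}" for b by simp
  have "coeff (P a) k \<in> {z. int p dvd z}"
   by (rule root_count_mult[OF zprime_int[OF p], where A = "{x}" and \<mu> = "%_. Suc (degree (P a))"]) (use all in auto)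
  then show False using al(3)[OF a] k(1) by (simp add: coP)
 qed
 have kpsum: "(\<Sum>x\<in>S. kp a x) \<le> k" if a: "a \<in> ?L R" for a
 proof (rule ccontr)
  assume n: "\<not> ?thesis"
  \<comment> \<open>The coefficients above k vanish only modulo p, so they are cut off before the
    degree is used.\<close>
  define P' where "P' = (\<Sum>j\<le>k. monom (coeff (P a) j) j)"
  have coP': "coeff P' j = (if j \<le> k then coeff (P a) j else 0)" for j by (auto simp: P'_def coeff_sum)
  have dvd: "int p dvd coeff (P a - P') j" for j
  proof (cases "j \<le> k")
   case False
   then have "int p dvd coeff (P a) j" using kmax by (auto simp: coP dq_def intro!: dvd_sum)
   then show ?thesis using False by (simp add: coP')
  qed (simp add: coP')
  have dvd2: "int p dvd coeff ((P a - P') \<circ>\<^sub>p [:x, 1:]) j" for x j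
   by (rule dvd_pcompose_linear) (rule dvd)
  have "degree P' \<le> k" by (rule degree_le) (simp add: coP')
  then have dP: "degree P' < sum (kp a) S" using n by simp
  have rP: "coeff (P' \<circ>\<^sub>p [:x, 1:]) j \<in> {z. int p dvd z}" if "x \<in> S" "j < kp a x" for x j
  proof -
   have "int p dvd coeff (P a \<circ>\<^sub>p [:x, 1:]) j" using not_less_Least[of j] that(2) unfolding kp_def by blast
   then have "int p dvd coeff (P a \<circ>\<^sub>p [:x, 1:]) j - coeff ((P a - P') \<circ>\<^sub>p [:x, 1:]) j" using dvd2 by (rule dvd_diff)
   then show ?thesis by (simp add: pcompose_diff)
  qed
  have "coeff P' k \<in> {z. int p dvd z}"
  proof (rule root_count_mult[OF zprime_int[OF p] S(1) _ rP dP])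
   show "x - y \<notin> {z. int p dvd z}" if "x \<in> S" "y \<in> S" "x \<noteq> y" for x y using S(2) that by blast
  qed
  moreover have "coeff P' k = dq R h (%e. c (k # e)) (al a) a"
   by (simp only: coP' coP k(1) order_refl if_True)
  ultimately show False using al(3)[OF a] by (simp only: mem_Collect_eq)
 qed
 define \<mu> where "\<mu> a = \<nu> (tl a) + kp (tl a) (hd a)" for a
 have L_Suc: "?L (Suc R) = (%(x, a). x # a) ` (S \<times> ?L R)"
 proof (rule set_eqI)
  fix a show "a \<in> ?L (Suc R) \<longleftrightarrow> a \<in> (%(x, a). x # a) ` (S \<times> ?L R)" by (cases a) auto
 qed
 have "(\<Sum>a\<in>?L (Suc R). \<mu> a) = (\<Sum>x\<in>S. \<Sum>a\<in>?L R. \<nu> a + kp a x)"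
  unfolding L_Suc by (subst sum.reindex) (auto simp: inj_on_def \<mu>_def sum.cartesian_product split_def)
 also have "... = card S * (\<Sum>a\<in>?L R. \<nu> a) + (\<Sum>a\<in>?L R. \<Sum>x\<in>S. kp a x)"
  unfolding sum.distrib sum_constant using sum.swap[of "%x a. kp a x" "?L R" S] by simp
 also have "... \<le> card S * (\<Sum>a\<in>?L R. \<nu> a) + (\<Sum>a\<in>?L R. h - 1)"
 proof (intro add_mono sum_mono order_refl)
  fix a assume "a \<in> ?L R"
  from kpsum[OF this] k(1) show "(\<Sum>x\<in>S. kp a x) \<le> h - 1" by linarith
 qed
 also have "... = (\<Sum>a\<in>?L R. \<nu> a) * card S + (h - 1) * card S ^ R"
  unfolding sum_constant cardL by (simp only: mult.commute of_nat_id)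
 finally have "(\<Sum>a\<in>?L (Suc R). \<mu> a) \<le> (h - 1) * R * card S ^ R + (h - 1) * card S ^ R"
  using \<nu>(2) by linarith
 then have "(\<Sum>a\<in>?L (Suc R). \<mu> a) * card S \<le> ((h - 1) * R * card S ^ R + (h - 1) * card S ^ R) * card S"
  by (rule mult_right_mono) simp
 also have "... = (h - 1) * Suc R * card S ^ Suc R"
 proof -
  have "(H * r * c + H * c) * s = H * Suc r * (s * c)" for H r c s :: nat by (simp add: algebra_simps)
  then show ?thesis unfolding power_Suc .
 qed
 finally have 1: "(\<Sum>a\<in>?L (Suc R). \<mu> a) * card S \<le> (h - 1) * Suc R * card S ^ Suc R" .
 have 2: "\<exists>\<beta>. length \<beta> = Suc R \<and> sum_list \<beta> \<le> \<mu> a \<and> \<not> int p dvd dq (Suc R) h c \<beta> a" if a: "a \<in> ?L (Suc R)" for a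
 proof -
  obtain x a' where x: "a = x # a'" "a' \<in> ?L R" "x \<in> S" using a unfolding L_Suc by auto
  have "\<not> int p dvd coeff (P a' \<circ>\<^sub>p [:x, 1:]) (kp a' x)" unfolding kp_def by (rule LeastI_ex[OF ex[OF x(2)]])
  then have "\<not> int p dvd dq (Suc R) h c (kp a' x # al a') a" unfolding x(1) dqS .
  then show ?thesis using al(1,2)[OF x(2)] by (intro exI[of _ "kp a' x # al a'"]) (simp add: \<mu>_def x(1))
 qed
 show ?case using 1 2 by (intro exI[of _ \<mu>]) auto
qed

lemma hm_cong:
 assumes "zideal Z" "length \<beta> = length e" "length a = length e" "length a' = length e"
  "\<And>i. i < length e ==> a ! i - a' ! i \<in> Z"
 shows "hm \<beta> e a - hm \<beta> e a' \<in> Z"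
 using assms(2-)
proof (induction e arbitrary: \<beta> a a')
 case Nil
 then show ?case using zidealD(1)[OF assms(1)] by simp
next
 case (Cons k e)
 obtain b \<beta>' x y u v where s: "\<beta> = b # \<beta>'" "a = x # u" "a' = y # v"
  using Cons.prems by (cases \<beta>; cases a; cases a') auto
 have "x - y \<in> Z" using Cons.prems(4)[of 0] s by simp
 moreover have "hm \<beta>' e u - hm \<beta>' e v \<in> Z"
  by (rule Cons.IH) (use Cons.prems s in \<open>auto dest: Cons.prems(4)[of "Suc i" for i]\<close>, use Cons.prems(4)[of "Suc i" for i] s in fastforce)
 moreover have "of_nat (k choose b) - of_nat (k choose b) \<in> Z" using zidealD(1)[OF assms(1)] by simp
 ultimately show ?case unfolding s hm.simps
  by (intro zideal_diff_mult[OF assms(1)] zideal_diff_power[OF assms(1)])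
qed

lemma hm_pcompose: "hm \<beta> e F \<circ>\<^sub>p q = hm \<beta> e (map (%f. f \<circ>\<^sub>p q) (F :: int poly list))"
proof (induction \<beta> e F rule: hm.induct)
 case (1 b bs e es a as)
 have pw: "(a ^ k) \<circ>\<^sub>p q = (a \<circ>\<^sub>p q) ^ k" for k by (induction k) (simp_all add: pcompose_mult pcompose_1)
 have "(of_nat (e choose b) :: int poly) \<circ>\<^sub>p q = of_nat (e choose b)" by (simp add: of_nat_poly)
 then show ?case using 1 by (simp add: pcompose_mult pw)
qed (simp_all add: pcompose_1)

lemma poly_hm: "poly (hm \<beta> e F) x = hm \<beta> e (map (%f. poly f x) (F :: int poly list))"
 by (induction \<beta> e F rule: hm.induct) simp_all

lemma hm_const: "hm \<beta> e (map (%x. [:x:]) a) = [:hm \<beta> e (a :: int list):]"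
 by (induction \<beta> e a rule: hm.induct) (simp_all add: of_nat_poly poly_const_pow one_pCons)

lemma degree_hm:
 assumes "length \<beta> = R" "e \<in> lst R h" "length F = R" "\<And>f. f \<in> set F ==> degree (f :: int poly) \<le> d"
 shows "degree (hm \<beta> e F) \<le> R * ((h - 1) * d)"
 using assms
proof (induction R arbitrary: \<beta> e F)
 case 0
 then show ?case by (simp add: lst_0)
next
 case (Suc R)
 obtain b \<beta>' x F' k e' where s: "\<beta> = b # \<beta>'" "F = x # F'" "e = k # e'" "k < h" "e' \<in> lst R h"
  using Suc.prems by (auto simp: length_Suc_conv lst_Suc)
 have "degree (of_nat (k choose b) * x ^ (k - b)) \<le> degree (x ^ (k - b))"
  by (rule order_trans[OF degree_mult_le]) simp
 also have "... \<le> degree x * (k - b)" by (rule degree_power_le)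
 also have "... \<le> d * (h - 1)" using Suc.prems(4)[of x] s by (intro mult_mono) auto
 finally have 1: "degree (of_nat (k choose b) * x ^ (k - b)) \<le> d * (h - 1)" .
 have 2: "degree (hm \<beta>' e' F') \<le> R * ((h - 1) * d)" by (rule Suc.IH) (use Suc.prems s in auto)
 show ?case unfolding s hm.simps
  by (rule order_trans[OF degree_mult_le]) (use 1 2 in \<open>simp add: mult.commute\<close>)
qed

lemma vpow_low_coeff:
 assumes "length v = length g" "\<And>f. f \<in> set v ==> coeff (f :: int poly) 0 = 0" "k < sum_list g"
 shows "coeff (vpow v g) k = 0"
proof -
 have "[:0, 1:] ^ sum_list g dvd vpow v g" using assms(1,2)
 proof (induction v g rule: vpow.induct)
  case (1 v vs g gs)
  have "[:0, 1:] dvd v" using 1(3)[of v] by (simp add: dvd_iff_poly_eq_0 poly_0_coeff_0)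
  then have "[:0, 1:] ^ g dvd v ^ g" by (rule dvd_power_same)
  moreover have "[:0, 1:] ^ sum_list gs dvd vpow vs gs" using 1 by simp
  ultimately show ?case by (simp add: power_add mult_dvd_mono)
 qed auto
 then obtain w where "vpow v g = [:0, 1:] ^ sum_list g * w" by blast
 moreover have "[:0, 1:] ^ j = (monom 1 j :: int poly)" for j by (simp add: monom_altdef)
 ultimately show ?thesis using assms(3) by (simp add: coeff_monom_mult)
qed

text \<open>Vanishing to order R at one point costs at most 4^R conditions on h^R coefficients, so
  demanding this high multiplicity only costs a factor 4 in \<open>h\<close>.\<close>

lemma exists_multiplicity_poly:
 assumes p: "1 < p" and B: "finite B" "card B * 2 ^ (2 * R) < h ^ R"
 shows "\<exists>c. (\<exists>e\<in>lst R h. \<not> int p dvd c e) \<and> (\<forall>b\<in>B. \<forall>\<beta>\<in>low R R. int p dvd dq R h c \<beta> b)"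
proof -
 have "card (B \<times> low R R) = card B * card (low R R)" by (rule card_cartesian_product)
 also have "... \<le> card B * 2 ^ (2 * R)" using card_low[of R R] by (simp add: mult_2)
 also have "... < card (lst R h)" using B(2) by (simp add: card_lst)
 finally obtain c where "\<exists>e\<in>lst R h. \<not> int p dvd c e"
  "\<forall>k\<in>B \<times> low R R. int p dvd (\<Sum>e\<in>lst R h. c e * hm (snd k) e (fst k))"
  using linear_mod_solution[OF p finite_lst, of "B \<times> low R R" R h "%k e. hm (snd k) e (fst k)"] B(1) by auto
 then show ?thesis unfolding dq_def by (intro exI[of _ c]) auto
qed

text \<open>A derivative of order at most R/2 still vanishes on \<open>B\<close> to order R/2. Along
  a curve of degree below t it becomes a univariate polynomial of degree below R h t with at least 2
  h t zeros of that multiplicity, so it vanishes on the whole curve, in particular where the curve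
  meets the rows.\<close>

lemma curve_vanishes:
 assumes p: "prime p" and c: "\<And>b \<beta>. b \<in> B ==> \<beta> \<in> low R R ==> int p dvd dq R h c \<beta> b"
  and F: "length F = R" "\<And>f. f \<in> set F ==> degree (f :: int poly) < t" and h: "0 < h" and R: "0 < R"
  and Y: "finite Y" "\<And>y y'. y \<in> Y ==> y' \<in> Y ==> int p dvd y - y' ==> y = y'"
  and hit: "\<And>y. y \<in> Y ==> \<exists>b\<in>B. length b = R \<and> (\<forall>i<R. int p dvd poly (F ! i) y - b ! i)"
  and many: "2 * h * t \<le> card Y" and \<beta>: "length \<beta> = R" "2 * sum_list \<beta> \<le> R"
 shows "int p dvd dq R h c \<beta> (map (%f. poly f x) F)"
proof -
 define A where "A = (\<Sum>e\<in>lst R h. smult (c e) (hm \<beta> e F))"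
 have ZI: "zideal {z. int p dvd z}" using zprime_int[OF p] by (rule zprimeD)
 have el: "length e = R" if "e \<in> lst R h" for e using that by (simp add: lst_def)
 have root: "coeff (A \<circ>\<^sub>p [:y, 1:]) k \<in> {z. int p dvd z}" if y: "y \<in> Y" and k: "k < R - sum_list \<beta>" for y k
 proof -
  define a where "a = map (%f. poly f y) F"
  define V where "V = map (%f. f \<circ>\<^sub>p [:y, 1:] - [:poly f y:]) F"
  have Fc: "map (%f. f \<circ>\<^sub>p [:y, 1:]) F = map2 (+) (map (%x. [:x:]) a) V"
   by (rule nth_equalityI) (auto simp: a_def V_def)
  have la: "length (map (%x. [:x:]) a) = R" "length V = R" using F by (auto simp: a_def V_def)
  have V0: "coeff f 0 = 0" if "f \<in> set V" for f
   using that by (auto simp: V_def poly_pcompose simp flip: poly_0_coeff_0)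
  have "A \<circ>\<^sub>p [:y, 1:] = (\<Sum>e\<in>lst R h. smult (c e) (hm \<beta> e (map2 (+) (map (%x. [:x:]) a) V)))"
   unfolding A_def by (simp add: pcompose_sum pcompose_smult hm_pcompose Fc)
  also have "... = (\<Sum>e\<in>lst R h. \<Sum>g\<in>lst R h. of_nat (bprod \<beta> g) * vpow V g * [:c e * hm (map2 (+) \<beta> g) e a:])"
  proof (intro sum.cong refl)
   fix e assume e: "e \<in> lst R h"
   have sm: "smult r (sum f G) = (\<Sum>g\<in>G. smult r (f g))" for r :: int and f and G :: "nat list set"
    by (induction G rule: infinite_finite_induct) (simp_all add: smult_add_right)
   show "smult (c e) (hm \<beta> e (map2 (+) (map (%x. [:x:]) a) V)) =
    (\<Sum>g\<in>lst R h. of_nat (bprod \<beta> g) * vpow V g * [:c e * hm (map2 (+) \<beta> g) e a:])"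
    unfolding hasse_taylor[OF \<beta>(1) e la] hm_const sm by simp
  qed
  also have "... = (\<Sum>g\<in>lst R h. of_nat (bprod \<beta> g) * vpow V g * [:dq R h c (map2 (+) \<beta> g) a:])"
   unfolding dq_def by (subst sum.swap) (simp add: smult_sum)
  finally have Ay: "A \<circ>\<^sub>p [:y, 1:] = (\<Sum>g\<in>lst R h. of_nat (bprod \<beta> g) * vpow V g * [:dq R h c (map2 (+) \<beta> g) a:])" .
  have "int p dvd coeff (of_nat (bprod \<beta> g) * vpow V g * [:dq R h c (map2 (+) \<beta> g) a:]) k" if g: "g \<in> lst R h" for g
  \<comment> \<open>Terms of low order vanish because \<open>B\<close> is a multiple zero; in the
    others the displacement \<open>V\<close> has no constant term, so nothing appears below order
    \<open>sum_list g\<close>.\<close>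
  proof (cases "sum_list \<beta> + sum_list g < R")
   case True
   have sl: "sum_list (map2 (+) \<beta> g) = sum_list \<beta> + sum_list g" using \<beta>(1) el[OF g]
    by (simp add: sum_list_sum_nth sum.distrib)
   then have bg: "map2 (+) \<beta> g \<in> low R R" using True \<beta>(1) el[OF g] by (simp add: low_def)
   obtain b where b: "b \<in> B" "length b = R" "\<And>i. i < R ==> int p dvd poly (F ! i) y - b ! i" using hit[OF y] by blast
   have "dq R h c (map2 (+) \<beta> g) a - dq R h c (map2 (+) \<beta> g) b \<in> {z. int p dvd z}"
    unfolding dq_def
   proof (intro zideal_diff_sum[OF ZI])
    fix e assume e: "e \<in> lst R h"
    have "hm (map2 (+) \<beta> g) e a - hm (map2 (+) \<beta> g) e b \<in> {z. int p dvd z}"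
     by (rule hm_cong[OF ZI]) (use \<beta>(1) el[OF g] el[OF e] F b in \<open>auto simp: a_def\<close>)
    from zidealD(3)[OF ZI this, of "c e"]
    show "c e * hm (map2 (+) \<beta> g) e a - c e * hm (map2 (+) \<beta> g) e b \<in> {z. int p dvd z}"
     by (simp add: right_diff_distrib)
   qed
   then have "int p dvd dq R h c (map2 (+) \<beta> g) a"
    using c[OF b(1) bg] zideal_mem_cong[OF ZI] by blast
   then show ?thesis by simp
  next
   case False
   then have "k < sum_list g" using k by linarith
   then have "coeff (vpow V g) k = 0" by (intro vpow_low_coeff) (use la el[OF g] V0 in auto)
   then show ?thesis by (simp add: of_nat_poly)
  qed
  then show ?thesis unfolding Ay coeff_sum by (auto intro: dvd_sum)
 qed
 have t: "0 < t"
 proof -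
  have "hd F \<in> set F" using F(1) R by (intro hd_in_set) auto
  then show ?thesis using F(2)[of "hd F"] by linarith
 qed
 have "degree A \<le> R * ((h - 1) * (t - 1))" unfolding A_def
 proof (intro degree_sum_le finite_lst)
  fix e assume e: "e \<in> lst R h"
  have "degree (hm \<beta> e F) \<le> R * ((h - 1) * (t - 1))"
   by (rule degree_hm[OF \<beta>(1) e F(1)]) (use F(2) in force)
  then show "degree (smult (c e) (hm \<beta> e F)) \<le> R * ((h - 1) * (t - 1))" by (rule order_trans[OF degree_smult_le])
 qed
 also have "... < R * (h * t)"
 proof -
  have "(h - 1) * (t - 1) < h * t" using h t by (intro mult_strict_mono) auto
  then show ?thesis using R by simp
 qed
 also have "... \<le> card Y * (R - sum_list \<beta>)"
 proof -
  have "2 * (R * (h * t)) = (2 * h * t) * R" by simp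
  also have "... \<le> card Y * (2 * (R - sum_list \<beta>))" using many \<beta>(2) by (intro mult_mono) auto
  finally show ?thesis by simp
 qed
 also have "... = (\<Sum>y\<in>Y. R - sum_list \<beta>)" by simp
 finally have dA: "degree A < (\<Sum>y\<in>Y. R - sum_list \<beta>)" .
 have "coeff A i \<in> {z. int p dvd z}" for i
 proof (rule root_count_mult[OF zprime_int[OF p] Y(1) _ root dA])
  show "y - y' \<notin> {z. int p dvd z}" if "y \<in> Y" "y' \<in> Y" "y \<noteq> y'" for y y' using Y(2) that by blast
 qed
 then have "int p dvd poly A x" unfolding poly_altdef by (auto intro: dvd_sum)
 moreover have "poly A x = dq R h c \<beta> (map (%f. poly f x) F)"
  unfolding A_def dq_def by (simp add: poly_sum poly_hm)
 ultimately show ?thesis by simp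
qed

subsection \<open>A weak design from polynomials\<close>

text \<open>The base-q digits of \<open>j\<close> serve as coefficients, so small indices give
  polynomials of small degree. Each new block then overlaps little, on average, with the earlier
  ones.\<close>

definition dpoly :: "nat => nat => nat => nat => nat" where
 "dpoly q R j a = (\<Sum>r<R. (j div q ^ r mod q) * a ^ r) mod q"

definition gpoly :: "nat => nat => nat => int poly" where
 "gpoly q R j = (\<Sum>r<R. monom (int (j div q ^ r mod q)) r)"

lemma coeff_gpoly: "coeff (gpoly q R j) r = (if r < R then int (j div q ^ r mod q) else 0)"
 by (auto simp: gpoly_def coeff_sum)

lemma dpoly_eq_iff: "dpoly q R i a = dpoly q R j a \<longleftrightarrow> int q dvd poly (gpoly q R i - gpoly q R j) (int a)"
proof -
 have "poly (gpoly q R i) (int a) = int (\<Sum>r<R. (i div q ^ r mod q) * a ^ r)" for i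
  by (simp add: gpoly_def poly_sum poly_monom)
 then have "int q dvd poly (gpoly q R i - gpoly q R j) (int a) \<longleftrightarrow>
   int (\<Sum>r<R. (i div q ^ r mod q) * a ^ r) mod int q = int (\<Sum>r<R. (j div q ^ r mod q) * a ^ r) mod int q"
  by (simp only: poly_diff mod_eq_dvd_iff)
 then show ?thesis unfolding dpoly_def zmod_int[symmetric] of_nat_eq_iff by blast
qed

lemma digits_eq_imp_eq:
 "(\<forall>r<k. i div q ^ r mod q = j div q ^ r mod q) ==> i div q ^ k = j div q ^ k ==> i = (j::nat)"
proof (induction k)
 case (Suc k)
 have e: "(i div q ^ k) div q = i div q ^ Suc k" for i by (simp only: power_Suc2 div_mult2_eq)
 have "i div q ^ k div q * q + i div q ^ k mod q = j div q ^ k div q * q + j div q ^ k mod q"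
  using Suc.prems(1)[rule_format, OF lessI] Suc.prems(2) by (simp only: e)
 then have "i div q ^ k = j div q ^ k" by (simp only: div_mult_mod_eq)
 then show ?case using Suc by simp
qed simp

lemma gpoly_vanish:
 assumes q: "prime q" and A: "finite A" "\<And>a. a \<in> A ==> a < q"
  and van: "\<And>a. a \<in> A ==> int q dvd poly (gpoly q R i - gpoly q R j) (int a)"
  and deg: "degree (gpoly q R i - gpoly q R j) < card A" and r: "r < R"
 shows "i div q ^ r mod q = j div q ^ r mod q"
proof -
 have "coeff (gpoly q R i - gpoly q R j) r \<in> {x. int q dvd x}"
 proof (rule root_count[OF zprime_int[OF q], where A = "int ` A"])
  show "a - b \<notin> {x. int q dvd x}" if "a \<in> int ` A" "b \<in> int ` A" "a \<noteq> b" for a b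
   using that A(2) by (auto dest: mod_eq_dvd_iff[THEN iffD2] simp flip: zmod_int)
  show "degree (gpoly q R i - gpoly q R j) < card (int ` A)" using deg by (simp add: card_image)
 qed (use A van in auto)
 then have "int q dvd int (i div q ^ r mod q) - int (j div q ^ r mod q)" using r by (simp add: coeff_gpoly)
 then show ?thesis using prime_gt_0_nat[OF q] by (metis mod_eq_dvd_iff mod_mod_trivial of_nat_eq_iff zmod_int)
qed

definition agree :: "nat => nat => nat => nat => nat => nat set" where
 "agree q R \<l> i j = {a. a < \<l> \<and> dpoly q R j a = dpoly q R i a}"

lemma sum_pow_subsets:
 assumes "finite S"
 shows "(\<Sum>A\<in>Pow S. (1 / real q) ^ card A) = (1 + 1 / real q) ^ card S"
 using prod_add[OF assms, of "%_. 1 / real q" "%_. 1"] by (simp add: add.commute)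

text \<open>All j in the block share the digits from r upward and differ from i at digit r. A set A
  of agreement points therefore has at most r elements, and interpolation leaves at most q^(r - |A|)
  choices of j. Writing a power of 2 as a number of subsets and exchanging the sums yields (1 +
  1/q)^\<l>.\<close>

lemma design_block:
 assumes q: "prime q" and \<l>: "\<l> \<le> q" and r: "r < R" and st: "st mod q ^ r = 0" "st div q ^ Suc r = i div q ^ Suc r"
  and d: "st div q ^ r mod q < i div q ^ r mod q"
 shows "(\<Sum>j\<in>{st..<st + q ^ r}. 2 ^ card (agree q R \<l> i j)) \<le> real q ^ r * (1 + 1 / q) ^ \<l>"
proof -
 have q1: "1 < q" using q prime_gt_1_nat by blast
 let ?J = "{st..<st + q ^ r}"
 have jr: "j div q ^ r = st div q ^ r" if "j \<in> ?J" for j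
 proof -
  have st': "st = st div q ^ r * q ^ r" using st(1) by (metis add.right_neutral div_mult_mod_eq)
  have j1: "st div q ^ r * q ^ r \<le> j" using that st' by auto
  have j2: "j < (st div q ^ r + 1) * q ^ r" using that st' by auto
  have "j div q ^ r < st div q ^ r + 1" using j2 q1 by (simp add: div_less_iff_less_mult)
  moreover have "st div q ^ r \<le> j div q ^ r" using j1 q1 by (simp add: less_eq_div_iff_mult_less_eq)
  ultimately show ?thesis by simp
 qed
 have hi: "j div q ^ s = i div q ^ s" if "j \<in> ?J" "r < s" for j s
 proof -
  have e: "k div q ^ s = k div q ^ Suc r div q ^ (s - Suc r)" for k
   using that(2) by (simp add: div_mult2_eq[symmetric] power_add[symmetric] flip: power_Suc)
  have "j div q ^ Suc r = st div q ^ Suc r" using jr[OF that(1)] by (simp only: power_Suc2 div_mult2_eq)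
  then show ?thesis using st(2) e by metis
 qed
 have lead: "j div q ^ r mod q \<noteq> i div q ^ r mod q" if "j \<in> ?J" for j using d jr[OF that] by simp
 have deg: "degree (gpoly q R j - gpoly q R i) \<le> r" if "j \<in> ?J" for j
  by (rule degree_le) (use hi that in \<open>auto simp: coeff_gpoly\<close>)
 have small: "card (agree q R \<l> i j) \<le> r" if j: "j \<in> ?J" for j
 proof (rule ccontr)
  assume "\<not> ?thesis"
  then have "j div q ^ r mod q = i div q ^ r mod q"
   by (intro gpoly_vanish[OF q, of "agree q R \<l> i j" R j i r])
    (use \<l> deg[OF j] r in \<open>auto simp: agree_def dpoly_eq_iff\<close>)
  then show False using lead[OF j] by simp
 qed
 have fin: "finite (agree q R \<l> i j)" for j by (simp add: agree_def)
 have cnt: "real (card {j \<in> ?J. A \<subseteq> agree q R \<l> i j}) \<le> real q ^ r * (1 / real q) ^ card A" if A: "A \<in> Pow {..<\<l>}" for A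
 proof (cases "card A \<le> r")
  case False
  have "{j \<in> ?J. A \<subseteq> agree q R \<l> i j} = {}"
  proof (rule ccontr)
   assume "\<not> ?thesis"
   then obtain j where j: "j \<in> ?J" "A \<subseteq> agree q R \<l> i j" by blast
   then have "card A \<le> r" using small[OF j(1)] card_mono[OF fin j(2)] by linarith
   then show False using False by simp
  qed
  then show ?thesis by (simp only: card.empty) simp
 next
  case True
  let ?S = "{j \<in> ?J. A \<subseteq> agree q R \<l> i j}" let ?k = "card A"
  have finA: "finite A" using A finite_subset by auto
  have inj: "inj_on (%j. j div q ^ ?k) ?S"
  proof (rule inj_onI)
   fix j j' assume j: "j \<in> ?S" "j' \<in> ?S" "j div q ^ ?k = j' div q ^ ?k"
   show "j = j'"
   proof (rule digits_eq_imp_eq[OF _ j(3)], intro allI impI)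
    fix s assume s: "s < ?k"
    have up: "j div q ^ s = j' div q ^ s" if "?k \<le> s" for s
    proof -
     have e: "x div q ^ s = x div q ^ ?k div q ^ (s - ?k)" for x
      using that by (simp add: div_mult2_eq[symmetric] power_add[symmetric])
     show ?thesis using j(3) e by metis
    qed
    show "j div q ^ s mod q = j' div q ^ s mod q"
    proof (rule gpoly_vanish[OF q finA, where R = R])
     show "a < q" if "a \<in> A" for a using that A \<l> by auto
     show "int q dvd poly (gpoly q R j - gpoly q R j') (int a)" if "a \<in> A" for a
     proof -
      have "dpoly q R j a = dpoly q R i a" "dpoly q R j' a = dpoly q R i a" using that j by (auto simp: agree_def)
      then show ?thesis by (simp only: dpoly_eq_iff[symmetric])
     qed
     have "degree (gpoly q R j - gpoly q R j') \<le> ?k - 1"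
      by (rule degree_le) (use up s in \<open>auto simp: coeff_gpoly\<close>)
     then show "degree (gpoly q R j - gpoly q R j') < ?k" using s by simp
     show "s < R" using s True r by simp
    qed
   qed
  qed
  have sub: "(%j. j div q ^ ?k) ` ?S \<subseteq> {st div q ^ ?k..<st div q ^ ?k + q ^ (r - ?k)}"
  proof clarify
   fix j assume j: "j \<in> ?J"
   have qr: "q ^ r = q ^ (r - ?k) * q ^ ?k" using True by (simp flip: power_add)
   have "st div q ^ ?k \<le> j div q ^ ?k" using j by (intro div_le_mono) simp
   moreover have "j div q ^ ?k < st div q ^ ?k + q ^ (r - ?k)"
   proof -
    have "st mod q ^ ?k = 0" using st(1) qr dvd_trans[of "q ^ ?k" "q ^ r" st] by (simp add: mod_eq_0_iff_dvd)
    then have "st = st div q ^ ?k * q ^ ?k" by (metis add.right_neutral div_mult_mod_eq)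
    then have "j < (st div q ^ ?k + q ^ (r - ?k)) * q ^ ?k" using j qr by (simp add: distrib_right)
    then show ?thesis using q1 by (simp add: div_less_iff_less_mult)
   qed
   ultimately show "j div q ^ ?k \<in> {st div q ^ ?k..<st div q ^ ?k + q ^ (r - ?k)}" by simp
  qed
  have "card ?S \<le> q ^ (r - ?k)" using card_mono[OF _ sub] card_image[OF inj] by simp
  then have "real (card ?S) \<le> real q ^ (r - ?k)" by (metis of_nat_le_iff of_nat_power)
  also have "... = real q ^ r * (1 / real q) ^ ?k" using True q1 by (simp add: power_diff power_one_over)
  finally show ?thesis .
 qed
 have "(\<Sum>j\<in>?J. 2 ^ card (agree q R \<l> i j)) = (\<Sum>j\<in>?J. real (card (Pow (agree q R \<l> i j))))"
  by (simp add: card_Pow fin)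
 also have "... = (\<Sum>j\<in>?J. \<Sum>A\<in>Pow {..<\<l>}. of_bool (A \<subseteq> agree q R \<l> i j))"
 proof (intro sum.cong refl)
  fix j
  have "Pow (agree q R \<l> i j) = {A \<in> Pow {..<\<l>}. A \<subseteq> agree q R \<l> i j}" by (auto simp: agree_def)
  then show "real (card (Pow (agree q R \<l> i j))) = (\<Sum>A\<in>Pow {..<\<l>}. of_bool (A \<subseteq> agree q R \<l> i j))"
   by (simp add: of_bool_def sum.If_cases Int_def)
 qed
 also have "... = (\<Sum>A\<in>Pow {..<\<l>}. \<Sum>j\<in>?J. of_bool (A \<subseteq> agree q R \<l> i j))" by (rule sum.swap)
 also have "... = (\<Sum>A\<in>Pow {..<\<l>}. real (card {j \<in> ?J. A \<subseteq> agree q R \<l> i j}))"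
  by (intro sum.cong refl) (simp add: of_bool_def sum.If_cases Int_def del: atLeastLessThan_iff)
 also have "... \<le> (\<Sum>A\<in>Pow {..<\<l>}. real q ^ r * (1 / real q) ^ card A)" by (intro sum_mono cnt)
 also have "... = real q ^ r * (1 + 1 / q) ^ \<l>"
  unfolding sum_distrib_left[symmetric] by (subst sum_pow_subsets) auto
 finally show ?thesis .
qed

text \<open>The indices below i are sorted by the highest digit in which they differ from i. That
  digit is smaller than the one of i, and every class is a union of blocks as in
  \<open>design_block\<close>.\<close>

lemma weak_design:
 assumes q: "prime q" and \<l>: "\<l> \<le> q" and i: "i < q ^ R"
 shows "(\<Sum>j<i. 2 ^ card (agree q R \<l> i j)) \<le> (1 + 1 / real q) ^ \<l> * real i"
proof -
 have q1: "1 < q" using q prime_gt_1_nat by blast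
 define c where "c = (1 + 1 / real q) ^ \<l>"
 define f where "f j = (2 ^ card (agree q R \<l> i j) :: real)" for j
 have blocks: "(\<Sum>j\<in>{i div q ^ Suc r * q ^ Suc r..<i div q ^ Suc r * q ^ Suc r + d * q ^ r}. f j) \<le> c * real (d * q ^ r)"
  if r: "r < R" and "d \<le> i div q ^ r mod q" for r d
  using that(2)
 proof (induction d)
  case (Suc d)
  let ?A = "i div q ^ Suc r * q ^ Suc r" let ?st = "?A + d * q ^ r"
  have d: "d < q" using Suc.prems mod_less_divisor[of q "i div q ^ r"] q1 by linarith
  have st: "?st = (i div q ^ Suc r * q + d) * q ^ r" by (simp add: algebra_simps)
  have st': "?st div q ^ r = i div q ^ Suc r * q + d" unfolding st using q1 by simp
  have "?st div q ^ Suc r = (?st div q ^ r) div q" by (simp only: power_Suc2 div_mult2_eq)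
  also have "... = i div q ^ Suc r" unfolding st' using d by simp
  finally have b: "?st div q ^ Suc r = i div q ^ Suc r" .
  have "(\<Sum>j\<in>{?st..<?st + q ^ r}. f j) \<le> real q ^ r * c"
   unfolding f_def c_def
  proof (rule design_block[OF q \<l> r _ b])
   show "?st mod q ^ r = 0" unfolding st by simp
   show "?st div q ^ r mod q < i div q ^ r mod q" unfolding st' using Suc.prems d by simp
  qed
  moreover have "(\<Sum>j\<in>{?A..<?A + Suc d * q ^ r}. f j) = (\<Sum>j\<in>{?A..<?st}. f j) + (\<Sum>j\<in>{?st..<?st + q ^ r}. f j)"
   by (subst sum.atLeastLessThan_concat) (auto simp: algebra_simps)
  ultimately show ?case using Suc by (simp add: algebra_simps)
 qed simp
 have "(\<Sum>j\<in>{i div q ^ r * q ^ r..<i}. f j) \<le> c * real (i - i div q ^ r * q ^ r)" if "r \<le> R" for r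
  using that
 proof (induction r)
  case (Suc r)
  let ?A = "i div q ^ Suc r * q ^ Suc r" let ?B = "i div q ^ r * q ^ r" let ?d = "i div q ^ r mod q"
  have "i div q ^ r = i div q ^ Suc r * q + ?d" by (simp only: power_Suc2 div_mult2_eq div_mult_mod_eq)
  then have B: "?B = ?A + ?d * q ^ r" by (metis add_mult_distrib mult.assoc mult.commute power_Suc)
  have le: "?B \<le> i" by simp
  have "(\<Sum>j\<in>{?A..<i}. f j) = (\<Sum>j\<in>{?A..<?B}. f j) + (\<Sum>j\<in>{?B..<i}. f j)"
   by (rule sum.atLeastLessThan_concat[symmetric]) (use B le in auto)
  also have "... \<le> c * real (?d * q ^ r) + c * real (i - ?B)"
   using blocks[of r ?d] Suc unfolding B[symmetric] by (intro add_mono) auto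
  also have "... = c * real (?d * q ^ r + (i - ?B))" by (simp only: of_nat_add distrib_left)
  also have "?d * q ^ r + (i - ?B) = i - ?A" using B le by simp
  finally show ?case .
 qed simp
 from this[of R] i show ?thesis by (simp add: f_def c_def atLeast0LessThan)
qed

subsection \<open>The code and the extractor\<close>

text \<open>The code is a Reed-Solomon code concatenated with the Hadamard code \<open>ip\<close>.\<close>

definition ip :: "nat => bool list => nat => bool" where
 "ip w r v = odd (\<Sum>t<w. of_bool (r ! t \<and> bit v t) :: nat)"

definition rsval :: "nat => bool list => nat => nat" where
 "rsval p x \<beta> = (\<Sum>j<length x. of_bool (x ! j) * \<beta> ^ j) mod p"

definition rsh :: "nat => nat => nat => bool list => bool list => bool" where
 "rsh p b w x v = ip w (drop b v) (rsval p x (num (take b v)))"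

text \<open>Allowing m digits for an index below m is generous and spares a logarithm. The seed has
  one row of q positions for each codeword coordinate a, so different coordinates never share a
  position.\<close>

definition tre :: "nat => nat => nat => nat => nat => bool list => bool list => bool list" where
 "tre p b w q m x y = map (%i. rsh p b w x (map (%a. y ! (a * q + dpoly q m i a)) [0..<b + w])) [0..<m]"

lemma length_tre [simp]: "length (tre p b w q m x y) = m"
 by (simp add: tre_def)

lemma ip_flip:
 assumes "t0 < w" "length r = w"
 shows "ip w (r[t0 := \<not> r ! t0]) v = (ip w r v \<noteq> bit v t0)"
proof -
 have s: "(\<Sum>t<w. of_bool (r' ! t \<and> bit v t) :: nat) = of_bool (r' ! t0 \<and> bit v t0) + (\<Sum>t\<in>{..<w} - {t0}. of_bool (r' ! t \<and> bit v t))" for r'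
  using assms by (subst sum.remove[of _ t0]) auto
 have "(\<Sum>t\<in>{..<w} - {t0}. of_bool (r[t0 := \<not> r ! t0] ! t \<and> bit v t)) = (\<Sum>t\<in>{..<w} - {t0}. of_bool (r ! t \<and> bit v t) :: nat)"
  by (rule sum.cong) auto
 then show ?thesis unfolding ip_def s[of r] s[of "r[t0 := \<not> r ! t0]"] using assms by auto
qed

text \<open>Flipping a bit of \<open>r\<close> at a place where v and v' differ changes the sign of
  the product.\<close>

lemma ip_orthogonal:
 assumes "v < 2 ^ w" "v' < 2 ^ w" "v \<noteq> v'"
 shows "avg (bits w) (%r. (if ip w r v then 1 else -1) * (if ip w r v' then 1 else -1)) = (0::real)"
proof -
 have "nbits w v \<noteq> nbits w v'" using assms num_nbits by metis
 then have "\<exists>t<w. bit v t \<noteq> bit v' t" by (rule contrapos_np) (auto simp: nbits_def)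
 then obtain t0 where t0: "t0 < w" "bit v t0 \<noteq> bit v' t0" by blast
 define g where "g r = (if ip w r v then 1 else -1) * (if ip w r v' then 1 else (-1::real))" for r
 define fl where "fl r = r[t0 := \<not> r ! t0]" for r :: "bool list"
 have "bij_betw fl (bits w) (bits w)"
  by (rule bij_betwI[where g = fl]) (use t0 in \<open>auto simp: fl_def\<close>)
 then have "avg (bits w) g = avg (bits w) (%r. g (fl r))" by (rule avg_bij)
 also have "... = avg (bits w) (%r. (-1) * g r)"
  by (rule avg_cong) (use t0 in \<open>auto simp: g_def fl_def ip_flip\<close>)
 also have "... = - avg (bits w) g" by (subst avg_cmult) simp
 finally have "avg (bits w) g = 0" by simp
 then show ?thesis unfolding g_def .
qed

text \<open>Where the Reed-Solomon symbols differ, the Hadamard parts are orthogonal; the symbols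
  agree in at most N places, because distinct polynomials of degree below N do.\<close>

lemma code_pair:
 assumes p: "prime p" "2 ^ b \<le> p" "p \<le> 2 ^ w" and xy: "x \<in> bits N" "y \<in> bits N" "x \<noteq> y"
 shows "avg (bits (b + w)) (%v. (if rsh p b w x v then 1 else -1) * (if rsh p b w y v then 1 else -1)) \<le> real N / 2 ^ b"
proof -
 have p1: "1 < p" using p prime_gt_1_nat by blast
 define U where "U = {u \<in> bits b. rsval p x (num u) = rsval p y (num u)}"
 have "card U \<le> N"
 proof (rule ccontr)
  assume n: "\<not> ?thesis"
  let ?f = "fpoly x - fpoly y"
  have inj: "inj_on (%u. int (num u)) U" by (rule inj_onI) (auto simp: U_def intro: num_inj)
  have N: "0 < N" using xy by (cases N) auto
  have "coeff ?f i \<in> {z. int p dvd z}" for i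
  proof (rule root_count[OF zprime_int[OF p(1)], where A = "(%u. int (num u)) ` U"])
   show "finite ((%u. int (num u)) ` U)" unfolding U_def by (intro finite_imageI finite_subset[OF _ finite_bits[of b]]) blast
   show "a - a' \<notin> {z. int p dvd z}" if aa: "a \<in> (%u. int (num u)) ` U" "a' \<in> (%u. int (num u)) ` U" "a \<noteq> a'" for a a'
   proof -
    obtain u u' where u: "a = int (num u)" "a' = int (num u')" "length u = b" "length u' = b"
     using aa by (auto simp: U_def)
    have "num u < p" "num u' < p" using num_less[of u] num_less[of u'] u p(2) by auto
    then show ?thesis using aa(3) u by (auto dest: mod_eq_dvd_iff[THEN iffD2] simp flip: zmod_int)
   qed
   show "poly ?f a \<in> {z. int p dvd z}" if aU: "a \<in> (%u. int (num u)) ` U" for a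
   proof -
    obtain u where u: "a = int (num u)" "rsval p x (num u) = rsval p y (num u)" using aU by (auto simp: U_def)
    have "poly (fpoly z) a = int (\<Sum>j<length z. of_bool (z ! j) * num u ^ j)" for z
     by (simp add: poly_fpoly u(1))
    then have "poly (fpoly x) a mod int p = poly (fpoly y) a mod int p"
     using u(2) unfolding rsval_def by (metis zmod_int)
    then show ?thesis by (simp add: mod_eq_dvd_iff)
   qed
   have "x \<noteq> []" "y \<noteq> []" using N xy(1,2) by auto
   then have "degree ?f < N" using degree_fpoly[of x] degree_fpoly[of y] xy(1,2) by (intro degree_diff_less) auto
   then show "degree ?f < card ((%u. int (num u)) ` U)" using n by (simp add: card_image[OF inj])
  qed
  then show False using fpoly_inj[OF p1, of x y] xy by simp
 qed
 have "avg (bits (b + w)) (%v. (if rsh p b w x v then 1 else -1) * (if rsh p b w y v then 1 else -1))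
   = avg (bits b) (%u. avg (bits w) (%r. (if ip w r (rsval p x (num u)) then 1 else -1) * (if ip w r (rsval p y (num u)) then 1 else (-1::real))))"
  unfolding avg_append by (intro avg_cong) (simp add: rsh_def)
 also have "... \<le> avg (bits b) (%u. of_bool (rsval p x (num u) = rsval p y (num u)))"
 proof (rule avg_mono)
  fix u
  have lt: "rsval p z (num u) < 2 ^ w" for z using p(3) p1 by (auto simp: rsval_def intro: order_less_le_trans[OF mod_less_divisor])
  show "avg (bits w) (%r. (if ip w r (rsval p x (num u)) then 1 else -1) * (if ip w r (rsval p y (num u)) then 1 else (-1::real)))
   \<le> of_bool (rsval p x (num u) = rsval p y (num u))"
  proof (cases "rsval p x (num u) = rsval p y (num u)")
   case True
   then show ?thesis by (auto intro!: avg_le_const)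
  next
   case False
   then show ?thesis using ip_orthogonal[OF lt lt False] by simp
  qed
 qed
 also have "... = real (card U) / 2 ^ b" by (simp add: frc_avg[symmetric] frc_def U_def)
 also have "... \<le> real N / 2 ^ b" using \<open>card U \<le> N\<close> by (intro divide_right_mono) auto
 finally show ?thesis .
qed

theorem cext_tre:
 assumes p: "prime p" "2 ^ b \<le> p" "p \<le> 2 ^ w" and q: "prime q" "b + w \<le> q" and m: "0 < m" and eps: "0 < eps"
  and N: "real N / 2 ^ b \<le> 2 * (eps / m)\<^sup>2" and \<rho>: "(1 + 1 / real q) ^ (b + w) \<le> \<rho>"
 shows "cext N ((b + w) * q) m (m * 2 powr (\<rho> * m) * (1 / (2 * (eps / m)\<^sup>2))) eps (tre p b w q m)"
proof -
 let ?pos = "%i a. a * q + dpoly q m i a"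
 have q1: "1 < q" using q prime_gt_1_nat by blast
 have dl: "dpoly q m i a < q" for i a using q1 by (simp add: dpoly_def)
 interpret design "rsh p b w" ?pos m "b + w" "(b + w) * q"
 proof
  show "?pos i a < (b + w) * q" if "a < b + w" for i a
  proof -
   have "?pos i a < (a + 1) * q" using dl[of i a] by simp
   also have "... \<le> (b + w) * q" using that by (intro mult_right_mono) auto
   finally show ?thesis .
  qed
  show "a = a'" if "?pos i a = ?pos j a'" for i j a a'
  proof -
   have "?pos i a div q = a" for i a using dl[of i a] by simp
   then show ?thesis using that by metis
  qed
 qed
 have out: "out x y = tre p b w q m x y" for x y by (simp add: out_def tre_def proj_def)
 have "1 \<le> (1 + 1 / real q) ^ (b + w)" by (rule one_le_power) simp
 then have \<rho>1: "1 \<le> \<rho>" using \<rho> by (rule order_trans)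
 show ?thesis unfolding cext_def bad_def
 proof (intro allI impI)
  fix T assume T: "T \<subseteq> bits m"
  have "real (card {x \<in> bits N. card T / 2 ^ m + eps < frc (bits ((b + w) * q)) (%y. out x y \<in> T)})
   \<le> m * 2 powr (\<rho> * m) * (1 / (2 * (eps / m)\<^sup>2))"
  proof (rule trevisan_bad[OF T finite_bits \<rho>1])
   show "0 \<le> eps" using eps by simp
   fix i assume i: "i < m"
   have "m < q ^ m" using q1 less_exp[of m] power_mono[of 2 q m] by linarith
   then have iq: "i < q ^ m" using i by simp
   have "length (isec i j) = card (agree q m (b + w) i j)" if "j < i" for j
   proof -
    have "set (isec i j) = agree q m (b + w) i j" by (auto simp: isec_def agree_def)
    then show ?thesis by (metis distinct_card distinct_filter distinct_upt isec_def)
   qed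
   then have "real (\<Sum>j<i. 2 ^ length (isec i j)) = (\<Sum>j<i. 2 ^ card (agree q m (b + w) i j))" by simp
   also have "... \<le> (1 + 1 / real q) ^ (b + w) * real i" by (rule weak_design[OF q iq])
   also have "... \<le> \<rho> * real i" using \<rho> by (rule mult_right_mono) simp
   finally show "real (\<Sum>j<i. 2 ^ length (isec i j)) \<le> \<rho> * real i" .
  next
   fix G
   show "real (card {x \<in> bits N. 1/2 + eps / m < frc (bits (b + w)) (%v. rsh p b w x v = G v)}) \<le> 1 / (2 * (eps / m)\<^sup>2)"
    by (rule list_size_bound) (use code_pair[OF p] N eps m in \<open>auto intro: order_trans simp del: bits_iff\<close>)
  qed
  then show "real (card {x \<in> bits N. card T / 2 ^ m + eps < frc (bits ((b + w) * q)) (%y. tre p b w q m x y \<in> T)})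
   \<le> m * 2 powr (\<rho> * m) * (1 / (2 * (eps / m)\<^sup>2))" by (simp only: out)
 qed
qed

subsection \<open>Merging along a curve\<close>

definition slice :: "nat => bool list => nat => nat" where
 "slice b V c = num (map (%j. V ! (c * b + j)) [0..<b])"

text \<open>Lagrange polynomials without denominators, which spares inverses modulo p: at i the
  curve passes through row i times a constant that is nonzero modulo p. The summand
  \<open>p - j\<close> stands for -j in the natural numbers.\<close>

definition mcoef :: "nat => nat => nat => nat => nat" where
 "mcoef p t i y = (\<Prod>j<t. if j = i then 1 else y + (p - j)) mod p"

definition msym :: "nat => nat => nat => (nat => bool list) => nat => nat => nat" where
 "msym p b t rw y c = (\<Sum>i<t. slice b (rw i) c * mcoef p t i y) mod p"

definition merge :: "nat => nat => nat => nat => nat => (nat => bool list) => bool list => bool list" where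
 "merge p b w t R rw y = map (%\<iota>. bit (msym p b t rw (num y) (\<iota> div w)) (\<iota> mod w)) [0..<R * w]"

lemma length_merge [simp]: "length (merge p b w t R rw y) = R * w"
 by (simp add: merge_def)

lemma slice_less: "slice b V c < 2 ^ b"
 unfolding slice_def using num_less[of "map (%j. V ! (c * b + j)) [0..<b]"] by simp

lemma slice_inj:
 assumes "length V = R * b" "length V' = R * b" "\<And>c. c < R ==> slice b V c = slice b V' c"
 shows "V = V'"
proof (rule nth_equalityI)
 show "length V = length V'" using assms by simp
 fix i assume i: "i < length V"
 then have b: "0 < b" using assms(1) by (cases b) auto
 have c: "i div b < R" using i assms(1) b by (simp add: div_less_iff_less_mult)
 have e: "map (%j. V ! (i div b * b + j)) [0..<b] = map (%j. V' ! (i div b * b + j)) [0..<b]"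
  using assms(3)[OF c] unfolding slice_def by (intro num_inj) auto
 have n: "map f [0..<b] ! (i mod b) = f (i mod b)" for f :: "nat => bool"
  using mod_less_divisor[OF b, of i] by simp
 have "V ! (i div b * b + i mod b) = V' ! (i div b * b + i mod b)"
  using arg_cong[OF e, of "%l. l ! (i mod b)"] unfolding n .
 then show "V ! i = V' ! i" unfolding div_mult_mod_eq .
qed

lemma slice_merge:
 assumes "0 < p" "p \<le> 2 ^ w" "c < R"
 shows "slice w (merge p b w t R rw y) c = msym p b t rw (num y) c"
proof -
 have "msym p b t rw (num y) c < 2 ^ w" using assms by (auto simp: msym_def intro: order_less_le_trans[OF mod_less_divisor])
 moreover have "map (%j. merge p b w t R rw y ! (c * w + j)) [0..<w] = nbits w (msym p b t rw (num y) c)"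
 proof (rule nth_equalityI)
  fix j assume "j < length (map (%j. merge p b w t R rw y ! (c * w + j)) [0..<w])"
  then have j: "j < w" by simp
  have "c * w + j < (c + 1) * w" using j by simp
  also have "... \<le> R * w" using assms(3) by (intro mult_right_mono) auto
  finally show "map (%j. merge p b w t R rw y ! (c * w + j)) [0..<w] ! j = nbits w (msym p b t rw (num y) c) ! j"
   using j by (simp add: merge_def nbits_def)
 qed simp
 ultimately show ?thesis by (simp add: slice_def)
qed

definition mpoly :: "nat => nat => int poly" where
 "mpoly t i = (\<Prod>j<t. if j = i then 1 else [:- int j, 1:])"

lemma degree_mpoly: "i < t ==> degree (mpoly t i) < t"
proof -
 assume i: "i < t"
 have "degree (mpoly t i) \<le> (\<Sum>j<t. degree (if j = i then 1 else [:- int j, 1:]))"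
  unfolding mpoly_def by (rule degree_prod_sum_le[unfolded o_def]) simp
 also have "... \<le> (\<Sum>j<t. if j = i then 0 else 1)" by (intro sum_mono) auto
 also have "... = card ({..<t} - {i})" by (simp add: sum.If_cases Diff_eq)
 also have "... < t" using i by simp
 finally show ?thesis .
qed

lemma poly_mpoly: "poly (mpoly t i) x = (\<Prod>j<t. if j = i then 1 else x - int j)"
 unfolding mpoly_def poly_prod by (intro prod.cong) auto

lemma poly_mpoly_0: "i < t ==> j < t ==> i \<noteq> j ==> poly (mpoly t i) (int j) = 0"
 unfolding poly_mpoly by (rule prod_zero) (auto intro!: bexI[of _ j])

lemma poly_mpoly_cong:
 assumes "t \<le> p"
 shows "[int (mcoef p t i y) = poly (mpoly t i) (int y)] (mod int p)"
proof -
 have "[int (\<Prod>j<t. if j = i then 1 else y + (p - j)) = poly (mpoly t i) (int y)] (mod int p)"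
  unfolding poly_mpoly of_nat_prod
 proof (rule cong_prod)
  fix j assume "j \<in> {..<t}"
  then show "[int (if j = i then 1 else y + (p - j)) = (if j = i then 1 else int y - int j)] (mod int p)"
   using assms by (auto simp: cong_iff_dvd_diff of_nat_diff)
 qed
 then show ?thesis by (simp add: mcoef_def zmod_int cong_def)
qed

lemma poly_mpoly_nz:
 assumes p: "prime p" and "t \<le> p" "i < t"
 shows "\<not> int p dvd poly (mpoly t i) (int i)"
proof
 assume "int p dvd poly (mpoly t i) (int i)"
 then obtain j where j: "j < t" "int p dvd (if j = i then 1 else int i - int j)"
  unfolding poly_mpoly using p by (auto simp: prime_dvd_prod_iff)
 show False
 proof (cases "j = i")
  case True
  then show False using j p by auto
 next
  case False
  have "int i - int j \<noteq> 0" using False by simp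
  moreover have "int p dvd int i - int j" using j(2) False by simp
  ultimately have "\<bar>int p\<bar> \<le> \<bar>int i - int j\<bar>" by (rule dvd_imp_le_int)
  then show False using j(1) assms(2,3) by linarith
 qed
qed

text \<open>Merging read backwards: a small set \<open>B\<close> of outputs yields sparse tests, one
  per row and chosen before the rows, and hitting \<open>B\<close> for many seeds forces every row
  into its test. One good row is then enough. The tests collect the rows at which all derivatives up
  to order R/2 of a polynomial with multiple zeros on \<open>B\<close> vanish; Schwartz-Zippel
  bounds their density.\<close>

lemma merge_test:
 assumes p: "prime p" "2 ^ b \<le> p" "p \<le> 2 ^ w" and t: "t \<le> 2 ^ b" and R: "0 < R" and h: "0 < h" and b0: "0 < b"
  and B: "B \<subseteq> bits (R * w)" "card B * 2 ^ (2 * R) < h ^ R"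
 shows "\<exists>T. (\<forall>i<t. T i \<subseteq> bits (R * b) \<and> real (card (T i)) / 2 ^ (R * b) \<le> 2 * real h / 2 ^ b) \<and>
  (\<forall>rw. (\<forall>i<t. rw i \<in> bits (R * b)) \<longrightarrow> 2 * h * t \<le> card {y \<in> bits b. merge p b w t R rw y \<in> B} \<longrightarrow> (\<forall>i<t. rw i \<in> T i))"
proof -
 have p1: "1 < p" using p prime_gt_1_nat by blast
 define B' where "B' = (%V. map (%c. int (slice w V c)) [0..<R]) ` B"
 have finB: "finite B" using B(1) finite_bits finite_subset by blast
 have "card B' \<le> card B" unfolding B'_def by (rule card_image_le[OF finB])
 then have "card B' * 2 ^ (2 * R) \<le> card B * 2 ^ (2 * R)" by (rule mult_right_mono) simp
 then have "card B' * 2 ^ (2 * R) < h ^ R" using B(2) by (rule le_less_trans)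
 moreover have "finite B'" unfolding B'_def by (rule finite_imageI[OF finB])
 ultimately obtain c where c: "\<exists>e\<in>lst R h. \<not> int p dvd c e"
  and cB: "\<And>v \<beta>. v \<in> B' ==> \<beta> \<in> low R R ==> int p dvd dq R h c \<beta> v"
  using exists_multiplicity_poly[OF p1, of B' R h] by blast
 define \<theta> where "\<theta> i = poly (mpoly t i) (int i)" for i
 define enc where "enc i V = map (%c. int (slice b V c) * \<theta> i) [0..<R]" for i V
 define T where "T i = {V \<in> bits (R * b). \<forall>\<beta>. length \<beta> = R \<longrightarrow> 2 * sum_list \<beta> \<le> R \<longrightarrow> int p dvd dq R h c \<beta> (enc i V)}" for i
 have \<theta>: "\<not> int p dvd \<theta> i" if "i < t" for i
  unfolding \<theta>_def using that t p(2) by (intro poly_mpoly_nz[OF p(1)]) auto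
 have dist: "u = v" if "int p dvd int u * \<theta> i - int v * \<theta> i" "u < 2 ^ b" "v < 2 ^ b" "i < t" for u v i
 proof -
  have "int p dvd (int u - int v) * \<theta> i" using that(1) by (simp add: left_diff_distrib)
  then have "int p dvd int u - int v" using \<theta>[OF that(4)] p(1) by (simp add: prime_dvd_mult_iff)
  moreover have "\<bar>int u - int v\<bar> < int p" using that(2,3) p(2) by auto
  ultimately show ?thesis using dvd_imp_le_int[of "int u - int v" "int p"] by fastforce
 qed
 have dens: "real (card (T i)) / 2 ^ (R * b) \<le> 2 * real h / 2 ^ b" if i: "i < t" for i
 proof -
  define S where "S = (%v. int v * \<theta> i) ` {..<2 ^ b}"
  have injS: "inj_on (%v. int v * \<theta> i) {..<2 ^ b}"
  proof (rule inj_onI)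
   fix u v :: nat assume uv: "u \<in> {..<2 ^ b}" "v \<in> {..<2 ^ b}" "int u * \<theta> i = int v * \<theta> i"
   have "int p dvd int u * \<theta> i - int v * \<theta> i" unfolding uv(3) by simp
   then show "u = v" using uv(1,2) i by (intro dist) auto
  qed
  have pe: "((2::nat) ^ b) ^ R = 2 ^ (R * b)" by (simp only: power_mult[symmetric] mult.commute)
  have cS: "card S = 2 ^ b" unfolding S_def by (simp add: card_image[OF injS])
  have dS: "x = y" if xy: "x \<in> S" "y \<in> S" "int p dvd x - y" for x y
  proof -
   obtain u v where uv: "x = int u * \<theta> i" "y = int v * \<theta> i" "u < 2 ^ b" "v < 2 ^ b"
    using xy(1,2) unfolding S_def by blast
   have "u = v" using xy(3) unfolding uv(1,2) by (rule dist) (use uv i in auto)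
   then show ?thesis using uv by simp
  qed
  have fS: "finite S" unfolding S_def by simp
  obtain \<mu> where \<mu>: "\<And>a. length a = R ==> set a \<subseteq> S ==> \<exists>\<beta>. length \<beta> = R \<and> sum_list \<beta> \<le> \<mu> a \<and> \<not> int p dvd dq R h c \<beta> a"
   and s\<mu>: "(\<Sum>a\<in>{a. length a = R \<and> set a \<subseteq> S}. \<mu> a) * card S \<le> (h - 1) * R * card S ^ R"
   using schwartz_zippel_mult[OF p(1) fS dS c h] by blast
  have enc: "length (enc i V) = R" "set (enc i V) \<subseteq> S" for V
   using slice_less[of b V] by (auto simp: enc_def S_def)
  have inj: "inj_on (enc i) (bits (R * b))"
  proof (rule inj_onI)
   fix V V' assume V: "V \<in> bits (R * b)" "V' \<in> bits (R * b)" "enc i V = enc i V'"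
   have "slice b V k = slice b V' k" if "k < R" for k
   proof -
    have e: "enc i V ! k = enc i V' ! k" by (simp only: V(3))
    have "int (slice b V k) * \<theta> i = int (slice b V' k) * \<theta> i" using e that unfolding enc_def by (simp del: mult_cancel_right)
    then have "int p dvd int (slice b V k) * \<theta> i - int (slice b V' k) * \<theta> i" by (simp only: diff_self dvd_0_right)
    then show ?thesis by (rule dist[OF _ slice_less slice_less i])
   qed
   then show "V = V'" using slice_inj V by auto
  qed
  have fT: "finite (T i)" unfolding T_def by (rule finite_subset[OF _ finite_bits]) blast
  \<comment> \<open>Otherwise a derivative of order at most R/2 would be nonzero at the encoding of
    a member of the test.\<close>
  have mu: "R \<le> 2 * \<mu> (enc i V)" if "V \<in> T i" for V
  proof (rule ccontr)
   assume "\<not> ?thesis"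
   moreover obtain \<beta> where "length \<beta> = R" "sum_list \<beta> \<le> \<mu> (enc i V)" "\<not> int p dvd dq R h c \<beta> (enc i V)"
    using \<mu>[OF enc] by blast
   moreover have "int p dvd dq R h c \<beta> (enc i V)" if "length \<beta> = R" "2 * sum_list \<beta> \<le> R" for \<beta>
    using \<open>V \<in> T i\<close> that by (auto simp: T_def)
   ultimately show False by force
  qed
  have "card (T i) * R = (\<Sum>V\<in>T i. R)" by simp
  also have "... \<le> (\<Sum>V\<in>T i. 2 * \<mu> (enc i V))" by (rule sum_mono) (rule mu)
  also have "... = 2 * (\<Sum>a\<in>enc i ` T i. \<mu> a)"
   using inj by (subst sum.reindex) (auto simp: T_def sum_distrib_left intro: inj_on_subset)
  also have "... \<le> 2 * (\<Sum>a\<in>{a. length a = R \<and> set a \<subseteq> S}. \<mu> a)"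
  proof -
   have "finite {a. length a = R \<and> set a \<subseteq> S}" using finite_lists_length_eq[OF fS, of R] by (simp add: conj_commute)
   moreover have "enc i ` T i \<subseteq> {a. length a = R \<and> set a \<subseteq> S}" using enc by blast
   ultimately show ?thesis by (simp add: sum_mono2)
  qed
  finally have "card (T i) * R * card S \<le> 2 * (\<Sum>a\<in>{a. length a = R \<and> set a \<subseteq> S}. \<mu> a) * card S"
   by (rule mult_right_mono) simp
  also have "... \<le> 2 * ((h - 1) * R * card S ^ R)" using s\<mu> by simp
  also have "... \<le> 2 * (h * R * card S ^ R)" by simp
  finally have "(card (T i) * 2 ^ b) * R \<le> (2 * h * 2 ^ (R * b)) * R" unfolding cS pe by (simp only: ac_simps)
  then have "card (T i) * 2 ^ b \<le> 2 * h * 2 ^ (R * b)" using R by simp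
  then have "real (card (T i) * 2 ^ b) \<le> real (2 * h * 2 ^ (R * b))" by (rule of_nat_mono)
  then show ?thesis by (simp add: field_simps)
 qed
 have hit: "rw i \<in> T i"
  if rw: "\<forall>i<t. rw i \<in> bits (R * b)" and many: "2 * h * t \<le> card {y \<in> bits b. merge p b w t R rw y \<in> B}" and i: "i < t" for rw i
 proof -
  define F where "F = map (%c. \<Sum>i<t. smult (int (slice b (rw i) c)) (mpoly t i)) [0..<R]"
  define Y0 where "Y0 = {y \<in> bits b. merge p b w t R rw y \<in> B}"
  define Y where "Y = (%y. int (num y)) ` Y0"
  have cY: "card Y = card Y0" unfolding Y_def by (rule card_image) (auto intro!: inj_onI num_inj simp: Y0_def)
  have "finite Y0" unfolding Y0_def by (rule finite_subset[OF _ finite_bits]) blast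
  then have fY: "finite Y" unfolding Y_def by (rule finite_imageI)
  have dY: "y = y'" if yy: "y \<in> Y" "y' \<in> Y" "int p dvd y - y'" for y y'
  proof -
   obtain u v where u: "y = int (num u)" "y' = int (num v)" "length u = b" "length v = b"
    using yy(1,2) by (auto simp: Y_def Y0_def)
   have "\<bar>y - y'\<bar> < int p" using num_less[of u] num_less[of v] u p(2) by auto
   then have "y - y' = 0" using yy(3) dvd_imp_le_int[of "y - y'" "int p"] by linarith
   then show ?thesis by simp
  qed
  have hitY: "\<exists>v\<in>B'. length v = R \<and> (\<forall>i<R. int p dvd poly (F ! i) y - v ! i)" if yY: "y \<in> Y" for y
  proof -
   obtain u where u: "y = int (num u)" "merge p b w t R rw u \<in> B" using yY by (auto simp: Y_def Y0_def)
   let ?V = "merge p b w t R rw u"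
   have "int p dvd poly (F ! c) y - int (slice w ?V c)" if "c < R" for c
   proof -
    have "[int (\<Sum>i<t. slice b (rw i) c * mcoef p t i (num u)) = (\<Sum>i<t. int (slice b (rw i) c) * poly (mpoly t i) (int (num u)))] (mod int p)"
     unfolding of_nat_sum of_nat_mult using t p(2) by (intro cong_sum cong_mult cong_refl poly_mpoly_cong) simp
    then have "[int (msym p b t rw (num u) c) = poly (F ! c) y] (mod int p)"
     using that unfolding msym_def by (simp add: F_def poly_sum u(1) zmod_int cong_def)
    then have "int p dvd poly (F ! c) y - int (msym p b t rw (num u) c)"
     by (simp only: cong_iff_dvd_diff dvd_diff_commute)
    moreover have "slice w ?V c = msym p b t rw (num u) c" using p1 p(3) that by (intro slice_merge) auto
    ultimately show ?thesis by (simp only:)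
   qed
   then show ?thesis using u(2) unfolding B'_def by (intro bexI[of _ "map (%c. int (slice w ?V c)) [0..<R]"]) auto
  qed
  have deg: "degree f < t" if fF: "f \<in> set F" for f
  proof -
   obtain c where "f = (\<Sum>i<t. smult (int (slice b (rw i) c)) (mpoly t i))" using fF unfolding F_def set_map by blast
   moreover have "degree (\<Sum>i<t. smult (int (slice b (rw i) c)) (mpoly t i)) \<le> t - 1"
   proof (rule degree_sum_le)
    fix j assume "j \<in> {..<t}"
    then have "degree (mpoly t j) < t" by (intro degree_mpoly) simp
    then show "degree (smult (int (slice b (rw j) c)) (mpoly t j)) \<le> t - 1"
     using degree_smult_le[of "int (slice b (rw j) c)" "mpoly t j"] by linarith
   qed simp
   ultimately have "degree f \<le> t - 1" by (simp only:)
   then show ?thesis using i by linarith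
  qed
  have Fx: "map (%f. poly f (int i)) F = enc i (rw i)"
  proof (rule nth_equalityI)
   fix c assume "c < length (map (%f. poly f (int i)) F)"
   then have c: "c < R" by (simp add: F_def)
   have "(\<Sum>j<t. int (slice b (rw j) c) * poly (mpoly t j) (int i)) = int (slice b (rw i) c) * \<theta> i"
   proof -
    have "(\<Sum>j<t. int (slice b (rw j) c) * poly (mpoly t j) (int i)) =
     (\<Sum>j<t. if j = i then int (slice b (rw i) c) * \<theta> i else 0)"
     using i by (intro sum.cong refl) (simp add: \<theta>_def poly_mpoly_0)
    then show ?thesis using i by simp
   qed
   then show "map (%f. poly f (int i)) F ! c = enc i (rw i) ! c" using c by (simp add: F_def enc_def poly_sum)
  qed (simp add: F_def enc_def)
  have "int p dvd dq R h c \<beta> (enc i (rw i))" if \<beta>: "length \<beta> = R" "2 * sum_list \<beta> \<le> R" for \<beta>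
  proof -
   have "2 * h * t \<le> card Y" using many unfolding cY Y0_def .
   moreover have "length F = R" by (simp add: F_def)
   ultimately have "int p dvd dq R h c \<beta> (map (%f. poly f (int i)) F)"
    by (intro curve_vanishes[OF p(1) cB _ deg h R fY dY hitY _ \<beta>])
   then show ?thesis unfolding Fx .
  qed
  then show ?thesis using rw i unfolding T_def by blast
 qed
 show ?thesis
 proof (intro exI[of _ T] conjI allI impI)
  show "T i \<subseteq> bits (R * b)" for i unfolding T_def by blast
 qed (fact dens, rule hit, blast+)
qed

section \<open>Compositions\<close>

lemma frc_comp:
 assumes "0 \<le> \<theta>" "\<And>a. a \<in> bits d1 ==> \<not> Q a ==> frc (bits d2) (P a) \<le> \<theta>"
 shows "frc (bits (d1 + d2)) (%s. P (take d1 s) (drop d1 s)) \<le> frc (bits d1) Q + \<theta>"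
proof -
 have "frc (bits (d1 + d2)) (%s. P (take d1 s) (drop d1 s)) = avg (bits d1) (%a. frc (bits d2) (P a))"
  unfolding frc_append by (rule avg_cong) simp
 also have "... \<le> avg (bits d1) (%a. of_bool (Q a) + \<theta>)"
 proof (rule avg_mono)
  fix a assume a: "a \<in> bits d1"
  show "frc (bits d2) (P a) \<le> of_bool (Q a) + \<theta>"
  proof (cases "Q a")
   case True
   then show ?thesis using frc_le_1[OF finite_bits, of d2 "P a"] assms(1) by simp
  next
   case False
   then show ?thesis using assms(2)[OF a] by simp
  qed
 qed
 also have "... = frc (bits d1) Q + \<theta>" by (simp add: avg_add avg_const frc_avg)
 finally show ?thesis .
qed

lemma cext_mono: "cext N d m K eps E ==> K \<le> K' ==> eps \<le> eps' ==> cext N d m K' eps' E"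
 unfolding cext_def
proof (intro allI impI)
 fix T assume a: "\<forall>T\<subseteq>bits m. real (card (bad N d E T (real (card T) / 2 ^ m + eps))) \<le> K" "K \<le> K'" "eps \<le> eps'" "T \<subseteq> bits m"
 have "card (bad N d E T (real (card T) / 2 ^ m + eps')) \<le> card (bad N d E T (real (card T) / 2 ^ m + eps))"
  by (rule card_mono[OF finite_bad]) (use a(3) in \<open>auto simp: bad_def\<close>)
 then show "real (card (bad N d E T (real (card T) / 2 ^ m + eps'))) \<le> K'"
  using a(1,2,4) by (meson of_nat_le_iff order_trans)
qed

lemma cextD:
 assumes "cext N d m K eps E" "T \<subseteq> bits m"
 shows "real (card (bad N d E T (real (card T) / 2 ^ m + eps))) \<le> K"
 using assms unfolding cext_def by blast

lemma bad_comp: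
 assumes C: "\<And>x s. x \<in> bits N ==> s \<in> bits dc ==> C x s \<in> bits M" and \<theta>: "0 \<le> \<theta>"
 shows "bad N (dc + de) (%x s. E (C x (take dc s)) (drop dc s)) T (\<theta> + eps) \<subseteq> bad N dc C (bad M de E T \<theta>) eps"
proof
 fix x assume x: "x \<in> bad N (dc + de) (%x s. E (C x (take dc s)) (drop dc s)) T (\<theta> + eps)"
 then have xN: "x \<in> bits N" and
  big: "\<theta> + eps < frc (bits (dc + de)) (%s. E (C x (take dc s)) (drop dc s) \<in> T)" by (auto simp: bad_def)
 have "frc (bits (dc + de)) (%s. E (C x (take dc s)) (drop dc s) \<in> T) \<le> frc (bits dc) (%s. C x s \<in> bad M de E T \<theta>) + \<theta>"
  by (rule frc_comp[OF \<theta>, where P = "%a b. E (C x a) b \<in> T"]) (use C[OF xN] in \<open>auto simp: bad_def\<close>)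
 then show "x \<in> bad N dc C (bad M de E T \<theta>) eps" using big xN by (simp add: bad_def)
qed

lemma cext_ccond:
 assumes C: "ccond N dc M K' K epsc C" and E: "cext M de m K' eps E"
  and rg: "\<And>x s. x \<in> bits N ==> s \<in> bits dc ==> C x s \<in> bits M" and eps: "0 \<le> eps"
 shows "cext N (dc + de) m K (eps + epsc) (%x s. E (C x (take dc s)) (drop dc s))"
 unfolding cext_def
proof (intro allI impI)
 fix T assume T: "T \<subseteq> bits m"
 let ?\<theta> = "real (card T) / 2 ^ m + eps"
 have "card (bad N (dc + de) (%x s. E (C x (take dc s)) (drop dc s)) T (?\<theta> + epsc)) \<le> card (bad N dc C (bad M de E T ?\<theta>) epsc)"
  by (rule card_mono[OF finite_bad]) (use eps in \<open>intro bad_comp[OF rg], auto\<close>)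
 moreover have "real (card (bad N dc C (bad M de E T ?\<theta>) epsc)) \<le> K"
  by (rule C[unfolded ccond_def, rule_format]) (unfold bad_def, blast, fold bad_def, rule cextD[OF E T])
 ultimately show "real (card (bad N (dc + de) (%x s. E (C x (take dc s)) (drop dc s)) T (real (card T) / 2 ^ m + (eps + epsc)))) \<le> K"
  by (simp add: add.assoc)
qed

lemma ccond_comp:
 assumes C: "ccond N dc M K' K epsc C" and E: "ccond M de M' K'' K' eps E"
  and rg: "\<And>x s. x \<in> bits N ==> s \<in> bits dc ==> C x s \<in> bits M" and eps: "0 \<le> eps"
 shows "ccond N (dc + de) M' K'' K (eps + epsc) (%x s. E (C x (take dc s)) (drop dc s))"
 unfolding ccond_def
proof (intro allI impI)
 fix B assume B: "B \<subseteq> bits M'" "real (card B) \<le> K''"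
 have "card (bad N (dc + de) (%x s. E (C x (take dc s)) (drop dc s)) B (eps + epsc)) \<le> card (bad N dc C (bad M de E B eps) epsc)"
  by (rule card_mono[OF finite_bad]) (intro bad_comp[OF rg] eps)
 moreover have "real (card (bad M de E B eps)) \<le> K'" using E B unfolding ccond_def by blast
 then have "real (card (bad N dc C (bad M de E B eps) epsc)) \<le> K"
  by (intro C[unfolded ccond_def, rule_format]) (unfold bad_def, blast)
 ultimately show "real (card (bad N (dc + de) (%x s. E (C x (take dc s)) (drop dc s)) B (eps + epsc))) \<le> K" by simp
qed

section \<open>Extraction from a prefix with a seed drawn from the suffix\<close>

definition blk :: "nat => (bool list => bool list => bool list) => (bool list => bool list => bool list) => bool list => bool list => bool list" where
 "blk N1 E1 E2 x s = E1 (take N1 x) (E2 (drop N1 x) s)"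

definition bad1 where
 "bad1 N1 dB m eps1 E1 T = bad N1 dB E1 T (real (card T) / 2 ^ m + eps1)"

definition bad2 where
 "bad2 N2 ds dB eps2 E1 E2 T u = bad N2 ds E2 {y \<in> bits dB. E1 u y \<in> T} (real (card {y \<in> bits dB. E1 u y \<in> T}) / 2 ^ dB + eps2)"

lemma card_bad1: "cext N1 dB m K1 eps1 E1 ==> T \<subseteq> bits m ==> real (card (bad1 N1 dB m eps1 E1 T)) \<le> K1"
 unfolding bad1_def by (rule cextD)

lemma card_bad2: "cext N2 ds dB K0 eps2 E2 ==> real (card (bad2 N2 ds dB eps2 E1 E2 T u)) \<le> K0"
 unfolding bad2_def by (rule cextD) blast+

lemma block_frc:
 assumes x: "x \<in> bits (N1 + N2)" and rg: "\<And>v s. v \<in> bits N2 ==> s \<in> bits ds ==> E2 v s \<in> bits dB"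
  and g1: "take N1 x \<notin> bad1 N1 dB m eps1 E1 T" and g2: "drop N1 x \<notin> bad2 N2 ds dB eps2 E1 E2 T (take N1 x)"
 shows "frc (bits ds) (%s. blk N1 E1 E2 x s \<in> T) \<le> real (card T) / 2 ^ m + eps1 + eps2"
proof -
 let ?u = "take N1 x" let ?v = "drop N1 x"
 have u: "?u \<in> bits N1" "?v \<in> bits N2" using x by auto
 have "frc (bits ds) (%s. blk N1 E1 E2 x s \<in> T) = frc (bits ds) (%s. E2 ?v s \<in> {y \<in> bits dB. E1 ?u y \<in> T})"
  unfolding blk_def by (rule frc_cong) (use rg[OF u(2)] in blast)
 also have "... \<le> real (card {y \<in> bits dB. E1 ?u y \<in> T}) / 2 ^ dB + eps2"
  using g2 u(2) unfolding bad2_def bad_def by force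
 also have "real (card {y \<in> bits dB. E1 ?u y \<in> T}) / 2 ^ dB = frc (bits dB) (%y. E1 ?u y \<in> T)" by (simp add: frc_def)
 also have "... \<le> real (card T) / 2 ^ m + eps1" using g1 u(1) unfolding bad1_def bad_def by force
 finally show ?thesis by simp
qed

lemma finite_bad1 [simp]: "finite (bad1 N1 dB m eps1 E1 T)" by (simp add: bad1_def)
lemma finite_bad2 [simp]: "finite (bad2 N2 ds dB eps2 E1 E2 T u)" by (simp add: bad2_def)

lemma card_Sigma_le:
 assumes "finite A" "\<And>a. a \<in> A ==> finite (B a)" "\<And>a. a \<in> A ==> real (card (B a)) \<le> c"
 shows "real (card (Sigma A B)) \<le> real (card A) * c"
proof -
 have "real (card (Sigma A B)) = (\<Sum>a\<in>A. real (card (B a)))" using assms by (subst card_SigmaI) auto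
 also have "... \<le> (\<Sum>a\<in>A. c)" by (intro sum_mono assms)
 finally show ?thesis by simp
qed

text \<open>Prefix and suffix need not be independent. A bad input has a bad prefix with any suffix,
  or any prefix u with a suffix that is bad for the set of inner seeds sending u into
  \<open>T\<close>; the two summands count these cases.\<close>

lemma cext_blk:
 assumes E1: "cext N1 dB m K1 eps1 E1" and E2: "cext N2 ds dB K0 eps2 E2"
  and rg: "\<And>v s. v \<in> bits N2 ==> s \<in> bits ds ==> E2 v s \<in> bits dB"
 shows "cext (N1 + N2) ds m (K1 * 2 ^ N2 + 2 ^ N1 * K0) (eps1 + eps2) (blk N1 E1 E2)"
 unfolding cext_def
proof (intro allI impI)
 fix T assume T: "T \<subseteq> bits m"
 let ?P = "bad1 N1 dB m eps1 E1 T" let ?S = "bad2 N2 ds dB eps2 E1 E2 T"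
 let ?app = "%(u, v). u @ v :: bool list"
 let ?X = "bad (N1 + N2) ds (blk N1 E1 E2) T (real (card T) / 2 ^ m + (eps1 + eps2))"
 have sub: "?X \<subseteq> ?app ` (?P \<times> bits N2) \<union> ?app ` Sigma (bits N1) ?S"
 proof
  fix x assume x: "x \<in> ?X"
  then have xl: "length x = N1 + N2" by (simp add: bad_def)
  have xe: "x = ?app (take N1 x, drop N1 x)" by simp
  have "take N1 x \<in> ?P \<or> drop N1 x \<in> ?S (take N1 x)"
  proof (rule ccontr)
   assume "\<not> ?thesis"
   then have "frc (bits ds) (%s. blk N1 E1 E2 x s \<in> T) \<le> real (card T) / 2 ^ m + eps1 + eps2"
    using xl by (intro block_frc[OF _ rg]) auto
   then show False using x by (simp add: bad_def)
  qed
  then show "x \<in> ?app ` (?P \<times> bits N2) \<union> ?app ` Sigma (bits N1) ?S"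
  proof
   assume "take N1 x \<in> ?P"
   then have "(take N1 x, drop N1 x) \<in> ?P \<times> bits N2" using xl by simp
   then show ?thesis using xe by blast
  next
   assume "drop N1 x \<in> ?S (take N1 x)"
   then have "(take N1 x, drop N1 x) \<in> Sigma (bits N1) ?S" using xl by simp
   then show ?thesis using xe by blast
  qed
 qed
 have fin: "finite (?P \<times> bits N2)" "finite (Sigma (bits N1) ?S)" by auto
 have "card ?X \<le> card (?app ` (?P \<times> bits N2) \<union> ?app ` Sigma (bits N1) ?S)"
  using fin by (intro card_mono[OF _ sub]) auto
 also have "... \<le> card (?app ` (?P \<times> bits N2)) + card (?app ` Sigma (bits N1) ?S)" by (rule card_Un_le)
 also have "... \<le> card (?P \<times> bits N2) + card (Sigma (bits N1) ?S)" by (intro add_mono card_image_le fin)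
 finally have "real (card ?X) \<le> real (card (?P \<times> bits N2) + card (Sigma (bits N1) ?S))" by (rule of_nat_mono)
 also have "... = real (card (?P \<times> bits N2)) + real (card (Sigma (bits N1) ?S))" by (rule of_nat_add)
 also have "real (card (?P \<times> bits N2)) \<le> K1 * 2 ^ N2"
  using card_bad1[OF E1 T] by (simp add: card_cartesian_product)
 also have "real (card (Sigma (bits N1) ?S)) \<le> real (card (bits N1)) * K0"
  by (intro card_Sigma_le card_bad2[OF E2]) auto
 finally show "real (card ?X) \<le> K1 * 2 ^ N2 + 2 ^ N1 * K0" by simp
qed

text \<open>At every cut the prefix or the suffix is bad. If the empty prefix is bad, there is a cut
  with a bad prefix that is the last one or is followed by a cut whose prefix is good and whose
  suffix is therefore bad. Only the g bits between the two cuts are then free, whence K1 * 2^g * K0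
  for each cut; the additional 1 counts the case of a good empty prefix.\<close>

lemma rows_bad:
 assumes t: "0 < t" "(t - 1) * g \<le> N" "N \<le> t * g"
  and E1: "\<And>i. i < t ==> cext (i * g) dB m K1 eps1 E1" and E2: "\<And>i. i < t ==> cext (N - i * g) ds dB K0 eps2 E2"
  and rg: "\<And>v s. s \<in> bits ds ==> E2 v s \<in> bits dB" and K: "1 \<le> K0" "1 \<le> K1"
  and T: "\<And>i. i < t ==> T i \<subseteq> bits m \<and> real (card (T i)) / 2 ^ m \<le> \<delta>"
 shows "real (card {x \<in> bits N. \<forall>i<t. \<delta> + eps1 + eps2 < frc (bits ds) (%s. blk (i * g) E1 E2 x s \<in> T i)}) \<le> (real t + 1) * (K1 * 2 ^ g * K0)"
  (is "real (card ?X) \<le> _")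
proof -
 define P where "P i = bad1 (i * g) dB m eps1 E1 (T i)" for i
 define S where "S i = bad2 (N - i * g) ds dB eps2 E1 E2 (T i)" for i
 define A where "A i = (if Suc i < t then (%((u, v), z). u @ v @ z) ` Sigma (P i \<times> bits g) (%(u, v). S (Suc i) (u @ v))
   else (%(u, v). u @ v) ` (P i \<times> bits (N - i * g)))" for i
 have ig: "i * g \<le> N" if "i < t" for i
  using mult_right_mono[of i "t - 1" g] that t(2) by linarith
 have dich: "take (i * g) x \<in> P i \<or> drop (i * g) x \<in> S i (take (i * g) x)" if x: "x \<in> ?X" and i: "i < t" for x i
 proof (rule ccontr)
  assume n: "\<not> ?thesis"
  have "frc (bits ds) (%s. blk (i * g) E1 E2 x s \<in> T i) \<le> real (card (T i)) / 2 ^ m + eps1 + eps2"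
  proof (rule block_frc)
   show "x \<in> bits (i * g + (N - i * g))" using x ig[OF i] by simp
  qed (use n rg in \<open>auto simp: P_def S_def\<close>)
  then have "frc (bits ds) (%s. blk (i * g) E1 E2 x s \<in> T i) \<le> \<delta> + eps1 + eps2" using T[OF i] by linarith
  then show False using x i by force
 qed
 have sub: "?X \<subseteq> S 0 [] \<union> (\<Union>i<t. A i)"
 proof
  fix x assume x: "x \<in> ?X"
  then have xl: "length x = N" by simp
  show "x \<in> S 0 [] \<union> (\<Union>i<t. A i)"
  proof (cases "[] \<in> P 0")
   case False
   then show ?thesis using dich[OF x t(1)] by simp
  next
   case True
   \<comment> \<open>If no such cut existed, badness of the prefix would propagate from cut 0 past
     every cut.\<close>
   have "\<exists>i<t. take (i * g) x \<in> P i \<and> (Suc i < t \<longrightarrow> take (Suc i * g) x \<notin> P (Suc i))"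
   proof (rule ccontr)
    assume n: "\<not> ?thesis"
    have "j < t \<and> take (j * g) x \<in> P j" for j
     by (induction j) (use True t(1) n in auto)
    then show False by blast
   qed
   then obtain i where i: "i < t" "take (i * g) x \<in> P i" "Suc i < t \<longrightarrow> take (Suc i * g) x \<notin> P (Suc i)" by blast
   have "x \<in> A i"
   proof (cases "Suc i < t")
    case True
    let ?u = "take (i * g) x" let ?v = "take g (drop (i * g) x)" let ?z = "drop (Suc i * g) x"
    have ig': "Suc i * g = i * g + g" by simp
    have uv: "?u @ ?v = take (Suc i * g) x" unfolding ig' take_add ..
    have "?z \<in> S (Suc i) (?u @ ?v)" unfolding uv using dich[OF x True] i(3) True by blast
    moreover have "?v \<in> bits g" using ig[OF True] xl by simp
    ultimately have "((?u, ?v), ?z) \<in> Sigma (P i \<times> bits g) (%(u, v). S (Suc i) (u @ v))" using i(2) by simp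
    moreover have "x = ?u @ ?v @ ?z" using uv by (metis append.assoc append_take_drop_id)
    ultimately show ?thesis unfolding A_def using True by (auto intro!: image_eqI[of _ _ "((?u, ?v), ?z)"])
   next
    case False
    have "(take (i * g) x, drop (i * g) x) \<in> P i \<times> bits (N - i * g)" using i(2) xl by simp
    moreover have "x = take (i * g) x @ drop (i * g) x" by simp
    ultimately show ?thesis unfolding A_def using False by (auto intro!: image_eqI[of _ _ "(take (i * g) x, drop (i * g) x)"])
   qed
   then show ?thesis using i(1) by blast
  qed
 qed
 have fP: "finite (P i)" and fS: "finite (S i u)" for i u by (simp_all add: P_def S_def)
 have cP: "real (card (P i)) \<le> K1" if "i < t" for i unfolding P_def by (rule card_bad1[OF E1]) (use T that in auto)
 have cS: "real (card (S i u)) \<le> K0" if "i < t" for i u unfolding S_def by (rule card_bad2[OF E2[OF that]])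
 define G where "G i = Sigma (P i \<times> bits g) (%(u, v). S (Suc i) (u @ v))" for i
 have fG: "finite (G i)" for i unfolding G_def
 proof (rule finite_SigmaI)
  show "finite (P i \<times> bits g)" using fP by simp
  show "finite (case a of (u, v) => S (Suc i) (u @ v))" for a by (cases a) (simp add: fS)
 qed
 have fH: "finite (P i \<times> bits (N - i * g))" for i using fP by simp
 have fA: "finite (A i)" for i unfolding A_def G_def[symmetric]
  by (cases "Suc i < t") (simp_all only: if_True if_False finite_imageI fG fH)
 have cA: "real (card (A i)) \<le> K1 * 2 ^ g * K0" if i: "i < t" for i
 proof (cases "Suc i < t")
  case True
  have "A i = (%((u, v), z). u @ v @ z) ` G i" unfolding A_def G_def using True by (simp only: if_True)
  then have "real (card (A i)) \<le> real (card (G i))" by (simp only: of_nat_mono card_image_le[OF fG])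
  also have "... \<le> real (card (P i \<times> bits g)) * K0" unfolding G_def
  proof (rule card_Sigma_le)
   show "finite (P i \<times> bits g)" using fP by simp
   show "finite (case a of (u, v) => S (Suc i) (u @ v))" for a by (cases a) (simp add: fS)
   show "real (card (case a of (u, v) => S (Suc i) (u @ v))) \<le> K0" for a by (cases a) (simp add: cS[OF True])
  qed
  also have "... = real (card (P i)) * 2 ^ g * K0" by (simp add: card_cartesian_product)
  also have "... \<le> K1 * 2 ^ g * K0" using cP[OF i] K by (intro mult_right_mono) auto
  finally show ?thesis .
 next
  case False
  \<comment> \<open>Behind the last cut at most g bits remain; they are counted as free.\<close>
  then have it: "i = t - 1" using i by simp
  have g: "N - i * g \<le> g" using t unfolding it by (cases t) auto
  have "A i = (%(u, v). u @ v) ` (P i \<times> bits (N - i * g))" unfolding A_def using False by (simp only: if_False)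
  then have "real (card (A i)) \<le> real (card (P i \<times> bits (N - i * g)))" by (simp only: of_nat_mono card_image_le[OF fH])
  also have "... = real (card (P i)) * 2 ^ (N - i * g)" by (simp add: card_cartesian_product)
  also have "... \<le> K1 * 2 ^ g" using cP[OF i] K g by (intro mult_mono power_increasing) auto
  also have "... \<le> K1 * 2 ^ g * K0" using K mult_left_mono[of 1 K0 "K1 * 2 ^ g"] by simp
  finally show ?thesis .
 qed
 have "card ?X \<le> card (S 0 [] \<union> (\<Union>i<t. A i))" using fS fA by (intro card_mono[OF _ sub]) auto
 also have "... \<le> card (S 0 []) + card (\<Union>i<t. A i)" by (rule card_Un_le)
 also have "card (\<Union>i<t. A i) \<le> (\<Sum>i<t. card (A i))" by (rule card_UN_le) simp
 finally have "card ?X \<le> card (S 0 []) + (\<Sum>i<t. card (A i))" by simp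
 then have "real (card ?X) \<le> real (card (S 0 []) + (\<Sum>i<t. card (A i)))" by (rule of_nat_mono)
 also have "... = real (card (S 0 [])) + (\<Sum>i<t. real (card (A i)))" by (simp only: of_nat_add of_nat_sum)
 also have "... \<le> K0 + (\<Sum>i<t. K1 * 2 ^ g * K0)" by (intro add_mono sum_mono cA cS t(1)) auto
 also have "... \<le> (real t + 1) * (K1 * 2 ^ g * K0)"
 proof -
  have "1 * 1 \<le> K1 * 2 ^ g" using K by (intro mult_mono) auto
  then have "1 * K0 \<le> K1 * 2 ^ g * K0" using K by (intro mult_right_mono) auto
  then show ?thesis by (simp add: distrib_right)
 qed
 finally show ?thesis .
qed

lemma zero_le_mult_imp_left: "0 \<le> e * 2 ^ b ==> 0 \<le> (e::real)"
 by (meson not_le mult_neg_pos zero_less_power zero_less_numeral)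

section \<open>The merger as a condenser\<close>

lemma ccond_merge:
 assumes p: "prime p" "2 ^ b \<le> p" "p \<le> 2 ^ w" and t: "t \<le> 2 ^ b" "0 < t" and R: "0 < R" and h: "0 < h" and b0: "0 < b"
  and K': "K' * 2 ^ (2 * R) < real h ^ R" and eps: "0 \<le> \<theta>" "2 * real h * real t \<le> eps3 * 2 ^ b"
  and rg: "\<And>i x s. rx i x s \<in> bits (R * b)"
  and rb: "\<And>T. (\<And>i. i < t ==> T i \<subseteq> bits (R * b) \<and> real (card (T i)) / 2 ^ (R * b) \<le> 2 * real h / 2 ^ b) ==>
   real (card {x \<in> bits N. \<forall>i<t. \<theta> < frc (bits ds) (%s. rx i x s \<in> T i)}) \<le> K"
 shows "ccond N (ds + b) (R * w) K' K (\<theta> + eps3) (%x s. merge p b w t R (%i. rx i x (take ds s)) (drop ds s))"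
 unfolding ccond_def
proof (intro allI impI)
 fix B assume B: "B \<subseteq> bits (R * w)" "real (card B) \<le> K'"
 have "real (card B * 2 ^ (2 * R)) \<le> K' * 2 ^ (2 * R)" using B(2) by simp
 also have "... < real (h ^ R)" using K' by simp
 finally have cB: "card B * 2 ^ (2 * R) < h ^ R" by (simp only: of_nat_less_iff)
 obtain T where T: "\<And>i. i < t ==> T i \<subseteq> bits (R * b) \<and> real (card (T i)) / 2 ^ (R * b) \<le> 2 * real h / 2 ^ b"
  and hit: "\<And>rw. (\<forall>i<t. rw i \<in> bits (R * b)) ==> 2 * h * t \<le> card {y \<in> bits b. merge p b w t R rw y \<in> B} ==> (\<forall>i<t. rw i \<in> T i)"
  using merge_test[OF p t(1) R h b0 B(1) cB] by blast
 let ?C = "%x s. merge p b w t R (%i. rx i x (take ds s)) (drop ds s)"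
 let ?X = "{x \<in> bits N. \<forall>i<t. \<theta> < frc (bits ds) (%s. rx i x s \<in> T i)}"
 have "bad N (ds + b) ?C B (\<theta> + eps3) \<subseteq> ?X"
 proof
  fix x assume x: "x \<in> bad N (ds + b) ?C B (\<theta> + eps3)"
  show "x \<in> ?X"
  proof (rule ccontr)
   assume "x \<notin> ?X"
   moreover have "x \<in> bits N" using x by (simp add: bad_def)
   ultimately obtain i where i: "i < t" "frc (bits ds) (%s. rx i x s \<in> T i) \<le> \<theta>"
    unfolding mem_Collect_eq by (meson not_le)
   have "0 \<le> 2 * real h * real t" by simp
   then have "0 \<le> eps3 * 2 ^ b" using eps(2) by linarith
   then have e3: "0 \<le> eps3" by (rule zero_le_mult_imp_left)
   \<comment> \<open>If row i misses its test, the curve meets \<open>B\<close> for fewer than 2 h t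
     of the 2^b curve seeds; their fraction is charged to \<open>eps3\<close>.\<close>
   have "frc (bits (ds + b)) (%s. ?C x s \<in> B) \<le> frc (bits ds) (%s. rx i x s \<in> T i) + eps3"
   proof (rule frc_comp[OF e3, where P = "%a y. merge p b w t R (%i. rx i x a) y \<in> B"])
    fix a assume "a \<in> bits ds" "rx i x a \<notin> T i"
    then have "\<not> 2 * h * t \<le> card {y \<in> bits b. merge p b w t R (%i. rx i x a) y \<in> B}" using hit[of "%i. rx i x a"] rg i(1) by blast
    then have "real (card {y \<in> bits b. merge p b w t R (%i. rx i x a) y \<in> B}) \<le> real (2 * h * t)" by linarith
    also have "... \<le> eps3 * 2 ^ b" using eps(2) by simp
    finally show "frc (bits b) (%y. merge p b w t R (%i. rx i x a) y \<in> B) \<le> eps3" by (simp add: frc_def divide_le_eq del: bits_iff)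
   qed
   then show False using x i(2) by (simp add: bad_def)
  qed
 qed
 then have "card (bad N (ds + b) ?C B (\<theta> + eps3)) \<le> card ?X"
  by (rule card_mono[rotated]) (rule finite_subset[OF _ finite_bits[of N]], blast)
 moreover have "real (card ?X) \<le> K" by (rule rb) (rule T)
 ultimately show "real (card (bad N (ds + b) ?C B (\<theta> + eps3))) \<le> K" by linarith
qed

section \<open>Concatenating outputs extracted from one input\<close>

lemma layers:
 fixes y :: real
 assumes "0 < J" "0 \<le> y" "y \<le> 1"
 shows "y \<le> (\<Sum>j<J. of_bool (real j / real J < y)) / real J" "(\<Sum>j<J. of_bool (real j / real J < y)) / real J \<le> y + 1 / real J"
proof -
 define c where "c = nat \<lceil>real J * y\<rceil>"
 have c0: "0 \<le> real J * y" using assms by simp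
 have "real J * y \<le> real J" using assms by (simp add: mult_left_le)
 then have cJ: "c \<le> J" unfolding c_def by linarith
 have "{j \<in> {..<J}. real j / real J < y} = {..<c}"
 proof -
  have e: "real j / real J < y \<longleftrightarrow> j < c" for j
  proof -
   have "real j / real J < y \<longleftrightarrow> real j < real J * y" using assms(1) by (simp add: divide_less_eq mult.commute)
   then show ?thesis unfolding c_def by (simp add: zless_nat_eq_int_zless less_ceiling_iff)
  qed
  show ?thesis unfolding e using cJ by auto
 qed
 moreover have "(\<Sum>j<J. of_bool (real j / real J < y)) = real (card {j \<in> {..<J}. real j / real J < y})"
  by (simp add: of_bool_def sum.If_cases Int_def)
 ultimately have s: "(\<Sum>j<J. of_bool (real j / real J < y)) = real c" by simp
 have "real J * y \<le> real c" "real c \<le> real J * y + 1" using c0 unfolding c_def by linarith+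
 then show "y \<le> (\<Sum>j<J. of_bool (real j / real J < y)) / real J" "(\<Sum>j<J. of_bool (real j / real J < y)) / real J \<le> y + 1 / real J"
  unfolding s using assms(1) by (simp_all add: field_simps)
qed

text \<open>For each first output z the second extractor faces the section of the test at z;
  excluding the inputs that are bad for some z costs the factor 2^m1, the entropy spent on z. The
  first extractor faces the density of the section, a real-valued function, which is resolved into J
  threshold tests at the price of 1 / J.\<close>

lemma cext_concat:
 assumes E1: "cext N d1 m1 K1 eps1 E1" and E2: "cext N d2 m2 K2 eps2 E2" and J: "0 < J"
  and rg: "\<And>x s. s \<in> bits d1 ==> E1 x s \<in> bits m1" and rg2: "\<And>x s. s \<in> bits d2 ==> E2 x s \<in> bits m2"
 shows "cext N (d1 + d2) (m1 + m2) (2 ^ m1 * K2 + real J * K1) (eps1 + eps2 + 1 / real J) (%x s. E1 x (take d1 s) @ E2 x (drop d1 s))"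
 unfolding cext_def
proof (intro allI impI)
 fix T assume T: "T \<subseteq> bits (m1 + m2)"
 define f where "f z = frc (bits m2) (%b. z @ b \<in> T)" for z
 have f01: "0 \<le> f z" "f z \<le> 1" for z by (simp_all add: f_def frc_nonneg frc_le_1)
 have "frc (bits (m1 + m2)) (%y. y \<in> T) = avg (bits m1) f" unfolding f_def by (rule frc_append)
 moreover have "{y \<in> bits (m1 + m2). y \<in> T} = T" using T by blast
 ultimately have af: "avg (bits m1) f = real (card T) / 2 ^ (m1 + m2)" by (simp add: frc_def)
 define U where "U j = {z \<in> bits m1. real j / real J < f z}" for j
 define X2 where "X2 z = bad N d2 E2 {b \<in> bits m2. z @ b \<in> T} (real (card {b \<in> bits m2. z @ b \<in> T}) / 2 ^ m2 + eps2)" for z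
 define X1 where "X1 j = bad N d1 E1 (U j) (real (card (U j)) / 2 ^ m1 + eps1)" for j
 let ?E = "%x s. E1 x (take d1 s) @ E2 x (drop d1 s)"
 let ?X = "bad N (d1 + d2) ?E T (real (card T) / 2 ^ (m1 + m2) + (eps1 + eps2 + 1 / real J))"
 have "?X \<subseteq> (\<Union>z\<in>bits m1. X2 z) \<union> (\<Union>j<J. X1 j)"
 proof
  fix x assume x: "x \<in> ?X"
  then have xN: "x \<in> bits N" by (simp add: bad_def)
  show "x \<in> (\<Union>z\<in>bits m1. X2 z) \<union> (\<Union>j<J. X1 j)"
  proof (rule ccontr)
   assume n: "\<not> ?thesis"
   have "frc (bits (d1 + d2)) (%s. ?E x s \<in> T) = avg (bits d1) (%a. frc (bits d2) (%b. E1 x a @ E2 x b \<in> T))"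
    unfolding frc_append by (rule avg_cong) simp
   also have "... \<le> avg (bits d1) (%a. f (E1 x a) + eps2)"
   proof (rule avg_mono)
    fix a assume a: "a \<in> bits d1"
    let ?z = "E1 x a"
    have "x \<notin> X2 ?z" using n rg[OF a] by blast
    then have "frc (bits d2) (%b. E2 x b \<in> {b \<in> bits m2. ?z @ b \<in> T}) \<le> real (card {b \<in> bits m2. ?z @ b \<in> T}) / 2 ^ m2 + eps2"
     using xN unfolding X2_def bad_def by force
    also have "real (card {b \<in> bits m2. ?z @ b \<in> T}) / 2 ^ m2 = f ?z" by (simp add: f_def frc_def)
    finally show "frc (bits d2) (%b. ?z @ E2 x b \<in> T) \<le> f ?z + eps2"
     using frc_cong[of "bits d2" "%b. E2 x b \<in> {b \<in> bits m2. ?z @ b \<in> T}" "%b. ?z @ E2 x b \<in> T"] rg2 by force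
   qed
   also have "... = avg (bits d1) (%a. f (E1 x a)) + eps2" by (simp add: avg_add avg_const)
   also have "avg (bits d1) (%a. f (E1 x a)) \<le> avg (bits d1) (%a. (1 / real J) * (\<Sum>j<J. of_bool (real j / real J < f (E1 x a))))"
    using layers(1)[OF J f01] by (intro avg_mono) simp
   also have "... = (1 / real J) * (\<Sum>j<J. frc (bits d1) (%a. real j / real J < f (E1 x a)))"
    by (simp only: avg_cmult avg_sum frc_avg[OF finite_bits])
   also have "... \<le> (1 / real J) * (\<Sum>j<J. frc (bits m1) (%z. real j / real J < f z) + eps1)"
   proof (intro mult_left_mono sum_mono)
    fix j assume "j \<in> {..<J}"
    then have "x \<notin> X1 j" using n by blast
    then have "frc (bits d1) (%a. E1 x a \<in> U j) \<le> real (card (U j)) / 2 ^ m1 + eps1"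
     using xN unfolding X1_def bad_def by force
    moreover have "frc (bits d1) (%a. E1 x a \<in> U j) = frc (bits d1) (%a. real j / real J < f (E1 x a))"
     by (rule frc_cong) (use rg in \<open>auto simp: U_def\<close>)
    ultimately show "frc (bits d1) (%a. real j / real J < f (E1 x a)) \<le> frc (bits m1) (%z. real j / real J < f z) + eps1"
     by (simp add: frc_def U_def)
   qed simp
   also have "... = eps1 + avg (bits m1) (%z. (1 / real J) * (\<Sum>j<J. of_bool (real j / real J < f z)))"
    using J by (simp only: avg_cmult avg_sum frc_avg[OF finite_bits]) (simp add: sum.distrib field_simps)
   also have "avg (bits m1) (%z. (1 / real J) * (\<Sum>j<J. of_bool (real j / real J < f z))) \<le> avg (bits m1) (%z. f z + 1 / real J)"
    using layers(2)[OF J f01] by (intro avg_mono) simp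
   also have "... = real (card T) / 2 ^ (m1 + m2) + 1 / real J" using af by (simp add: avg_add avg_const)
   finally show False using x by (simp add: bad_def)
  qed
 qed
 then have "card ?X \<le> card ((\<Union>z\<in>bits m1. X2 z) \<union> (\<Union>j<J. X1 j))" by (intro card_mono) (auto simp: X1_def X2_def)
 also have "... \<le> card (\<Union>z\<in>bits m1. X2 z) + card (\<Union>j<J. X1 j)" by (rule card_Un_le)
 also have "... \<le> (\<Sum>z\<in>bits m1. card (X2 z)) + (\<Sum>j<J. card (X1 j))" by (intro add_mono card_UN_le) auto
 finally have "real (card ?X) \<le> real ((\<Sum>z\<in>bits m1. card (X2 z)) + (\<Sum>j<J. card (X1 j)))" by (rule of_nat_mono)
 also have "... = (\<Sum>z\<in>bits m1. real (card (X2 z))) + (\<Sum>j<J. real (card (X1 j)))" by (simp only: of_nat_add of_nat_sum)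
 also have "... \<le> (\<Sum>z\<in>bits m1. K2) + (\<Sum>j<J. K1)"
  unfolding X1_def X2_def U_def by (intro add_mono sum_mono cextD[OF E1] cextD[OF E2]) blast+
 finally show "real (card ?X) \<le> 2 ^ m1 * K2 + real J * K1" by simp
qed

section \<open>From counts of bad inputs to min-entropy sources\<close>

lemma pmf_le_min_entropy:
 assumes "is_source n k X"
 shows "pmf X x \<le> 2 powr (- k)"
proof (cases "x \<in> set_pmf X")
 case False
 then show ?thesis by (simp add: set_pmf_iff)
next
 case True
 have fin: "finite (set_pmf X)" using assms finite_bits finite_subset unfolding is_source_def by blast
 have "k \<le> log 2 (1 / pmf X x)"
  using assms True fin unfolding is_source_def min_entropy_def
  by (meson Min_le finite_imageI imageI order_trans)
 moreover have pos: "0 < pmf X x" using True by (simp add: pmf_positive)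
 ultimately have "2 powr k \<le> 1 / pmf X x" by (simp add: le_log_iff)
 then show ?thesis using pos by (simp add: powr_minus_divide field_simps)
qed

text \<open>The bad inputs have total probability at most K * 2^-k, hence at most eps', and all
  others exceed the density of the test by at most eps. Deviations downward are deviations upward of
  the complement.\<close>

theorem extractor_of_cext:
 assumes E: "cext n d m K eps E" and rg: "\<And>x s. x \<in> bits n ==> s \<in> bits d ==> E x s \<in> bits m"
  and K: "K \<le> eps' * 2 powr k" and eps: "0 \<le> eps"
 shows "is_extractor n d m k (eps + eps') E"
 unfolding is_extractor_def
proof (intro conjI ballI allI impI rg)
 fix X assume X: "is_source n k X"
 let ?P = "map_pmf (%(x, s). E x s) (pair_pmf X (uniform_bits d))"
 have sX: "set_pmf X \<subseteq> bits n" using X by (simp add: is_source_def)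
 have su: "set_pmf (uniform_bits d) = bits d" for d unfolding uniform_bits_def by (rule set_pmf_of_set) auto
 have U: "measure_pmf.prob (uniform_bits m) T = real (card T) / 2 ^ m" if "T \<subseteq> bits m" for T
  unfolding uniform_bits_def using that by (subst measure_pmf_of_set) (auto simp: Int_absorb1)
 have P: "measure_pmf.prob ?P T = (\<Sum>x\<in>bits n. pmf X x * frc (bits d) (%s. E x s \<in> T))" for T
 proof -
  have "measure_pmf.prob ?P T = measure_pmf.prob (pair_pmf X (uniform_bits d)) ((%(x, s). E x s) -` T \<inter> (bits n \<times> bits d))"
   unfolding measure_map_pmf
   by (rule measure_pmf.finite_measure_eq_AE) (use sX su in \<open>auto simp: AE_measure_pmf_iff\<close>)
  also have "(%(x, s). E x s) -` T \<inter> (bits n \<times> bits d) = Sigma (bits n) (%x. {s \<in> bits d. E x s \<in> T})" by auto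
  also have "measure_pmf.prob (pair_pmf X (uniform_bits d)) ... = (\<Sum>z\<in>Sigma (bits n) (%x. {s \<in> bits d. E x s \<in> T}). pmf (pair_pmf X (uniform_bits d)) z)"
   by (rule measure_measure_pmf_finite) (auto simp del: bits_iff)
  also have "... = (\<Sum>x\<in>bits n. \<Sum>s\<in>{s \<in> bits d. E x s \<in> T}. pmf (pair_pmf X (uniform_bits d)) (x, s))"
   by (subst sum.Sigma) (auto simp del: bits_iff)
  also have "... = (\<Sum>x\<in>bits n. \<Sum>s\<in>{s \<in> bits d. E x s \<in> T}. pmf X x * (1 / 2 ^ d))"
   by (intro sum.cong refl) (auto simp: pmf_pair uniform_bits_def)
  finally show ?thesis by (simp add: frc_def ac_simps)
 qed
 have tot: "(\<Sum>x\<in>bits n. pmf X x) = 1" using sX by (intro sum_pmf_eq_1) auto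
 have up: "measure_pmf.prob ?P T \<le> real (card T) / 2 ^ m + (eps + eps')" if T: "T \<subseteq> bits m" for T
 proof -
  let ?\<theta> = "real (card T) / 2 ^ m + eps"
  let ?B = "bad n d E T ?\<theta>"
  have \<theta>: "0 \<le> ?\<theta>" using eps by simp
  have "measure_pmf.prob ?P T \<le> (\<Sum>x\<in>bits n. pmf X x * ?\<theta> + (if x \<in> ?B then 2 powr (- k) else 0))"
   unfolding P
  proof (rule sum_mono)
   fix x assume x: "x \<in> bits n"
   show "pmf X x * frc (bits d) (%s. E x s \<in> T) \<le> pmf X x * ?\<theta> + (if x \<in> ?B then 2 powr (- k) else 0)"
   proof (cases "x \<in> ?B")
    case True
    have "pmf X x * frc (bits d) (%s. E x s \<in> T) \<le> pmf X x * 1" by (intro mult_left_mono frc_le_1) auto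
    also have "... \<le> 2 powr (- k)" using pmf_le_min_entropy[OF X] by simp
    also have "... \<le> pmf X x * ?\<theta> + 2 powr (- k)" using \<theta> by simp
    finally show ?thesis using True by simp
   next
    case False
    then have "frc (bits d) (%s. E x s \<in> T) \<le> ?\<theta>" using x unfolding bad_def by force
    then show ?thesis using False by (simp add: mult_left_mono)
   qed
  qed
  also have "... = ?\<theta> + real (card {x \<in> bits n. x \<in> ?B}) * 2 powr (- k)"
   unfolding sum.distrib sum_distrib_right[symmetric] tot by (simp add: sum.If_cases Int_def del: bits_iff)
  also have "{x \<in> bits n. x \<in> ?B} = ?B" unfolding bad_def by blast
  also have "?\<theta> + real (card ?B) * 2 powr (- k) \<le> ?\<theta> + (eps' * 2 powr k) * 2 powr (- k)"
   using cextD[OF E T] K by (intro add_left_mono mult_right_mono) auto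
  also have "... = real (card T) / 2 ^ m + (eps + eps')" by (simp add: powr_minus field_simps)
  finally show ?thesis .
 qed
 have "\<bar>measure_pmf.prob ?P T - measure_pmf.prob (uniform_bits m) T\<bar> \<le> eps + eps'" if T: "T \<subseteq> bits m" for T
 proof -
  let ?T' = "bits m - T"
  have "measure_pmf.prob ?P (T \<union> ?T') = measure_pmf.prob ?P T + measure_pmf.prob ?P ?T'"
   by (rule measure_pmf.finite_measure_Union) auto
  moreover have "measure_pmf.prob ?P (T \<union> ?T') = 1"
  proof -
   have "set_pmf ?P \<subseteq> T \<union> ?T'" using T sX su rg by (auto simp del: bits_iff)
   then show ?thesis by (subst measure_pmf.prob_eq_1) (auto simp: AE_measure_pmf_iff)
  qed
  ultimately have c: "measure_pmf.prob ?P ?T' = 1 - measure_pmf.prob ?P T" by simp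
  have "card ?T' = 2 ^ m - card T" using T by (simp add: card_Diff_subset finite_subset[OF T])
  moreover have "card T \<le> 2 ^ m" using card_mono[OF finite_bits T] by simp
  ultimately have "real (card ?T') / 2 ^ m = 1 - real (card T) / 2 ^ m" by (simp add: of_nat_diff field_simps)
  then show ?thesis using up[OF T] up[of ?T'] c U[OF T] by (simp add: abs_le_iff)
 qed
 then show "stat_dist (bits m) ?P (uniform_bits m) \<le> eps + eps'"
  unfolding stat_dist_def by (subst Max_le_iff) auto
qed

section \<open>Primes in polynomially short intervals\<close>

lemma leibniz_triangle:
 assumes "k < n"
 shows "1 / (real (n + 1) * real (n choose Suc k)) = 1 / (real n * real ((n - 1) choose k)) - 1 / (real (n + 1) * real (n choose k))"
proof -
 have c0: "0 < n choose k" "0 < n - 1 choose k" using assms by (simp_all add: zero_less_binomial)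
 have "Suc k * (n choose Suc k) = (n - k) * (n choose k)"
  unfolding binomial_absorb_comp binomial_absorption ..
 then have "real (Suc k) * real (n choose Suc k) = real (n - k) * real (n choose k)" unfolding of_nat_mult[symmetric] by simp
 then have a: "(real k + 1) * real (n choose Suc k) = (real n - real k) * real (n choose k)" using assms by (simp add: of_nat_diff add.commute)
 have "real (n - k) * real (n choose k) = real n * real ((n - 1) choose k)"
  unfolding of_nat_mult[symmetric] binomial_absorb_comp ..
 then have b: "real n * real ((n - 1) choose k) = (real n - real k) * real (n choose k)" using assms by (simp add: of_nat_diff)
 have gen: "1 / (s * (A * u / v)) = 1 / (u * A) - 1 / (s * A)" if "0 < A" "0 < u" "0 < v" "0 < s" "v = s - u" for A u v s :: real
  using that by (simp add: field_simps)
 have x: "real (n choose Suc k) = real (n choose k) * (real n - real k) / (real k + 1)" using a by (simp add: field_simps)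
 show ?thesis unfolding b x using assms c0 by (intro gen) auto
qed

text \<open>Nair's argument with Leibniz's harmonic triangle: column 0 becomes integral when
  multiplied by the lcm, and every later column consists of differences of entries of the one
  before.\<close>

lemma lcm_leibniz:
 assumes "n < M" "k \<le> n"
 shows "real (Lcm {1..M}) / (real (n + 1) * real (n choose k)) \<in> \<int>"
 using assms
proof (induction k arbitrary: n)
 case 0
 have "n + 1 dvd Lcm {1..M}" using 0 by (intro dvd_Lcm) auto
 then obtain c where "Lcm {1..M} = (n + 1) * c" by blast
 then have e: "real (Lcm {1..M}) = real (n + 1) * real c" by (simp only: of_nat_mult)
 have "real (Lcm {1..M}) / (real (n + 1) * real (n choose 0)) = real c" unfolding e by simp
 then show ?case by (simp only: Ints_of_nat)
next
 case (Suc k)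
 let ?D = "real (Lcm {1..M})"
 have "?D / (real (n + 1) * real (n choose Suc k)) = ?D * (1 / (real (n + 1) * real (n choose Suc k)))" by simp
 also have "... = ?D / (real n * real ((n - 1) choose k)) - ?D / (real (n + 1) * real (n choose k))"
  unfolding leibniz_triangle[OF Suc_le_lessD[OF Suc.prems(2)]] by (simp add: right_diff_distrib)
 also have "... \<in> \<int>"
 proof (rule Ints_diff)
  have "?D / (real (n - 1 + 1) * real ((n - 1) choose k)) \<in> \<int>" by (rule Suc.IH) (use Suc.prems in auto)
  moreover have "n - 1 + 1 = n" using Suc.prems by simp
  ultimately show "?D / (real n * real ((n - 1) choose k)) \<in> \<int>" by (simp only:)
  show "?D / (real (n + 1) * real (n choose k)) \<in> \<int>" by (rule Suc.IH) (use Suc.prems in auto)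
 qed
 finally show ?case .
qed

lemma Lcm_Suc: "Lcm {1..Suc M} = lcm (Suc M) (Lcm {1..M})"
 by (simp add: atLeastAtMostSuc_conv)

lemma Lcm_pos: "0 < Lcm {1..M::nat}"
 by (induction M) (simp_all add: Lcm_Suc[unfolded One_nat_def] lcm_pos_nat)

text \<open>Integrality of the middle entry of row 2N makes the lcm at least (2N + 1) times the
  central binomial coefficient. This is at least 4^N, of which 2^N is kept.\<close>

lemma Lcm_ge: "2 ^ N \<le> Lcm {1..2 * N + 1}"
proof -
 define c where "c = (2 * N + 1) * ((2 * N) choose N)"
 have cpos: "0 < c" unfolding c_def by simp
 have "2 * N < 2 * N + 1" "N \<le> 2 * N" by simp_all
 then have "real (Lcm {1..2 * N + 1}) / real c \<in> \<int>"
  using lcm_leibniz[of "2 * N" "2 * N + 1" N] unfolding c_def of_nat_mult[of "2 * N + 1"] by (simp only:)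
 then obtain z where z: "real (Lcm {1..2 * N + 1}) / real c = real_of_int z" by (rule Ints_cases)
 have "0 < real (Lcm {1..2 * N + 1}) / real c" using Lcm_pos cpos by simp
 then have "1 \<le> real_of_int z" unfolding z by simp
 then have "real c \<le> real (Lcm {1..2 * N + 1})" unfolding z[symmetric] using cpos by (simp add: le_divide_eq)
 moreover have "2 ^ N \<le> real c"
 proof (cases "N = 0")
  case False
  have "(4::real) ^ N / (2 * real N) \<le> real ((2 * N) choose N)"
   by (rule central_binomial_lower_bound) (use False in simp)
  then have "4 ^ N \<le> (2 * real N) * real ((2 * N) choose N)" using False by (simp add: field_simps)
  also have "... \<le> real c" unfolding c_def of_nat_mult by (intro mult_right_mono) auto
  finally have "4 ^ N \<le> real c" .
  moreover have "(2::real) ^ N \<le> 4 ^ N" by (intro power_mono) auto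
  ultimately show ?thesis by linarith
 qed (simp add: c_def)
 ultimately have "real (2 ^ N) \<le> real (Lcm {1..2 * N + 1})" by simp
 then show ?thesis by (simp only: of_nat_le_iff)
qed

lemma prime_power_dvd_Lcm:
 assumes "prime (p::nat)" "p ^ k dvd Lcm {1..M}" "0 < k"
 shows "\<exists>m\<in>{1..M}. p ^ k dvd m"
 using assms(2)
proof (induction M)
 case 0
 then show ?case using assms(1,3) prime_gt_1_nat[of p] by auto
next
 case (Suc M)
 have e: "Lcm {1..Suc M} = lcm (Suc M) (Lcm {1..M})" by (rule Lcm_Suc)
 have "multiplicity p (lcm (Suc M) (Lcm {1..M})) = max (multiplicity p (Suc M)) (multiplicity p (Lcm {1..M}))"
  using Lcm_pos[of M] assms(1) by (intro multiplicity_lcm) (auto intro: prime_imp_prime_elem)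
 moreover have "k \<le> multiplicity p (lcm (Suc M) (Lcm {1..M}))"
 proof (rule multiplicity_geI)
  show "p ^ k dvd lcm (Suc M) (Lcm {1..M})" using Suc.prems unfolding e .
  show "lcm (Suc M) (Lcm {1..M}) \<noteq> 0" using Lcm_pos[of "Suc M"] unfolding e by linarith
  show "\<not> is_unit p" using prime_gt_1_nat[OF assms(1)] by simp
 qed
 ultimately have "k \<le> multiplicity p (Suc M) \<or> k \<le> multiplicity p (Lcm {1..M})" by linarith
 then show ?case
 proof
  assume "k \<le> multiplicity p (Suc M)"
  then have "p ^ k dvd Suc M" by (rule multiplicity_dvd')
  then show ?thesis by (intro bexI[of _ "Suc M"]) auto
 next
  assume "k \<le> multiplicity p (Lcm {1..M})"
  then have "p ^ k dvd Lcm {1..M}" by (rule multiplicity_dvd')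
  then show ?thesis using Suc.IH by force
 qed
qed

lemma quadratic_less_exp: "7 \<le> X ==> 2 * X\<^sup>2 + 1 < (2::nat) ^ X"
proof (induction X rule: nat_induct_at_least)
 case (Suc X)
 have "7 * X \<le> X * X" using Suc.hyps by (intro mult_right_mono) auto
 moreover have "2 * (Suc X)\<^sup>2 + 1 = 2 * (X * X) + 4 * X + 3" "2 * (2 * X\<^sup>2 + 1) = 4 * (X * X) + 2" by (simp_all add: power2_eq_square)
 ultimately have "2 * (Suc X)\<^sup>2 + 1 \<le> 2 * (2 * X\<^sup>2 + 1)" using Suc.hyps by linarith
 also have "... < 2 ^ Suc X" using Suc.IH by simp
 finally show ?case .
qed simp

text \<open>Without a prime between X and M = 2X^2 + 1, the lcm of 1, ..., M would be a product of
  at most X prime powers, none above M, and 2^(X^2) would be at most M^X. The quadratic length of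
  the interval only affects exponents later on.\<close>

lemma exists_prime_between:
 assumes "7 \<le> X"
 shows "\<exists>p::nat. prime p \<and> X \<le> p \<and> p \<le> 2 * X\<^sup>2 + 1"
proof (rule ccontr)
 assume n: "\<not> ?thesis"
 define M where "M = 2 * X\<^sup>2 + 1"
 define D where "D = Lcm {1..M}"
 have D0: "0 < D" unfolding D_def by (rule Lcm_pos)
 have f: "p < X \<and> p ^ multiplicity p D \<le> M" if "p \<in> prime_factors D" for p
 proof -
  have p: "prime p" "p dvd D" using that by auto
  have m: "0 < multiplicity p D" using that by (simp add: prime_factors_multiplicity)
  obtain m where "m \<in> {1..M}" "p ^ multiplicity p D dvd m"
   using prime_power_dvd_Lcm[OF p(1) multiplicity_dvd[of p D, unfolded D_def] m[unfolded D_def]] unfolding D_def by blast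
  then have "p ^ multiplicity p D \<le> m" "m \<le> M" by (simp_all add: dvd_imp_le)
  then have le: "p ^ multiplicity p D \<le> M" by (rule order_trans)
  have "p ^ 1 \<le> p ^ multiplicity p D" using m prime_gt_0_nat[OF p(1)] by (intro power_increasing) auto
  then have "p \<le> M" using le by simp
  then have "p < X" using n p(1) unfolding M_def not_less[symmetric] by blast
  then show ?thesis using le by blast
 qed
 have "2 ^ X\<^sup>2 \<le> D" unfolding D_def M_def by (rule Lcm_ge)
 also have "D = (\<Prod>p\<in>prime_factors D. p ^ multiplicity p D)" using prime_factorization_nat[OF D0] by simp
 also have "... \<le> (\<Prod>p\<in>prime_factors D. M)" by (intro prod_mono) (use f in auto)
 also have "... = M ^ card (prime_factors D)" by simp
 also have "... \<le> M ^ X"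
 proof (rule power_increasing)
  have "prime_factors D \<subseteq> {..<X}" using f by auto
  then show "card (prime_factors D) \<le> X" using card_mono[of "{..<X}"] by fastforce
 qed (simp add: M_def)
 finally have "(2 ^ X) ^ X \<le> M ^ X" unfolding power2_eq_square power_mult .
 moreover have "(2 ^ X) ^ X \<le> M ^ X \<longleftrightarrow> 2 ^ X \<le> M" using assms by (intro power_mono_iff) auto
 ultimately have "2 ^ X \<le> M" by blast
 moreover have "2 * X\<^sup>2 + 1 < 2 ^ X" by (rule quadratic_less_exp) (rule assms)
 ultimately show False unfolding M_def by simp
qed

definition nprime :: "nat => nat" where
 "nprime X = (LEAST p. prime p \<and> X \<le> p)"

lemma nprime: "prime (nprime X)" "X \<le> nprime X" "nprime X \<le> 2 * X\<^sup>2 + 7"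
proof -
 have "\<exists>p::nat. prime p \<and> X \<le> p \<and> p \<le> 2 * X\<^sup>2 + 7"
 proof (cases "7 \<le> X")
  case True
  obtain p :: nat where "prime p" "X \<le> p" "p \<le> 2 * X\<^sup>2 + 1" using exists_prime_between[OF True] by blast
  then show ?thesis by (intro exI[of _ p]) simp
 next
  case False
  moreover have "prime (7::nat)" by simp
  ultimately show ?thesis by (intro exI[of _ 7]) auto
 qed
 then obtain p where p: "prime p" "X \<le> p" "p \<le> 2 * X\<^sup>2 + 7" by blast
 have "prime (nprime X) \<and> X \<le> nprime X" unfolding nprime_def by (rule LeastI[of _ p]) (use p in blast)
 moreover have "nprime X \<le> p" unfolding nprime_def by (rule Least_le) (use p in blast)
 ultimately show "prime (nprime X)" "X \<le> nprime X" "nprime X \<le> 2 * X\<^sup>2 + 7" using p by auto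
qed

section \<open>Existence of extractors for short inputs\<close>

lemma exp_half_le: "0 \<le> x ==> x \<le> (1::real) ==> exp x \<le> 1 + x + x\<^sup>2"
 by (rule exp_bound)

text \<open>Chernoff's bound as a count: functions are weighted by exp(x * hits), and the total
  weight factors over the arguments. The choice x = eps/2 minimises x^2 - x * eps, whence the
  exponent eps^2/4.\<close>

lemma count_functions:
 fixes eps :: real
 assumes fin: "finite I" and B: "finite B" "B \<noteq> {}" "T \<subseteq> B" and Z: "Z \<subseteq> I" and eps: "0 < eps" "eps \<le> 1"
 shows "real (card {E \<in> PiE I (%_. B). (real (card T) / card B + eps) * card Z \<le> real (card {z \<in> Z. E z \<in> T})})
  \<le> real (card (PiE I (%_. B))) * exp (- (card Z * eps\<^sup>2 / 4))"
proof -
 define \<mu> where "\<mu> = real (card T) / card B"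
 define x where "x = eps / 2"
 have finZ: "finite Z" using Z fin finite_subset by blast
 have cB: "0 < real (card B)" using B by (simp add: card_gt_0_iff)
 have \<mu>: "0 \<le> \<mu>" "\<mu> \<le> 1" using card_mono[OF B(1,3)] cB by (auto simp: \<mu>_def)
 define f where "f z y = (if z \<in> Z \<and> y \<in> T then exp x else (1::real))" for z y
 let ?X = "{E \<in> PiE I (%_. B). (\<mu> + eps) * card Z \<le> real (card {z \<in> Z. E z \<in> T})}"
 have finP: "finite (PiE I (%_. B))" using fin B(1) by (intro finite_PiE) auto
 have fprod: "(\<Prod>z\<in>I. f z (E z)) = exp (x * real (card {z \<in> Z. E z \<in> T}))" for E
 proof -
  have "(\<Prod>z\<in>I. f z (E z)) = (\<Prod>z\<in>{z \<in> Z. E z \<in> T}. exp x)"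
   unfolding f_def using fin Z by (intro prod.mono_neutral_cong_right) auto
  also have "... = exp x ^ card {z \<in> Z. E z \<in> T}" by simp
  finally show ?thesis by (simp add: exp_of_nat_mult[symmetric] mult.commute)
 qed
 have fsum: "(\<Sum>y\<in>B. f z y) \<le> real (card B) * (if z \<in> Z then exp (\<mu> * (x + x\<^sup>2)) else 1)" for z
 proof (cases "z \<in> Z")
  case True
  have "(\<Sum>y\<in>B. f z y) = (\<Sum>y\<in>B. 1 + (if y \<in> T then exp x - 1 else 0))"
   using True by (intro sum.cong) (auto simp: f_def)
  also have "... = real (card B) + real (card T) * (exp x - 1)"
   using B by (simp add: sum.distrib sum.If_cases Int_absorb1)
  also have "... = real (card B) * (1 + \<mu> * (exp x - 1))" using cB by (simp add: \<mu>_def field_simps)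
  also have "... \<le> real (card B) * (1 + \<mu> * (x + x\<^sup>2))"
   using exp_half_le[of x] eps \<mu> by (intro mult_left_mono add_left_mono) (auto simp: x_def)
  also have "... \<le> real (card B) * exp (\<mu> * (x + x\<^sup>2))" by (intro mult_left_mono exp_ge_add_one_self) auto
  finally show ?thesis using True by simp
 qed (simp add: f_def)
 have "real (card ?X) * exp (x * ((\<mu> + eps) * card Z)) = (\<Sum>E\<in>?X. exp (x * ((\<mu> + eps) * card Z)))" by simp
 also have "... \<le> (\<Sum>E\<in>?X. \<Prod>z\<in>I. f z (E z))"
  unfolding fprod using eps by (intro sum_mono) (auto simp: x_def intro!: mult_left_mono)
 also have "... \<le> (\<Sum>E\<in>PiE I (%_. B). \<Prod>z\<in>I. f z (E z))"
  unfolding fprod using finP by (intro sum_mono2) auto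
 also have "... = (\<Prod>z\<in>I. \<Sum>y\<in>B. f z y)" using fin B(1) by (intro prod_sum_PiE[symmetric]) auto
 also have "... \<le> (\<Prod>z\<in>I. real (card B) * (if z \<in> Z then exp (\<mu> * (x + x\<^sup>2)) else 1))"
  using fsum by (intro prod_mono) (auto intro!: sum_nonneg simp: f_def)
 also have "... = real (card B) ^ card I * exp (\<mu> * (x + x\<^sup>2)) ^ card Z"
  using fin Z by (simp add: prod.distrib prod.If_cases Int_absorb1)
 also have "real (card B) ^ card I = real (card (PiE I (%_. B)))" using fin by (simp add: card_PiE)
 finally have "real (card ?X) * exp (x * ((\<mu> + eps) * card Z)) \<le> real (card (PiE I (%_. B))) * exp (card Z * (\<mu> * (x + x\<^sup>2)))"
  by (simp add: exp_of_nat_mult)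
 then have "real (card ?X) \<le> real (card (PiE I (%_. B))) * exp (card Z * (\<mu> * (x + x\<^sup>2))) / exp (x * ((\<mu> + eps) * card Z))"
  by (simp add: le_divide_eq)
 also have "... = real (card (PiE I (%_. B))) * exp (card Z * (\<mu> * (x + x\<^sup>2)) - x * ((\<mu> + eps) * card Z))" by (simp add: exp_diff)
 also have "... \<le> real (card (PiE I (%_. B))) * exp (- (card Z * eps\<^sup>2 / 4))"
 proof (intro mult_left_mono, subst exp_le_cancel_iff)
  have "\<mu> * x\<^sup>2 \<le> 1 * x\<^sup>2" using \<mu> by (intro mult_right_mono) auto
  then have "\<mu> * (x + x\<^sup>2) - x * (\<mu> + eps) \<le> - (eps\<^sup>2 / 4)" by (simp add: x_def power2_eq_square algebra_simps)
  then have "card Z * (\<mu> * (x + x\<^sup>2) - x * (\<mu> + eps)) \<le> card Z * (- (eps\<^sup>2 / 4))" by (intro mult_left_mono) auto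
  then show "card Z * (\<mu> * (x + x\<^sup>2)) - x * ((\<mu> + eps) * card Z) \<le> - (card Z * eps\<^sup>2 / 4)" by (simp add: algebra_simps)
 qed simp
 finally show ?thesis unfolding \<mu>_def .
qed

text \<open>Union bound over all tests and all sets of K inputs: a function that fails has K bad
  inputs for one test, and together they hit that test too often. As K is eps * 2^k rounded up,
  having fewer than K bad inputs means at most eps * 2^k of them.\<close>

lemma exists_cext:
 fixes eps :: real
 assumes eps: "0 < eps" "eps \<le> 1" and D: "4 * (real n + 1 / eps) < 2 ^ d * eps\<^sup>2"
 shows "\<exists>E. (\<forall>x s. E x s \<in> bits k) \<and> cext n d k (eps * 2 ^ k) eps E"
proof -
 define K where "K = nat \<lceil>eps * 2 ^ k\<rceil>"
 have Kr: "eps * 2 ^ k \<le> real K" "real K < eps * 2 ^ k + 1"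
 proof -
  have "0 \<le> eps * 2 ^ k" using eps by simp
  then show "eps * 2 ^ k \<le> real K" "real K < eps * 2 ^ k + 1" unfolding K_def by linarith+
 qed
 let ?I = "bits n \<times> bits d" let ?B = "bits k"
 let ?P = "PiE ?I (%_. ?B)"
 define badE where "badE A T = {E \<in> ?P. (real (card T) / card ?B + eps) * card (A \<times> bits d) \<le> real (card {z \<in> A \<times> bits d. E z \<in> T})}" for A T
 define \<A> where "\<A> = {A. A \<subseteq> bits n \<and> card A = K}"
 have finA: "finite \<A>" unfolding \<A>_def by (rule finite_subset[of _ "Pow (bits n)"]) auto
 have finP: "finite ?P" by (intro finite_PiE) auto
 have K0: "0 < K" unfolding K_def using eps by (simp add: zero_less_mult_iff)
 have cA: "real (card \<A>) \<le> 2 ^ (n * K)"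
 proof -
  have "\<A> \<subseteq> set ` {xs. set xs \<subseteq> bits n \<and> length xs = K}"
  proof
   fix A assume A: "A \<in> \<A>"
   then have "finite A" unfolding \<A>_def using finite_subset finite_bits by blast
   then obtain xs where "set xs = A" "distinct xs" using finite_distinct_list by blast
   then show "A \<in> set ` {xs. set xs \<subseteq> bits n \<and> length xs = K}"
    using A unfolding \<A>_def by (intro image_eqI[of _ _ xs]) (auto simp: distinct_card)
  qed
  moreover have f: "finite {xs. set xs \<subseteq> bits n \<and> length xs = K}" by (rule finite_lists_length_eq) simp
  ultimately have "card \<A> \<le> card (set ` {xs. set xs \<subseteq> bits n \<and> length xs = K})" by (intro card_mono) auto
  also have "... \<le> card {xs. set xs \<subseteq> bits n \<and> length xs = K}" by (rule card_image_le[OF f])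
  also have "... = 2 ^ (n * K)" by (subst card_lists_length_eq) (auto simp: power_mult)
  finally have "real (card \<A>) \<le> real (2 ^ (n * K))" by (rule of_nat_mono)
  then show ?thesis by simp
 qed
 have bd: "real (card (badE A T)) \<le> real (card ?P) * exp (- (real (K * 2 ^ d) * eps\<^sup>2 / 4))" if "A \<in> \<A>" "T \<in> Pow ?B" for A T
 proof -
  have c: "card (A \<times> bits d) = K * 2 ^ d" using that by (simp add: \<A>_def card_cartesian_product)
  have "A \<times> bits d \<subseteq> ?I" using that by (auto simp: \<A>_def)
  then have "real (card (badE A T)) \<le> real (card ?P) * exp (- (card (A \<times> bits d) * eps\<^sup>2 / 4))"
   unfolding badE_def using that eps by (intro count_functions) auto
  then show ?thesis unfolding c .
 qed
 have "real (card (\<Union>(A, T)\<in>\<A> \<times> Pow ?B. badE A T)) \<le> real (\<Sum>(A, T)\<in>\<A> \<times> Pow ?B. card (badE A T))"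
  using finA by (intro of_nat_mono, unfold split_def, intro card_UN_le) auto
 also have "... = (\<Sum>z\<in>\<A> \<times> Pow ?B. real (card (badE (fst z) (snd z))))" by (simp add: split_def)
 also have "... \<le> (\<Sum>z\<in>\<A> \<times> Pow ?B. real (card ?P) * exp (- (real (K * 2 ^ d) * eps\<^sup>2 / 4)))"
  using bd by (intro sum_mono) auto
 also have "... = real (card \<A>) * 2 ^ (2 ^ k) * (real (card ?P) * exp (- (real (K * 2 ^ d) * eps\<^sup>2 / 4)))"
  by (simp add: card_cartesian_product card_Pow)
 also have "... \<le> 2 ^ (n * K) * 2 ^ (2 ^ k) * (real (card ?P) * exp (- (real (K * 2 ^ d) * eps\<^sup>2 / 4)))"
  using cA by (intro mult_right_mono) auto
 also have "... < real (card ?P)"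
 proof -
  have "2 ^ (n * K) * 2 ^ (2 ^ k) \<le> exp (real (n * K + 2 ^ k))"
  proof -
   have "(2::real) \<le> exp 1" using exp_ge_add_one_self[of 1] by simp
   then have "(2::real) ^ (n * K + 2 ^ k) \<le> exp 1 ^ (n * K + 2 ^ k)" by (intro power_mono) auto
   moreover have "exp 1 ^ N = exp (real N)" for N using exp_of_nat_mult[of N "1::real"] by simp
   ultimately show ?thesis by (simp only: power_add of_nat_add exp_add)
  qed
  moreover have "real (n * K + 2 ^ k) < real (K * 2 ^ d) * eps\<^sup>2 / 4"
  proof -
   have "2 ^ k \<le> real K * (1 / eps)" using Kr(1) eps by (simp add: field_simps)
   then have "real (n * K + 2 ^ k) \<le> real K * (real n + 1 / eps)" by (simp add: algebra_simps)
   also have "... < real K * (2 ^ d * eps\<^sup>2 / 4)" using K0 D by (intro mult_strict_left_mono) auto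
   finally show ?thesis by (simp add: algebra_simps)
  qed
  ultimately have "2 ^ (n * K) * 2 ^ (2 ^ k) < exp (real (K * 2 ^ d) * eps\<^sup>2 / 4)" by (meson exp_less_cancel_iff le_less_trans)
  then have "2 ^ (n * K) * 2 ^ (2 ^ k) * exp (- (real (K * 2 ^ d) * eps\<^sup>2 / 4)) < 1" by (simp add: exp_minus divide_simps)
  moreover have "0 < real (card ?P)" by (simp add: card_PiE)
  ultimately have "real (card ?P) * (2 ^ (n * K) * 2 ^ (2 ^ k) * exp (- (real (K * 2 ^ d) * eps\<^sup>2 / 4))) < real (card ?P) * 1"
   by (intro mult_strict_left_mono)
  then show ?thesis by (simp only: ac_simps mult_1_right)
 qed
 finally have lt: "card (\<Union>(A, T)\<in>\<A> \<times> Pow ?B. badE A T) < card ?P" by simp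
 have "\<not> ?P \<subseteq> (\<Union>(A, T)\<in>\<A> \<times> Pow ?B. badE A T)"
 proof
  assume s: "?P \<subseteq> (\<Union>(A, T)\<in>\<A> \<times> Pow ?B. badE A T)"
  have "finite (\<Union>(A, T)\<in>\<A> \<times> Pow ?B. badE A T)" using finA finP by (auto simp: badE_def)
  then show False using card_mono[OF _ s] lt by simp
 qed
 then obtain F where F: "F \<in> ?P" "\<And>A T. A \<in> \<A> ==> T \<subseteq> ?B ==> F \<notin> badE A T" by blast
 define E where "E x s = (if x \<in> bits n \<and> s \<in> bits d then F (x, s) else replicate k False)" for x s
 have rg: "E x s \<in> bits k" for x s using F(1) by (auto simp: E_def PiE_iff)
 have "cext n d k (eps * 2 ^ k) eps E" unfolding cext_def
 proof (intro allI impI)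
  fix T assume T: "T \<subseteq> ?B"
  let ?X = "bad n d E T (real (card T) / 2 ^ k + eps)"
  have "card ?X < K"
  proof (rule ccontr)
   assume "\<not> ?thesis"
   then obtain A where A: "A \<subseteq> ?X" "card A = K" using obtain_subset_with_card_n[of K ?X] by (metis not_less)
   have AA: "A \<in> \<A>" using A unfolding \<A>_def bad_def by blast
   have finA': "finite A" using A(1) finite_bad finite_subset by blast
   have "{z \<in> A \<times> bits d. F z \<in> T} = Sigma A (%x. {s \<in> bits d. E x s \<in> T})"
    using AA by (auto simp: E_def \<A>_def)
   then have "real (card {z \<in> A \<times> bits d. F z \<in> T}) = (\<Sum>x\<in>A. real (card {s \<in> bits d. E x s \<in> T}))"
    using finA' by (simp add: card_SigmaI del: bits_iff)
   also have "... \<ge> (\<Sum>x\<in>A. (real (card T) / 2 ^ k + eps) * 2 ^ d)"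
   proof (rule sum_mono)
    fix x assume "x \<in> A"
    then have "real (card T) / 2 ^ k + eps < frc (bits d) (%s. E x s \<in> T)" using A(1) unfolding bad_def by blast
    then show "(real (card T) / 2 ^ k + eps) * 2 ^ d \<le> real (card {s \<in> bits d. E x s \<in> T})"
     by (simp add: frc_def less_divide_eq)
   qed
   finally have "(real (card T) / 2 ^ k + eps) * real (card A * 2 ^ d) \<le> real (card {z \<in> A \<times> bits d. F z \<in> T})"
    by (simp add: mult.commute mult.left_commute)
   then have "F \<in> badE A T" using F(1) by (simp add: badE_def card_cartesian_product del: bits_iff)
   then show False using F(2)[OF AA T] by blast
  qed
  then have "real (card ?X) + 1 \<le> real K" by linarith
  then show "real (card ?X) \<le> eps * 2 ^ k" using Kr(2) by linarith
 qed
 then show ?thesis using rg by blast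
qed

section \<open>The construction\<close>

text \<open>
 \<open>pP n\<close> is the size of the prime field, \<open>pb n\<close> the number of bits that fit into a symbol, \<open>pa n\<close> a
 nonresidue, \<open>pq n\<close> the order of the design and \<open>pm n\<close> the resulting seed length of Trevisan's extractor,
 which is polylogarithmic; \<open>pp3\<close>, \<open>pb3\<close>, \<open>pq3\<close> are the same data for the inner extractor \<open>sml\<close> that
 produces such seeds. For min-entropy \<open>kp\<close>, a row has \<open>rR n kp\<close> symbols, consecutive cuts are \<open>rg n kp\<close>
 apart and \<open>rv n kp\<close> is the length of the suffix cut off the merged string. The error is \<open>O(1 / log\<^sup>c n)\<close>.
\<close>

definition lg :: "nat => nat" where "lg n = (LEAST i. n < 2 ^ Suc i)"
definition crt :: "nat => nat" where "crt l = (LEAST i. l < Suc i ^ 3)"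
definition pP :: "nat => nat" where "pP n = nprime (n ^ 4)"
definition pb :: "nat => nat" where "pb n = lg (pP n)"
text \<open>The disjunct \<open>pP n = 2\<close> keeps \<open>LEAST\<close> defined where there is
  no nonresidue.\<close>

definition pa :: "nat => nat" where "pa n = (LEAST a. pP n = 2 \<or> nonres (pP n) a)"
definition pq :: "nat => nat" where "pq n = nprime (2 * (pb n + 1) * lg n)"
definition pm :: "nat => nat" where "pm n = (pb n + (pb n + 1)) * pq n"
text \<open>Twice the bound that the distance condition of \<open>cext_tre\<close> puts on 2^b for
  source length 2 * (pb n + 1) * pm n, pm n output bits and error 1 / lg^c; the 2 allows for
  rounding the field size down to a power of two.\<close>

definition pY :: "nat => nat => nat" where "pY c n = 2 * (pb n + 1) * pm n ^ 3 * (lg n ^ c) ^ 2"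
definition pp3 :: "nat => nat => nat" where "pp3 c n = nprime (pY c n)"
definition pb3 :: "nat => nat => nat" where "pb3 c n = lg (pp3 c n)"
definition pq3 :: "nat => nat => nat" where "pq3 c n = nprime (pb3 c n + (pb3 c n + 1))"

text \<open>Condensing first makes the length polylogarithmic, whatever the length of
  \<open>v\<close>. The code of the inner extractor then has symbols of O(log log n) bits, and its
  seed stays below log n.\<close>

definition sml :: "nat => nat => bool list => bool list => bool list" where
 "sml c n v s = tre (pp3 c n) (pb3 c n) (pb3 c n + 1) (pq3 c n) (pm n)
   (pv (pP n) (pa n) (pb n) (pb n + 1) (pm n) v (take (2 * pb n) s)) (drop (2 * pb n) s)"

definition sd :: "nat => nat => nat" where
 "sd c n = 2 * pb n + (pb3 c n + (pb3 c n + 1)) * pq3 c n"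

text \<open>The subtracted share 1/\<lambda>^2 pays for the spacing of the cuts, the design and the
  inner seed.\<close>

definition rR :: "nat => nat => nat" where
 "rR n kp = kp div (pb n + 1) - kp div (pb n + 1) div (crt (lg n)) ^ 2"

definition rg :: "nat => nat => nat" where
 "rg n kp = kp div (pb n + 1) * (2 * (pb n + 1)) div lg n + 1"

text \<open>Merging loses \<lambda> bits per symbol, and all of this loss may fall on the suffix;
  the next summand is the entropy needed for an inner seed, and 2 is slack.\<close>

definition rv :: "nat => nat => nat" where
 "rv n kp = rR n kp * crt (lg n) + (pb n + 1) * pm n + 2"

definition cnd :: "nat => nat => nat => bool list => bool list => bool list" where
 "cnd c n kp x s = merge (pP n) (pb n) (pb n + 1) (lg n) (rR n kp)
   (%i. blk (i * rg n kp) (tre (pP n) (pb n) (pb n + 1) (pq n) (rR n kp * pb n)) (sml c n) x (take (sd c n) s)) (drop (sd c n) s)"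

definition cnd2 :: "nat => nat => nat => bool list => bool list => bool list" where
 "cnd2 c n kp x s = cnd c n kp (pv (pP n) (pa n) (pb n) (pb n + 1) (kp div (pb n + 1)) x (take (2 * pb n) s)) (drop (2 * pb n) s)"

definition cd :: "nat => nat => nat" where
 "cd c n = 2 * pb n + (sd c n + pb n)"

definition rnd :: "nat => nat => nat => nat => bool list => bool list => bool list" where
 "rnd c n kp mo x s = blk (rR n kp * (pb n + 1) - rv n kp) (tre (pP n) (pb n) (pb n + 1) (pq n) mo) (sml c n)
   (cnd2 c n kp x (take (cd c n) s)) (drop (cd c n) s)"

definition rd :: "nat => nat => nat" where
 "rd c n = cd c n + sd c n"

fun pext :: "nat => nat => nat => nat => bool list => bool list => bool list" where
 "pext c n 0 kp x s = []"
| "pext c n (Suc r) kp x s = rnd c n kp (kp - kp div crt (lg n)) x (take (rd c n) s) @ pext c n r (kp div crt (lg n)) x (drop (rd c n) s)"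

lemma lg_bounds: "0 < n ==> 2 ^ lg n \<le> n" "n < 2 ^ (lg n + 1)"
proof -
 have "n < 2 ^ Suc n" using less_exp[of "Suc n"] by linarith
 then show 1: "n < 2 ^ (lg n + 1)" unfolding lg_def using LeastI[of "%i. n < 2 ^ Suc i" n] by simp
 assume n: "0 < n"
 show "2 ^ lg n \<le> n"
 proof (cases "lg n")
  case (Suc i)
  then have "\<not> n < 2 ^ Suc i" using not_less_Least[of i "%i. n < 2 ^ Suc i"] unfolding lg_def by simp
  then show ?thesis using Suc by simp
 qed (use n in simp)
qed

lemma lg_le: "lg n \<le> n"
proof (cases "n = 0")
 case True
 then show ?thesis by (auto simp: lg_def intro: Least_le)
next
 case False
 then show ?thesis using lg_bounds(1)[of n] less_exp[of "lg n"] by linarith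
qed

lemma crt_bounds: "crt l ^ 3 \<le> l" "l < (crt l + 1) ^ 3"
proof -
 have "l < Suc l ^ 3" using self_le_power[of "Suc l" 3] by simp
 then show "l < (crt l + 1) ^ 3" unfolding crt_def using LeastI[of "%i. l < Suc i ^ 3" l] by simp
 show "crt l ^ 3 \<le> l"
 proof (cases "crt l")
  case (Suc i)
  then have "\<not> l < Suc i ^ 3" using not_less_Least[of i "%i. l < Suc i ^ 3"] unfolding crt_def by simp
  then show ?thesis using Suc by simp
 qed simp
qed

lemma pP: "prime (pP n)" "n ^ 4 \<le> pP n" "pP n \<le> 2 * (n ^ 4)\<^sup>2 + 7" "1 < pP n"
 using nprime[of "n ^ 4"] prime_gt_1_nat by (auto simp: pP_def)

lemma pb: "2 ^ pb n \<le> pP n" "pP n < 2 ^ (pb n + 1)"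
 using lg_bounds[of "pP n"] pP(4)[of n] by (auto simp: pb_def)

text \<open>1 and p - 1 have the same square, so squaring is not onto modulo an odd prime.\<close>

lemma exists_nonres:
 assumes "prime p" "p \<noteq> 2"
 shows "\<exists>a<p. nonres p a"
proof (rule ccontr)
 assume n: "\<not> ?thesis"
 have p: "2 < p" using assms prime_ge_2_nat[of p] by linarith
 let ?f = "%b. b * b mod p"
 have "{..<p} \<subseteq> ?f ` ({..<p} - {p - 1})"
 proof
  fix a assume "a \<in> {..<p}"
  then have a: "a < p" by simp
  then obtain b :: int where b: "int p dvd b\<^sup>2 - int a" using n unfolding nonres_def by blast
  define c where "c = nat (b mod int p)"
  have c: "int c = b mod int p" "c < p" using p by (auto simp: c_def nat_less_iff)
  have ba: "b * b mod int p = int a mod int p" using b by (simp add: power2_eq_square mod_eq_dvd_iff)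
  have ca: "int c * int c mod int p = int a mod int p" unfolding c(1) using ba by (simp add: mod_simps)
  then have "int (c * c mod p) = int (a mod p)" by (simp add: zmod_int)
  then have fc: "?f c = a" using a by simp
  show "a \<in> ?f ` ({..<p} - {p - 1})"
  proof (cases "c = p - 1")
   case False
   then show ?thesis using fc c(2) by (intro image_eqI[of _ _ c]) auto
  next
   case True
   obtain m where m: "p = m + 2" using p le_Suc_ex[of 2 p] by (auto simp: add.commute)
   have "?f (p - 1) = (m * p + 1) mod p" by (simp add: m algebra_simps)
   also have "... = 1" unfolding mod_mult_self3 using p by simp
   finally have "?f (p - 1) = 1" .
   then have "a = 1" using fc True by simp
   then show ?thesis using p by (intro image_eqI[of _ _ 1]) auto
  qed
 qed
 then have "card {..<p} \<le> card (?f ` ({..<p} - {p - 1}))" by (intro card_mono) auto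
 also have "... \<le> card ({..<p} - {p - 1})" by (intro card_image_le) auto
 also have "... < card {..<p}" using p by (simp add: card_Diff_singleton)
 finally show False by simp
qed

text \<open>Bounded quantification makes the condition available to the expression language
  below.\<close>

lemma nonres_iff:
 assumes "0 < p"
 shows "nonres p a \<longleftrightarrow> (\<forall>b<p. b * b mod p \<noteq> a mod p)"
proof
 assume r: "nonres p a"
 show "\<forall>b<p. b * b mod p \<noteq> a mod p"
 proof (intro allI impI notI)
  fix b assume "b * b mod p = a mod p"
  then have "int (b * b mod p) = int (a mod p)" by (simp only:)
  then have "int b * int b mod int p = int a mod int p" by (simp only: zmod_int of_nat_mult)
  then have "int p dvd (int b)\<^sup>2 - int a" by (simp add: power2_eq_square mod_eq_dvd_iff)
  then show False using r unfolding nonres_def by blast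
 qed
next
 assume r: "\<forall>b<p. b * b mod p \<noteq> a mod p"
 show "nonres p a" unfolding nonres_def
 proof (intro allI notI)
  fix b :: int assume "int p dvd b\<^sup>2 - int a"
  then have ba: "b * b mod int p = int a mod int p" by (simp add: power2_eq_square mod_eq_dvd_iff)
  define c where "c = nat (b mod int p)"
  have c: "int c = b mod int p" "c < p" using assms by (auto simp: c_def nat_less_iff)
  have "int c * int c mod int p = int a mod int p" unfolding c(1) using ba by (simp add: mod_simps)
  then have "int (c * c mod p) = int (a mod p)" by (simp add: zmod_int)
  then show False using r c(2) by auto
 qed
qed

lemma pa: "pP n \<noteq> 2 ==> nonres (pP n) (pa n)"
proof -
 assume p: "pP n \<noteq> 2"
 then obtain a where "nonres (pP n) a" using exists_nonres[OF pP(1)] by blast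
 then have "pP n = 2 \<or> nonres (pP n) (pa n)" unfolding pa_def using LeastI[of "%a. pP n = 2 \<or> nonres (pP n) a" a] by blast
 then show ?thesis using p by blast
qed

subsection \<open>Parameters\<close>

lemma one_plus_inverse_power: "0 < q ==> (1 + 1 / real q) ^ k \<le> exp (real k / real q)"
proof -
 assume "0 < q"
 have "(1 + 1 / real q) ^ k \<le> exp (1 / real q) ^ k" by (intro power_mono exp_ge_add_one_self) auto
 then show ?thesis by (simp add: exp_of_nat_mult[symmetric])
qed

text \<open>What is required of large \<open>n\<close>. The exponent 564 + 48 * c is 12 * (47 + 4 *
  c), twelve times the exponent in \<open>pp3_le\<close>, as \<open>b3_le\<close> needs.\<close>

locale big =
 fixes n c :: nat
 assumes lam: "1000 \<le> crt (lg n)" and pw: "lg n ^ (564 + 48 * c) \<le> 2 ^ crt (lg n)"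
begin

abbreviation "l \<equiv> lg n"
abbreviation "lm \<equiv> crt (lg n)"
abbreviation "b \<equiv> pb n"
abbreviation "w \<equiv> pb n + 1"
abbreviation "P \<equiv> pP n"
abbreviation "e \<equiv> lg n ^ c"
abbreviation "q \<equiv> pq n"

lemma lam3: "lm ^ 3 \<le> l" by (rule crt_bounds)

lemma lam2: "lm ^ 2 \<le> l"
proof -
 have "lm ^ 2 \<le> lm ^ 3" using lam by (intro power_increasing) auto
 then show ?thesis using lam3 by linarith
qed

lemma lam1: "lm \<le> l"
 using self_le_power[of lm 3] lam lam3 by simp

lemma l1000: "1000 \<le> l" using lam lam1 by linarith

lemma n0: "0 < n"
proof (rule ccontr)
 assume "\<not> ?thesis"
 then have "l = 0" using lg_le[of n] by simp
 then show False using l1000 by simp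
qed

lemma n_ge: "2 ^ l \<le> n" using lg_bounds(1)[OF n0] .

lemma pw_le: "k \<le> 564 + 48 * c ==> l ^ k \<le> 2 ^ lm"
 using power_increasing[of k "564 + 48 * c" l] l1000 pw by (meson le_trans less_le_trans numeral_One one_le_numeral order_refl)

lemma lam_n: "2 ^ lm \<le> n"
 using power_increasing[OF lam1, of "2::nat"] n_ge by linarith

lemma pw_n: "k \<le> 564 + 48 * c ==> l ^ k \<le> n"
 using pw_le lam_n le_trans by blast

lemma e1: "1 \<le> e" using l1000 by simp

lemma b_ge: "4 * l \<le> b"
proof -
 have "(2::nat) ^ (4 * l) = (2 ^ l) ^ 4" by (simp add: power_mult[symmetric] mult.commute)
 also have "... \<le> n ^ 4" by (intro power_mono n_ge) simp
 also have "... < 2 ^ (b + 1)" using pP(2)[of n] pb(2)[of n] by linarith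
 finally have "4 * l < b + 1" by (rule power_less_imp_less_exp[rotated]) simp
 then show ?thesis by simp
qed

lemma w_le: "w \<le> 9 * l"
proof -
 have "n ^ 8 \<le> (2 ^ (l + 1)) ^ 8" using lg_bounds(2)[of n] by (intro power_mono) auto
 also have "... = 2 ^ (8 * l + 8)"
 proof -
  have k: "8 * l + 8 = (l + 1) * 8" by simp
  show ?thesis unfolding k power_mult ..
 qed
 finally have n8: "n ^ 8 \<le> 2 ^ (8 * l + 8)" .
 have "2 ^ b \<le> P" by (rule pb)
 also have "... \<le> 2 * n ^ 8 + 7" using pP(3)[of n] by (simp add: power_mult[symmetric])
 also have "... \<le> 2 * 2 ^ (8 * l + 8) + 7" using n8 by simp
 also have "... < 2 ^ (8 * l + 10)"
 proof -
  have "(1::nat) \<le> 2 ^ (8 * l)" by simp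
  moreover have "(2::nat) ^ (8 * l + 8) = 256 * 2 ^ (8 * l)" "(2::nat) ^ (8 * l + 10) = 1024 * 2 ^ (8 * l)" by (simp_all add: power_add)
  ultimately show ?thesis by linarith
 qed
 finally have "b < 8 * l + 10" by (rule power_less_imp_less_exp[rotated]) simp
 then show ?thesis using l1000 by simp
qed

lemma q_ge: "2 * w * l \<le> q" "prime q" using nprime[of "2 * w * l"] by (auto simp: pq_def)

lemma q_le: "q \<le> l ^ 5"
proof -
 have "q \<le> 2 * (2 * w * l)\<^sup>2 + 7" unfolding pq_def by (rule nprime)
 also have "... \<le> 2 * (2 * (9 * l) * l)\<^sup>2 + 7" using w_le by (intro add_mono mult_left_mono power_mono mult_mono) auto
 also have "... = 648 * l ^ 4 + 7" by (simp add: power2_eq_square power4_eq_xxxx)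
 also have "... \<le> 1000 * l ^ 4"
 proof -
  have "1 \<le> l ^ 4" using l1000 by simp
  then show ?thesis by linarith
 qed
 also have "... \<le> l * l ^ 4" using l1000 by (intro mult_right_mono) auto
 finally show ?thesis by (simp add: numeral_eq_Suc)
qed

lemma pm_le: "pm n \<le> l ^ 7"
proof -
 have "b + (b + 1) \<le> 18 * l" using w_le by linarith
 then have "pm n \<le> 18 * l * l ^ 5" unfolding pm_def by (intro mult_mono q_le) auto
 also have "... \<le> l * l * l ^ 5" using l1000 by (intro mult_right_mono) auto
 finally show ?thesis by (simp add: numeral_eq_Suc)
qed

lemma pm_ge: "l \<le> pm n"
proof -
 have "l \<le> (b + (b + 1)) * 1" using b_ge by simp
 also have "... \<le> pm n" unfolding pm_def using prime_gt_0_nat[OF q_ge(2)] by (intro mult_left_mono) auto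
 finally show ?thesis .
qed

lemma wpm: "w * pm n \<le> l ^ 9"
proof -
 have "w * pm n \<le> 9 * l * l ^ 7" by (intro mult_mono w_le pm_le) auto
 also have "... \<le> l * l * l ^ 7" using l1000 by (intro mult_right_mono) auto
 finally show ?thesis by (simp add: numeral_eq_Suc)
qed

lemma pY_le: "pY c n \<le> l ^ (23 + 2 * c)"
proof -
 have "pY c n \<le> 2 * (9 * l) * (l ^ 7) ^ 3 * e ^ 2" unfolding pY_def
  by (intro mult_mono power_mono w_le pm_le order_refl) auto
 also have "... \<le> l * l * (l ^ 7) ^ 3 * e ^ 2" using l1000 by (intro mult_right_mono) auto
 also have "... = l ^ (1 + 1 + 21 + 2 * c)" by (simp only: power_add power_mult[symmetric] power_one_right) (simp add: mult.commute)
 finally show ?thesis by simp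
qed

lemma pp3_le: "pp3 c n \<le> l ^ (47 + 4 * c)"
proof -
 have "pp3 c n \<le> 2 * (pY c n)\<^sup>2 + 7" unfolding pp3_def by (rule nprime)
 also have "... \<le> 2 * (l ^ (23 + 2 * c))\<^sup>2 + 7" by (intro add_mono mult_left_mono power_mono pY_le) auto
 also have "... \<le> 9 * (l ^ (23 + 2 * c))\<^sup>2" using l1000 by simp
 also have "... \<le> l * (l ^ (23 + 2 * c))\<^sup>2" using l1000 by (intro mult_right_mono) auto
 also have "... = l ^ (1 + (23 + 2 * c) * 2)" by (simp only: power_add power_mult power_one_right)
 finally show ?thesis by (simp add: algebra_simps)
qed

lemma b3_le: "12 * pb3 c n \<le> lm"
proof -
 have "0 < pp3 c n" unfolding pp3_def using nprime(1) prime_gt_0_nat by blast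
 then have "2 ^ pb3 c n \<le> pp3 c n" unfolding pb3_def by (rule lg_bounds)
 then have "(2 ^ pb3 c n) ^ 12 \<le> (l ^ (47 + 4 * c)) ^ 12" using pp3_le by (intro power_mono) (auto intro: order_trans)
 also have "... = l ^ (564 + 48 * c)" by (simp add: power_mult[symmetric] algebra_simps)
 also have "... \<le> 2 ^ lm" by (rule pw)
 finally have "(2::nat) ^ (12 * pb3 c n) \<le> 2 ^ lm" by (simp add: power_mult[symmetric] mult.commute)
 then show ?thesis by (rule power_le_imp_le_exp[rotated]) simp
qed

lemma q3: "prime (pq3 c n)" "pb3 c n + (pb3 c n + 1) \<le> pq3 c n" unfolding pq3_def by (rule nprime)+

text \<open>For code positions of u bits the design prime is at most 2u^2 + 7, so the seed is cubic
  in u = O(log log n). It fits because \<lambda> is at least 3u and \<lambda>^3 is at most log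
  n.\<close>

lemma seed3: "(pb3 c n + (pb3 c n + 1)) * pq3 c n \<le> l"
proof -
 let ?u = "pb3 c n + (pb3 c n + 1)"
 have "pq3 c n \<le> 2 * ?u\<^sup>2 + 7" unfolding pq3_def by (rule nprime)
 also have "... \<le> 9 * ?u\<^sup>2"
 proof -
  have "1 \<le> ?u\<^sup>2" by simp
  then show ?thesis by linarith
 qed
 finally have "?u * pq3 c n \<le> ?u * (9 * ?u\<^sup>2)" by (rule mult_left_mono) simp
 also have "... \<le> (3 * ?u) ^ 3"
 proof -
  have "u * (9 * u\<^sup>2) \<le> (3 * u) ^ 3" for u :: nat by (simp add: power2_eq_square power3_eq_cube)
  then show ?thesis .
 qed
 also have "... \<le> lm ^ 3" using b3_le lam by (intro power_mono) auto
 finally show ?thesis using lam3 by linarith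
qed

lemma rd_le: "rd c n \<le> 65 * l"
 unfolding rd_def cd_def sd_def using seed3 w_le by linarith

lemma n_big: "8 * e ^ 2 * l ^ 8 \<le> n" "pm n * e \<le> n" "e \<le> n" "8 \<le> n" "pm n \<le> n"
proof -
 have "8 * e ^ 2 * l ^ 8 \<le> l * e ^ 2 * l ^ 8" using l1000 by (intro mult_right_mono) auto
 also have "... = l ^ (1 + 2 * c + 8)" by (simp only: power_add power_mult[symmetric] power_one_right) (simp add: mult.commute)
 also have "... \<le> n" by (rule pw_n) simp
 finally show "8 * e ^ 2 * l ^ 8 \<le> n" .
 have "pm n * e \<le> l ^ 7 * e" by (intro mult_right_mono pm_le) simp
 also have "... = l ^ (7 + c)" by (simp only: power_add)
 also have "... \<le> n" by (rule pw_n) simp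
 finally show "pm n * e \<le> n" .
 show "e \<le> n" by (rule pw_n) simp
 have "l ^ 1 \<le> n" by (rule pw_n) simp
 then show "8 \<le> n" using l1000 by simp
 show "pm n \<le> n" using pm_le pw_n[of 7] by simp
qed

lemma P_big: "n \<le> P" "2 * n \<le> P" "P \<noteq> 2" "n ^ 4 \<le> 2 * 2 ^ b" "16 \<le> P"
proof -
 have "2 * n \<le> n * n" using n_big(4) by simp
 also have "... \<le> n ^ 4" using power_increasing[of 2 4 n] n0 by (simp add: power2_eq_square)
 also have "... \<le> P" by (rule pP)
 finally show "2 * n \<le> P" .
 then show "n \<le> P" "P \<noteq> 2" "16 \<le> P" using n_big(4) by auto
 show "n ^ 4 \<le> 2 * 2 ^ b" using pP(2)[of n] pb(2)[of n] by simp
qed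

lemma nat_le_real: "a \<le> d ==> real a \<le> real d" by simp

text \<open>The field size n^4 originates here: the 2^(2b) evaluation points reached by the seed
  must outnumber the degree bound N * P * m by the factor \<open>e\<close>.\<close>

lemma pv_cond:
 assumes N: "0 < N" "N \<le> 2 * n" and m: "0 < m" "m \<le> n" and K: "2 * K' < real P ^ m"
 shows "ccond N (2 * b) (m * (2 * w)) K' (real P ^ m) (1 / e) (pv P (pa n) b w m)"
proof (rule ccond_pv[OF pP(1) pa[OF P_big(3)] N(1) _ m(1) _ _ _ K])
 show "N \<le> P" using N P_big(2) by linarith
 show "2 ^ b \<le> P" "P \<le> 2 ^ w" using pb[of n] by auto
 have "N * P * m * e \<le> (2 * n) * (2 * 2 ^ b) * n * n"
  using N m n_big(3) pb(2)[of n] by (intro mult_mono) auto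
 also have "... = 4 * n ^ 3 * 2 ^ b" by (simp add: power3_eq_cube)
 also have "... \<le> 2 ^ b * 2 ^ b"
 proof (rule mult_right_mono)
  have "8 * n ^ 3 \<le> n * n ^ 3" using n_big(4) by (intro mult_right_mono) auto
  also have "... = n ^ 4" by (simp add: numeral_eq_Suc)
  finally show "4 * n ^ 3 \<le> 2 ^ b" using P_big(4) by linarith
 qed simp
 finally have "N * P * m * e \<le> 2 ^ (2 * b)" by (simp add: power_mult power2_eq_square mult_2 power_add)
 then have "real (N * P * m * e) \<le> real (2 ^ (2 * b))" by (rule nat_le_real)
 then have 1: "real (N * P * m) * real e \<le> 2 ^ (2 * b)" by simp
 have "0 < real e" using e1 l1000 by simp
 then show "real (N * P * m) \<le> 1 / real e * 2 ^ (2 * b)"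
  unfolding times_divide_eq_left mult_1_left by (subst pos_le_divide_eq) (assumption, rule 1)
qed

lemma sml_cext:
 assumes N: "0 < N" "N \<le> 2 * n"
 shows "cext N (sd c n) (pm n) (real P ^ pm n) (2 / e) (sml c n)"
proof -
 let ?m = "pm n" let ?p = "pp3 c n" let ?b = "pb3 c n" let ?q = "pq3 c n"
 let ?K = "?m * 2 powr (3 * real ?m) * (1 / (2 * (1 / e / ?m)\<^sup>2))"
 have m0: "0 < ?m" using pm_ge l1000 by linarith
 have p: "prime ?p" "pY c n \<le> ?p" unfolding pp3_def by (rule nprime)+
 have b3: "2 ^ ?b \<le> ?p" "?p < 2 ^ (?b + 1)" unfolding pb3_def using lg_bounds prime_gt_0_nat[OF p(1)] by auto
 have e0: "0 < real e" using e1 l1000 by simp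
 have E: "cext (?m * (2 * w)) ((?b + (?b + 1)) * ?q) ?m ?K (1 / e) (tre ?p ?b (?b + 1) ?q ?m)"
 proof (rule cext_tre[OF p(1) b3(1) _ q3 m0])
  show "?p \<le> 2 ^ (?b + 1)" using b3(2) by simp
  show "0 < 1 / real e" using e0 by simp
  have "pY c n < 2 * 2 ^ ?b" using p(2) b3(2) by simp
  then have "w * ?m ^ 3 * e\<^sup>2 \<le> 2 ^ ?b" unfolding pY_def by linarith
  then have "real (w * ?m ^ 3 * e\<^sup>2) \<le> real (2 ^ ?b)" by (rule nat_le_real)
  then have 1: "real w * real ?m ^ 3 * (real e)\<^sup>2 \<le> 2 ^ ?b" by (simp only: of_nat_mult of_nat_power of_nat_numeral)
  have "real (?m * (2 * w)) * ((real e)\<^sup>2 * (real ?m)\<^sup>2) = 2 * (real w * real ?m ^ 3 * (real e)\<^sup>2)"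
   by (simp only: of_nat_mult of_nat_numeral power2_eq_square power3_eq_cube) (simp only: ac_simps)
  also have "... \<le> 2 * 2 ^ ?b" using 1 by simp
  finally have "real (?m * (2 * w)) * ((real e)\<^sup>2 * (real ?m)\<^sup>2) \<le> 2 * 2 ^ ?b" .
  then have "real (?m * (2 * w)) / 2 ^ ?b \<le> 2 / ((real e)\<^sup>2 * (real ?m)\<^sup>2)"
   using e0 m0 by (subst pos_divide_le_eq, simp, subst times_divide_eq_left, subst pos_le_divide_eq) auto
  then show "real (?m * (2 * w)) / 2 ^ ?b \<le> 2 * (1 / real e / real ?m)\<^sup>2"
   by (simp only: power_divide power_one divide_divide_eq_left times_divide_eq_right mult_1_right power_mult_distrib)
  have "(1 + 1 / real ?q) ^ (?b + (?b + 1)) \<le> exp (real (?b + (?b + 1)) / real ?q)"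
   by (rule one_plus_inverse_power) (use prime_gt_0_nat[OF q3(1)] in simp)
  also have "... \<le> exp 1"
  proof (subst exp_le_cancel_iff, subst divide_le_eq_1_pos)
   show "0 < real ?q" using prime_gt_0_nat[OF q3(1)] by simp
   show "real (?b + (?b + 1)) \<le> real ?q" using q3(2) by (rule nat_le_real)
  qed
  also have "... \<le> 3" by (rule exp_le)
  finally show "(1 + 1 / real ?q) ^ (?b + (?b + 1)) \<le> 3" .
 qed
 \<comment> \<open>The inner extractor needs little more than 3 * pm bits of entropy and the
   condenser supplies pm * log P, so the crude overlap factor 3 of the inner design does no
   harm.\<close>
 have K: "2 * ?K < real P ^ ?m"
 proof -
  have "?m ^ 3 * e\<^sup>2 \<le> (l ^ 7) ^ 3 * e\<^sup>2" by (intro mult_right_mono power_mono pm_le) auto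
  also have "... = l ^ (21 + 2 * c)" by (simp only: power_add power_mult[symmetric]) (simp add: mult.commute)
  also have "... \<le> 2 ^ lm" by (rule pw_le) simp
  also have "... \<le> 2 ^ l" using lam1 by simp
  also have "... < 2 ^ (?m + 1)" using pm_ge by (intro power_strict_increasing) auto
  finally have "real (?m ^ 3 * e\<^sup>2) < real (2 ^ (?m + 1))" by (simp only: of_nat_less_iff)
  then have 1: "real ?m ^ 3 * (real e)\<^sup>2 < 2 * 2 ^ ?m" by simp
  have "2 powr (3 * real ?m) = 2 powr (real (3 * ?m))" by simp
  also have "... = 2 ^ (3 * ?m)" by (rule powr_realpow) simp
  finally have pp: "2 powr (3 * real ?m) = (8::real) ^ ?m" by (simp add: power_mult)
  have "2 * ?K = (real ?m ^ 3 * (real e)\<^sup>2) * 8 ^ ?m"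
   unfolding pp using e0 m0 by (simp add: power_divide power2_eq_square power3_eq_cube)
  also have "... \<le> (real ?m ^ 3 * (real e)\<^sup>2) * 8 ^ ?m" by simp
  also have "... < (2 * 2 ^ ?m) * 8 ^ ?m" using 1 by (intro mult_strict_right_mono) auto
  also have "... = 2 * 16 ^ ?m" by (simp add: power_mult_distrib[symmetric])
  also have "... \<le> 2 ^ ?m * 16 ^ ?m"
   using power_increasing[of 1 ?m "2::real"] m0 by (intro mult_right_mono) auto
  also have "... = 32 ^ ?m" by (simp add: power_mult_distrib[symmetric])
  also have "... \<le> real P ^ ?m"
  proof (intro power_mono)
   have "2 * 16 \<le> 2 * n" "16 \<le> n" using pw_n[of 1] l1000 by auto
   then show "32 \<le> real P" using P_big(2) by simp
  qed simp
  finally show ?thesis .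
 qed
 have C: "ccond N (2 * b) (?m * (2 * w)) ?K (real P ^ ?m) (1 / e) (pv P (pa n) b w ?m)"
  by (rule pv_cond[OF N m0 n_big(5) K])
 have "cext N (2 * b + (?b + (?b + 1)) * ?q) ?m (real P ^ ?m) (1 / e + 1 / e)
   (%x s. tre ?p ?b (?b + 1) ?q ?m (pv P (pa n) b w ?m x (take (2 * b) s)) (drop (2 * b) s))"
  by (rule cext_ccond[OF C E]) (use e0 in auto)
 then show ?thesis unfolding sd_def sml_def[abs_def] by simp
qed

text \<open>A design prime of at least 2 * w * l brings the overlap factor down to 1 + 2/l; the
  additional w bits cover the length of the list and the number of output positions.\<close>

lemma tre_cext:
 assumes N: "N \<le> 2 * n" and m: "0 < m" "m \<le> n"
 shows "cext N (pm n) m (2 powr ((1 + 2 / l) * m + w)) (1 / e) (tre P b w q m)"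
proof -
 let ?\<rho> = "1 + 2 / real l"
 have e0: "0 < real e" using e1 l1000 by simp
 have q0: "0 < q" using prime_gt_0_nat[OF q_ge(2)] .
 have "cext N ((b + w) * q) m (m * 2 powr (?\<rho> * m) * (1 / (2 * (1 / e / m)\<^sup>2))) (1 / e) (tre P b w q m)"
 proof (rule cext_tre[OF pP(1) pb(1) _ q_ge(2) _ m(1)])
  show "P \<le> 2 ^ w" using pb(2)[of n] by simp
  have "b + w \<le> 2 * w * 1" by simp
  also have "... \<le> 2 * w * l" using l1000 by (intro mult_left_mono) auto
  finally show "b + w \<le> q" using q_ge(1) by simp
  show "0 < 1 / real e" using e0 by simp
  have "N * (e\<^sup>2 * m\<^sup>2) \<le> 2 * n * (e\<^sup>2 * n\<^sup>2)" by (intro mult_mono power_mono N m) auto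
  also have "... = 2 * e\<^sup>2 * n ^ 3" by (simp only: power2_eq_square power3_eq_cube ac_simps)
  also have "... \<le> n * n ^ 3"
  proof (rule mult_right_mono)
   have "2 * e\<^sup>2 * 1 \<le> 8 * e\<^sup>2 * l ^ 8" using l1000 by (intro mult_mono) auto
   then show "2 * e\<^sup>2 \<le> n" using n_big(1) by linarith
  qed simp
  also have "... = n ^ 4" by (simp add: numeral_eq_Suc)
  finally have "N * (e\<^sup>2 * m\<^sup>2) \<le> 2 * 2 ^ b" using P_big(4) by simp
  then have "real (N * (e\<^sup>2 * m\<^sup>2)) \<le> real (2 * 2 ^ b)" by (rule nat_le_real)
  then have "real N * ((real e)\<^sup>2 * (real m)\<^sup>2) \<le> 2 * 2 ^ b" by simp
  then have "real N / 2 ^ b \<le> 2 / ((real e)\<^sup>2 * (real m)\<^sup>2)"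
   using e0 m by (subst pos_divide_le_eq, simp, subst times_divide_eq_left, subst pos_le_divide_eq) auto
  then show "real N / 2 ^ b \<le> 2 * (1 / real e / real m)\<^sup>2"
   by (simp only: power_divide power_one divide_divide_eq_left times_divide_eq_right mult_1_right power_mult_distrib)
  have l0: "0 < real l" using l1000 by simp
  have "(1 + 1 / real q) ^ (b + w) \<le> exp (real (b + w) / real q)" by (rule one_plus_inverse_power[OF q0])
  also have "... \<le> exp (1 / real l)"
  proof (subst exp_le_cancel_iff)
   have "(b + w) * l \<le> 2 * w * l" by (intro mult_right_mono) auto
   then have "(b + w) * l \<le> q" using q_ge(1) by linarith
   then have "real (b + w) * real l \<le> real q" using nat_le_real by (metis of_nat_mult)
   then show "real (b + w) / real q \<le> 1 / real l" using l0 q0 by (simp add: field_simps)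
  qed
  also have "... \<le> 1 + 1 / real l + (1 / real l)\<^sup>2" by (rule exp_bound) (use l1000 in auto)
  also have "... \<le> 1 + 2 / real l"
  proof -
   have "1 / real l \<le> 1" using l1000 by simp
   then have "(1 / real l) * (1 / real l) \<le> 1 * (1 / real l)" by (intro mult_right_mono) auto
   then show ?thesis by (simp add: power2_eq_square)
  qed
  finally show "(1 + 1 / real q) ^ (b + w) \<le> 1 + 2 / real l" .
 qed
 moreover have "m * 2 powr (?\<rho> * m) * (1 / (2 * (1 / e / m)\<^sup>2)) \<le> 2 powr (?\<rho> * m + w)"
 proof -
  have "m ^ 3 * e\<^sup>2 \<le> n ^ 3 * n"
  proof (intro mult_mono power_mono m)
   have "e\<^sup>2 * 1 \<le> 8 * e\<^sup>2 * l ^ 8" using l1000 by (intro mult_mono) auto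
   then show "e\<^sup>2 \<le> n" using n_big(1) by linarith
  qed auto
  also have "... = n ^ 4" by (simp add: numeral_eq_Suc)
  also have "... \<le> 2 ^ w" using P_big(4) by simp
  finally have "real (m ^ 3 * e\<^sup>2) \<le> real (2 ^ w)" by (rule nat_le_real)
  then have "real m ^ 3 * (real e)\<^sup>2 \<le> 2 ^ w" by (simp only: of_nat_mult of_nat_power of_nat_numeral)
  moreover have "0 \<le> real m ^ 3 * (real e)\<^sup>2" by simp
  ultimately have 1: "real m ^ 3 * (real e)\<^sup>2 / 2 \<le> 2 ^ w" by linarith
  have "m * 2 powr (?\<rho> * m) * (1 / (2 * (1 / e / m)\<^sup>2)) = 2 powr (?\<rho> * m) * (real m ^ 3 * (real e)\<^sup>2 / 2)"
   using e0 m by (simp add: power_divide power2_eq_square power3_eq_cube)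
  also have "... \<le> 2 powr (?\<rho> * m) * 2 ^ w" by (rule mult_left_mono[OF 1]) simp
  also have "... = 2 powr (?\<rho> * m + w)" by (simp add: powr_add powr_realpow)
  finally show ?thesis .
 qed
 ultimately show ?thesis unfolding pm_def by (rule cext_mono) simp
qed

end

subsection \<open>One round and its iteration\<close>

lemma nat_div_bounds:
 assumes "0 < d"
 shows "real (a div d) \<le> real a / real d" "real a / real d \<le> real (a div d) + 1"
proof -
 have "a div d * d \<le> a" by (rule div_times_less_eq_dividend)
 then have "real (a div d * d) \<le> real a" by (rule of_nat_mono)
 then have 1: "real (a div d) * real d \<le> real a" by (simp only: of_nat_mult)
 have "a mod d < d" using assms by simp
 then have "a \<le> (a div d + 1) * d" unfolding distrib_right mult_1 using div_mult_mod_eq[of a d] by linarith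
 then have "real a \<le> real ((a div d + 1) * d)" by (rule of_nat_mono)
 then have 2: "real a \<le> (real (a div d) + 1) * real d" by (simp only: of_nat_mult of_nat_add of_nat_1)
 show "real (a div d) \<le> real a / real d" using 1 assms by (simp add: pos_le_divide_eq)
 show "real a / real d \<le> real (a div d) + 1" using 2 assms by (simp add: pos_divide_le_eq)
qed

context big
begin

text \<open>The entropy budget of a round. The condenser provides m1 = kp / w symbols of 2 * w bits
  with entropy b each. A row has about m1 (1 - 1/\<lambda>^2) symbols, so its length, the design
  loss, one spacing and an inner seed fit into b * m1 bits. Merging leaves R (w - \<lambda>) of R *
  w bits, and kp - kp / \<lambda> of them are extracted. In units of 1/e the error 9 is 1 for the
  condenser, 4 for a row (outer extractor 1, inner one 2, density 1), 1 for the curve and 1 + 2 for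
  the last extraction.\<close>

lemma round_cext:
 assumes kp: "kp \<le> n" "l ^ 13 \<le> kp"
 shows "cext n (rd c n) (kp - kp div lm) (2 ^ kp) (9 / e) (rnd c n kp (kp - kp div lm))"
proof -
 define m1 where "m1 = kp div w"
 define R where "R = rR n kp"
 define g where "g = rg n kp"
 define v2 where "v2 = rv n kp"
 define mo where "mo = kp - kp div lm"
 define N1 where "N1 = m1 * (2 * w)"
 define \<rho> where "\<rho> = 1 + 2 / real l"
 have R_def': "R = m1 - m1 div lm\<^sup>2" by (simp add: R_def rR_def m1_def)
 have g_def': "g = N1 div l + 1" by (simp add: g_def rg_def N1_def m1_def)
 have v2_def': "v2 = R * lm + w * pm n + 2" by (simp add: v2_def rv_def R_def)
 have e0: "0 < real e" using e1 l1000 by simp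
 have l0: "0 < l" using l1000 by simp
 have lm0: "0 < lm" using lam by simp
 have kp0: "0 < kp" using kp(2) l0 by (metis less_le_trans zero_less_power)
 have m1w: "m1 * w \<le> kp" "kp < m1 * w + w"
 proof -
  show "m1 * w \<le> kp" by (simp only: m1_def div_times_less_eq_dividend)
  have "kp mod w < w" by (rule mod_less_divisor) simp
  then show "kp < m1 * w + w" using div_mult_mod_eq[of kp w] unfolding m1_def by linarith
 qed
 have l13: "1000 * l ^ 10 \<le> l ^ 11" "l ^ 11 * l \<le> kp" "l \<le> l ^ 10" "l ^ 9 \<le> l ^ 10"
 proof -
  have "1000 * l ^ 10 \<le> l * l ^ 10" using l1000 by (intro mult_right_mono) auto
  then show "1000 * l ^ 10 \<le> l ^ 11" by (simp only: power_Suc[symmetric]) simp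
  have "l ^ 11 * l = l ^ 12" by (simp add: power_Suc2[symmetric])
  also have "... \<le> l ^ 13" using l0 by (intro power_increasing) auto
  finally show "l ^ 11 * l \<le> kp" using kp(2) by linarith
  show "l \<le> l ^ 10" using l0 by (intro self_le_power) auto
  show "l ^ 9 \<le> l ^ 10" using l0 by (intro power_increasing) auto
 qed
 have "l ^ 11 * 1 \<le> l ^ 11 * l" using l0 by (intro mult_left_mono) auto
 then have l11: "l ^ 11 \<le> kp" using l13(2) by linarith
 have small: "l + 3 * w + w * pm n + 10 \<le> 30 * l ^ 10"
 proof -
  define W where "W = w * pm n"
  have "W \<le> l ^ 9" unfolding W_def by (rule wpm)
  moreover have "l + 3 * x \<le> 28 * l" if "x \<le> 9 * l" for x using that by linarith
  then have "l + 3 * w \<le> 28 * l" using w_le by blast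
  moreover have "28 * l + 10 \<le> 29 * l ^ 10" using l13(3) l1000 by linarith
  ultimately have "l + 3 * w + W + 10 \<le> 30 * l ^ 10" using l13(4) by linarith
  then show ?thesis unfolding W_def .
 qed
 have m1_big: "l ^ 10 * 100 \<le> m1"
 proof -
  have "(m1 + 1) * (9 * l) \<ge> (m1 + 1) * w" by (intro mult_left_mono w_le) simp
  then have "l ^ 11 * l < (m1 + 1) * 9 * l" using l13(2) m1w(2) by (simp add: algebra_simps)
  then have "l ^ 11 < (m1 + 1) * 9" using l0 by simp
  then have "l ^ 11 < m1 * 9 + 9" by (simp add: distrib_right)
  then show ?thesis using l13 l1000 by linarith
 qed
 have m10: "0 < m1" "m1 \<le> n"
 proof -
  show "0 < m1" using m1_big l0 l13(3) by linarith
  show "m1 \<le> n" using kp(1) unfolding m1_def by (meson div_le_dividend order_trans)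
 qed
 have N1n: "N1 \<le> 2 * n" using m1w(1) kp(1) unfolding N1_def by simp
 define rl where "rl = real lm"
 have lr: "1000 \<le> rl" unfolding rl_def using lam by simp
 have lr3: "rl ^ 3 \<le> real l" unfolding rl_def using nat_le_real[OF lam3] by simp
 have inv: "1 / real l \<le> 1 / rl ^ 3" using lr lr3 l0 by (intro divide_left_mono) (auto intro!: mult_pos_pos)
 have Rb1: "real R \<le> real m1 - real m1 / rl\<^sup>2 + 1" "real m1 - real m1 / rl\<^sup>2 \<le> real R"
 proof -
  have "m1 div lm\<^sup>2 \<le> m1" by simp
  then have R': "real R = real m1 - real (m1 div lm\<^sup>2)" unfolding R_def' by (simp add: of_nat_diff)
  have d: "real (m1 div lm\<^sup>2) \<le> real m1 / real (lm\<^sup>2)" by (rule nat_div_bounds) (use lm0 in simp)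
  have d2: "real m1 / real (lm\<^sup>2) \<le> real (m1 div lm\<^sup>2) + 1" by (rule nat_div_bounds) (use lm0 in simp)
  show "real R \<le> real m1 - real m1 / rl\<^sup>2 + 1" "real m1 - real m1 / rl\<^sup>2 \<le> real R"
   using d d2 R' by (simp_all add: rl_def)
 qed
 have m1r: "1 \<le> real m1" using m10 by simp
 have R0: "0 < R"
 proof -
  have "1 * 2 \<le> rl * rl" using lr by (intro mult_mono) auto
  then have "real m1 / rl\<^sup>2 \<le> real m1 / 2" by (intro divide_left_mono) (auto simp: power2_eq_square)
  then have "0 < real R" using Rb1(2) m1r by linarith
  then show ?thesis by simp
 qed
 have Rm1: "R \<le> m1" unfolding R_def' by simp
 have Rbn: "0 < R * b" "R * b \<le> n"
 proof -
  show "0 < R * b" using R0 b_ge l0 by simp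
  have "R * b \<le> m1 * w" using Rm1 by (intro mult_mono) auto
  then show "R * b \<le> n" using m1w(1) kp(1) by linarith
 qed
 define Krow where "Krow = (real l + 1) * (2 powr (\<rho> * real (R * b) + w) * 2 ^ g * real P ^ pm n)"
 have P2w: "real P \<le> 2 ^ w" using pb(2)[of n] nat_le_real[of P "2 ^ w"] by simp
 have P2b: "2 ^ b \<le> real P" using nat_le_real[OF pb(1)[of n]] by simp
 have Ppm: "real P ^ pm n \<le> 2 ^ (w * pm n)"
  using power_mono[OF P2w, of "pm n"] by (simp only: power_mult of_nat_0_le_iff)
 have gN: "N1 \<le> l * g" "(l - 1) * g < N1"
 proof -
  have m: "N1 mod l < l" using l0 by simp
  have N: "N1 = l * (N1 div l) + N1 mod l" by simp
  then show "N1 \<le> l * g" unfolding g_def' distrib_left mult_1_right using m by linarith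
  have "l * l \<le> N1"
  proof -
   have "l * l \<le> l ^ 10 * 100" using power_increasing[of 2 10 l] l0 by (simp add: power2_eq_square)
   also have "... \<le> m1 * 1" using m1_big by simp
   also have "... \<le> N1" unfolding N1_def by (intro mult_left_mono) auto
   finally show ?thesis .
  qed
  then have "l \<le> N1 div l" using l0 by (simp add: less_eq_div_iff_mult_less_eq)
  moreover have "(l - 1) * g + (N1 div l + 1) = l * (N1 div l) + l"
  proof -
   obtain l' where "l = Suc l'" using l0 by (cases l) auto
   then show ?thesis by (simp add: g_def' algebra_simps)
  qed
  ultimately show "(l - 1) * g < N1" using N by linarith
 qed
 \<comment> \<open>With X = b * m1 the shorter rows set X / \<lambda>^2 aside. The terms 2 X /
   \<lambda>^3 from the design and 4 X / \<lambda>^3 from the spacing use at most half of it, the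
   polylogarithmic terms less than the other half.\<close>
 have KrowP: "2 * Krow < real P ^ m1"
 proof -
  define X where "X = real (b * m1)"
  have X0: "0 \<le> X" unfolding X_def by simp
  have b1: "real w \<le> 2 * real b" using b_ge l1000 by simp
  have Rb: "real (R * b) \<le> X - X / rl\<^sup>2 + real b"
   using mult_right_mono[OF Rb1(1), of "real b"] unfolding X_def by (simp add: algebra_simps)
  have "X / rl\<^sup>2 \<ge> 0" using X0 by simp
  have "R * b \<le> b * m1" using mult_right_mono[OF Rm1, of b] by (simp only: mult.commute)
  then have RX: "real (R * b) \<le> X" unfolding X_def by (rule nat_le_real)
  have t2: "2 / real l * real (R * b) \<le> 2 * (X / rl ^ 3)"
  proof -
   have "(1 / real l) * real (R * b) \<le> (1 / rl ^ 3) * X" using RX inv lr by (intro mult_mono) auto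
   then show ?thesis by simp
  qed
  have tg: "real g \<le> 4 * (X / rl ^ 3) + 1"
  proof -
   have "real g \<le> real N1 / real l + 1" unfolding g_def' using nat_div_bounds(1)[OF l0, of N1] by simp
   also have "real N1 / real l = (1 / real l) * real N1" by simp
   also have "... \<le> (1 / rl ^ 3) * (4 * X)"
   proof (intro mult_mono inv)
    have "real m1 * (2 * real w) \<le> real m1 * (2 * (2 * real b))" using b1 by (intro mult_left_mono) auto
    moreover have "real N1 = real m1 * (2 * real w)" unfolding N1_def by (simp only: of_nat_mult of_nat_numeral)
    moreover have "4 * X = real m1 * (2 * (2 * real b))" unfolding X_def by simp
    ultimately show "real N1 \<le> 4 * X" by (simp only:)
   qed (use lr in auto)
   finally show ?thesis by simp
  qed
  have c6: "6 * (X / rl ^ 3) \<le> X / rl\<^sup>2 / 2"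
  proof -
   define U where "U = X / rl\<^sup>2"
   have U0: "0 \<le> U" unfolding U_def using X0 by simp
   have "X / rl ^ 3 = U / rl" unfolding U_def by (simp only: divide_divide_eq_left power3_eq_cube power2_eq_square)
   moreover have "12 * (U / rl) \<le> rl * (U / rl)" using lr U0 by (intro mult_right_mono) auto
   moreover have "rl * (U / rl) = U" using lr by simp
   ultimately have "12 * (X / rl ^ 3) \<le> U" by simp
   then show ?thesis unfolding U_def[symmetric] by linarith
  qed
  have st: "real (l + 3 * w + w * pm n + 10) < X / rl\<^sup>2 / 2"
  proof -
   have "(l + 3 * w + w * pm n + 10) * (2 * lm\<^sup>2) \<le> (30 * l ^ 10) * (2 * l)"
    using small lam2 by (intro mult_mono) auto
   also have "... = 60 * (l ^ 10 * l)" by simp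
   also have "... < (4 * l) * (l ^ 10 * 100)" using l0 by simp
   also have "... \<le> b * m1" by (intro mult_mono b_ge m1_big) auto
   finally have "real ((l + 3 * w + w * pm n + 10) * (2 * lm\<^sup>2)) < X" unfolding X_def by (simp only: of_nat_less_iff)
   then have s: "real (l + 3 * w + w * pm n + 10) * (2 * rl\<^sup>2) < X" by (simp only: of_nat_mult of_nat_power of_nat_numeral rl_def)
   have "0 < 2 * rl\<^sup>2" using lr by simp
   then have "real (l + 3 * w + w * pm n + 10) < X / (2 * rl\<^sup>2)" using s by (subst pos_less_divide_eq)
   then show ?thesis by (simp add: mult.commute)
  qed
  have ex: "1 + real l + (\<rho> * real (R * b) + real w) + real g + real (w * pm n) < X"
  proof -
   have "\<rho> * real (R * b) = real (R * b) + 2 / real l * real (R * b)" unfolding \<rho>_def by (simp only: distrib_right mult_1_left)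
   moreover have "real (l + 3 * w + w * pm n + 10) = real l + 3 * real w + real (w * pm n) + 10" by (simp only: of_nat_add of_nat_mult of_nat_numeral)
   moreover have "real b \<le> real w" by simp
   moreover have "1 + L + (A + W) + G + M < X" if "0 \<le> W" "A = B + D" "S = L + 3 * W + M + 10" "b' \<le> W" "B \<le> X - U + b'"
    "D \<le> 2 * V" "G \<le> 4 * V + 1" "6 * V \<le> U / 2" "S < U / 2" for A B D S L W M G U V b' :: real
    using that by linarith
   moreover have "0 \<le> real w" by (rule of_nat_0_le_iff)
   ultimately show ?thesis using Rb t2 tg c6 st by blast
  qed
  have "real l + 1 \<le> 2 powr real l"
  proof -
   have "l + 1 \<le> 2 ^ l" using less_exp[of l] by linarith
   then have "real (l + 1) \<le> real (2 ^ l)" by (rule nat_le_real)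
   then show ?thesis by (simp add: powr_realpow)
  qed
  then have "Krow \<le> 2 powr real l * (2 powr (\<rho> * real (R * b) + w) * 2 powr real g * 2 powr real (w * pm n))"
  proof -
   assume l1: "real l + 1 \<le> 2 powr real l"
   have P': "real P ^ pm n \<le> 2 powr real (w * pm n)" using Ppm by (subst powr_realpow) simp_all
   have g': "(2::real) ^ g \<le> 2 powr real g" by (subst powr_realpow) simp_all
   show ?thesis unfolding Krow_def by (intro mult_mono order_refl l1 g' P') simp_all
  qed
  then have "2 * Krow \<le> 2 powr 1 * (2 powr real l * (2 powr (\<rho> * real (R * b) + w) * 2 powr real g * 2 powr real (w * pm n)))" by simp
  also have "... = 2 powr (1 + real l + (\<rho> * real (R * b) + real w) + real g + real (w * pm n))"
   by (simp only: powr_add mult.assoc)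
  also have "... < 2 powr X" using ex by simp
  also have "... = 2 ^ (b * m1)" unfolding X_def by (rule powr_realpow) simp
  also have "... \<le> real P ^ m1" unfolding power_mult by (intro power_mono P2b) simp
  finally show ?thesis .
 qed
 \<comment> \<open>The largest number of exponents per variable that keeps the curve error 2 h l /
   2^b at most 1 / e.\<close>
 define h where "h = 2 ^ b div (2 * l * e)"
 have wlm: "lm \<le> w" using lam1 b_ge by linarith
 \<comment> \<open>Since 32 * l * e is at most 2^\<lambda>, the merger loses no more than \<lambda>
   bits per symbol, even with the factor 4 for multiplicities.\<close>
 have h_ge: "8 * 2 ^ (w - lm) \<le> h"
 proof -
  have "32 * l * e \<le> l * l * e" using l1000 by (intro mult_right_mono) auto
  also have "... = l ^ (2 + c)" by (simp add: power_add power2_eq_square)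
  also have "... \<le> 2 ^ lm" by (rule pw_le) simp
  finally have "2 ^ (w - lm) * (32 * l * e) \<le> 2 ^ (w - lm) * 2 ^ lm" by (rule mult_left_mono) simp
  also have "... = 2 ^ w" using wlm by (simp only: power_add[symmetric]) simp
  also have "... = 2 * 2 ^ b" by simp
  finally have "2 ^ (w - lm) * (32 * l * e) \<le> 2 * 2 ^ b" .
  moreover have "(8 * A) * (2 * x * y) \<le> C" if "A * (32 * x * y) \<le> 2 * C" for A x y C :: nat
  proof -
   have "A * (32 * x * y) = 2 * ((8 * A) * (2 * x * y))" by simp
   then show ?thesis using that by linarith
  qed
  ultimately have "(8 * 2 ^ (w - lm)) * (2 * l * e) \<le> 2 ^ b" by blast
  moreover have "0 < 2 * l * e" using l0 by simp
  ultimately show ?thesis unfolding h_def by (simp only: less_eq_div_iff_mult_less_eq)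
 qed
 have h0: "0 < h" using h_ge by (meson less_le_trans mult_pos_pos zero_less_numeral zero_less_power)
 have h_le: "h * (2 * l * e) \<le> 2 ^ b" unfolding h_def by (rule div_times_less_eq_dividend)
 define K' where "K' = (2::real) ^ (R * (w - lm))"
 have K'h: "K' * 2 ^ (2 * R) < real h ^ R"
 proof -
  have "real (8 * 2 ^ (w - lm)) \<le> real h" using h_ge by (rule nat_le_real)
  then have "4 * 2 ^ (w - lm) < real h" using zero_less_power[of "2::real" "w - lm"] by (simp del: zero_less_power)
  then have "(4 * 2 ^ (w - lm)) ^ R < real h ^ R" using R0 by (intro power_strict_mono) auto
  moreover have "K' * 2 ^ (2 * R) = (4 * 2 ^ (w - lm)) ^ R"
  proof -
   have "(2::real) ^ (R * (w - lm)) = (2 ^ (w - lm)) ^ R" by (simp only: power_mult[symmetric] mult.commute)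
   moreover have "(2::real) ^ (2 * R) = 4 ^ R" by (simp add: power_mult)
   ultimately show ?thesis unfolding K'_def by (simp add: power_mult_distrib)
  qed
  ultimately show ?thesis by simp
 qed
 let ?E1 = "tre P b w q (R * b)"
 let ?E2 = "sml c n"
 have rs: "sml c n v s \<in> bits (pm n)" for v s by (simp add: sml_def)
 have hl: "2 * real h * real l \<le> 1 / e * 2 ^ b" "2 * real h / 2 ^ b \<le> 1 / e"
 proof -
  have "real (h * (2 * l * e)) \<le> real (2 ^ b)" using h_le by (rule nat_le_real)
  then have "2 * real h * real l * real e \<le> 2 ^ b" by (simp add: mult_ac)
  then show 1: "2 * real h * real l \<le> 1 / e * 2 ^ b"
   unfolding times_divide_eq_left mult_1_left using e0 by (subst pos_le_divide_eq)
  have "2 * real h * 1 \<le> 2 * real h * real l" using l0 by (intro mult_left_mono) auto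
  then have "2 * real h \<le> 1 / e * 2 ^ b" using 1 by linarith
  then show "2 * real h / 2 ^ b \<le> 1 / e" by (subst pos_divide_le_eq) auto
 qed
 have merge: "ccond N1 (sd c n + b) (R * w) K' Krow (4 / e + 1 / e) (cnd c n kp)"
 proof -
  have "ccond N1 (sd c n + b) (R * w) K' Krow (4 / e + 1 / e)
   (%x s. merge P b w l R (%i. blk (i * g) ?E1 ?E2 x (take (sd c n) s)) (drop (sd c n) s))"
  proof (rule ccond_merge[OF pP(1) pb(1) _ _ l0 R0 h0 _ K'h _ hl(1)])
   show "P \<le> 2 ^ w" using pb(2)[of n] by simp
   show "l \<le> 2 ^ b" using b_ge less_exp[of b] by linarith
   show "0 < b" using b_ge l0 by linarith
   show "0 \<le> 4 / real e" by simp
   show "blk (i * g) ?E1 ?E2 x s \<in> bits (R * b)" for i x s by (simp add: blk_def)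
   fix T assume T: "\<And>i. i < l ==> T i \<subseteq> bits (R * b) \<and> real (card (T i)) / 2 ^ (R * b) \<le> 2 * real h / 2 ^ b"
   have "real (card {x \<in> bits N1. \<forall>i<l. 1 / e + 1 / e + 2 / e < frc (bits (sd c n)) (%s. blk (i * g) ?E1 ?E2 x s \<in> T i)})
    \<le> (real l + 1) * (2 powr (\<rho> * real (R * b) + w) * 2 ^ g * real P ^ pm n)"
   proof (rule rows_bad[OF l0 _ gN(1) _ _ rs])
    show "(l - 1) * g \<le> N1" using gN(2) by simp
    have ig: "i * g \<le> (l - 1) * g" if "i < l" for i using that by (intro mult_right_mono) auto
    show "cext (i * g) (pm n) (R * b) (2 powr (\<rho> * real (R * b) + w)) (1 / e) ?E1" if "i < l" for i
    proof -
     have "i * g < N1" using ig[OF that] gN(2) by (rule le_less_trans)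
     then show ?thesis unfolding \<rho>_def using N1n Rbn by (intro tre_cext) linarith+
    qed
    show "cext (N1 - i * g) (sd c n) (pm n) (real P ^ pm n) (2 / e) ?E2" if "i < l" for i
    proof -
     have "i * g < N1" using ig[OF that] gN(2) by (rule le_less_trans)
     then show ?thesis using N1n by (intro sml_cext) linarith+
    qed
    show "1 \<le> real P ^ pm n" using P_big(5) by (intro one_le_power) simp
    show "1 \<le> 2 powr (\<rho> * real (R * b) + w)" by (rule ge_one_powr_ge_zero) (auto simp: \<rho>_def)
    show "T i \<subseteq> bits (R * b) \<and> real (card (T i)) / 2 ^ (R * b) \<le> 1 / e" if "i < l" for i
     using T[OF that] hl(2) by linarith
   qed
   then show "real (card {x \<in> bits N1. \<forall>i<l. 4 / e < frc (bits (sd c n)) (%s. blk (i * g) ?E1 ?E2 x s \<in> T i)}) \<le> Krow"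
    unfolding Krow_def by (simp only: add_divide_distrib[symmetric]) simp
  qed
  then show ?thesis unfolding cnd_def[abs_def] R_def g_def .
 qed
 have C: "ccond n (cd c n) (R * w) K' (real P ^ m1) (4 / e + 1 / e + 1 / e) (cnd2 c n kp)"
 proof -
  have "ccond n (2 * b) N1 Krow (real P ^ m1) (1 / e) (pv P (pa n) b w m1)"
   unfolding N1_def by (rule pv_cond[OF n0 _ m10 KrowP]) simp
  then have "ccond n (2 * b + (sd c n + b)) (R * w) K' (real P ^ m1) (4 / e + 1 / e + 1 / e)
   (%x s. cnd c n kp (pv P (pa n) b w m1 x (take (2 * b) s)) (drop (2 * b) s))"
   by (rule ccond_comp[OF _ merge]) (auto simp: N1_def)
  then show ?thesis unfolding cd_def cnd2_def[abs_def] m1_def .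
 qed
 have mo0: "0 < mo" "mo \<le> n"
 proof -
  have "kp div lm < kp" using kp0 lam by (intro div_less_dividend) auto
  then show "0 < mo" unfolding mo_def by simp
  show "mo \<le> n" unfolding mo_def using kp(1) by simp
 qed
 \<comment> \<open>The unextracted part Y / \<lambda> of Y = kp dominates the shortened rows, the
   merging loss and the design loss. The summand 1 makes the first term of \<open>cext_blk\<close>
   at most half of \<open>K'\<close>.\<close>
 have fin: "\<rho> * real mo + real w + real v2 + 1 \<le> real R * real (w - lm)"
 proof -
  define Y where "Y = real kp"
  have mo_le: "real mo \<le> Y - Y / rl + 1"
  proof -
   have "real kp / real lm \<le> real (kp div lm) + 1" by (rule nat_div_bounds(2)[OF lm0])
   moreover have "real mo = real kp - real (kp div lm)" unfolding mo_def by (simp add: of_nat_diff)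
   ultimately show ?thesis unfolding Y_def rl_def by linarith
  qed
  have Y0: "0 \<le> Y" unfolding Y_def by simp
  have t2: "2 / real l * real mo \<le> 2 * (Y / rl ^ 3)"
  proof -
   have "real mo \<le> Y" unfolding mo_def Y_def by simp
   then have "(1 / real l) * real mo \<le> (1 / rl ^ 3) * Y" using inv lr by (intro mult_mono) auto
   then show ?thesis by simp
  qed
  have Rl: "real R * rl \<le> Y / rl\<^sup>2 / 4"
  proof -
   have "R * (4 * l) \<le> m1 * w" using Rm1 b_ge by (intro mult_mono) auto
   then have "real (R * (4 * l)) \<le> Y" unfolding Y_def using m1w(1) by (intro nat_le_real) linarith
   then have "4 * (real R * real l) \<le> Y" by simp
   moreover have "real R * rl ^ 3 \<le> real R * real l" by (intro mult_left_mono lr3) simp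
   ultimately have "4 * (real R * rl ^ 3) \<le> Y" by linarith
   then have "(real R * rl) * (4 * rl\<^sup>2) \<le> Y" by (simp add: power3_eq_cube power2_eq_square mult_ac)
   moreover have "0 < 4 * rl\<^sup>2" using lr by simp
   ultimately have "real R * rl \<le> Y / (4 * rl\<^sup>2)" by (subst pos_le_divide_eq)
   then show ?thesis by (simp add: mult.commute)
  qed
  have Rw: "Y - real w - Y / rl\<^sup>2 \<le> real R * real w"
  proof -
   have "(real m1 - real m1 / rl\<^sup>2) * real w \<le> real R * real w" using Rb1(2) by (intro mult_right_mono) auto
   moreover have "(real m1 - real m1 / rl\<^sup>2) * real w = real (m1 * w) - real (m1 * w) / rl\<^sup>2"
    by (simp only: left_diff_distrib of_nat_mult times_divide_eq_left)
   moreover have "real (m1 * w) / rl\<^sup>2 \<le> Y / rl\<^sup>2" unfolding Y_def using m1w(1) by (intro divide_right_mono nat_le_real) auto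
   moreover have "Y - real w \<le> real (m1 * w)"
   proof -
    have "real kp \<le> real (m1 * w + w)" using m1w(2) by (intro nat_le_real) simp
    then show ?thesis unfolding Y_def by simp
   qed
   ultimately show ?thesis by linarith
  qed
  have c3: "2 * (Y / rl ^ 3) + 2 * (Y / rl\<^sup>2) \<le> Y / rl / 2"
  proof -
   define Z where "Z = Y / rl\<^sup>2"
   have Z0: "0 \<le> Z" unfolding Z_def using Y0 by simp
   have "Y / rl ^ 3 = Z / rl" unfolding Z_def by (simp add: power3_eq_cube power2_eq_square)
   also have "... \<le> Z / 1" using lr Z0 by (intro divide_left_mono) auto
   finally have 1: "Y / rl ^ 3 \<le> Z" by simp
   have "Y / rl = rl * Z" unfolding Z_def using lr by (simp add: power2_eq_square)
   moreover have "8 * Z \<le> rl * Z" using lr Z0 by (intro mult_right_mono) auto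
   moreover have "2 * A + 2 * Z' \<le> B / 2" if "B = C" "8 * Z' \<le> C" "A \<le> Z'" for A B C Z' :: real using that by linarith
   ultimately show ?thesis using 1 unfolding Z_def[symmetric] by blast
  qed
  have st: "real (2 * w + w * pm n + 4) \<le> Y / rl / 2"
  proof -
   have "(2 * w + w * pm n + 4) * (2 * lm) \<le> (30 * l ^ 10) * (2 * l)"
   proof (rule mult_mono)
    have "2 * x + y + 4 \<le> Z" if "l + 3 * x + y + 10 \<le> Z" for x y Z :: nat using that by linarith
    from this[OF small] show "2 * w + w * pm n + 4 \<le> 30 * l ^ 10" .
    show "2 * lm \<le> 2 * l" using lam1 by simp
   qed auto
   also have "... = (60 * l ^ 10) * l" by simp
   also have "... \<le> l ^ 11 * l" using l13(1) by (intro mult_right_mono) linarith+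
   also have "... \<le> kp" by (rule l13)
   finally have "real ((2 * w + w * pm n + 4) * (2 * lm)) \<le> Y" unfolding Y_def by (rule nat_le_real)
   then have s: "real (2 * w + w * pm n + 4) * (2 * rl) \<le> Y" by (simp only: of_nat_mult of_nat_numeral rl_def)
   have "0 < 2 * rl" using lr by simp
   then have "real (2 * w + w * pm n + 4) \<le> Y / (2 * rl)" using s by (subst pos_le_divide_eq)
   then show ?thesis by (simp add: mult.commute)
  qed
  have v: "real v2 = real R * rl + real (w * pm n) + 2" unfolding v2_def' rl_def by simp
  have st': "real (2 * w + w * pm n + 4) = 2 * real w + real (w * pm n) + 4" by (simp only: of_nat_add of_nat_mult of_nat_numeral)
  have \<rho>m: "\<rho> * real mo = real mo + 2 / real l * real mo" unfolding \<rho>_def by (simp only: distrib_right mult_1_left)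
  have wl: "real R * real (w - lm) = real R * real w - real R * rl" using wlm by (simp only: of_nat_diff right_diff_distrib rl_def)
  have "0 \<le> Y / rl\<^sup>2" using Y0 by simp
  moreover have "M0 + D + W + (RL + M + 2) + 1 \<le> RW - RL" if "0 \<le> U" "M0 \<le> Y - T + 1" "D \<le> 2 * V" "RL \<le> U / 4"
   "Y - W - U \<le> RW" "2 * V + 2 * U \<le> T / 2" "2 * W + M + 4 \<le> T / 2" for M0 D W RL M RW U T V :: real
   using that by linarith
  ultimately show ?thesis unfolding v \<rho>m wl using mo_le t2 Rl Rw c3 st[unfolded st'] by blast
 qed
 have v2R: "v2 \<le> R * w"
 proof -
  have "0 \<le> \<rho> * real mo" unfolding \<rho>_def by simp
  then have "real v2 \<le> real R * real (w - lm)" using fin by linarith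
  also have "... \<le> real R * real w" by (intro mult_left_mono) auto
  finally have "real v2 \<le> real (R * w)" by (simp only: of_nat_mult)
  then show ?thesis by (simp only: of_nat_le_iff)
 qed
 have Rwn: "R * w \<le> n" using mult_right_mono[OF Rm1, of w] m1w(1) kp(1) by linarith
 have E: "cext (R * w) (sd c n) mo K' (1 / e + 2 / e) (blk (R * w - v2) (tre P b w q mo) (sml c n))"
 proof -
  have "cext (R * w - v2 + v2) (sd c n) mo (2 powr (\<rho> * real mo + w) * 2 ^ v2 + 2 ^ (R * w - v2) * real P ^ pm n) (1 / e + 2 / e)
   (blk (R * w - v2) (tre P b w q mo) (sml c n))"
  proof (rule cext_blk)
   show "cext (R * w - v2) (pm n) mo (2 powr (\<rho> * real mo + w)) (1 / e) (tre P b w q mo)"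
    unfolding \<rho>_def using Rwn mo0 by (intro tre_cext) auto
   show "cext v2 (sd c n) (pm n) (real P ^ pm n) (2 / e) (sml c n)"
    using v2R Rwn by (intro sml_cext) (auto simp: v2_def')
  qed (rule rs)
  moreover have "2 powr (\<rho> * real mo + w) * 2 ^ v2 + 2 ^ (R * w - v2) * real P ^ pm n \<le> K'"
  proof -
   have K'p: "K' = 2 powr (real R * real (w - lm))"
    unfolding K'_def using powr_realpow[of 2 "R * (w - lm)"] by simp
   have "2 powr (\<rho> * real mo + w) * 2 ^ v2 = 2 powr (\<rho> * real mo + real w + real v2)"
    by (simp add: powr_add powr_realpow)
   also have "... \<le> 2 powr (real R * real (w - lm) - 1)" using fin by (intro powr_mono) auto
   also have "... = K' / 2" unfolding K'p by (simp add: powr_diff)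
   finally have 1: "2 powr (\<rho> * real mo + w) * 2 ^ v2 \<le> K' / 2" .
   have "(2::real) ^ (R * w - v2) * real P ^ pm n \<le> 2 ^ (R * w - v2) * 2 ^ (w * pm n)" using Ppm by (intro mult_left_mono) auto
   also have "... = 2 ^ (R * w - v2 + w * pm n)" by (simp add: power_add)
   also have "... \<le> 2 ^ (R * (w - lm) - 1)"
   proof (intro power_increasing)
    have "R * (w - lm) = R * w - R * lm" by (rule diff_mult_distrib2)
    then show "R * w - v2 + w * pm n \<le> R * (w - lm) - 1" using v2R v2_def' by linarith
   qed simp
   also have "... = K' / 2"
   proof -
    have "0 < R * (w - lm)" using v2R v2_def' R0 lam1 b_ge l0 by simp
    then obtain z where "R * (w - lm) = Suc z" using not0_implies_Suc by blast
    then show ?thesis unfolding K'_def by simp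
   qed
   finally show ?thesis using 1 by linarith
  qed
  ultimately show ?thesis using v2R by (simp only: le_add_diff_inverse2) (erule cext_mono, auto)
 qed
 have "cext n (cd c n + sd c n) mo (real P ^ m1) ((1 / e + 2 / e) + (4 / e + 1 / e + 1 / e))
  (%x s. blk (R * w - v2) (tre P b w q mo) (sml c n) (cnd2 c n kp x (take (cd c n) s)) (drop (cd c n) s))"
  by (rule cext_ccond[OF C E]) (auto simp: cnd2_def cnd_def R_def)
 moreover have "real P ^ m1 \<le> 2 ^ kp"
 proof -
  have "real P ^ m1 \<le> (2 ^ w) ^ m1" by (intro power_mono P2w) simp
  also have "... = 2 ^ (m1 * w)" by (simp only: power_mult[symmetric] mult.commute)
  also have "... \<le> 2 ^ kp" using m1w(1) by (intro power_increasing) auto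
  finally show ?thesis .
 qed
 moreover have "(1 / real e + 2 / e) + (4 / e + 1 / e + 1 / e) \<le> 9 / real e" by (simp only: add_divide_distrib[symmetric]) simp
 ultimately show ?thesis unfolding rd_def rnd_def[abs_def] R_def v2_def mo_def by (rule cext_mono)
qed

text \<open>Joining a round of error 9 / e to the remaining ones by \<open>cext_concat\<close> with
  J = e thresholds adds 1 / e. The factor 2^m1 lost there is matched by the smaller entropy demanded
  of the later rounds.\<close>

lemma pext_cext:
 assumes "kp \<le> n" "\<And>j. j < r ==> l ^ 13 \<le> kp div lm ^ j"
 shows "cext n (r * rd c n) (kp - kp div lm ^ r) (real (r * e) * 2 ^ kp) (real r * (10 / e)) (pext c n r kp)
  \<and> (\<forall>x s. pext c n r kp x s \<in> bits (kp - kp div lm ^ r))"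
 using assms
proof (induction r arbitrary: kp)
 case 0
 have "bad n 0 (%x s. []) T (real (card T)) = {}" if "T \<subseteq> bits 0" for T
 proof -
  have "T = {} \<or> T = {[]}" using that by (auto simp: bits_def)
  then show ?thesis by (auto simp: bad_def frc_def bits_def)
 qed
 then show ?case by (auto simp: cext_def)
next
 case (Suc r)
 let ?kp = "kp div lm"
 have e0: "0 < e" using e1 by linarith
 have pw: "kp div lm ^ Suc j = ?kp div lm ^ j" for j by (simp only: power_Suc div_mult2_eq)
 have k2: "l ^ 13 \<le> ?kp div lm ^ j" if "j < r" for j using Suc.prems(2)[of "Suc j"] that unfolding pw by simp
 have k1: "l ^ 13 \<le> kp" using Suc.prems(2)[of 0] by simp
 have kpn: "?kp \<le> n" using Suc.prems(1) by (meson div_le_dividend order_trans)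
 have IH: "cext n (r * rd c n) (?kp - ?kp div lm ^ r) (real (r * e) * 2 ^ ?kp) (real r * (10 / e)) (pext c n r ?kp)"
  "pext c n r ?kp x s \<in> bits (?kp - ?kp div lm ^ r)" for x s
  using Suc.IH[OF kpn k2] by blast+
 have r1: "rnd c n kp (kp - ?kp) x s \<in> bits (kp - ?kp)" for x s by (simp add: rnd_def blk_def)
 have le: "?kp \<le> kp" "?kp div lm ^ r \<le> ?kp" by simp_all
 then have len: "kp - ?kp + (?kp - ?kp div lm ^ r) = kp - kp div lm ^ Suc r" unfolding pw by linarith
 have "cext n (rd c n + r * rd c n) (kp - ?kp + (?kp - ?kp div lm ^ r))
   (2 ^ (kp - ?kp) * (real (r * e) * 2 ^ ?kp) + real e * 2 ^ kp) (9 / e + real r * (10 / e) + 1 / e)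
   (%x s. rnd c n kp (kp - ?kp) x (take (rd c n) s) @ pext c n r ?kp x (drop (rd c n) s))"
  by (rule cext_concat[OF round_cext[OF Suc.prems(1) k1] IH(1) e0 r1 IH(2)])
 moreover have "2 ^ (kp - ?kp) * (real (r * e) * 2 ^ ?kp) + real e * 2 ^ kp = real (Suc r * e) * 2 ^ kp"
 proof -
  have "(2::real) ^ (kp - ?kp) * 2 ^ ?kp = 2 ^ kp" using le(1) by (simp only: power_add[symmetric]) simp
  then have "2 ^ (kp - ?kp) * (real (r * e) * 2 ^ ?kp) = real (r * e) * 2 ^ kp" by (simp only: mult.left_commute)
  then show ?thesis by (simp add: distrib_right)
 qed
 moreover have "9 / real e + real r * (10 / e) + 1 / e = real (Suc r) * (10 / real e)"
  by (simp add: add_divide_distrib[symmetric] distrib_right)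
 moreover have "pext c n (Suc r) kp = (%x s. rnd c n kp (kp - ?kp) x (take (rd c n) s) @ pext c n r ?kp x (drop (rd c n) s))"
  by (intro ext) simp
 moreover have "pext c n (Suc r) kp x s \<in> bits (kp - kp div lm ^ Suc r)" for x s
  using r1 IH(2) unfolding len[symmetric] by simp
 ultimately show ?case unfolding len by (simp only: mult_Suc) blast
qed

end

section \<open>Structured tape programs\<close>

datatype cmd =
  Act nat "nat => nat \<times> move"
 | Seq cmd cmd (infixr ";;" 60)
 | IfC nat "nat => bool" cmd cmd
 | WhileC nat "nat => bool" cmd

text \<open>The step counts are exact for the compiled code: one step for a test and one for the
  jump past an else branch or back to a loop head.\<close>

inductive run :: "cmd => tape list => nat => tape list => bool" where
 run_Act: "i < length ts ==> run (Act i f) ts 1 (ts[i := act_tape (ts ! i) (f (read_tape (ts ! i)))])"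
| run_Seq: "run c1 ts t1 ts1 ==> run c2 ts1 t2 ts2 ==> run (c1 ;; c2) ts (t1 + t2) ts2"
| run_IfT: "i < length ts ==> P (read_tape (ts ! i)) ==> run c1 ts t ts' ==> run (IfC i P c1 c2) ts (t + 2) ts'"
| run_IfF: "i < length ts ==> \<not> P (read_tape (ts ! i)) ==> run c2 ts t ts' ==> run (IfC i P c1 c2) ts (t + 1) ts'"
| run_WhileF: "i < length ts ==> \<not> P (read_tape (ts ! i)) ==> run (WhileC i P c) ts 1 ts"
| run_WhileT: "i < length ts ==> P (read_tape (ts ! i)) ==> run c ts t1 ts1 ==> run (WhileC i P c) ts1 t2 ts2
  ==> run (WhileC i P c) ts (t1 + t2 + 2) ts2"

lemma run_length: "run c ts t ts' ==> length ts' = length ts"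
 by (induction rule: run.induct) auto

type_synonym instr = "nat \<times> (nat => nat \<times> move) \<times> (nat => nat)"

fun csize :: "cmd => nat" where
 "csize (Act i f) = 1"
| "csize (c1 ;; c2) = csize c1 + csize c2"
| "csize (IfC i P c1 c2) = csize c1 + csize c2 + 2"
| "csize (WhileC i P c) = csize c + 2"

text \<open>Addresses are machine states, and the address behind the last instruction is the halting
  state. A jump is an instruction that leaves tape 0 unchanged.\<close>

fun compile :: "cmd => nat => instr list" where
 "compile (Act i f) s = [(i, f, %_. s + 1)]"
| "compile (c1 ;; c2) s = compile c1 s @ compile c2 (s + csize c1)"
| "compile (IfC i P c1 c2) s =
   [(i, %a. (a, MStay), %a. if P a then s + 1 else s + 2 + csize c1)] @ compile c1 (s + 1) @
   [(0, %a. (a, MStay), %_. s + 2 + csize c1 + csize c2)] @ compile c2 (s + 2 + csize c1)"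
| "compile (WhileC i P c) s =
   [(i, %a. (a, MStay), %a. if P a then s + 1 else s + 2 + csize c)] @ compile c (s + 1) @
   [(0, %a. (a, MStay), %_. s)]"

lemma length_compile [simp]: "length (compile c s) = csize c"
 by (induction c arbitrary: s) auto

fun wf_cmd :: "nat => cmd => bool" where
 "wf_cmd nt (Act i f) \<longleftrightarrow> i < nt \<and> (\<forall>a<5. fst (f a) < 5)"
| "wf_cmd nt (c1 ;; c2) \<longleftrightarrow> wf_cmd nt c1 \<and> wf_cmd nt c2"
| "wf_cmd nt (IfC i P c1 c2) \<longleftrightarrow> i < nt \<and> wf_cmd nt c1 \<and> wf_cmd nt c2"
| "wf_cmd nt (WhileC i P c) \<longleftrightarrow> i < nt \<and> wf_cmd nt c"

lemma compile_next: "(i, f, nx) \<in> set (compile c s) ==> nx a \<le> s + csize c"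
 by (induction c arbitrary: s) (fastforce split: if_splits)+

lemma compile_wf: "wf_cmd nt c ==> 0 < nt ==> (i, f, nx) \<in> set (compile c s) ==> i < nt \<and> (\<forall>a<5. fst (f a) < 5)"
 by (induction c arbitrary: s) (fastforce split: if_splits)+

definition prog_tm :: "nat => cmd => turing_machine" where
 "prog_tm nt c = \<lparr>states = csize c + 1, symbols = 5, tapes = nt, start = 0, halt = csize c,
   delta = (%q as. if q < csize c then
    (case compile c 0 ! q of (i, f, nx) => (nx (as ! i), (map (%a. (a, MStay)) as)[i := f (as ! i)]))
    else (csize c, map (%a. (a, MStay)) as))\<rparr>"

lemma wf_prog_tm:
 assumes "wf_cmd nt c" "2 \<le> nt"
 shows "wf_tm (prog_tm nt c)"
 unfolding wf_tm_def
proof (intro conjI allI impI)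
 fix q as assume q: "q < states (prog_tm nt c)" and l: "length as = tapes (prog_tm nt c)"
  and s: "set as \<subseteq> {..<symbols (prog_tm nt c)}"
 have l': "length as = nt" and s': "set as \<subseteq> {..<5}" using l s by (auto simp: prog_tm_def)
 have "fst (delta (prog_tm nt c) q as) < states (prog_tm nt c) \<and>
   length (snd (delta (prog_tm nt c) q as)) = tapes (prog_tm nt c) \<and>
    fst ` set (snd (delta (prog_tm nt c) q as)) \<subseteq> {..<symbols (prog_tm nt c)}"
 proof (cases "q < csize c")
  case True
  obtain i f nx where ins: "compile c 0 ! q = (i, f, nx)" by (cases "compile c 0 ! q") auto
  have mem: "(i, f, nx) \<in> set (compile c 0)" using True ins
   by (metis length_compile nth_mem)
  have wf: "i < nt" "\<forall>a<5. fst (f a) < 5" using compile_wf[OF assms(1) _ mem] assms(2) by auto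
  have "as ! i < 5" using wf(1) l' s' nth_mem by fastforce
  then have "fst (f (as ! i)) < 5" using wf by auto
  then have "fst ` set ((map (%a. (a, MStay)) as)[i := f (as ! i)]) \<subseteq> {..<5}"
   using set_update_subset_insert[of "map (%a. (a, MStay)) as" i "f (as ! i)"] s' by fastforce
  then show ?thesis using True ins compile_next[OF mem, of "as ! i"] l' by (simp add: prog_tm_def)
 next
  case False
  then show ?thesis using q l' s' by (auto simp: prog_tm_def)
 qed
 then show "fst (delta (prog_tm nt c) q as) < states (prog_tm nt c)"
   "length (snd (delta (prog_tm nt c) q as)) = tapes (prog_tm nt c)"
    "fst ` set (snd (delta (prog_tm nt c) q as)) \<subseteq> {..<symbols (prog_tm nt c)}" by auto
qed (use assms in \<open>auto simp: prog_tm_def\<close>)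

lemma act_tape_stay [simp]: "act_tape t (read_tape t, MStay) = t"
 by (simp add: act_tape_def read_tape_def)

lemma prog_tm_step:
 assumes "q < csize c" "compile c 0 ! q = (i, f, nx)" "i < length ts"
 shows "tm_step (prog_tm nt c) (q, ts) =
  (nx (read_tape (ts ! i)), ts[i := act_tape (ts ! i) (f (read_tape (ts ! i)))])"
proof -
 have "map2 act_tape ts ((map (%a. (a, MStay)) (map read_tape ts))[i := f (map read_tape ts ! i)]) =
   ts[i := act_tape (ts ! i) (f (read_tape (ts ! i)))]"
  by (rule nth_equalityI) (use assms(3) in \<open>auto simp: nth_list_update\<close>)
 then show ?thesis using assms by (simp add: tm_step_def prog_tm_def)
qed

text \<open>Subprograms keep their absolute addresses, so the induction over runs speaks of
  fragments of one fixed program.\<close>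

definition code_at :: "instr list => nat => instr list => bool" where
 "code_at code s cs \<longleftrightarrow> s + length cs \<le> length code \<and> (\<forall>k<length cs. code ! (s + k) = cs ! k)"

lemma code_at_append: "code_at code s (a @ b) \<longleftrightarrow> code_at code s a \<and> code_at code (s + length a) b"
 unfolding code_at_def
proof (intro iffI conjI allI impI, goal_cases)
 case (2 k)
 then show ?case by (auto simp: nth_append dest: spec[of _ k])
next
 case (4 k)
 then show ?case by (auto simp: nth_append ac_simps dest: spec[of _ "length a + k"])
next
 case (6 k)
 show ?case
 proof (cases "k < length a")
  case False
  then have "k - length a < length b" using 6 by auto
  then have "code ! (s + length a + (k - length a)) = b ! (k - length a)" using 6 by blast
  moreover have "s + length a + (k - length a) = s + k" using False by simp
  ultimately show ?thesis using False by (simp add: nth_append)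
 qed (use 6 in \<open>auto simp: nth_append\<close>)
qed auto

lemma code_at_single: "code_at code s [x] \<longleftrightarrow> s < length code \<and> code ! s = x"
 by (auto simp: code_at_def)

lemma code_at_Cons: "code_at code s (x # xs) \<longleftrightarrow> s < length code \<and> code ! s = x \<and> code_at code (Suc s) xs"
 using code_at_append[of code s "[x]" xs] by (simp add: code_at_single)

lemma run_tm_steps:
 assumes "run c ts t ts'" "code_at (compile c0 0) s (compile c s)" "0 < length ts"
 shows "(tm_step (prog_tm nt c0) ^^ t) (s, ts) = (s + csize c, ts')"
 using assms
proof (induction arbitrary: s rule: run.induct)
 case (run_Act i ts f)
 then show ?case using prog_tm_step[of s c0 i f _ ts nt]
  by (simp add: code_at_single)
next
 case (run_Seq c1 ts t1 ts1 c2 t2 ts2)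
 have "(tm_step (prog_tm nt c0) ^^ t1) (s, ts) = (s + csize c1, ts1)"
  using run_Seq by (auto simp: code_at_append)
 moreover have "(tm_step (prog_tm nt c0) ^^ t2) (s + csize c1, ts1) = (s + csize c1 + csize c2, ts2)"
  using run_Seq run_length[OF run_Seq.hyps(1)] by (auto simp: code_at_append)
 ultimately show ?case by (simp add: add.commute[of t1] funpow_add add.assoc)
next
 case (run_IfT i ts P c1 t ts' c2)
 have s: "tm_step (prog_tm nt c0) (s, ts) = (s + 1, ts)"
  using run_IfT prog_tm_step[of s c0 i _ _ ts nt] by (auto simp: code_at_append code_at_single code_at_Cons)
 have "(tm_step (prog_tm nt c0) ^^ t) (s + 1, ts) = (s + 1 + csize c1, ts')"
  using run_IfT by (auto simp: code_at_append code_at_single code_at_Cons)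
 moreover have "tm_step (prog_tm nt c0) (s + 1 + csize c1, ts') = (s + 2 + csize c1 + csize c2, ts')"
  using run_IfT prog_tm_step[of "s + 1 + csize c1" c0 0 _ _ ts' nt] run_length[OF run_IfT.hyps(3)]
  by (auto simp: code_at_append code_at_single code_at_Cons)
 ultimately have "(tm_step (prog_tm nt c0) ^^ (1 + (t + 1))) (s, ts) = (s + 2 + csize c1 + csize c2, ts')"
  unfolding funpow_add using s by (simp add: funpow_swap1)
 then show ?case by (simp add: ac_simps)
next
 case (run_IfF i ts P c2 t ts' c1)
 have s: "tm_step (prog_tm nt c0) (s, ts) = (s + 2 + csize c1, ts)"
  using run_IfF prog_tm_step[of s c0 i _ _ ts nt] by (auto simp: code_at_append code_at_single code_at_Cons)
 have "(tm_step (prog_tm nt c0) ^^ t) (s + 2 + csize c1, ts) = (s + 2 + csize c1 + csize c2, ts')"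
  using run_IfF by (auto simp: code_at_append code_at_single code_at_Cons numeral_2_eq_2)
 then have "(tm_step (prog_tm nt c0) ^^ (t + 1)) (s, ts) = (s + 2 + csize c1 + csize c2, ts')"
  unfolding funpow_add using s by simp
 then show ?case by (simp add: ac_simps)
next
 case (run_WhileF i ts P c)
 then have "tm_step (prog_tm nt c0) (s, ts) = (s + 2 + csize c, ts)"
  using prog_tm_step[of s c0 i _ _ ts nt] by (auto simp: code_at_append code_at_single code_at_Cons)
 then show ?case by (simp add: ac_simps)
next
 case (run_WhileT i ts P c t1 ts1 t2 ts2)
 have s: "tm_step (prog_tm nt c0) (s, ts) = (s + 1, ts)"
  using run_WhileT prog_tm_step[of s c0 i _ _ ts nt] by (auto simp: code_at_append code_at_single code_at_Cons)
 have "(tm_step (prog_tm nt c0) ^^ t1) (s + 1, ts) = (s + 1 + csize c, ts1)"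
  using run_WhileT by (auto simp: code_at_append code_at_single code_at_Cons)
 moreover have "tm_step (prog_tm nt c0) (s + 1 + csize c, ts1) = (s, ts1)"
  using run_WhileT prog_tm_step[of "s + 1 + csize c" c0 0 _ _ ts1 nt] run_length[OF run_WhileT.hyps(3)]
  by (auto simp: code_at_append code_at_single code_at_Cons)
 moreover have "(tm_step (prog_tm nt c0) ^^ t2) (s, ts1) = (s + csize (WhileC i P c), ts2)"
  using run_WhileT run_length[OF run_WhileT.hyps(3)] by auto
 ultimately have "(tm_step (prog_tm nt c0) ^^ (t2 + (1 + (t1 + 1)))) (s, ts) = (s + csize (WhileC i P c), ts2)"
  unfolding funpow_add using s by simp
 then show ?case by (simp add: ac_simps)
qed

lemma tm_step_halted: "fst cf = halt M ==> (tm_step M ^^ t) cf = cf"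
 by (induction t) (auto simp: tm_step_def)

lemma run_outputs_within:
 assumes "run c (snd (initial_config (prog_tm nt c) w)) t ts'" "fst (ts' ! 1) = tape_content v" "t \<le> T" "2 \<le> nt"
 shows "outputs_within (prog_tm nt c) T w v"
proof -
 have "(tm_step (prog_tm nt c) ^^ t) (initial_config (prog_tm nt c) w) = (csize c, ts')"
  using run_tm_steps[OF assms(1), of c 0 nt] assms(4)
  by (auto simp: initial_config_def code_at_def prog_tm_def)
 then have "(tm_step (prog_tm nt c) ^^ (T - t + t)) (initial_config (prog_tm nt c) w) = (csize c, ts')"
  unfolding funpow_add by (simp add: tm_step_halted prog_tm_def)
 then show ?thesis using assms by (simp add: outputs_within_def prog_tm_def)
qed

section \<open>Counter programs\<close>

text \<open>A counter is a tape whose value is its head position; cell 0 carries the mark 4.\<close>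

definition ctr :: "nat => tape" where
 "ctr v = (%i. if i = 0 then 4 else 0, int v)"

type_synonym cstate = "nat \<times> nat list \<times> (nat => nat)"

fun conf :: "nat => nat list => cstate => tape list" where
 "conf nc w (h, out, f) =
   (tape_content w, int h) # (tape_content out, int (length out)) # map (%j. ctr (f j)) [0..<nc]"

definition ex :: "nat => nat list => cmd => cstate => nat => cstate => bool" where
 "ex nc w c s T s' \<longleftrightarrow> (\<exists>t\<le>T. run c (conf nc w s) t (conf nc w s'))"

lemma ex_mono: "ex nc w c s T s' ==> T \<le> T' ==> ex nc w c s T' s'"
 unfolding ex_def by (meson le_trans)

lemma ex_Seq: "ex nc w c1 s T1 s1 ==> ex nc w c2 s1 T2 s2 ==> ex nc w (c1 ;; c2) s (T1 + T2) s2"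
 unfolding ex_def by (meson add_mono run_Seq)

abbreviation "inc r \<equiv> Act (r + 2) (%a. (a, MRight))"
abbreviation "dec r \<equiv> Act (r + 2) (%a. (a, MLeft))"
abbreviation "inR \<equiv> Act 0 (%a. (a, MRight))"
abbreviation "inL \<equiv> Act 0 (%a. (a, MLeft))"
abbreviation "whileNZ r \<equiv> WhileC (r + 2) (%a. a \<noteq> 4)"
abbreviation "ifNZ r \<equiv> IfC (r + 2) (%a. a \<noteq> 4)"

lemma length_conf [simp]: "length (conf nc w s) = nc + 2"
 by (cases s) auto

lemma nth_conf [simp]:
 "conf nc w (h, out, f) ! 0 = (tape_content w, int h)"
 "conf nc w (h, out, f) ! Suc 0 = (tape_content out, int (length out))"
 "r < nc ==> conf nc w (h, out, f) ! Suc (Suc r) = ctr (f r)"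
 by simp_all

lemma read_ctr: "read_tape (ctr v) = 4 \<longleftrightarrow> v = 0"
 by (simp add: ctr_def read_tape_def)

lemma conf_upd:
 "(conf nc w (h, out, f))[0 := (tape_content w, int h')] = conf nc w (h', out, f)"
 "(conf nc w (h, out, f))[Suc 0 := (tape_content out', int (length out'))] = conf nc w (h, out', f)"
 "r < nc ==> (conf nc w (h, out, f))[Suc (Suc r) := ctr v] = conf nc w (h, out, f(r := v))"
 by (auto intro!: nth_equalityI simp: nth_list_update)

declare conf.simps [simp del]

lemma act_keep: "act_tape t (read_tape t, m) = (fst t, move_head m (snd t))"
 by (simp add: act_tape_def read_tape_def)

lemma ex_Act:
 assumes "i < nc + 2" "(conf nc w s)[i := act_tape (conf nc w s ! i) (f (read_tape (conf nc w s ! i)))] = conf nc w s'"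
 shows "ex nc w (Act i f) s 1 s'"
 unfolding ex_def using run_Act[of i "conf nc w s" f] assms by (intro exI[of _ 1]) simp

lemma ctr_move: "act_tape (ctr v) (read_tape (ctr v), MRight) = ctr (Suc v)"
 "0 < v ==> act_tape (ctr v) (read_tape (ctr v), MLeft) = ctr (v - 1)"
 unfolding act_keep by (auto simp: ctr_def)

lemma ex_inc: "r < nc ==> ex nc w (inc r) (h, out, f) 1 (h, out, f(r := Suc (f r)))"
 by (rule ex_Act) (simp_all add: ctr_move conf_upd)

lemma ex_dec: "r < nc ==> 0 < f r ==> ex nc w (dec r) (h, out, f) 1 (h, out, f(r := f r - 1))"
 by (rule ex_Act) (simp_all add: ctr_move conf_upd)

lemma ex_inR: "ex nc w inR (h, out, f) 1 (Suc h, out, f)"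
 using conf_upd(1)[of nc w h out f "Suc h"] by (intro ex_Act) (simp_all add: act_keep add.commute)

lemma ex_inL: "0 < h ==> ex nc w inL (h, out, f) 1 (h - 1, out, f)"
 using conf_upd(1)[of nc w h out f "h - 1"] by (intro ex_Act) (simp_all add: act_keep of_nat_diff)

lemma tape_content_snoc: "(tape_content out)(int (length out) := a) = tape_content (out @ [a])"
 by (auto simp: tape_content_def nth_append fun_eq_iff)

lemma ex_out: "ex nc w (Act 1 (%_. (a, MRight))) (h, out, f) 1 (h, out @ [a], f)"
 using conf_upd(2)[of nc w h out f "out @ [a]"]
 by (intro ex_Act) (simp_all add: act_tape_def tape_content_snoc add.commute)

lemma ex_ifNZ:
 assumes "r < nc" "0 < f r ==> ex nc w c1 (h, out, f) T s'" "f r = 0 ==> ex nc w c2 (h, out, f) T s'"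
 shows "ex nc w (ifNZ r c1 c2) (h, out, f) (T + 2) s'"
proof (cases "f r = 0")
 case True
 then obtain t where "t \<le> T" "run c2 (conf nc w (h, out, f)) t (conf nc w s')"
  using assms(3) by (auto simp: ex_def)
 then show ?thesis using True assms(1)
  run_IfF[of "r + 2" "conf nc w (h, out, f)" "%a. a \<noteq> 4" c2 t _ c1]
  unfolding ex_def by (intro exI[of _ "t + 1"]) (auto simp: read_ctr)
next
 case False
 then obtain t where "t \<le> T" "run c1 (conf nc w (h, out, f)) t (conf nc w s')"
  using assms(2) by (auto simp: ex_def)
 then show ?thesis using False assms(1)
  run_IfT[of "r + 2" "conf nc w (h, out, f)" "%a. a \<noteq> 4" c1 t _ c2]
  unfolding ex_def by (intro exI[of _ "t + 2"]) (auto simp: read_ctr)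
qed

lemma ex_whileNZ:
 assumes "r < nc" "\<And>i. i < n ==> 0 < snd (snd (S i)) r \<and> ex nc w c (S i) T (S (Suc i))" "snd (snd (S n)) r = 0"
 shows "ex nc w (whileNZ r c) (S 0) (n * (T + 2) + 1) (S n)"
 using assms(2,3)
proof (induction n arbitrary: S)
 case 0
 obtain h out f where S: "S 0 = (h, out, f)" by (cases "S 0")
 show ?case using 0 assms(1) S run_WhileF[of "r + 2" "conf nc w (S 0)" "%a. a \<noteq> 4" c] unfolding ex_def
  by (intro exI[of _ 1]) (auto simp: read_ctr)
next
 case (Suc n)
 obtain h out f where S: "S 0 = (h, out, f)" by (cases "S 0")
 have "ex nc w (whileNZ r c) (S (Suc 0)) (n * (T + 2) + 1) (S (Suc n))"
  using Suc.IH[of "%i. S (Suc i)"] Suc.prems by auto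
 then obtain t2 where t2: "t2 \<le> n * (T + 2) + 1" "run (whileNZ r c) (conf nc w (S (Suc 0))) t2 (conf nc w (S (Suc n)))"
  by (auto simp: ex_def)
 obtain t1 where t1: "t1 \<le> T" "run c (conf nc w (S 0)) t1 (conf nc w (S (Suc 0)))"
  using Suc.prems(1)[of 0] by (auto simp: ex_def)
 have "run (whileNZ r c) (conf nc w (S 0)) (t1 + t2 + 2) (conf nc w (S (Suc n)))"
  by (rule run_WhileT[OF _ _ t1(2) t2(2)]) (use assms(1) S Suc.prems(1)[of 0] in \<open>auto simp: read_ctr\<close>)
 then show ?case unfolding ex_def using t1(1) t2(1) by (intro exI[of _ "t1 + t2 + 2"]) auto
qed

definition "clear r = whileNZ r (dec r)"
definition "mov r d = whileNZ r (dec r ;; inc d)"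
definition "acopy r d tmp = whileNZ r (dec r ;; inc d ;; inc tmp) ;; mov tmp r"

lemma ex_clear:
 assumes "r < nc"
 shows "ex nc w (clear r) (h, out, f) (3 * f r + 1) (h, out, f(r := 0))"
proof -
 define S where "S i = (h, out, f(r := f r - i))" for i
 have "ex nc w (dec r) (S i) 1 (S (Suc i))" if "i < f r" for i
  using ex_dec[of r nc "f(r := f r - i)" w h out] that assms by (simp add: S_def)
 then have "ex nc w (whileNZ r (dec r)) (S 0) (f r * (1 + 2) + 1) (S (f r))"
  by (intro ex_whileNZ) (use assms in \<open>auto simp: S_def\<close>)
 then have "ex nc w (whileNZ r (dec r)) (S 0) (3 * f r + 1) (S (f r))" by (rule ex_mono) simp
 then show ?thesis by (simp add: S_def clear_def)
qed

lemma ex_mov: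
 assumes "r < nc" "d < nc" "r \<noteq> d"
 shows "ex nc w (mov r d) (h, out, f) (4 * f r + 1) (h, out, f(r := 0, d := f d + f r))"
proof -
 define S where "S i = (h, out, f(r := f r - i, d := f d + i))" for i
 have "ex nc w (dec r ;; inc d) (S i) (1 + 1) (S (Suc i))" if "i < f r" for i
 proof -
  have 1: "ex nc w (dec r) (S i) 1 (h, out, f(r := f r - Suc i, d := f d + i))"
   using ex_dec[of r nc "f(r := f r - i, d := f d + i)" w h out] that assms
   by (simp add: S_def fun_upd_twist)
  have 2: "ex nc w (inc d) (h, out, f(r := f r - Suc i, d := f d + i)) 1 (S (Suc i))"
   using ex_inc[of d nc w h out "f(r := f r - Suc i, d := f d + i)"] assms
   by (simp add: S_def)
  show ?thesis by (rule ex_Seq[OF 1 2])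
 qed
 then have "ex nc w (whileNZ r (dec r ;; inc d)) (S 0) (f r * (1 + 1 + 2) + 1) (S (f r))"
  by (intro ex_whileNZ) (use assms in \<open>auto simp: S_def\<close>)
 then have "ex nc w (whileNZ r (dec r ;; inc d)) (S 0) (4 * f r + 1) (S (f r))" by (rule ex_mono) simp
 then show ?thesis using assms by (simp add: S_def mov_def)
qed

lemma ex_acopy:
 assumes "r < nc" "d < nc" "tmp < nc" "r \<noteq> d" "r \<noteq> tmp" "d \<noteq> tmp" "f tmp = 0"
 shows "ex nc w (acopy r d tmp) (h, out, f) (9 * f r + 2) (h, out, f(d := f d + f r))"
proof -
 define S where "S i = (h, out, f(r := f r - i, d := f d + i, tmp := i))" for i
 have "ex nc w (dec r ;; inc d ;; inc tmp) (S i) (1 + (1 + 1)) (S (Suc i))" if "i < f r" for i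
 proof -
  have 1: "ex nc w (dec r) (S i) 1 (h, out, f(r := f r - Suc i, d := f d + i, tmp := i))"
   using ex_dec[of r nc "f(r := f r - i, d := f d + i, tmp := i)" w h out] that assms
   by (simp add: S_def fun_upd_twist)
  have 2: "ex nc w (inc d) (h, out, f(r := f r - Suc i, d := f d + i, tmp := i)) 1
    (h, out, f(r := f r - Suc i, d := f d + Suc i, tmp := i))"
   using ex_inc[of d nc w h out "f(r := f r - Suc i, d := f d + i, tmp := i)"] assms
   by (simp add: fun_upd_twist)
  have 3: "ex nc w (inc tmp) (h, out, f(r := f r - Suc i, d := f d + Suc i, tmp := i)) 1 (S (Suc i))"
   using ex_inc[of tmp nc w h out "f(r := f r - Suc i, d := f d + Suc i, tmp := i)"] assms
   by (simp add: S_def)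
  show ?thesis by (rule ex_Seq[OF 1 ex_Seq[OF 2 3]])
 qed
 then have A: "ex nc w (whileNZ r (dec r ;; inc d ;; inc tmp)) (S 0) (f r * (1 + (1 + 1) + 2) + 1) (S (f r))"
  by (intro ex_whileNZ) (use assms in \<open>auto simp: S_def\<close>)
 have S0: "S 0 = (h, out, f)" using assms by (auto simp: S_def)
 have "(f(r := 0, d := f d + f r, tmp := f r))(tmp := 0, r := 0 + f r) = f(d := f d + f r)"
  using assms by (auto simp: fun_eq_iff)
 then have B: "ex nc w (mov tmp r) (S (f r)) (4 * f r + 1) (h, out, f(d := f d + f r))"
  using ex_mov[of tmp nc r w h out "f(r := 0, d := f d + f r, tmp := f r)"] assms by (simp add: S_def)
 show ?thesis unfolding acopy_def S0[symmetric]
  by (rule ex_mono[OF ex_Seq[OF A B]]) simp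
qed

section \<open>Bounded arithmetic expressions\<close>

text \<open>
 Numbers are handled in unary, so polynomially bounded values cost polynomial time.
 \<open>Rec N B I S\<close> is primitive recursion with \<open>N\<close> steps from \<open>I\<close>, truncated at the bound \<open>B\<close>;
 variables are de Bruijn indices and \<open>Rd\<close> reads a symbol of the input word.
\<close>

datatype aexp = Var nat | Cst nat | Rd aexp | Add aexp aexp | Mul aexp aexp | Rec aexp aexp aexp aexp

fun ev :: "aexp => nat list => nat list => nat" where
 "ev (Var i) w e = (if i < length e then e ! i else 0)"
| "ev (Cst c) w e = c"
| "ev (Rd a) w e = (if ev a w e < length w \<and> w ! ev a w e \<le> 3 then w ! ev a w e else 0)"
| "ev (Add a b) w e = ev a w e + ev b w e"
| "ev (Mul a b) w e = ev a w e * ev b w e"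
| "ev (Rec N B I S) w e = rec_nat (ev I w e) (%i acc. min (ev S w (acc # i # e)) (ev B w e)) (ev N w e)"

fun need :: "aexp => nat" where
 "need (Var i) = 2"
| "need (Cst c) = 1"
| "need (Rd a) = max (need a) 2"
| "need (Add a b) = max (need a) (need b + 1)"
| "need (Mul a b) = max (max (need a) (need b + 1)) 4"
| "need (Rec N B I S) = max (max (need N) (need B + 1)) (max (max (need I + 2) (need S + 4)) 7)"

lemma need_pos: "1 \<le> need t"
 by (induction t) auto

fun incn :: "nat => nat => cmd" where
 "incn D 0 = clear D"
| "incn D (Suc c) = incn D c ;; inc D"

definition "mulloop D = whileNZ D (dec D ;; acopy (D + 1) (D + 2) (D + 3))"
text \<open>\<open>clear z\<close> meets an empty counter and serves as doing nothing.\<close>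

definition "minmov r b d z = whileNZ r (dec r ;; ifNZ b (dec b ;; inc d) (clear z)) ;; clear b"
definition "readin D = IfC 0 (%a. a = 1) (inc D) (IfC 0 (%a. a = 2) (inc D ;; inc D)
  (IfC 0 (%a. a = 3) (inc D ;; inc D ;; inc D) (clear D)))"

text \<open>Stack discipline: the counters from \<open>D\<close> on are zero at the start, and at
  the end \<open>D\<close> holds the value while the others are zero again. The counters of the
  variables, listed in \<sigma>, lie below \<open>D\<close>.\<close>

fun ccomp :: "aexp => nat list => nat => cmd" where
 "ccomp (Var i) \<sigma> D = (if i < length \<sigma> then acopy (\<sigma> ! i) D (D + 1) else clear D)"
| "ccomp (Cst c) \<sigma> D = incn D c"
| "ccomp (Rd a) \<sigma> D = ccomp a \<sigma> D ;; whileNZ D (dec D ;; inc (D + 1) ;; inR) ;; readin D ;; whileNZ (D + 1) (dec (D + 1) ;; inL)"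
| "ccomp (Add a b) \<sigma> D = ccomp a \<sigma> D ;; ccomp b \<sigma> (D + 1) ;; mov (D + 1) D"
| "ccomp (Mul a b) \<sigma> D = ccomp a \<sigma> D ;; ccomp b \<sigma> (D + 1) ;; mulloop D ;; clear (D + 1) ;; mov (D + 2) D"
| "ccomp (Rec N B I S) \<sigma> D = ccomp N \<sigma> D ;; ccomp B \<sigma> (D + 1) ;; ccomp I \<sigma> (D + 2) ;;
   whileNZ D (dec D ;; ccomp S ((D + 2) # (D + 3) # \<sigma>) (D + 4) ;; acopy (D + 1) (D + 5) (D + 6) ;; clear (D + 2) ;;
    minmov (D + 4) (D + 5) (D + 2) (D + 6) ;; inc (D + 3)) ;;
   clear (D + 1) ;; clear (D + 3) ;; mov (D + 2) D"

text \<open>Bounds the value when all variables are at most X. In \<open>Rec\<close> the cap makes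
  the bound independent of the number of steps; this keeps nested recursions polynomial.\<close>

fun vb :: "aexp => nat => nat" where
 "vb (Var i) X = X"
| "vb (Cst c) X = c"
| "vb (Rd a) X = 3"
| "vb (Add a b) X = vb a X + vb b X"
| "vb (Mul a b) X = vb a X * vb b X"
| "vb (Rec N B I S) X = vb B X + vb I X"

fun tb :: "aexp => nat => nat" where
 "tb (Var i) X = 9 * X + 2"
| "tb (Cst c) X = c + 1"
| "tb (Rd a) X = tb a X + (vb a X * 5 + 1 + (10 + (vb a X * 4 + 1)))"
| "tb (Add a b) X = tb a X + (tb b X + (4 * vb b X + 1))"
| "tb (Mul a b) X = tb a X + (tb b X + ((vb a X * (9 * vb b X + 5) + 1) + ((3 * vb b X + 1) + (4 * (vb a X * vb b X) + 1))))"
| "tb (Rec N B I S) X = (let V = vb B X + vb I X; Y = X + vb N X + V in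
   tb N X + (tb B X + (tb I X + ((vb N X * ((1 + (tb S Y + ((9 * vb B X + 2) + ((3 * V + 1) +
    ((vb S Y * 7 + 1 + (3 * vb B X + 1)) + 1))))) + 2) + 1) + ((3 * vb B X + 1) + ((3 * vb N X + 1) + (4 * V + 1)))))))"

lemma ev_le_vb:
 assumes "\<And>v. v \<in> set e ==> v \<le> X"
 shows "ev t w e \<le> vb t X"
 using assms
proof (induction t arbitrary: e X)
 case (Mul a b)
 then show ?case by (simp add: mult_mono)
next
 case (Add a b)
 then show ?case by (simp add: add_mono)
next
 case (Rec N B I S)
 have "ev I w e \<le> vb I X" "ev B w e \<le> vb B X" using Rec by auto
 then show ?case by (cases "ev N w e") (auto intro: le_trans[OF min.cobounded2])
qed (auto)

lemma rec_step_le: "rec_nat a (%i acc. min (g i acc) b) i \<le> a + (b::nat)"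
 by (cases i) auto

lemma wf_acopy [simp]: "wf_cmd nt (acopy r d z) \<longleftrightarrow> r + 2 < nt \<and> d + 2 < nt \<and> z + 2 < nt"
 "wf_cmd nt (clear r) \<longleftrightarrow> r + 2 < nt" "wf_cmd nt (mov r d) \<longleftrightarrow> r + 2 < nt \<and> d + 2 < nt"
 by (auto simp: acopy_def clear_def mov_def)

lemma wf_incn [simp]: "wf_cmd nt (incn D c) \<longleftrightarrow> D + 2 < nt"
 by (induction c) auto

lemma wf_ccomp: "D + need t + 2 \<le> nt ==> (\<And>s. s \<in> set \<sigma> ==> s < D) ==> wf_cmd nt (ccomp t \<sigma> D)"
proof (induction t arbitrary: \<sigma> D)
 case (Var i)
 then show ?case using nth_mem[of i \<sigma>] by fastforce
next
 case (Rec N B I S)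
 have "wf_cmd nt (ccomp N \<sigma> D)" by (rule Rec.IH(1)) (use Rec.prems in auto)
 moreover have "wf_cmd nt (ccomp B \<sigma> (D + 1))" by (rule Rec.IH(2)) (use Rec.prems in \<open>auto intro: less_SucI\<close>)
 moreover have "wf_cmd nt (ccomp I \<sigma> (D + 2))" by (rule Rec.IH(3)) (use Rec.prems in \<open>auto intro: less_SucI\<close>)
 moreover have "wf_cmd nt (ccomp S ((D + 2) # (D + 3) # \<sigma>) (D + 4))"
  by (rule Rec.IH(4)) (use Rec.prems in \<open>auto simp: less_Suc_eq dest!: \<close>, use Rec.prems(2) in fastforce)
 ultimately show ?case using Rec.prems by (auto simp: minmov_def)
next
 case (Rd a)
 then show ?case by (auto simp: readin_def)
next
 case (Add a b)
 have "wf_cmd nt (ccomp a \<sigma> D)" by (rule Add.IH(1)) (use Add.prems in auto)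
 moreover have "wf_cmd nt (ccomp b \<sigma> (D + 1))" by (rule Add.IH(2)) (use Add.prems in \<open>auto intro: less_SucI\<close>)
 ultimately show ?case using Add.prems need_pos[of b] by auto
next
 case (Mul a b)
 have "wf_cmd nt (ccomp a \<sigma> D)" by (rule Mul.IH(1)) (use Mul.prems in auto)
 moreover have "wf_cmd nt (ccomp b \<sigma> (D + 1))" by (rule Mul.IH(2)) (use Mul.prems in \<open>auto intro: less_SucI\<close>)
 ultimately show ?case using Mul.prems by (auto simp: mulloop_def)
qed auto

lemma ex_cong: "ex nc w c s T s' ==> s' = s'' ==> ex nc w c s T s''"
 by simp

lemma ex_incn: "D < nc ==> f D = 0 ==> ex nc w (incn D c) (h, out, f) (c + 1) (h, out, f(D := c))"
proof (induction c)
 case 0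
 then show ?case using ex_clear[OF 0(1), of w h out f] by (simp only: incn.simps mult_0_right add_0)
next
 case (Suc c)
 have "ex nc w (incn D (Suc c)) (h, out, f) (c + 1 + 1) (h, out, f(D := c, D := Suc ((f(D := c)) D)))"
  unfolding incn.simps by (rule ex_Seq[OF Suc.IH ex_inc]) (use Suc.prems in auto)
 then show ?case by (simp only: fun_upd_upd fun_upd_same Suc_eq_plus1)
qed

lemma ex_mulloop:
 assumes "D + 3 < nc" "f (D + 2) = 0" "f (D + 3) = 0"
 shows "ex nc w (mulloop D) (h, out, f) (f D * (9 * f (D + 1) + 5) + 1) (h, out, f(D := 0, D + 2 := f D * f (D + 1)))"
proof -
 define S where "S i = (h, out, f(D := f D - i, D + 2 := i * f (D + 1)))" for i
 have "ex nc w (dec D ;; acopy (D + 1) (D + 2) (D + 3)) (S i) (1 + (9 * f (D + 1) + 2)) (S (Suc i))" if "i < f D" for i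
 proof -
  have 1: "ex nc w (dec D) (S i) 1 (h, out, f(D := f D - Suc i, D + 2 := i * f (D + 1)))"
   using ex_dec[of D nc "f(D := f D - i, D + 2 := i * f (D + 1))" w h out] that assms
   by (simp add: S_def fun_upd_twist)
  have 2: "ex nc w (acopy (D + 1) (D + 2) (D + 3)) (h, out, f(D := f D - Suc i, D + 2 := i * f (D + 1)))
    (9 * f (D + 1) + 2) (S (Suc i))"
   using ex_acopy[of "D + 1" nc "D + 2" "D + 3" "f(D := f D - Suc i, D + 2 := i * f (D + 1))" w h out] assms
   by (simp add: S_def add.commute)
  show ?thesis by (rule ex_Seq[OF 1 2])
 qed
 then have "ex nc w (mulloop D) (S 0) (f D * (1 + (9 * f (D + 1) + 2) + 2) + 1) (S (f D))"
  unfolding mulloop_def by (intro ex_whileNZ) (use assms in \<open>auto simp: S_def\<close>)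
 then have "ex nc w (mulloop D) (S 0) (f D * (9 * f (D + 1) + 5) + 1) (S (f D))" by (rule ex_mono) (simp add: add_mult_distrib2)
 moreover have "f(D := f D, D + 2 := 0) = f" using assms by (auto simp: fun_eq_iff)
 ultimately show ?thesis by (simp add: S_def)
qed

lemma ex_minmov:
 assumes "r < nc" "b < nc" "d < nc" "z < nc" "distinct [r, b, d, z]" "f d = 0" "f z = 0"
 shows "ex nc w (minmov r b d z) (h, out, f) (f r * 7 + 1 + (3 * f b + 1)) (h, out, f(r := 0, b := 0, d := min (f r) (f b)))"
proof -
 define S where "S i = (h, out, f(r := f r - i, b := f b - i, d := min i (f b)))" for i
 have "ex nc w (dec r ;; ifNZ b (dec b ;; inc d) (clear z)) (S i) (1 + (1 + 1 + 2)) (S (Suc i))" if "i < f r" for i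
 proof -
  let ?g = "f(r := f r - Suc i, b := f b - i, d := min i (f b))"
  have 1: "ex nc w (dec r) (S i) 1 (h, out, ?g)"
   using ex_dec[of r nc "f(r := f r - i, b := f b - i, d := min i (f b))" w h out] that assms
   by (simp add: S_def fun_upd_twist)
  have 2: "ex nc w (dec b ;; inc d) (h, out, ?g) (1 + 1) (S (Suc i))" if "0 < ?g b"
  proof (rule ex_Seq)
   show "ex nc w (dec b) (h, out, ?g) 1 (h, out, ?g(b := ?g b - 1))" by (rule ex_dec) (use that assms in auto)
   have "?g(b := ?g b - 1, d := Suc ((?g(b := ?g b - 1)) d)) = f(r := f r - Suc i, b := f b - Suc i, d := min (Suc i) (f b))"
    using that assms by (auto simp: fun_eq_iff)
   then show "ex nc w (inc d) (h, out, ?g(b := ?g b - 1)) 1 (S (Suc i))"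
    unfolding S_def using ex_inc[of d nc w h out "?g(b := ?g b - 1)"] assms by metis
  qed
  have 3: "ex nc w (clear z) (h, out, ?g) (1 + 1) (S (Suc i))" if "?g b = 0"
  proof -
   have "?g(z := 0) = f(r := f r - Suc i, b := f b - Suc i, d := min (Suc i) (f b))"
    using that assms by (auto simp: fun_eq_iff)
   moreover have "?g z = 0" using assms by auto
   ultimately show ?thesis unfolding S_def
    using ex_mono[OF ex_clear[of z nc w h out ?g], of 2] assms by (simp add: numeral_2_eq_2)
  qed
  show ?thesis by (rule ex_Seq[OF 1 ex_ifNZ[OF assms(2) 2 3]])
 qed
 then have A: "ex nc w (whileNZ r (dec r ;; ifNZ b (dec b ;; inc d) (clear z))) (S 0) (f r * (1 + (1 + 1 + 2) + 2) + 1) (S (f r))"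
  by (intro ex_whileNZ) (use assms in \<open>auto simp: S_def\<close>)
 have B: "ex nc w (clear b) (S (f r)) (3 * (f b - f r) + 1) (h, out, f(r := 0, b := 0, d := min (f r) (f b)))"
  using ex_clear[of b nc w h out "f(r := 0, b := f b - f r, d := min (f r) (f b))"] assms
  by (simp add: S_def fun_upd_twist)
 have S0: "S 0 = (h, out, f)" using assms by (auto simp: S_def)
 show ?thesis unfolding minmov_def S0[symmetric] by (rule ex_mono[OF ex_Seq[OF A B]]) simp
qed

lemma ex_IfC0:
 assumes "P (tape_content w (int h)) ==> ex nc w c1 (h, out, f) T s'"
  "\<not> P (tape_content w (int h)) ==> ex nc w c2 (h, out, f) T s'"
 shows "ex nc w (IfC 0 P c1 c2) (h, out, f) (T + 2) s'"
proof (cases "P (tape_content w (int h))")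
 case True
 then obtain t where "t \<le> T" "run c1 (conf nc w (h, out, f)) t (conf nc w s')"
  using assms by (auto simp: ex_def)
 then show ?thesis using True
  run_IfT[of 0 "conf nc w (h, out, f)" P c1 t _ c2]
  unfolding ex_def by (intro exI[of _ "t + 2"]) (auto simp: read_tape_def)
next
 case False
 then obtain t where "t \<le> T" "run c2 (conf nc w (h, out, f)) t (conf nc w s')"
  using assms by (auto simp: ex_def)
 then show ?thesis using False
  run_IfF[of 0 "conf nc w (h, out, f)" P c2 t _ c1]
  unfolding ex_def by (intro exI[of _ "t + 1"]) (auto simp: read_tape_def)
qed

lemma ex_readin:
 assumes "D < nc" "f D = 0"
 shows "ex nc w (readin D) (h, out, f) 10 (h, out, f(D := if tape_content w (int h) \<le> 3 then tape_content w (int h) else 0))"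
proof -
 let ?s = "tape_content w (int h)" let ?r = "(h, out, f(D := if ?s \<le> 3 then ?s else 0))"
 have i1: "ex nc w (inc D) (h, out, f) 1 (h, out, f(D := 1))" using ex_inc[of D nc w h out f] assms by simp
 have i2: "ex nc w (inc D) (h, out, f(D := 1)) 1 (h, out, f(D := 2))" using ex_inc[of D nc w h out "f(D := 1)"] assms by (simp add: numeral_2_eq_2)
 have i3: "ex nc w (inc D) (h, out, f(D := 2)) 1 (h, out, f(D := 3))" using ex_inc[of D nc w h out "f(D := 2)"] assms by (simp add: numeral_3_eq_3)
 have i4: "ex nc w (clear D) (h, out, f) 1 (h, out, f(D := 0))" using ex_clear[of D nc w h out f] assms by simp
 have "ex nc w (readin D) (h, out, f) (((4 + 2) + 2) + 2) ?r"
  unfolding readin_def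
 proof (rule ex_IfC0)
  show "ex nc w (inc D) (h, out, f) (4 + 2 + 2) ?r" if "?s = 1" using ex_mono[OF i1, of "4 + 2 + 2"] that by simp
  show "ex nc w (IfC 0 (%a. a = 2) (inc D ;; inc D) (IfC 0 (%a. a = 3) (inc D ;; inc D ;; inc D) (clear D))) (h, out, f) (4 + 2 + 2) ?r"
   if "?s \<noteq> 1"
  proof (rule ex_IfC0)
   show "ex nc w (inc D ;; inc D) (h, out, f) (4 + 2) ?r" if "?s = 2" using ex_mono[OF ex_Seq[OF i1 i2], of "4 + 2"] that by simp
   show "ex nc w (IfC 0 (%a. a = 3) (inc D ;; inc D ;; inc D) (clear D)) (h, out, f) (4 + 2) ?r" if "?s \<noteq> 2"
   proof (rule ex_IfC0)
    show "ex nc w (inc D ;; inc D ;; inc D) (h, out, f) 4 ?r" if "?s = 3"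
     using ex_mono[OF ex_Seq[OF i1 ex_Seq[OF i2 i3]], of 4] that by simp
    show "ex nc w (clear D) (h, out, f) 4 ?r" if "?s \<noteq> 3"
     using ex_mono[OF i4, of 4] that \<open>?s \<noteq> 1\<close> \<open>?s \<noteq> 2\<close> by (cases "?s \<le> 3") (auto simp: le_Suc_eq numeral_3_eq_3 numeral_2_eq_2)
   qed
  qed
 qed
 then show ?thesis by simp
qed

lemma ccomp_correct:
 assumes "D + need t \<le> nc" "\<And>j. D \<le> j ==> f j = 0" "\<And>s. s \<in> set \<sigma> ==> s < D"
  "map f \<sigma> = e" "length w \<le> X" "\<And>v. v \<in> set e ==> v \<le> X"
 shows "ex nc w (ccomp t \<sigma> D) (0, out, f) (tb t X) (0, out, f(D := ev t w e))"
 using assms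
proof (induction t arbitrary: \<sigma> D f e X)
 case (Var i)
 show ?case
 proof (cases "i < length \<sigma>")
  case True
  then have l: "\<sigma> ! i < D" using Var by auto
  have le: "length e = length \<sigma>" using Var.prems(4) by auto
  have fi: "f (\<sigma> ! i) = e ! i" using Var.prems(4) True by (metis nth_map)
  have fx: "e ! i \<le> X" using Var.prems(6) True le by (metis nth_mem)
  have A: "ex nc w (acopy (\<sigma> ! i) D (D + 1)) (0, out, f) (9 * f (\<sigma> ! i) + 2) (0, out, f(D := f D + f (\<sigma> ! i)))"
   by (rule ex_acopy) (use l Var in auto)
  have U: "f(D := f D + f (\<sigma> ! i)) = f(D := ev (Var i) w e)"
   using fi le Var.prems(2)[of D] True by simp
  have "9 * f (\<sigma> ! i) + 2 \<le> tb (Var i) X" using fi fx by simp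
  from ex_mono[OF A this] show ?thesis unfolding U using True by (simp only: ccomp.simps if_True)
 next
  case False
  then have "f(D := 0) = f(D := ev (Var i) w e)" using Var.prems(4) by auto
  moreover have "ex nc w (clear D) (0, out, f) (tb (Var i) X) (0, out, f(D := 0))"
   by (rule ex_mono[OF ex_clear]) (use Var.prems(1,2) in auto)
  ultimately show ?thesis using False by (simp only: ccomp.simps if_False)
 qed
next
 case (Cst c)
 then have "D < nc" "f D = 0" by auto
 from ex_incn[of D nc f w c 0 out, OF this] show ?case by (simp only: ccomp.simps tb.simps ev.simps)
next
 case (Rd a)
 define v where "v = ev a w e"
 have v: "v \<le> vb a X" unfolding v_def using ev_le_vb Rd.prems(6) by blast
 have A: "ex nc w (ccomp a \<sigma> D) (0, out, f) (tb a X) (0, out, f(D := v))"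
  unfolding v_def by (rule Rd.IH) (use Rd.prems in auto)
 have nc: "D + 1 < nc" using Rd.prems(1) by auto
 have fz: "f D = 0" "f (D + 1) = 0" using Rd.prems(2) by auto
 define S where "S i = (i, out, f(D := v - i, D + 1 := i))" for i
 have "ex nc w (dec D ;; inc (D + 1) ;; inR) (S i) (1 + (1 + 1)) (S (Suc i))" if "i < v" for i
 proof -
  have 1: "ex nc w (dec D) (S i) 1 (i, out, f(D := v - Suc i, D + 1 := i))"
   using ex_dec[of D nc "f(D := v - i, D + 1 := i)" w i out] that nc by (simp add: S_def fun_upd_twist)
  have 2: "ex nc w (inc (D + 1)) (i, out, f(D := v - Suc i, D + 1 := i)) 1 (i, out, f(D := v - Suc i, D + 1 := Suc i))"
   using ex_inc[of "D + 1" nc w i out "f(D := v - Suc i, D + 1 := i)"] nc by simp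
  have 3: "ex nc w inR (i, out, f(D := v - Suc i, D + 1 := Suc i)) 1 (S (Suc i))"
   unfolding S_def by (rule ex_inR)
  show ?thesis by (rule ex_Seq[OF 1 ex_Seq[OF 2 3]])
 qed
 then have "ex nc w (whileNZ D (dec D ;; inc (D + 1) ;; inR)) (S 0) (v * (1 + (1 + 1) + 2) + 1) (S v)"
  by (intro ex_whileNZ) (use nc in \<open>auto simp: S_def\<close>)
 moreover have "S 0 = (0, out, f(D := v))" using fz by (auto simp: S_def fun_eq_iff)
 ultimately have B: "ex nc w (whileNZ D (dec D ;; inc (D + 1) ;; inR)) (0, out, f(D := v)) (vb a X * 5 + 1) (S v)"
  using v by (auto elim!: ex_mono)
 define r where "r = (if tape_content w (int v) \<le> 3 then tape_content w (int v) else 0)"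
 have r: "r = ev (Rd a) w e" unfolding r_def v_def by (auto simp: tape_content_def)
 have C: "ex nc w (readin D) (S v) 10 (v, out, f(D := r, D + 1 := v))"
  using ex_readin[of D nc "f(D := 0, D + 1 := v)" w v out] nc by (simp add: S_def r_def fun_upd_twist)
 define U where "U i = (v - i, out, f(D := r, D + 1 := v - i))" for i
 have "ex nc w (dec (D + 1) ;; inL) (U i) (1 + 1) (U (Suc i))" if "i < v" for i
 proof -
  have 1: "ex nc w (dec (D + 1)) (U i) 1 (v - i, out, f(D := r, D + 1 := v - Suc i))"
   using ex_dec[of "D + 1" nc "f(D := r, D + 1 := v - i)" w "v - i" out] that nc by (simp add: U_def)
  have 2: "ex nc w inL (v - i, out, f(D := r, D + 1 := v - Suc i)) 1 (U (Suc i))"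
   using ex_inL[of "v - i" nc w out "f(D := r, D + 1 := v - Suc i)"] that by (simp add: U_def)
  show ?thesis by (rule ex_Seq[OF 1 2])
 qed
 then have "ex nc w (whileNZ (D + 1) (dec (D + 1) ;; inL)) (U 0) (v * (1 + 1 + 2) + 1) (U v)"
  by (intro ex_whileNZ) (use nc in \<open>auto simp: U_def\<close>)
 moreover have "U v = (0, out, f(D := r))" using fz by (auto simp: U_def fun_eq_iff)
 ultimately have E: "ex nc w (whileNZ (D + 1) (dec (D + 1) ;; inL)) (v, out, f(D := r, D + 1 := v)) (vb a X * 4 + 1) (0, out, f(D := r))"
  using v by (auto simp: U_def elim!: ex_mono)
 show ?case using ex_Seq[OF A ex_Seq[OF B ex_Seq[OF C E]]] by (simp only: ccomp.simps tb.simps r)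
next
 case (Add a b)
 have A: "ex nc w (ccomp a \<sigma> D) (0, out, f) (tb a X) (0, out, f(D := ev a w e))"
  by (rule Add.IH) (use Add.prems in auto)
 have mf: "map (f(D := x)) \<sigma> = e" for x unfolding Add.prems(4)[symmetric]
  by (rule map_cong) (use Add.prems(3) in fastforce)+
 have B: "ex nc w (ccomp b \<sigma> (D + 1)) (0, out, f(D := ev a w e)) (tb b X) (0, out, f(D := ev a w e, D + 1 := ev b w e))"
  by (rule Add.IH) (use Add.prems mf in \<open>auto intro: less_SucI\<close>)
 have v: "ev b w e \<le> vb b X" using ev_le_vb Add.prems(6) by blast
 have "D + 1 < nc" using Add.prems(1) need_pos[of b] by auto
 then have C: "ex nc w (mov (D + 1) D) (0, out, f(D := ev a w e, D + 1 := ev b w e)) (4 * ev b w e + 1)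
  (0, out, f(D := ev (Add a b) w e))"
  using ex_mov[of "D + 1" nc D w 0 out "f(D := ev a w e, D + 1 := ev b w e)"] Add.prems(2)[of "D + 1"]
  by (auto elim!: ex_cong)
 show ?case unfolding ccomp.simps tb.simps
  by (rule ex_mono[OF ex_Seq[OF A ex_Seq[OF B C]]]) (use v in simp)
next
 case (Mul a b)
 define x y where "x = ev a w e" and "y = ev b w e"
 have A: "ex nc w (ccomp a \<sigma> D) (0, out, f) (tb a X) (0, out, f(D := x))"
  unfolding x_def by (rule Mul.IH) (use Mul.prems in auto)
 have mf: "map (f(D := z)) \<sigma> = e" for z unfolding Mul.prems(4)[symmetric]
  by (rule map_cong) (use Mul.prems(3) in fastforce)+
 have B: "ex nc w (ccomp b \<sigma> (D + 1)) (0, out, f(D := x)) (tb b X) (0, out, f(D := x, D + 1 := y))"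
  unfolding y_def by (rule Mul.IH) (use Mul.prems mf in \<open>auto intro: less_SucI\<close>)
 have v: "x \<le> vb a X" "y \<le> vb b X" unfolding x_def y_def using ev_le_vb Mul.prems(6) by blast+
 have nc: "D + 3 < nc" using Mul.prems(1) by auto
 have fz: "f D = 0" "f (D + 1) = 0" "f (D + 2) = 0" "f (D + 3) = 0" using Mul.prems(2) by auto
 have C: "ex nc w (mulloop D) (0, out, f(D := x, D + 1 := y)) (x * (9 * y + 5) + 1) (0, out, f(D + 1 := y, D + 2 := x * y))"
  using ex_mulloop[of D nc "f(D := x, D + 1 := y)" w 0 out] nc fz
  by (auto simp: fun_eq_iff elim!: ex_cong)
 have E: "ex nc w (clear (D + 1)) (0, out, f(D + 1 := y, D + 2 := x * y)) (3 * y + 1) (0, out, f(D + 2 := x * y))"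
  using ex_clear[of "D + 1" nc w 0 out "f(D + 1 := y, D + 2 := x * y)"] nc fz
  by (auto simp: fun_eq_iff elim!: ex_cong)
 have F: "ex nc w (mov (D + 2) D) (0, out, f(D + 2 := x * y)) (4 * (x * y) + 1) (0, out, f(D := x * y))"
  using ex_mov[of "D + 2" nc D w 0 out "f(D + 2 := x * y)"] nc fz
  by (auto simp: fun_eq_iff elim!: ex_cong)
 have le: "x * (9 * y + 5) \<le> vb a X * (9 * vb b X + 5)" "x * y \<le> vb a X * vb b X"
  using v by (auto intro!: mult_mono)
 show ?case unfolding ccomp.simps tb.simps ev.simps x_def[symmetric] y_def[symmetric]
  by (rule ex_mono[OF ex_Seq[OF A ex_Seq[OF B ex_Seq[OF C ex_Seq[OF E F]]]]]) (use v le in linarith)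
next
 case (Rec N B I S)
 define n b where "n = ev N w e" and "b = ev B w e"
 define acc where "acc = rec_nat (ev I w e) (%i acc. min (ev S w (acc # i # e)) b)"
 define V Y where "V = vb B X + vb I X" and "Y = X + vb N X + V"
 have bnd: "n \<le> vb N X" "b \<le> vb B X" "ev I w e \<le> vb I X"
  unfolding n_def b_def using ev_le_vb Rec.prems(6) by blast+
 have acc_le: "acc i \<le> V" for i unfolding acc_def V_def
  using rec_step_le[of "ev I w e" "%i acc. ev S w (acc # i # e)" b i] bnd by linarith
 have nc: "D + 6 < nc" using Rec.prems(1) by auto
 have fz: "f D = 0" "f (D + 1) = 0" "f (D + 2) = 0" "f (D + 3) = 0" "f (D + 4) = 0" "f (D + 5) = 0" "f (D + 6) = 0"
  using Rec.prems(2) by auto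
 have mf: "map g \<sigma> = e" if "\<And>j. j < D ==> g j = f j" for g
  unfolding Rec.prems(4)[symmetric] by (rule map_cong) (use Rec.prems(3) that in auto)
 have A1: "ex nc w (ccomp N \<sigma> D) (0, out, f) (tb N X) (0, out, f(D := n))"
  unfolding n_def by (rule Rec.IH) (use Rec.prems in auto)
 have A2: "ex nc w (ccomp B \<sigma> (D + 1)) (0, out, f(D := n)) (tb B X) (0, out, f(D := n, D + 1 := b))"
  unfolding b_def by (rule Rec.IH(2), use Rec.prems(1) in simp, use Rec.prems(2) in simp, use Rec.prems(3) in fastforce,
   rule mf, simp, rule Rec.prems(5), erule Rec.prems(6))
 have A3: "ex nc w (ccomp I \<sigma> (D + 2)) (0, out, f(D := n, D + 1 := b)) (tb I X) (0, out, f(D := n, D + 1 := b, D + 2 := acc 0))"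
  unfolding acc_def old.nat.simps by (rule Rec.IH(3), use Rec.prems(1) in simp, use Rec.prems(2) in simp, use Rec.prems(3) in fastforce,
   rule mf, simp, rule Rec.prems(5), erule Rec.prems(6))
 \<comment> \<open>The counters of the loop: remaining steps, cap, accumulator, index.\<close>
 define G where "G i = f(D := n - i, D + 1 := b, D + 2 := acc i, D + 3 := i)" for i
 define St where "St i = (0::nat, out, G i)" for i
 let ?K = "1 + (tb S Y + ((9 * vb B X + 2) + ((3 * V + 1) + ((vb S Y * 7 + 1 + (3 * vb B X + 1)) + 1))))"
 have body: "ex nc w (dec D ;; ccomp S ((D + 2) # (D + 3) # \<sigma>) (D + 4) ;; acopy (D + 1) (D + 5) (D + 6) ;; clear (D + 2) ;;
    minmov (D + 4) (D + 5) (D + 2) (D + 6) ;; inc (D + 3)) (St i) ?K (St (Suc i))" if i: "i < n" for i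
 proof -
  let ?g = "f(D := n - Suc i, D + 1 := b, D + 2 := acc i, D + 3 := i)"
  define v where "v = ev S w (acc i # i # e)"
  have v: "v \<le> vb S Y" unfolding v_def
  proof (rule ev_le_vb)
   show "u \<le> Y" if "u \<in> set (acc i # i # e)" for u
    using that acc_le[of i] i bnd Rec.prems(6)[of u] unfolding Y_def by (auto intro: le_trans)
  qed
  have 1: "ex nc w (dec D) (St i) 1 (0, out, ?g)"
   using ex_dec[of D nc "G i" w 0 out] i nc by (auto simp: St_def G_def fun_eq_iff elim!: ex_cong)
  have 2: "ex nc w (ccomp S ((D + 2) # (D + 3) # \<sigma>) (D + 4)) (0, out, ?g) (tb S Y) (0, out, ?g(D + 4 := v))"
   unfolding v_def
  proof (rule Rec.IH(4))
   show "D + 4 + need S \<le> nc" using Rec.prems(1) by auto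
   show "?g j = 0" if "D + 4 \<le> j" for j using that Rec.prems(2)[of j] by auto
   show "s < D + 4" if "s \<in> set ((D + 2) # (D + 3) # \<sigma>)" for s using that Rec.prems(3)[of s] by auto
   show "map ?g ((D + 2) # (D + 3) # \<sigma>) = acc i # i # e" using mf[of ?g] by simp
   show "length w \<le> Y" using Rec.prems(5) by (simp add: Y_def)
   show "u \<le> Y" if "u \<in> set (acc i # i # e)" for u
    using that acc_le[of i] i bnd Rec.prems(6)[of u] unfolding Y_def by (auto intro: le_trans)
  qed
  have 3: "ex nc w (acopy (D + 1) (D + 5) (D + 6)) (0, out, ?g(D + 4 := v)) (9 * b + 2) (0, out, ?g(D + 4 := v, D + 5 := b))"
   using ex_acopy[of "D + 1" nc "D + 5" "D + 6" "?g(D + 4 := v)" w 0 out] nc fz by simp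
  have 4: "ex nc w (clear (D + 2)) (0, out, ?g(D + 4 := v, D + 5 := b)) (3 * acc i + 1) (0, out, ?g(D + 4 := v, D + 5 := b, D + 2 := 0))"
   using ex_clear[of "D + 2" nc w 0 out "?g(D + 4 := v, D + 5 := b)"] nc by simp
  have 5: "ex nc w (minmov (D + 4) (D + 5) (D + 2) (D + 6)) (0, out, ?g(D + 4 := v, D + 5 := b, D + 2 := 0))
    (v * 7 + 1 + (3 * b + 1)) (0, out, ?g(D + 2 := min v b))"
   using ex_minmov[of "D + 4" nc "D + 5" "D + 2" "D + 6" "?g(D + 4 := v, D + 5 := b, D + 2 := 0)" w 0 out] nc fz
   by (auto simp: fun_eq_iff elim!: ex_cong)
  have 6: "ex nc w (inc (D + 3)) (0, out, ?g(D + 2 := min v b)) 1 (St (Suc i))"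
   using ex_inc[of "D + 3" nc w 0 out "?g(D + 2 := min v b)"] nc
   by (auto simp: St_def G_def acc_def v_def fun_eq_iff elim!: ex_cong)
  have le: "9 * b + 2 \<le> 9 * vb B X + 2" "3 * acc i + 1 \<le> 3 * V + 1" "v * 7 + 1 + (3 * b + 1) \<le> vb S Y * 7 + 1 + (3 * vb B X + 1)"
   using bnd acc_le[of i] v by auto
  show ?thesis
   by (rule ex_mono[OF ex_Seq[OF 1 ex_Seq[OF 2 ex_Seq[OF 3 ex_Seq[OF 4 ex_Seq[OF 5 6]]]]]])
    (intro add_mono le order_refl)
 qed
 have A4: "ex nc w (whileNZ D (dec D ;; ccomp S ((D + 2) # (D + 3) # \<sigma>) (D + 4) ;; acopy (D + 1) (D + 5) (D + 6) ;; clear (D + 2) ;;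
    minmov (D + 4) (D + 5) (D + 2) (D + 6) ;; inc (D + 3))) (St 0) (n * (?K + 2) + 1) (St n)"
  by (rule ex_whileNZ) (use nc body in \<open>auto simp: St_def G_def\<close>)
 have S0: "St 0 = (0, out, f(D := n, D + 1 := b, D + 2 := acc 0))" using fz by (auto simp: St_def G_def fun_eq_iff)
 have A5: "ex nc w (clear (D + 1)) (St n) (3 * b + 1) (0, out, f(D + 2 := acc n, D + 3 := n))"
  using ex_clear[of "D + 1" nc w 0 out "G n"] nc fz by (auto simp: St_def G_def fun_eq_iff elim!: ex_cong)
 have A6: "ex nc w (clear (D + 3)) (0, out, f(D + 2 := acc n, D + 3 := n)) (3 * n + 1) (0, out, f(D + 2 := acc n))"
  using ex_clear[of "D + 3" nc w 0 out "f(D + 2 := acc n, D + 3 := n)"] nc fz by (auto simp: fun_eq_iff elim!: ex_cong)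
 have A7: "ex nc w (mov (D + 2) D) (0, out, f(D + 2 := acc n)) (4 * acc n + 1) (0, out, f(D := ev (Rec N B I S) w e))"
  using ex_mov[of "D + 2" nc D w 0 out "f(D + 2 := acc n)"] nc fz
  by (auto simp: fun_eq_iff acc_def n_def b_def elim!: ex_cong)
 have le: "n * (?K + 2) + 1 \<le> vb N X * (?K + 2) + 1" "3 * b + 1 \<le> 3 * vb B X + 1" "3 * n + 1 \<le> 3 * vb N X + 1" "4 * acc n + 1 \<le> 4 * V + 1"
  using mult_le_mono1[OF bnd(1), of "?K + 2"] bnd acc_le[of n] by linarith+
 show ?case unfolding ccomp.simps tb.simps Let_def V_def[symmetric] Y_def[symmetric]
  by (rule ex_mono[OF ex_Seq[OF A1 ex_Seq[OF A2 ex_Seq[OF A3 ex_Seq[OF A4[unfolded S0] ex_Seq[OF A5 ex_Seq[OF A6 A7]]]]]]])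
   (intro add_mono le order_refl)
qed

text \<open>With base X + 2 a single power absorbs constants, sums, products and compositions, also
  at X = 0; \<open>pb_standard\<close> converts to the form required of machines.\<close>

definition polyb :: "(nat => nat) => bool" where
 "polyb f \<longleftrightarrow> (\<exists>c. \<forall>X. f X \<le> (X + 2) ^ c)"

lemma pbI: "(\<And>X. f X \<le> (X + 2) ^ c) ==> polyb f"
 by (auto simp: polyb_def)

lemma pb_const [intro!]: "polyb (%_. c)"
proof (rule pbI)
 fix X :: nat
 have "c \<le> 2 ^ c" by (simp add: less_imp_le)
 also have "... \<le> (X + 2) ^ c" by (rule power_mono) auto
 finally show "c \<le> (X + 2) ^ c" .
qed

lemma pb_id [intro!]: "polyb (%X. X)"
 by (rule pbI[of _ 1]) simp

lemma pb_add [intro!]: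
 assumes "polyb f" "polyb g"
 shows "polyb (%X. f X + g X)"
proof -
 obtain c d where c: "\<And>X. f X \<le> (X + 2) ^ c" and d: "\<And>X. g X \<le> (X + 2) ^ d"
  using assms by (auto simp: polyb_def)
 show ?thesis
 proof (rule pbI)
  fix X :: nat
  have "f X + g X \<le> (X + 2) ^ (c + d) + (X + 2) ^ (c + d)"
   by (intro add_mono order_trans[OF c] order_trans[OF d] power_increasing) auto
  also have "... = 2 * (X + 2) ^ (c + d)" by simp
  also have "... \<le> (X + 2) ^ (c + d + 1)" by simp
  finally show "f X + g X \<le> (X + 2) ^ (c + d + 1)" .
 qed
qed

lemma pb_mult [intro!]:
 assumes "polyb f" "polyb g"
 shows "polyb (%X. f X * g X)"
proof -
 obtain c d where c: "\<And>X. f X \<le> (X + 2) ^ c" and d: "\<And>X. g X \<le> (X + 2) ^ d"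
  using assms by (auto simp: polyb_def)
 have "f X * g X \<le> (X + 2) ^ (c + d)" for X
  unfolding power_add by (intro mult_mono c d) auto
 then show ?thesis by (rule pbI)
qed

lemma pb_comp:
 assumes "polyb f" "polyb g"
 shows "polyb (%X. f (g X))"
proof -
 obtain c d where c: "\<And>X. f X \<le> (X + 2) ^ c" and d: "\<And>X. g X \<le> (X + 2) ^ d"
  using assms by (auto simp: polyb_def)
 have "f (g X) \<le> (X + 2) ^ ((d + 2) * c)" for X
 proof -
  have "1 \<le> (X + 2) ^ d" by simp
  then have "g X + 2 \<le> 3 * (X + 2) ^ d" using d[of X] by linarith
  also have "... \<le> (X + 2) ^ 2 * (X + 2) ^ d" by (rule mult_right_mono) (auto simp: power2_eq_square)
  finally have "g X + 2 \<le> (X + 2) ^ (d + 2)" by (simp only: power_add mult.commute)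
  then have "(g X + 2) ^ c \<le> ((X + 2) ^ (d + 2)) ^ c" by (rule power_mono) simp
  then show ?thesis using c[of "g X"] by (metis order_trans power_mult)
 qed
 then show ?thesis by (rule pbI)
qed

lemma pb_vb: "polyb (vb t)"
proof (induction t)
 case (Rec N B I S)
 then show ?case unfolding vb.simps by blast
qed (unfold vb.simps, blast+)

lemma pb_tb: "polyb (tb t)"
proof (induction t)
 case (Rec N B I S)
 have Y: "polyb (%X. X + vb N X + (vb B X + vb I X))" by (intro pb_add pb_id pb_vb)
 show ?case unfolding tb.simps Let_def
  by (intro pb_add pb_mult pb_const pb_id pb_vb Rec.IH pb_comp[OF Rec.IH(4) Y] pb_comp[OF pb_vb Y])
qed (unfold tb.simps, (intro pb_add pb_mult pb_const pb_id pb_vb; assumption)+)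

lemma pb_standard:
 assumes "polyb f"
 shows "\<exists>a e. \<forall>X. f X \<le> a + a * X ^ e"
proof -
 obtain c where c: "\<And>X. f X \<le> (X + 2) ^ c" using assms by (auto simp: polyb_def)
 have "f X \<le> 3 ^ c + 3 ^ c * X ^ c" for X
 proof (cases "X = 0")
  case True
  have "(2::nat) ^ c \<le> 3 ^ c" by (rule power_mono) auto
  moreover have "f 0 \<le> 2 ^ c" using c[of 0] by (simp only: add_0)
  ultimately have "f 0 \<le> 3 ^ c" by linarith
  then show ?thesis unfolding True by (rule trans_le_add1)
 next
  case False
  then have "(X + 2) ^ c \<le> (3 * X) ^ c" by (intro power_mono) auto
  then show ?thesis using c[of X] by (simp add: power_mult_distrib)
 qed
 then show ?thesis by blast
qed

text \<open>A machine starts on blank tapes, whereas counters rely on the mark in cell 0.\<close>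

fun initc :: "nat => cmd" where
 "initc 0 = Act 0 (%a. (a, MStay))"
| "initc (Suc k) = initc k ;; Act (k + 2) (%_. (4, MStay))"

lemma run_initc:
 assumes "k \<le> nc"
 shows "run (initc k) ((tape_content w, 0) # replicate (nc + 1) (tape_content [], 0)) (k + 1)
  ((tape_content w, 0) # (tape_content [], 0) # map (%j. if j < k then ctr 0 else (tape_content [], 0)) [0..<nc])"
 using assms
proof (induction k)
 case 0
 have "replicate (nc + 1) (tape_content [], 0) = (tape_content [], 0) # map (%j. (tape_content [], 0 :: int)) [0..<nc]"
  by (simp add: map_replicate_const)
 then show ?case using run_Act[of 0 "(tape_content w, 0) # replicate (nc + 1) (tape_content [], 0)" "%a. (a, MStay)"]
  by simp
next
 case (Suc k)
 let ?l = "%k. (tape_content w, 0) # (tape_content [], 0) # map (%j. if j < k then ctr 0 else (tape_content [], 0)) [0..<nc]"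
 have "act_tape (tape_content [], 0) (4, MStay) = ctr 0"
  by (auto simp: act_tape_def ctr_def tape_content_def fun_eq_iff)
 then have e: "(?l k)[k + 2 := act_tape (?l k ! (k + 2)) (4, MStay)] = ?l (Suc k)" using Suc.prems
  by (auto intro!: nth_equalityI simp: nth_list_update nth_Cons split: nat.splits)
 have "run (Act (k + 2) (%_. (4, MStay))) (?l k) 1 (?l (Suc k))"
  using run_Act[of "k + 2" "?l k" "%_. (4, MStay)"] Suc.prems unfolding e by simp
 then show ?case using run_Seq[OF Suc.IH] Suc.prems by fastforce
qed

lemma ex_while0:
 assumes "\<And>i. i < n ==> P (tape_content w (int (fst (S i)))) \<and> ex nc w c (S i) T (S (Suc i))"
  "\<not> P (tape_content w (int (fst (S n))))"
 shows "ex nc w (WhileC 0 P c) (S 0) (n * (T + 2) + 1) (S n)"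
 using assms
proof (induction n arbitrary: S)
 case 0
 obtain h out f where S: "S 0 = (h, out, f)" by (cases "S 0")
 show ?case using 0 S run_WhileF[of 0 "conf nc w (S 0)" P c] unfolding ex_def
  by (intro exI[of _ 1]) (auto simp: read_tape_def)
next
 case (Suc n)
 obtain h out f where S: "S 0 = (h, out, f)" by (cases "S 0")
 have "ex nc w (WhileC 0 P c) (S (Suc 0)) (n * (T + 2) + 1) (S (Suc n))"
  using Suc.IH[of "%i. S (Suc i)"] Suc.prems by auto
 then obtain t2 where t2: "t2 \<le> n * (T + 2) + 1" "run (WhileC 0 P c) (conf nc w (S (Suc 0))) t2 (conf nc w (S (Suc n)))"
  by (auto simp: ex_def)
 obtain t1 where t1: "t1 \<le> T" "run c (conf nc w (S 0)) t1 (conf nc w (S (Suc 0)))"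
  using Suc.prems(1)[of 0] by (auto simp: ex_def)
 have "run (WhileC 0 P c) (conf nc w (S 0)) (t1 + t2 + 2) (conf nc w (S (Suc n)))"
  by (rule run_WhileT[OF _ _ t1(2) t2(2)]) (use S Suc.prems(1)[of 0] in \<open>auto simp: read_tape_def\<close>)
 then show ?case unfolding ex_def using t1(1) t2(1) by (intro exI[of _ "t1 + t2 + 2"]) auto
qed

text \<open>Input words contain no blank, so the first blank is their end. The second counter brings
  the head back to cell 0.\<close>

definition "lenc = WhileC 0 (%a. a \<noteq> 0) (inR ;; inc 0 ;; inc 1) ;; whileNZ 1 (dec 1 ;; inL)"

lemma ex_lenc:
 assumes "2 \<le> nc" "set w \<subseteq> {1, 2, 3}"
 shows "ex nc w lenc (0, out, %_. 0) (length w * 5 + 1 + (length w * 4 + 1)) (0, out, (%_. 0)(0 := length w))"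
proof -
 let ?z = "%_::nat. 0::nat"
 let ?n = "length w"
 define S where "S i = (i, out, ?z(0 := i, 1 := i))" for i
 have tc: "tape_content w (int i) \<noteq> 0 \<longleftrightarrow> i < ?n" for i
 proof (cases "i < ?n")
  case True
  then have "w ! i \<in> {1, 2, 3}" using assms(2) nth_mem by blast
  then show ?thesis using True by (auto simp: tape_content_def)
 qed (simp add: tape_content_def)
 have "ex nc w (inR ;; inc 0 ;; inc 1) (S i) (1 + (1 + 1)) (S (Suc i))" for i
 proof -
  have 1: "ex nc w inR (S i) 1 (Suc i, out, ?z(0 := i, 1 := i))" unfolding S_def by (rule ex_inR)
  have 2: "ex nc w (inc 0) (Suc i, out, ?z(0 := i, 1 := i)) 1 (Suc i, out, ?z(0 := Suc i, 1 := i))"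
   using ex_inc[of 0 nc w "Suc i" out "?z(0 := i, 1 := i)"] assms by (simp add: fun_upd_twist)
  have 3: "ex nc w (inc 1) (Suc i, out, ?z(0 := Suc i, 1 := i)) 1 (S (Suc i))"
   using ex_inc[of 1 nc w "Suc i" out "?z(0 := Suc i, 1 := i)"] assms by (simp add: S_def)
  show ?thesis by (rule ex_Seq[OF 1 ex_Seq[OF 2 3]])
 qed
 then have A: "ex nc w (WhileC 0 (%a. a \<noteq> 0) (inR ;; inc 0 ;; inc 1)) (S 0) (?n * (1 + (1 + 1) + 2) + 1) (S ?n)"
  by (intro ex_while0) (use tc in \<open>auto simp: S_def\<close>)
 have S0: "S 0 = (0, out, ?z)" by (auto simp: S_def fun_eq_iff)
 define U where "U i = (?n - i, out, ?z(0 := ?n, 1 := ?n - i))" for i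
 have "ex nc w (dec 1 ;; inL) (U i) (1 + 1) (U (Suc i))" if "i < ?n" for i
 proof -
  have 1: "ex nc w (dec 1) (U i) 1 (?n - i, out, ?z(0 := ?n, 1 := ?n - Suc i))"
   using ex_dec[of "1" nc "?z(0 := ?n, 1 := ?n - i)" w "?n - i" out] that assms by (simp add: U_def)
  have 2: "ex nc w inL (?n - i, out, ?z(0 := ?n, 1 := ?n - Suc i)) 1 (U (Suc i))"
   using ex_inL[of "?n - i" nc w out "?z(0 := ?n, 1 := ?n - Suc i)"] that by (simp add: U_def)
  show ?thesis by (rule ex_Seq[OF 1 2])
 qed
 then have B: "ex nc w (whileNZ 1 (dec 1 ;; inL)) (U 0) (?n * (1 + 1 + 2) + 1) (U ?n)"
  by (intro ex_whileNZ) (use assms in \<open>auto simp: U_def\<close>)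
 have SU: "S ?n = U 0" by (simp add: S_def U_def)
 have Un: "U ?n = (0, out, ?z(0 := ?n))" by (auto simp: U_def fun_eq_iff)
 show ?thesis unfolding lenc_def S0[symmetric] Un[symmetric]
  by (rule ex_mono[OF ex_Seq[OF A B[folded SU]]]) simp
qed

text \<open>Counters 0 to 3 hold the input length, the number of output bits still to come, the
  index of the current bit and its value. The output is produced bit by bit and never stored in a
  counter.\<close>

definition main_cmd :: "aexp => aexp => nat => cmd" where
 "main_cmd L b nc = initc nc ;; lenc ;; ccomp L [0] 1 ;;
   whileNZ 1 (dec 1 ;; ccomp b [2, 0] 3 ;; ifNZ 3 (Act 1 (%_. (2, MRight))) (Act 1 (%_. (1, MRight))) ;; clear 3 ;; inc 2)"

theorem tm_of_aexps:
 "\<exists>M a e. wf_tm M \<and> (\<forall>w. set w \<subseteq> {1, 2, 3} \<longrightarrow>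
   outputs_within M (a + a * length w ^ e) w
    (map (%j. if ev b w [j, length w] \<noteq> 0 then 2 else 1) [0..<ev L w [length w]]))"
proof -
 define nc where "nc = 3 + need L + need b"
 define Y where "Y X = X + vb L X" for X
 define K where "K X = 1 + (tb b (Y X) + ((1 + 2) + ((3 * vb b (Y X) + 1) + 1)))" for X
 define T where "T X = (X * 5 + 1 + (X * 4 + 1)) + (tb L X + (vb L X * (K X + 2) + 1))" for X
 have "polyb Y" unfolding Y_def by (intro pb_add pb_id pb_vb)
 then have "polyb (%X. nc + 1 + T X)"
  unfolding T_def K_def by (intro pb_add pb_mult pb_const pb_id pb_vb pb_tb pb_comp[OF pb_tb] pb_comp[OF pb_vb])
 then obtain a e where ae: "\<And>X. nc + 1 + T X \<le> a + a * X ^ e" using pb_standard by blast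
 have wf: "wf_tm (prog_tm (nc + 2) (main_cmd L b nc))"
 proof (rule wf_prog_tm)
  have "wf_cmd (nc + 2) (initc k)" if "k \<le> nc" for k using that by (induction k) auto
  moreover have "wf_cmd (nc + 2) (ccomp L [0] 1)" "wf_cmd (nc + 2) (ccomp b [2, 0] 3)"
   by (rule wf_ccomp; auto simp: nc_def)+
  moreover note need_pos[of L]
  ultimately show "wf_cmd (nc + 2) (main_cmd L b nc)"
   by (simp add: main_cmd_def lenc_def nc_def)
 qed (simp add: nc_def)
 have "outputs_within (prog_tm (nc + 2) (main_cmd L b nc)) (a + a * length w ^ e) w
    (map (%j. if ev b w [j, length w] \<noteq> 0 then 2 else 1) [0..<ev L w [length w]])"
  if w: "set w \<subseteq> {1, 2, 3}" for w
 proof -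
  let ?z = "%_::nat. 0::nat"
  define l m where "l = length w" and "m = ev L w [l]"
  define out where "out i = map (%j. if ev b w [j, l] \<noteq> 0 then 2 else 1::nat) [0..<i]" for i
  have nc2: "3 < nc" using need_pos[of L] need_pos[of b] by (simp add: nc_def)
  have m_le: "m \<le> vb L l" unfolding m_def by (rule ev_le_vb) auto
  have A: "ex nc w lenc (0, [], ?z) (l * 5 + 1 + (l * 4 + 1)) (0, [], ?z(0 := l))"
   unfolding l_def by (rule ex_lenc) (use nc2 w in auto)
  have B: "ex nc w (ccomp L [0] 1) (0, [], ?z(0 := l)) (tb L l) (0, [], ?z(0 := l, 1 := m))"
   unfolding m_def by (rule ccomp_correct) (auto simp: nc_def l_def)
  define S where "S i = (0::nat, out i, ?z(0 := l, 1 := m - i, 2 := i))" for i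
  have body: "ex nc w (dec 1 ;; ccomp b [2, 0] 3 ;; ifNZ 3 (Act 1 (%_. (2, MRight))) (Act 1 (%_. (1, MRight))) ;; clear 3 ;; inc 2)
    (S i) (K l) (S (Suc i))" if i: "i < m" for i
  proof -
   define v where "v = ev b w [i, l]"
   let ?g = "?z(0 := l, 1 := m - Suc i, 2 := i)"
   have v: "v \<le> vb b (Y l)" unfolding v_def by (rule ev_le_vb) (use i m_le in \<open>auto simp: Y_def\<close>)
   have 1: "ex nc w (dec 1) (S i) 1 (0, out i, ?g)"
    using ex_dec[of 1 nc "?z(0 := l, 1 := m - i, 2 := i)" w 0 "out i"] i nc2 by (simp add: S_def fun_upd_twist)
   have 2: "ex nc w (ccomp b [2, 0] 3) (0, out i, ?g) (tb b (Y l)) (0, out i, ?g(3 := v))"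
    unfolding v_def by (rule ccomp_correct) (use i m_le in \<open>auto simp: nc_def Y_def l_def\<close>)
   have 3: "ex nc w (ifNZ 3 (Act 1 (%_. (2, MRight))) (Act 1 (%_. (1, MRight)))) (0, out i, ?g(3 := v)) (1 + 2) (0, out (Suc i), ?g(3 := v))"
    by (rule ex_ifNZ) (use nc2 ex_out[of nc w 2 0 "out i" "?g(3 := v)"] ex_out[of nc w 1 0 "out i" "?g(3 := v)"] in
     \<open>auto simp: out_def v_def\<close>)
   have 4: "ex nc w (clear 3) (0, out (Suc i), ?g(3 := v)) (3 * v + 1) (0, out (Suc i), ?g)"
    using ex_clear[of 3 nc w 0 "out (Suc i)" "?g(3 := v)"] nc2
    by (auto simp: fun_eq_iff elim!: ex_cong)
   have 5: "ex nc w (inc 2) (0, out (Suc i), ?g) 1 (S (Suc i))"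
    using ex_inc[of 2 nc w 0 "out (Suc i)" ?g] nc2 by (simp add: S_def)
   show ?thesis unfolding K_def
    by (rule ex_mono[OF ex_Seq[OF 1 ex_Seq[OF 2 ex_Seq[OF 3 ex_Seq[OF 4 5]]]]]) (use v in simp)
  qed
  have C: "ex nc w (whileNZ 1 (dec 1 ;; ccomp b [2, 0] 3 ;; ifNZ 3 (Act 1 (%_. (2, MRight))) (Act 1 (%_. (1, MRight))) ;; clear 3 ;; inc 2))
    (S 0) (m * (K l + 2) + 1) (S m)"
   by (rule ex_whileNZ) (use nc2 body in \<open>auto simp: S_def\<close>)
  have S0: "S 0 = (0, [], ?z(0 := l, 1 := m))" by (auto simp: S_def out_def fun_eq_iff)
  have "m * (K l + 2) \<le> vb L l * (K l + 2)" using m_le by (rule mult_le_mono1)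
  then obtain t where t: "t \<le> T l" "run (lenc ;; ccomp L [0] 1 ;;
    whileNZ 1 (dec 1 ;; ccomp b [2, 0] 3 ;; ifNZ 3 (Act 1 (%_. (2, MRight))) (Act 1 (%_. (1, MRight))) ;; clear 3 ;; inc 2))
    (conf nc w (0, [], ?z)) t (conf nc w (S m))"
   using ex_Seq[OF A ex_Seq[OF B C[unfolded S0]]] unfolding ex_def T_def
   by (meson add_le_mono le_trans order_refl)
  have ic: "snd (initial_config (prog_tm (nc + 2) (main_cmd L b nc)) w) = (tape_content w, 0) # replicate (nc + 1) (tape_content [], 0)"
   by (simp add: initial_config_def prog_tm_def)
  have cz: "(tape_content w, 0) # (tape_content [], 0) # map (%j. if j < nc then ctr 0 else (tape_content [], 0)) [0..<nc] = conf nc w (0, [], ?z)"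
   by (auto simp: conf.simps)
  have "run (main_cmd L b nc) (snd (initial_config (prog_tm (nc + 2) (main_cmd L b nc)) w)) (nc + 1 + t) (conf nc w (S m))"
   unfolding main_cmd_def[symmetric] ic using run_Seq[OF run_initc[of nc nc w, OF order_refl, unfolded cz] t(2)]
   by (simp only: main_cmd_def)
  then show ?thesis
  proof (rule run_outputs_within)
   show "fst (conf nc w (S m) ! 1) = tape_content (map (%j. if ev b w [j, length w] \<noteq> 0 then 2 else 1) [0..<ev L w [length w]])"
    by (simp add: S_def out_def m_def l_def)
   show "nc + 1 + t \<le> a + a * length w ^ e" using ae[of l] t(1) by (simp add: l_def)
  qed simp
 qed
 then show ?thesis using wf by blast
qed

section \<open>Functions computed by the expression language\<close>

type_synonym mem = "nat list \<times> nat list"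

definition vget :: "nat => nat list => nat" where
 "vget i e = (if i < length e then e ! i else 0)"

definition dn :: "mem => mem" where
 "dn h = (fst h, tl (snd h))"

definition hd0 :: "mem => nat" where
 "hd0 h = vget 0 (snd h)"

definition inp :: "mem => nat => nat" where
 "inp h i = (if i < length (fst h) \<and> fst h ! i \<le> 3 then fst h ! i else 0)"

text \<open>Everything has to hold in every memory state, not only in those arising from valid
  inputs; hence the side conditions that quantify over all \<open>h\<close> below.\<close>

definition pc :: "(mem => nat) => bool" where
 "pc F \<longleftrightarrow> (\<exists>t. \<forall>w e. ev t w e = F (w, e))"

named_theorems pci

text \<open>Weakening: a quantity computed outside a recursion is also used inside its step, where
  two more variables are bound.\<close>

fun ren :: "(nat => nat) => aexp => aexp" where
 "ren f (Var i) = Var (f i)"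
| "ren f (Cst c) = Cst c"
| "ren f (Rd a) = Rd (ren f a)"
| "ren f (Add a b) = Add (ren f a) (ren f b)"
| "ren f (Mul a b) = Mul (ren f a) (ren f b)"
| "ren f (Rec N B I S) = Rec (ren f N) (ren f B) (ren f I) (ren (%i. if i < 2 then i else f (i - 2) + 2) S)"

lemma vget_Suc [simp]: "vget (Suc i) (a # e) = vget i e"
 by (simp add: vget_def)

lemma ev_ren: "(\<And>i. vget (f i) e = vget i e') ==> ev (ren f t) w e = ev t w e'"
proof (induction t arbitrary: f e e')
 case (Rec N B I S)
 have "ev (ren (%i. if i < 2 then i else f (i - 2) + 2) S) w (acc # i # e) = ev S w (acc # i # e')" for acc i
 proof (rule Rec.IH(4))
  fix j
  show "vget (if j < 2 then j else f (j - 2) + 2) (acc # i # e) = vget j (acc # i # e')"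
  proof (cases "j < 2")
   case True
   then show ?thesis by (cases j) (auto simp: vget_def nth_Cons')
  next
   case False
   then obtain k where "j = Suc (Suc k)" by (metis add_2_eq_Suc le_Suc_ex not_less)
   then show ?thesis using Rec.prems[of k] by simp
  qed
 qed
 then show ?case using Rec.IH(1-3)[OF Rec.prems] by simp
qed (simp_all add: vget_def)

lemma pcI: "(\<And>w e. ev t w e = F (w, e)) ==> pc F"
 unfolding pc_def by blast

lemma pcw: "pc F ==> pc (%h. F (dn h))"
proof -
 assume "pc F"
 then obtain t where t: "\<And>w e. ev t w e = F (w, e)" unfolding pc_def by blast
 have "ev (ren Suc t) w e = ev t w (tl e)" for w e
  by (rule ev_ren) (auto simp: vget_def nth_tl)
 then show ?thesis by (intro pcI[of "ren Suc t"]) (simp add: t dn_def)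
qed

lemma pc_const [pci]: "pc (%h. c)"
 by (rule pcI[of "Cst c"]) simp

lemma pc_hd0 [pci]: "pc hd0"
 by (rule pcI[of "Var 0"]) (simp add: hd0_def vget_def)

lemmas pc_hd1 [pci] = pcw[OF pc_hd0]
lemmas pc_hd2 [pci] = pcw[OF pc_hd1]
lemmas pc_hd3 [pci] = pcw[OF pc_hd2]
lemmas pc_hd4 [pci] = pcw[OF pc_hd3]

lemma pc_inp [pci]: "pc A ==> pc (%h. inp h (A h))"
 unfolding pc_def by (metis ev.simps(3) fst_conv inp_def)

lemma pc_add [pci]: "pc A ==> pc B ==> pc (%h. A h + B h)"
 unfolding pc_def by (metis ev.simps(4))

lemma pc_mul [pci]: "pc A ==> pc B ==> pc (%h. A h * B h)"
 unfolding pc_def by (metis ev.simps(5))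

lemma pc_rec:
 assumes "pc N" "pc B" "pc I" "pc (%h. S (dn (dn h)) (hd0 (dn h)) (hd0 h))"
 shows "pc (%h. rec_nat (I h) (%i acc. min (S h i acc) (B h)) (N h))"
proof -
 obtain tN tB tI tS where "\<And>w e. ev tN w e = N (w, e)" "\<And>w e. ev tB w e = B (w, e)" "\<And>w e. ev tI w e = I (w, e)"
  "\<And>w e. ev tS w e = S (dn (dn (w, e))) (hd0 (dn (w, e))) (hd0 (w, e))"
  using assms unfolding pc_def by blast
 then show ?thesis by (intro pcI[of "Rec tN tB tI tS"]) (simp add: dn_def hd0_def vget_def)
qed

lemma pc_cong: "pc F ==> (\<And>h. G h = F h) ==> pc G"
 by (simp add: pc_def)

text \<open>A recursion whose values stay below \<open>B\<close>, so that the cap is inactive.\<close>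

lemma pc_iter:
 assumes pc: "pc N" "pc B" "pc I" "pc (%h. S (dn (dn h)) (hd0 (dn h)) (hd0 h))"
  and G: "\<And>h. G h 0 = I h" "\<And>h i. i < N h ==> G h (Suc i) = S h i (G h i)" "\<And>h i. i < N h ==> G h (Suc i) \<le> B h"
 shows "pc (%h. G h (N h))"
proof (rule pc_cong[OF pc_rec[OF pc]])
 fix h
 have "k \<le> N h ==> G h k = rec_nat (I h) (%i acc. min (S h i acc) (B h)) k" for k
 proof (induction k)
  case (Suc k)
  then show ?case using G(2,3)[of k h] by simp
 qed (simp add: G)
 then show "G h (N h) = rec_nat (I h) (%i acc. min (S h i acc) (B h)) (N h)" by simp
qed

section \<open>Arithmetic, logic and bounded search\<close>

lemma pc_min [pci]:
 assumes "pc A" "pc B"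
 shows "pc (%h. min (A h) (B h))"
 by (rule pc_cong[OF pc_rec[OF pc_const[of 1] assms(2) pc_const[of 0], where S = "%h i acc. A h"]])
  (simp_all add: pcw[OF pcw[OF assms(1)]])

lemma pc_pred: "pc A ==> pc (%h. A h - 1)"
 by (rule pc_iter[where G = "%h i. i - 1" and S = "%h i acc. i" and B = A and I = "%h. 0" and N = A])
  (assumption, assumption, rule pc_const, rule pc_hd1, auto)

lemma pc_sub [pci]:
 assumes "pc A" "pc B"
 shows "pc (%h. A h - B h)"
 by (rule pc_iter[where G = "%h i. A h - i" and S = "%h i acc. acc - 1" and B = A and I = A and N = B])
  (rule assms, rule assms, rule assms, rule pc_pred[OF pc_hd0], auto)

lemma pc_not [pci]:
 assumes "pc (%h. of_bool (P h))"
 shows "pc (%h. of_bool (\<not> P h))"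
 by (rule pc_cong[OF pc_sub[OF pc_const[of 1] assms]]) auto

lemma pc_conj [pci]:
 assumes "pc (%h. of_bool (P h))" "pc (%h. of_bool (Q h))"
 shows "pc (%h. of_bool (P h \<and> Q h))"
 by (rule pc_cong[OF pc_mul[OF assms]]) auto

lemma pc_imp [pci]:
 assumes "pc (%h. of_bool (P h))" "pc (%h. of_bool (Q h))"
 shows "pc (%h. of_bool (P h \<longrightarrow> Q h))"
 by (rule pc_cong[OF pc_not[OF pc_conj[OF assms(1) pc_not[OF assms(2)]]]]) auto

lemma pc_le [pci]:
 assumes "pc A" "pc B"
 shows "pc (%h. of_bool (A h \<le> B h))"
 by (rule pc_cong[OF pc_sub[OF pc_const[of 1] pc_sub[OF assms]]]) auto

lemma pc_less [pci]:
 assumes "pc A" "pc B"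
 shows "pc (%h. of_bool (A h < B h))"
 by (rule pc_cong[OF pc_not[OF pc_le[OF assms(2,1)]]]) (auto simp: not_le)

lemma pc_eq [pci]:
 assumes "pc A" "pc B"
 shows "pc (%h. of_bool (A h = (B h :: nat)))"
 by (rule pc_cong[OF pc_conj[OF pc_le[OF assms] pc_le[OF assms(2,1)]]]) auto

lemma pc_if [pci]:
 assumes "pc (%h. of_bool (P h))" "pc A" "pc B"
 shows "pc (%h. if P h then A h else B h)"
 by (rule pc_cong[OF pc_add[OF pc_mul[OF assms(1,2)] pc_mul[OF pc_not[OF assms(1)] assms(3)]]]) auto

lemma pc_ifb [pci]:
 assumes "pc (%h. of_bool (P h))" "pc (%h. of_bool (A h))" "pc (%h. of_bool (B h))"
 shows "pc (%h. of_bool (if P h then A h else B h))"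
 by (rule pc_cong[OF pc_if[OF assms]]) auto

lemma pc_count [pci]:
 assumes "pc N" "pc (%h. of_bool (P (dn h) (hd0 h)))"
 shows "pc (%h. card {i. i < N h \<and> P h i})"
proof -
 have P2: "pc (%h. of_bool (P (dn (dn h)) (hd0 (dn h))))" by (rule pcw[OF assms(2)])
 have c: "{i. i < Suc k \<and> P h i} = (if P h k then insert k {i. i < k \<and> P h i} else {i. i < k \<and> P h i})" for k h
  by (auto simp: less_Suc_eq)
 have le: "card {i. i < k \<and> P h i} \<le> k" for k h
  using card_mono[of "{..<k}" "{i. i < k \<and> P h i}"] by auto
 show ?thesis
 proof (rule pc_iter[where G = "%h k. card {i. i < k \<and> P h i}" and S = "%h i acc. acc + of_bool (P h i)" and B = N and I = "%h. 0" and N = N])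
  show "card {i. i < Suc k \<and> P h i} \<le> N h" if "k < N h" for k h using le[of "Suc k" h] that by simp
  show "card {i. i < Suc k \<and> P h i} = card {i. i < k \<and> P h i} + of_bool (P h k)" for k h unfolding c by simp
 qed (auto intro: assms P2 pci)
qed

lemma pc_ex [pci]:
 assumes "pc N" "pc (%h. of_bool (P (dn h) (hd0 h)))"
 shows "pc (%h. of_bool (\<exists>i<N h. P h i))"
proof (rule pc_cong[OF pc_less[OF pc_const[of 0] pc_count[OF assms]]])
 fix h
 have "finite {i. i < N h \<and> P h i}" by simp
 then show "of_bool (\<exists>i<N h. P h i) = (of_bool (0 < card {i. i < N h \<and> P h i}) :: nat)" by (auto simp: card_gt_0_iff)
qed

lemma pc_all [pci]:
 assumes "pc N" "pc (%h. of_bool (P (dn h) (hd0 h)))"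
 shows "pc (%h. of_bool (\<forall>i<N h. P h i))"
 by (rule pc_cong[OF pc_not[OF pc_ex[OF assms(1) pc_not[OF assms(2)]]]]) auto

lemma pc_div [pci]:
 assumes "pc A" "pc B"
 shows "pc (%h. A h div B h)"
proof (rule pc_cong)
 show "pc (%h. card {i. i < A h \<and> (0 < B h \<and> (i + 1) * B h \<le> A h)})"
  by (intro pci assms assms[THEN pcw])
 fix h
 show "A h div B h = card {i. i < A h \<and> (0 < B h \<and> (i + 1) * B h \<le> A h)}"
 proof (cases "B h = 0")
  case False
  have "(i + 1) * B h \<le> A h \<longleftrightarrow> i < A h div B h" for i
   using False less_eq_div_iff_mult_less_eq[of "B h" "i + 1" "A h"] by (simp add: Suc_le_eq)
  moreover have "A h div B h \<le> A h" by simp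
  ultimately have "{i. i < A h \<and> (0 < B h \<and> (i + 1) * B h \<le> A h)} = {..<A h div B h}"
   using False by (auto intro: less_le_trans)
  then show ?thesis by simp
 qed simp
qed

lemma pc_mod [pci]:
 assumes "pc A" "pc B"
 shows "pc (%h. A h mod B h)"
 by (rule pc_cong[OF pc_sub[OF assms(1) pc_mul[OF pc_div[OF assms] assms(2)]]]) (simp add: minus_div_mult_eq_mod)

text \<open>The search is a recursion whose accumulator is the candidate: it stays once
  \<open>P\<close> holds and otherwise grows by one. The renaming skips the loop index, since
  \<open>P\<close> reads the accumulator.\<close>

lemma pc_Least:
 assumes B: "pc B" and P: "pc (%h. of_bool (P (dn h) (hd0 h)))" and ex: "\<And>h. \<exists>i\<le>B h. P h i"
 shows "pc (%h. LEAST i. P h i)"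
proof (rule pc_cong)
 show "pc (%h. rec_nat 0 (%i acc. min (if P h acc then acc else acc + 1) (B h)) (B h))"
 proof (rule pc_rec[OF B B pc_const])
  have P': "pc (%h. of_bool (P (dn (dn h)) (hd0 h)))"
  proof -
   obtain t where t: "\<And>w e. ev t w e = of_bool (P (dn (w, e)) (hd0 (w, e)))" using P unfolding pc_def by blast
   have "ev (ren (%i. if i = 0 then 0 else Suc i) t) w e = ev t w (vget 0 e # tl (tl e))" for w e
    by (rule ev_ren) (auto simp: vget_def nth_tl nth_Cons')
   then show ?thesis by (intro pcI[of "ren (%i. if i = 0 then 0 else Suc i) t"]) (simp add: t dn_def hd0_def vget_def)
  qed
  show "pc (%h. if P (dn (dn h)) (hd0 h) then hd0 h else hd0 h + 1)" by (intro pci P')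
 qed
 fix h
 let ?L = "LEAST i. P h i"
 obtain i where i: "i \<le> B h" "P h i" using ex by blast
 have L: "P h ?L" "?L \<le> i" using i(2) by (auto intro: LeastI Least_le)
 have "rec_nat 0 (%i acc. min (if P h acc then acc else acc + 1) (B h)) k = min k ?L" for k
 proof (induction k)
  case (Suc k)
  show ?case
  proof (cases "k < ?L")
   case True
   then have "\<not> P h k" by (rule not_less_Least)
   then show ?thesis using Suc True L i by simp
  next
   case False
   then show ?thesis using Suc L i by simp
  qed
 qed simp
 then show "?L = rec_nat 0 (%i acc. min (if P h acc then acc else acc + 1) (B h)) (B h)" using L i by simp
qed

text \<open>The expressions have no substitution. A recursion with I + 1 steps that ignores its
  accumulator ends with index I, so it returns \<open>F\<close> at I.\<close>

lemma pc_let: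
 assumes "pc I" "pc B" "pc (%h. F (dn h) (hd0 h))" "\<And>h. F h (I h) \<le> B h"
 shows "pc (%h. F h (I h))"
proof (rule pc_cong)
 show "pc (%h. rec_nat 0 (%i acc. min (F h i) (B h)) (I h + 1))"
  by (rule pc_rec) (intro pci assms assms(3)[THEN pcw])+
 show "F h (I h) = rec_nat 0 (%i acc. min (F h i) (B h)) (I h + 1)" for h using assms(4) by simp
qed

lemma pc_msum:
 assumes "pc N" "pc p" "pc (%h. F (dn h) (hd0 h))" "\<And>h. 0 < p h"
 shows "pc (%h. (\<Sum>i<N h. F h i) mod p h)"
proof (rule pc_iter[where G = "%h k. (\<Sum>i<k. F h i) mod p h" and S = "%h i acc. (acc + F h i) mod p h" and B = p and I = "%h. 0" and N = N])
 show "pc (%h. (hd0 h + F (dn (dn h)) (hd0 (dn h))) mod p (dn (dn h)))"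
  by (intro pci assms(2)[THEN pcw, THEN pcw] assms(3)[THEN pcw])
 show "(\<Sum>i<Suc k. F h i) mod p h \<le> p h" for k h using mod_less_divisor[OF assms(4)] by (intro less_imp_le) blast
qed (auto intro: assms pci simp: mod_simps)

lemma pc_mprod:
 assumes "pc N" "pc p" "pc (%h. F (dn h) (hd0 h))" "\<And>h. 0 < p h"
 shows "pc (%h. (\<Prod>i<N h. F h i) mod p h)"
proof (rule pc_iter[where G = "%h k. (\<Prod>i<k. F h i) mod p h" and S = "%h i acc. (acc * F h i) mod p h" and B = p and I = "%h. 1 mod p h" and N = N])
 show "pc (%h. (hd0 h * F (dn (dn h)) (hd0 (dn h))) mod p (dn (dn h)))"
  by (intro pci assms(2)[THEN pcw, THEN pcw] assms(3)[THEN pcw])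
 show "(\<Prod>i<Suc k. F h i) mod p h \<le> p h" for k h using mod_less_divisor[OF assms(4)] by (intro less_imp_le) blast
qed (rule assms, rule assms, intro pci assms, auto simp: mod_simps)

text \<open>With a computed exponent only residues of powers are available, as the power itself
  exceeds every polynomial bound.\<close>

lemma pc_mpow:
 assumes "pc A" "pc j" "pc p" "\<And>h. 0 < p h"
 shows "pc (%h. A h ^ j h mod p h)"
 by (rule pc_cong[OF pc_mprod[OF assms(2,3), where F = "%h i. A h", OF pcw[OF assms(1)] assms(4)]]) simp

text \<open>Repeated division avoids forming the power.\<close>

lemma pc_divpow [pci]:
 assumes "pc A" "pc q" "pc r"
 shows "pc (%h. A h div q h ^ r h)"
proof (rule pc_iter[where G = "%h k. A h div q h ^ k" and S = "%h i acc. acc div q h" and B = A and I = A and N = r])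
 show "pc (%h. hd0 h div q (dn (dn h)))" by (intro pci assms(2)[THEN pcw, THEN pcw])
 show "A h div q h ^ Suc i = A h div q h ^ i div q h" for h i by (simp only: power_Suc2 div_mult2_eq)
qed (auto intro: assms)

lemma pc_bit [pci]:
 assumes "pc A" "pc t"
 shows "pc (%h. of_bool (bit (A h) (t h)))"
 by (rule pc_cong[OF pc_mod[OF pc_divpow[OF assms(1) pc_const[of 2] assms(2)] pc_const[of 2]]]) (simp add: bit_iff_odd mod_2_eq_odd)

lemma pc_cpow [pci]: "pc A ==> pc (%h. A h ^ (c::nat))"
 by (induction c) (auto intro: pci)

lemma prime_iff_no_factor: "prime (p::nat) \<longleftrightarrow> 1 < p \<and> (\<forall>i<p. \<forall>j<p. i * j \<noteq> p)"
proof
 assume p: "prime p"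
 show "1 < p \<and> (\<forall>i<p. \<forall>j<p. i * j \<noteq> p)"
 proof (intro conjI allI impI notI)
  show "1 < p" using p prime_gt_1_nat by blast
  fix i j assume ij: "i < p" "j < p" "i * j = p"
  then have "i = 1 \<or> i = p" using p prime_nat_iff by (metis dvd_triv_left)
  then show False using ij by auto
 qed
next
 assume a: "1 < p \<and> (\<forall>i<p. \<forall>j<p. i * j \<noteq> p)"
 show "prime p" unfolding prime_nat_iff
 proof (intro conjI allI impI)
  show "1 < p" using a by blast
  fix m assume "m dvd p"
  then obtain k where k: "p = m * k" by blast
  then have mk: "m \<le> p" "k \<le> p" "0 < p" using a by (cases m; cases k; simp)+
  have "m = p \<or> k = p"
  proof (rule ccontr)
   assume "\<not> ?thesis"
   then have "m < p" "k < p" using mk by auto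
   then show False using a k by blast
  qed
  moreover have "k = p ==> m = 1" using k mk(3) by auto
  ultimately show "m = 1 \<or> m = p" by blast
 qed
qed

lemma pc_nprime [pci]:
 assumes "pc A"
 shows "pc (%h. nprime (A h))"
 unfolding nprime_def
proof (rule pc_Least[where B = "%h. 2 * A h * A h + 7"])
 show "pc (%h. of_bool (prime (hd0 h) \<and> A (dn h) \<le> hd0 h))"
  unfolding prime_iff_no_factor by (intro pci assms[THEN pcw])
 show "\<exists>i\<le>2 * A h * A h + 7. prime i \<and> A h \<le> i" for h
  using nprime[of "A h"] by (intro exI[of _ "nprime (A h)"]) (simp add: power2_eq_square)
qed (intro pci assms)

section \<open>Computable bit strings\<close>

definition gb :: "bool list => nat => bool" where
 "gb xs i \<longleftrightarrow> i < length xs \<and> xs ! i"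

text \<open>A string is given by its length and access to single bits. Coded as one number it would
  have exponential value.\<close>

definition cs :: "(mem => bool list) => bool" where
 "cs X \<longleftrightarrow> pc (%h. length (X h)) \<and> pc (%h. of_bool (gb (X (dn h)) (hd0 h)))"

lemma cs_length [pci]: "cs X ==> pc (%h. length (X h))"
 by (simp add: cs_def)

lemma cs_gb [pci]: "cs X ==> pc I ==> pc (%h. of_bool (gb (X h) (I h)))"
 by (rule pc_let[where B = "%h. 1"]) (auto simp: cs_def intro: pci)

lemma csw: "cs X ==> cs (%h. X (dn h))"
 unfolding cs_def
proof (intro conjI)
 assume X: "pc (%h. length (X h)) \<and> pc (%h. of_bool (gb (X (dn h)) (hd0 h)))"
 then show "pc (%h. length (X (dn h)))" using pcw by blast
 have "cs X" using X by (simp add: cs_def)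
 then obtain t where t: "\<And>w e. ev t w e = of_bool (gb (X (dn (w, e))) (hd0 (w, e)))" using X unfolding pc_def by blast
 have "ev (ren (%i. if i = 0 then 0 else Suc i) t) w e = ev t w (vget 0 e # tl (tl e))" for w e
  by (rule ev_ren) (auto simp: vget_def nth_tl nth_Cons')
 then show "pc (%h. of_bool (gb (X (dn (dn h))) (hd0 h)))" by (intro pcI[of "ren (%i. if i = 0 then 0 else Suc i) t"]) (simp add: t dn_def hd0_def vget_def)
qed

lemma cs_tab [pci]:
 assumes "pc N" "pc (%h. of_bool (P (dn h) (hd0 h)))"
 shows "cs (%h. map (P h) [0..<N h])"
 unfolding cs_def
proof
 show "pc (%h. length (map (P h) [0..<N h]))" using assms by simp
 have "pc (%h. of_bool (hd0 h < N (dn h) \<and> P (dn h) (hd0 h)))" by (intro pci assms assms(1)[THEN pcw])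
 then show "pc (%h. of_bool (gb (map (P (dn h)) [0..<N (dn h)]) (hd0 h)))"
  by (rule pc_cong) (auto simp: gb_def)
qed

lemma cs_cong: "cs F ==> (\<And>h. G h = F h) ==> cs G"
 by (subgoal_tac "G = F") (simp, rule ext, blast)

lemma cs_take [pci]:
 assumes "cs X" "pc A"
 shows "cs (%h. take (A h) (X h))"
proof (rule cs_cong)
 show "cs (%h. map (%i. gb (X h) i) [0..<min (A h) (length (X h))])" by (intro pci assms assms(1)[THEN csw])
qed (auto intro!: nth_equalityI simp: gb_def)

lemma cs_drop [pci]:
 assumes "cs X" "pc A"
 shows "cs (%h. drop (A h) (X h))"
proof (rule cs_cong)
 show "cs (%h. map (%i. gb (X h) (A h + i)) [0..<length (X h) - A h])"
  by (intro pci assms assms(1)[THEN csw] assms(2)[THEN pcw])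
qed (auto intro!: nth_equalityI simp: gb_def)

lemma cs_append [pci]:
 assumes "cs X" "cs Y"
 shows "cs (%h. X h @ Y h)"
proof (rule cs_cong)
 show "cs (%h. map (%i. if i < length (X h) then gb (X h) i else gb (Y h) (i - length (X h))) [0..<length (X h) + length (Y h)])"
  by (intro pci assms assms[THEN csw])
qed (auto intro!: nth_equalityI simp: gb_def nth_append)

lemma cs_if [pci]:
 assumes "pc (%h. of_bool (P h))" "cs X" "cs Y"
 shows "cs (%h. if P h then X h else Y h)"
proof (rule cs_cong)
 show "cs (%h. map (%i. if P h then gb (X h) i else gb (Y h) i) [0..<if P h then length (X h) else length (Y h)])"
  by (intro pci assms assms(1)[THEN pcw] assms(2,3)[THEN csw])
qed (auto intro!: nth_equalityI simp: gb_def)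

lemma cs_const [pci]: "cs (%h. v)"
proof -
 have "pc (%h. of_bool (gb v (hd0 h)))"
 proof (induction v)
  case (Cons b v)
  have "pc (%h. of_bool (gb v (hd0 h - 1)))"
   by (rule pc_let[where B = "%h. 1" and F = "%h i. of_bool (gb v i)"]) (rule pc_sub[OF pc_hd0 pc_const], rule pc_const, rule Cons, simp)
  then have "pc (%h. if hd0 h = 0 then of_bool b else of_bool (gb v (hd0 h - 1)))"
   by (intro pc_if pc_eq pc_hd0 pc_const)
  then show ?case by (rule pc_cong) (auto simp: gb_def nth_Cons')
 qed (simp add: gb_def pc_const)
 then show ?thesis unfolding cs_def by (intro conjI pc_const)
qed

lemma pc_numm:
 assumes "cs X" "pc p" "\<And>h. 0 < p h"
 shows "pc (%h. num (X h) mod p h)"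
proof (rule pc_cong)
 show "pc (%h. (\<Sum>i<length (X h). of_bool (gb (X h) i) * (2 ^ i mod p h)) mod p h)"
  by (intro pc_msum pc_mpow pci assms assms(1)[THEN csw] assms(2)[THEN pcw])
 fix h
 have "(\<Sum>i<length (X h). of_bool (gb (X h) i) * (2 ^ i mod p h)) mod p h = (\<Sum>i<length (X h). of_bool (X h ! i) * 2 ^ i) mod p h"
  by (subst (1 2) mod_sum_eq[symmetric]) (auto simp: gb_def mod_simps intro!: arg_cong[where f = "%x. x mod p h"] sum.cong)
 then show "num (X h) mod p h = (\<Sum>i<length (X h). of_bool (gb (X h) i) * (2 ^ i mod p h)) mod p h"
  by (simp add: horner_sum_eq_sum lessThan_atLeast0)
qed

subsection \<open>The construction is computable\<close>

lemma pc_lg [pci]: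
 assumes "pc A"
 shows "pc (%h. lg (A h))"
proof (rule pc_cong)
 show "pc (%h. LEAST i. A h div 2 ^ (i + 1) = 0)"
 proof (rule pc_Least[where B = A])
  show "pc (%h. of_bool (A (dn h) div 2 ^ (hd0 h + 1) = 0))" by (intro pci assms[THEN pcw])
  show "\<exists>i\<le>A h. A h div 2 ^ (i + 1) = 0" for h
  proof (intro exI[of _ "A h"] conjI order_refl)
   have "A h < 2 ^ (A h + 1)" using less_exp[of "A h + 1"] by linarith
   then show "A h div 2 ^ (A h + 1) = 0" by (rule div_less)
  qed
 qed (rule assms)
 show "lg (A h) = (LEAST i. A h div 2 ^ (i + 1) = 0)" for h
  unfolding lg_def by (rule arg_cong[where f = Least]) (simp add: div_eq_0_iff)
qed

lemma pc_crt [pci]: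
 assumes "pc A"
 shows "pc (%h. crt (A h))"
 unfolding crt_def
proof (rule pc_Least[where B = A])
 have "pc (%h. of_bool (A (dn h) < (hd0 h + 1) ^ 3))" by (intro pci assms[THEN pcw])
 then show "pc (%h. of_bool (A (dn h) < Suc (hd0 h) ^ 3))" by simp
 show "\<exists>i\<le>A h. A h < Suc i ^ 3" for h
  using self_le_power[of "Suc (A h)" 3] by (intro exI[of _ "A h"]) simp
qed (rule assms)

lemma pc_pP [pci]: "pc A ==> pc (%h. pP (A h))" unfolding pP_def by (intro pci)
lemma pc_pb [pci]: "pc A ==> pc (%h. pb (A h))" unfolding pb_def by (intro pci)

lemma pc_pa [pci]:
 assumes "pc A"
 shows "pc (%h. pa (A h))"
 unfolding pa_def
proof (rule pc_Least[where B = "%h. pP (A h)"])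
 have e: "(pP n = 2 \<or> nonres (pP n) a) \<longleftrightarrow> (pP n \<noteq> 2 \<longrightarrow> (\<forall>b<pP n. b * b mod pP n \<noteq> a mod pP n))" for n a
  using nonres_iff[of "pP n" a] pP(4)[of n] by auto
 show "pc (%h. of_bool (pP (A (dn h)) = 2 \<or> nonres (pP (A (dn h))) (hd0 h)))"
  unfolding e by (intro pci assms[THEN pcw] assms[THEN pcw, THEN pcw])
 show "\<exists>i\<le>pP (A h). pP (A h) = 2 \<or> nonres (pP (A h)) i" for h
  using exists_nonres[OF pP(1)[of "A h"]] by (cases "pP (A h) = 2") (auto intro: less_imp_le)
qed (intro pci assms)

lemma pc_pq [pci]: "pc A ==> pc (%h. pq (A h))" unfolding pq_def by (intro pci)
lemma pc_pm [pci]: "pc A ==> pc (%h. pm (A h))" unfolding pm_def by (intro pci)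
lemma pc_pY [pci]: "pc A ==> pc (%h. pY c (A h))" unfolding pY_def by (intro pci)
lemma pc_pp3 [pci]: "pc A ==> pc (%h. pp3 c (A h))" unfolding pp3_def by (intro pci)
lemma pc_pb3 [pci]: "pc A ==> pc (%h. pb3 c (A h))" unfolding pb3_def by (intro pci)
lemma pc_pq3 [pci]: "pc A ==> pc (%h. pq3 c (A h))" unfolding pq3_def by (intro pci)
lemma pc_sd [pci]: "pc A ==> pc (%h. sd c (A h))" unfolding sd_def by (intro pci)
lemma pc_cd [pci]: "pc A ==> pc (%h. cd c (A h))" unfolding cd_def by (intro pci)
lemma pc_rd [pci]: "pc A ==> pc (%h. rd c (A h))" unfolding rd_def by (intro pci)
lemma pc_rR [pci]: "pc A ==> pc K ==> pc (%h. rR (A h) (K h))" unfolding rR_def by (intro pci)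
lemma pc_rg [pci]: "pc A ==> pc K ==> pc (%h. rg (A h) (K h))" unfolding rg_def by (intro pci)
lemma pc_rv [pci]: "pc A ==> pc K ==> pc (%h. rv (A h) (K h))" unfolding rv_def by (intro pci)

lemma pc_dpoly:
 assumes "pc q" "pc R" "pc j" "pc a" "\<And>h. 0 < q h"
 shows "pc (%h. dpoly (q h) (R h) (j h) (a h))"
proof (rule pc_cong)
 show "pc (%h. (\<Sum>r<R h. (j h div q h ^ r mod q h) * (a h ^ r mod q h)) mod q h)"
  by (intro pc_msum pc_mpow pci assms assms(1-4)[THEN pcw])
 fix h
 have "(\<Sum>r<R h. (j h div q h ^ r mod q h) * (a h ^ r mod q h)) mod q h
   = (\<Sum>r<R h. (j h div q h ^ r mod q h) * a h ^ r) mod q h"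
  by (subst (1 2) mod_sum_eq[symmetric]) (simp only: mod_mult_right_eq)
 then show "dpoly (q h) (R h) (j h) (a h) = (\<Sum>r<R h. (j h div q h ^ r mod q h) * (a h ^ r mod q h)) mod q h"
  by (simp only: dpoly_def)
qed

lemma pc_rsval:
 assumes "pc p" "cs x" "pc (%h. \<beta> h mod p h)" "\<And>h. 0 < p h"
 shows "pc (%h. rsval (p h) (x h) (\<beta> h))"
proof (rule pc_cong)
 show "pc (%h. (\<Sum>j<length (x h). of_bool (gb (x h) j) * ((\<beta> h mod p h) ^ j mod p h)) mod p h)"
  by (intro pc_msum pc_mpow pci assms assms(1,3)[THEN pcw] assms(2)[THEN csw])
 fix h
 have "(\<Sum>j<length (x h). of_bool (gb (x h) j) * ((\<beta> h mod p h) ^ j mod p h)) mod p h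
   = (\<Sum>j<length (x h). of_bool (gb (x h) j) * \<beta> h ^ j) mod p h"
  by (subst (1 2) mod_sum_eq[symmetric]) (simp only: mod_mult_right_eq power_mod)
 also have "... = rsval (p h) (x h) (\<beta> h)"
  unfolding rsval_def by (intro arg_cong2[where f = "(mod)"] sum.cong) (auto simp: gb_def)
 finally show "rsval (p h) (x h) (\<beta> h) = (\<Sum>j<length (x h). of_bool (gb (x h) j) * ((\<beta> h mod p h) ^ j mod p h)) mod p h" ..
qed

lemma pc_ip:
 assumes "pc w" "cs r" "pc v" "\<And>h. w h \<le> length (r h)"
 shows "pc (%h. of_bool (ip (w h) (r h) (v h)))"
proof (rule pc_cong)
 show "pc (%h. (\<Sum>t<w h. of_bool (gb (r h) t \<and> bit (v h) t)) mod 2)"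
  by (intro pc_msum pci assms assms(1,3)[THEN pcw] assms(2)[THEN csw]) simp
 fix h
 have "(\<Sum>t<w h. of_bool (gb (r h) t \<and> bit (v h) t)) = (\<Sum>t<w h. of_bool (r h ! t \<and> bit (v h) t) :: nat)"
  by (intro sum.cong) (use assms(4)[of h] in \<open>auto simp: gb_def\<close>)
 then show "of_bool (ip (w h) (r h) (v h)) = (\<Sum>t<w h. of_bool (gb (r h) t \<and> bit (v h) t)) mod (2::nat)"
  unfolding ip_def by (simp add: mod_2_eq_odd)
qed

lemma pc_code:
 assumes "pc p" "pc b" "pc w" "cs x" "cs v" "\<And>h. 0 < p h" "\<And>h. length (v h) = b h + w h"
 shows "pc (%h. of_bool (rsh (p h) (b h) (w h) (x h) (v h)))"
 unfolding rsh_def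
 by (intro pc_ip pc_rsval pc_numm pci assms) (simp add: assms(7))

lemma cs_tre:
 assumes "pc p" "pc b" "pc w" "pc q" "pc m" "cs x" "cs y" "\<And>h. 0 < p h" "\<And>h. 0 < q h"
  "\<And>h. length (y h) = (b h + w h) * q h"
 shows "cs (%h. tre (p h) (b h) (w h) (q h) (m h) (x h) (y h))"
proof (rule cs_cong)
 show "cs (%h. map (%i. rsh (p h) (b h) (w h) (x h)
   (map (%a. gb (y h) (a * q h + dpoly (q h) (m h) i a)) [0..<b h + w h])) [0..<m h])"
  by (intro pc_code pc_dpoly pci assms assms(1-5)[THEN pcw] assms(6,7)[THEN csw]
    assms(1-5)[THEN pcw, THEN pcw] assms(6,7)[THEN csw, THEN csw]) simp
 fix h
 have "y h ! (a * q h + dpoly (q h) (m h) i a) = gb (y h) (a * q h + dpoly (q h) (m h) i a)" if "a < b h + w h" for a i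
 proof -
  have "dpoly (q h) (m h) i a < q h" unfolding dpoly_def by (rule mod_less_divisor) (rule assms)
  then have "a * q h + dpoly (q h) (m h) i a < (a + 1) * q h" by simp
  also have "... \<le> (b h + w h) * q h" using that by (intro mult_right_mono) auto
  finally show ?thesis by (simp add: gb_def assms(10))
 qed
 then show "tre (p h) (b h) (w h) (q h) (m h) (x h) (y h) = map (%i. rsh (p h) (b h) (w h) (x h)
   (map (%a. gb (y h) (a * q h + dpoly (q h) (m h) i a)) [0..<b h + w h])) [0..<m h]"
  unfolding tre_def by (intro map_cong refl arg_cong[where f = "rsh (p h) (b h) (w h) (x h)"]) auto
qed

lemma qpow_mod: "qpow p a (u mod p, v mod p) j = qpow p a (u, v) j"
proof (induction j)
 case (Suc j)
 obtain x y where z: "qpow p a (u, v) j = (x, y)" by (cases "qpow p a (u, v) j")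
 have "[u mod p * x + a * (v mod p * y) = u * x + a * (v * y)] (mod p)" "[u mod p * y + v mod p * x = u * y + v * x] (mod p)"
  by (intro cong_add cong_mult cong_refl; simp add: cong_def)+
 then show ?case using Suc z by (simp add: qmul_def cong_def)
qed simp

lemma qpow_less: "1 < p ==> fst (qpow p a z j) < p \<and> snd (qpow p a z j) < p"
 by (cases j) (auto simp: qmul_def)

text \<open>A recursion carries a single number, so a pair of residues is coded in base p.\<close>

lemma pc_qpow_enc:
 assumes "pc p" "pc a" "pc u" "pc v" "pc j" "\<And>h. 1 < p h"
 shows "pc (%h. fst (qpow (p h) (a h) (u h, v h) (j h)) * p h + snd (qpow (p h) (a h) (u h, v h) (j h)))"
proof (rule pc_iter[where N = j and I = p and B = "%h. p h * p h"
  and G = "%h k. fst (qpow (p h) (a h) (u h, v h) k) * p h + snd (qpow (p h) (a h) (u h, v h) k)"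
  and S = "%h i acc. (u h * (acc div p h) + a h * (v h * (acc mod p h))) mod p h * p h + (u h * (acc mod p h) + v h * (acc div p h)) mod p h"])
 show "pc (%h. (u (dn (dn h)) * (hd0 h div p (dn (dn h))) + a (dn (dn h)) * (v (dn (dn h)) * (hd0 h mod p (dn (dn h))))) mod p (dn (dn h)) * p (dn (dn h))
   + (u (dn (dn h)) * (hd0 h mod p (dn (dn h))) + v (dn (dn h)) * (hd0 h div p (dn (dn h)))) mod p (dn (dn h)))"
  by (intro pci assms(1-4)[THEN pcw, THEN pcw])
 fix h i
 let ?z = "qpow (p h) (a h) (u h, v h)"
 have l: "fst (?z k) < p h" "snd (?z k) < p h" for k using qpow_less[OF assms(6)] by blast+
 have dm: "(fst (?z k) * p h + snd (?z k)) div p h = fst (?z k)" "(fst (?z k) * p h + snd (?z k)) mod p h = snd (?z k)" for k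
  using l[of k] assms(6)[of h] by simp_all
 show "fst (?z (Suc i)) * p h + snd (?z (Suc i)) =
  (u h * ((fst (?z i) * p h + snd (?z i)) div p h) + a h * (v h * ((fst (?z i) * p h + snd (?z i)) mod p h))) mod p h * p h +
  (u h * ((fst (?z i) * p h + snd (?z i)) mod p h) + v h * ((fst (?z i) * p h + snd (?z i)) div p h)) mod p h"
  unfolding dm by (simp add: qmul_def)
 have "fst (?z (Suc i)) * p h + snd (?z (Suc i)) \<le> fst (?z (Suc i)) * p h + p h" using l(2)[of "Suc i"] by linarith
 also have "... = (fst (?z (Suc i)) + 1) * p h" by simp
 also have "... \<le> p h * p h" using l(1)[of "Suc i"] by (intro mult_right_mono) linarith+
 finally show "fst (?z (Suc i)) * p h + snd (?z (Suc i)) \<le> p h * p h" .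
qed (use assms in \<open>auto intro: pci\<close>)

lemma pc_qpow:
 assumes "pc p" "pc a" "pc (%h. u h mod p h)" "pc (%h. v h mod p h)" "pc j" "\<And>h. 1 < p h"
 shows "pc (%h. fst (qpow (p h) (a h) (u h, v h) (j h)))" "pc (%h. snd (qpow (p h) (a h) (u h, v h) (j h)))"
proof -
 note e = pc_qpow_enc[OF assms, unfolded qpow_mod]
 have l: "fst (qpow (p h) (a h) (u h, v h) (j h)) < p h" "snd (qpow (p h) (a h) (u h, v h) (j h)) < p h" for h
  using qpow_less[OF assms(6)] by blast+
 show "pc (%h. fst (qpow (p h) (a h) (u h, v h) (j h)))"
 proof (rule pc_cong[OF pc_div[OF e assms(1)]])
  show "fst (qpow (p h) (a h) (u h, v h) (j h)) =
   (fst (qpow (p h) (a h) (u h, v h) (j h)) * p h + snd (qpow (p h) (a h) (u h, v h) (j h))) div p h" for h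
   using l[of h] assms(6)[of h] by simp
 qed
 show "pc (%h. snd (qpow (p h) (a h) (u h, v h) (j h)))"
 proof (rule pc_cong[OF pc_mod[OF e assms(1)]])
  show "snd (qpow (p h) (a h) (u h, v h) (j h)) =
   (fst (qpow (p h) (a h) (u h, v h) (j h)) * p h + snd (qpow (p h) (a h) (u h, v h) (j h))) mod p h" for h
   using l[of h] assms(6)[of h] by simp
 qed
qed

lemma qeval_gb: "qeval p a x z = ((\<Sum>j<length x. of_bool (gb x j) * fst (qpow p a z j)) mod p,
  (\<Sum>j<length x. of_bool (gb x j) * snd (qpow p a z j)) mod p)"
 unfolding qeval_def by (intro arg_cong2[where f = Pair] arg_cong2[where f = "(mod)"] sum.cong) (auto simp: gb_def)

lemma pc_qeval:
 assumes "pc p" "pc a" "cs x" "pc (%h. u h mod p h)" "pc (%h. v h mod p h)" "\<And>h. 1 < p h"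
 shows "pc (%h. fst (qeval (p h) (a h) (x h) (u h, v h)))" "pc (%h. snd (qeval (p h) (a h) (x h) (u h, v h)))"
proof -
 have p0: "0 < p h" for h using assms(6)[of h] by simp
 show "pc (%h. fst (qeval (p h) (a h) (x h) (u h, v h)))" "pc (%h. snd (qeval (p h) (a h) (x h) (u h, v h)))"
  unfolding qeval_gb fst_conv snd_conv
  by (intro pc_msum pc_qpow pci assms p0 assms(1,2,4,5)[THEN pcw] assms(3)[THEN csw])+
qed

lemma cs_pv:
 assumes "pc p" "pc a" "pc b" "pc w" "pc m" "cs x" "cs s" "\<And>h. 1 < p h"
 shows "cs (%h. pv (p h) (a h) (b h) (w h) (m h) (x h) (s h))"
proof -
 have p0: "0 < p h" for h using assms(8)[of h] by simp
 have um: "pc (%h. (num (take (b (dn h)) (s (dn h))) + hd0 h div (2 * w (dn h))) mod p (dn h))"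
 proof (rule pc_cong)
  show "pc (%h. (num (take (b (dn h)) (s (dn h))) mod p (dn h) + hd0 h div (2 * w (dn h))) mod p (dn h))"
   by (intro pc_numm pci p0 assms(1-5)[THEN pcw] assms(6,7)[THEN csw])
 qed (simp only: mod_add_left_eq)
 have vm: "pc (%h. num (drop (b (dn h)) (s (dn h))) mod p (dn h))"
  by (intro pc_numm pci p0 assms(1-5)[THEN pcw] assms(6,7)[THEN csw])
 show ?thesis unfolding pv_def Let_def
  by (intro cs_tab pc_ifb pc_less pc_bit pc_qeval um vm pci assms assms(1-5)[THEN pcw] assms(6,7)[THEN csw])
qed

lemma mod_sum_cong: "(\<And>i. i \<in> S ==> f i mod m = g i mod (m::nat)) ==> sum f S mod m = sum g S mod m"
 by (subst (1 2) mod_sum_eq[symmetric]) (simp cong: sum.cong)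

lemma mod_prod_cong: "(\<And>i. i \<in> S ==> f i mod m = g i mod (m::nat)) ==> prod f S mod m = prod g S mod m"
 by (subst (1 2) mod_prod_eq[symmetric]) (simp cong: prod.cong)

lemma pc_mcoef:
 assumes "pc p" "pc t" "pc i" "pc (%h. y h mod p h)" "\<And>h. 0 < p h"
 shows "pc (%h. mcoef (p h) (t h) (i h) (y h))"
proof (rule pc_cong)
 show "pc (%h. (\<Prod>j<t h. if j = i h then 1 else y h mod p h + (p h - j)) mod p h)"
  by (intro pc_mprod pci assms assms(1-4)[THEN pcw])
 fix h
 have "(\<Prod>j<t h. if j = i h then 1 else y h mod p h + (p h - j)) mod p h = (\<Prod>j<t h. if j = i h then 1 else y h + (p h - j)) mod p h"
  by (rule mod_prod_cong) (simp add: mod_add_left_eq)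
 then show "mcoef (p h) (t h) (i h) (y h) = (\<Prod>j<t h. if j = i h then 1 else y h mod p h + (p h - j)) mod p h"
  by (simp only: mcoef_def)
qed

text \<open>The index is clamped to \<open>R - 1\<close> so that slices are in range in every memory state.\<close>

lemma cs_merge:
 assumes "pc p" "pc b" "pc w" "pc t" "pc R" "cs (%h. rw (dn h) (hd0 h))" "cs y" "\<And>h. 0 < p h"
  "\<And>h i. length (rw h i) = R h * b h"
 shows "cs (%h. merge (p h) (b h) (w h) (t h) (R h) (rw h) (y h))"
proof (rule cs_cong)
 let ?c = "%h \<iota>. min (\<iota> div w h) (R h - 1)"
 let ?sym = "%h \<iota>. if R h = 0 then 0 else (\<Sum>i<t h. (slice (b h) (rw h i) (?c h \<iota>) mod p h) * mcoef (p h) (t h) i (num (y h))) mod p h"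
 \<comment> \<open>In the sum for one output bit the row index is innermost and the output position
   lies between it and the outer memory, so a variable is inserted there by renaming.\<close>
 have rw2: "cs (%h. rw (dn (dn h)) (hd0 h))"
 proof -
  obtain t1 where t1: "\<And>w e. ev t1 w e = length (rw (dn (w, e)) (hd0 (w, e)))" using assms(6) unfolding cs_def pc_def by blast
  have "pc (%h. of_bool (gb (rw (dn (dn h)) (hd0 (dn h))) (hd0 h)))" using assms(6) unfolding cs_def by blast
  then obtain t2 where t2: "\<And>w e. ev t2 w e = of_bool (gb (rw (dn (dn (w, e))) (hd0 (dn (w, e)))) (hd0 (w, e)))" unfolding pc_def by blast
  have 1: "pc (%h. length (rw (dn (dn h)) (hd0 h)))"
  proof (rule pcI[of "ren (%i. if i = 0 then 0 else Suc i) t1"])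
   fix w e
   have "ev (ren (%i. if i = 0 then 0 else Suc i) t1) w e = ev t1 w (vget 0 e # tl (tl e))"
    by (rule ev_ren) (auto simp: vget_def nth_tl nth_Cons')
   then show "ev (ren (%i. if i = 0 then 0 else Suc i) t1) w e = length (rw (dn (dn (w, e))) (hd0 (w, e)))"
    by (simp add: t1 dn_def hd0_def vget_def)
  qed
  have 2: "pc (%h. of_bool (gb (rw (dn (dn (dn h))) (hd0 (dn h))) (hd0 h)))"
  proof (rule pcI[of "ren (%i. if i < 2 then i else Suc i) t2"])
   fix w e
   have "ev (ren (%i. if i < 2 then i else Suc i) t2) w e = ev t2 w (vget 0 e # vget 1 e # tl (tl (tl e)))"
   proof (rule ev_ren)
    have tl: "vget k (tl e) = vget (Suc k) e" for k e by (auto simp: vget_def nth_tl)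
    have 0: "vget 0 (a # e) = a" for a e by (simp add: vget_def)
    fix i
    show "vget (if i < 2 then i else Suc i) e = vget i (vget 0 e # vget 1 e # tl (tl (tl e)))"
    proof (cases i)
     case (Suc j)
     then show ?thesis by (cases j) (simp_all add: tl 0)
    qed (simp add: 0)
   qed
   then show "ev (ren (%i. if i < 2 then i else Suc i) t2) w e = of_bool (gb (rw (dn (dn (dn (w, e)))) (hd0 (dn (w, e)))) (hd0 (w, e)))"
    by (simp add: t2 dn_def hd0_def vget_def nth_tl)
  qed
  show ?thesis unfolding cs_def using 1 2 by blast
 qed
 have sl: "pc (%h. if R (dn (dn h)) = 0 then 0 else slice (b (dn (dn h))) (rw (dn (dn h)) (hd0 h)) (?c (dn (dn h)) (hd0 (dn h))) mod p (dn (dn h)))"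
 proof (rule pc_cong)
  show "pc (%h. if R (dn (dn h)) = 0 then 0 else num (map (%j. gb (rw (dn (dn h)) (hd0 h)) (?c (dn (dn h)) (hd0 (dn h)) * b (dn (dn h)) + j)) [0..<b (dn (dn h))]) mod p (dn (dn h)))"
   by (intro pc_numm pci assms(8) rw2[THEN csw] rw2 assms(1-5)[THEN pcw, THEN pcw] assms(1-5)[THEN pcw, THEN pcw, THEN pcw])
  fix h' let ?h = "dn (dn h')"
  have "map (%j. rw ?h (hd0 h') ! (?c ?h (hd0 (dn h')) * b ?h + j)) [0..<b ?h] = map (%j. gb (rw ?h (hd0 h')) (?c ?h (hd0 (dn h')) * b ?h + j)) [0..<b ?h]" if "R ?h \<noteq> 0"
  proof (intro map_cong refl)
   fix j assume "j \<in> set [0..<b ?h]"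
   then have "?c ?h (hd0 (dn h')) * b ?h + j < (?c ?h (hd0 (dn h')) + 1) * b ?h" by simp
   also have "... \<le> R ?h * b ?h" using that by (intro mult_right_mono) auto
   finally show "rw ?h (hd0 h') ! (?c ?h (hd0 (dn h')) * b ?h + j) = gb (rw ?h (hd0 h')) (?c ?h (hd0 (dn h')) * b ?h + j)"
    by (simp add: gb_def assms(9))
  qed
  note eq = this
  show "(if R ?h = 0 then 0 else slice (b ?h) (rw ?h (hd0 h')) (?c ?h (hd0 (dn h'))) mod p ?h) =
   (if R ?h = 0 then 0 else num (map (%j. gb (rw ?h (hd0 h')) (?c ?h (hd0 (dn h')) * b ?h + j)) [0..<b ?h]) mod p ?h)"
  proof (cases "R ?h = 0")
   case True
   show ?thesis unfolding if_P[OF True] ..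
  next
   case False
   show ?thesis unfolding if_not_P[OF False] slice_def eq[OF False] ..
  qed
 qed
 show "cs (%h. map (%\<iota>. bit ((\<Sum>i<t h. (if R h = 0 then 0 else slice (b h) (rw h i) (?c h \<iota>) mod p h) * mcoef (p h) (t h) i (num (y h))) mod p h) (\<iota> mod w h)) [0..<R h * w h])"
  by (intro cs_tab pc_bit pc_msum sl pc_mul pc_mcoef pc_numm pci assms(1-5,7,8) assms(1-5)[THEN pcw] assms(7)[THEN csw]
    assms(1-5)[THEN pcw, THEN pcw] assms(7)[THEN csw, THEN csw])
 fix h
 show "merge (p h) (b h) (w h) (t h) (R h) (rw h) (y h) =
  map (%\<iota>. bit ((\<Sum>i<t h. (if R h = 0 then 0 else slice (b h) (rw h i) (?c h \<iota>) mod p h) * mcoef (p h) (t h) i (num (y h))) mod p h) (\<iota> mod w h)) [0..<R h * w h]"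
  unfolding merge_def msym_def
 proof (intro map_cong refl arg_cong2[where f = bit] mod_sum_cong)
  fix \<iota> i assume \<iota>: "\<iota> \<in> set [0..<R h * w h]"
  then have "0 < w h" by (cases "w h") auto
  then have d: "\<iota> div w h < R h" using \<iota> by (simp add: div_less_iff_less_mult)
  then have "?c h \<iota> = \<iota> div w h" "R h \<noteq> 0" by auto
  then show "slice (b h) (rw h i) (\<iota> div w h) * mcoef (p h) (t h) i (num (y h)) mod p h =
   (if R h = 0 then 0 else slice (b h) (rw h i) (?c h \<iota>) mod p h) * mcoef (p h) (t h) i (num (y h)) mod p h"
   by (simp add: mod_mult_left_eq)
 qed
qed

lemma length_sml [simp]: "length (sml c n v s) = pm n"
 by (simp add: sml_def)

lemma cs_sml:
 assumes "pc N" "cs v" "cs s" "\<And>h. length (s h) = sd c (N h)"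
 shows "cs (%h. sml c (N h) (v h) (s h))"
 unfolding sml_def
proof (rule cs_tre)
 show "cs (%h. pv (pP (N h)) (pa (N h)) (pb (N h)) (pb (N h) + 1) (pm (N h)) (v h) (take (2 * pb (N h)) (s h)))"
  by (intro cs_pv pci assms pP)
 show "length (drop (2 * pb (N h)) (s h)) = (pb3 c (N h) + (pb3 c (N h) + 1)) * pq3 c (N h)" for h
  by (simp add: assms(4) sd_def)
 show "0 < pp3 c (N h)" "0 < pq3 c (N h)" for h
  unfolding pp3_def pq3_def using nprime(1) prime_gt_0_nat by blast+
qed (intro pci assms)+

lemma pq_pos: "0 < pq n"
 unfolding pq_def using nprime(1) prime_gt_0_nat by blast

lemma cs_blk:
 assumes "pc N" "pc g" "pc m" "cs v" "cs s" "\<And>h. length (s h) = sd c (N h)"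
 shows "cs (%h. blk (g h) (tre (pP (N h)) (pb (N h)) (pb (N h) + 1) (pq (N h)) (m h)) (sml c (N h)) (v h) (s h))"
 unfolding blk_def
proof (rule cs_tre)
 show "0 < pP (N h)" for h using pP(4)[of "N h"] by simp
qed (intro cs_sml pci assms pq_pos | simp add: pm_def)+

lemma cs_cnd:
 assumes "pc N" "pc K" "cs x" "cs s" "\<And>h. length (s h) = sd c (N h) + pb (N h)"
 shows "cs (%h. cnd c (N h) (K h) (x h) (s h))"
 unfolding cnd_def
proof (rule cs_merge)
 show "0 < pP (N h)" for h using pP(4)[of "N h"] by simp
 show "length (blk (i * rg (N h) (K h)) (tre (pP (N h)) (pb (N h)) (pb (N h) + 1) (pq (N h)) (rR (N h) (K h) * pb (N h))) (sml c (N h)) (x h) (take (sd c (N h)) (s h)))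
  = rR (N h) (K h) * pb (N h)" for h i by (simp add: blk_def)
 show "cs (%h. blk (hd0 h * rg (N (dn h)) (K (dn h))) (tre (pP (N (dn h))) (pb (N (dn h))) (pb (N (dn h)) + 1) (pq (N (dn h))) (rR (N (dn h)) (K (dn h)) * pb (N (dn h))))
   (sml c (N (dn h))) (x (dn h)) (take (sd c (N (dn h))) (s (dn h))))"
  by (intro cs_blk pci assms(1,2)[THEN pcw] assms(3,4)[THEN csw]) (simp add: assms(5))
qed (intro pci assms)+

lemma cs_rnd:
 assumes "pc N" "pc K" "pc m" "cs x" "cs s" "\<And>h. length (s h) = rd c (N h)"
 shows "cs (%h. rnd c (N h) (K h) (m h) (x h) (s h))"
 unfolding rnd_def cnd2_def
 by (intro cs_blk cs_cnd cs_pv pci assms pP) (simp_all add: assms(6) rd_def cd_def)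

lemma length_rnd [simp]: "length (rnd c n kp m x s) = m"
 by (simp add: rnd_def blk_def)

lemma cs_pext:
 assumes "pc N" "cs x" "pc K" "cs s" "\<And>h. length (s h) = r * rd c (N h)"
 shows "cs (%h. pext c (N h) r (K h) (x h) (s h))"
 using assms(3-)
proof (induction r arbitrary: K s)
 case 0
 then show ?case by (simp add: cs_const)
next
 case (Suc r)
 show ?case unfolding pext.simps
  by (intro cs_append cs_rnd Suc.IH pci assms(1,2) Suc.prems(1,2)) (simp_all add: Suc.prems(3))
qed

subsection \<open>Uniform evaluation\<close>

lemma tm_of_cs:
 assumes "cs X"
 shows "\<exists>M a e. wf_tm M \<and> (\<forall>w. set w \<subseteq> {1, 2, 3} \<longrightarrow>
   outputs_within M (a + a * length w ^ e) w (enc_bits (X (w, [length w]))))"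
proof -
 obtain L where L: "\<And>w e. ev L w e = length (X (w, e))" using assms unfolding cs_def pc_def by blast
 have "pc (%h. of_bool (gb (X (dn h)) (hd0 h)))" using assms unfolding cs_def by blast
 then obtain b where b: "\<And>w e. ev b w e = of_bool (gb (X (dn (w, e))) (hd0 (w, e)))" unfolding pc_def by blast
 have "map (%j. if ev b w [j, length w] \<noteq> 0 then 2 else 1) [0..<ev L w [length w]] = enc_bits (X (w, [length w]))" for w
  by (rule nth_equalityI) (auto simp: L b enc_bits_def dn_def hd0_def vget_def gb_def)
 then show ?thesis using tm_of_aexps[of b L] by simp
qed

text \<open>The unary k is a run of the symbol 2. The alternative \<open>hd0 h \<le> i\<close>
  bounds the search by the input length in every memory state.\<close>

definition dK :: "mem => nat" where "dK h = (LEAST i. inp h i \<noteq> 2 \<or> hd0 h \<le> i)"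
definition dS :: "mem => nat" where "dS h = (LEAST i. (dK h < i \<and> inp h i = 3) \<or> hd0 h \<le> i)"
definition dx :: "mem => bool list" where "dx h = map (%j. inp h (dK h + 1 + j) = 2) [0..<dS h - dK h - 1]"
text \<open>The length is supplied from outside, since the seed length can be computed from
  \<open>n\<close>.\<close>

definition ds :: "mem => nat => bool list" where "ds h m = map (%j. inp h (dS h + 1 + j) = 2) [0..<m]"

text \<open>The input tape is the same below a binder, but its recorded length is not.\<close>

lemma pc_inp_dn: "pc A ==> pc (%h. inp (dn h) (A h))"
 by (rule pc_cong[OF pc_inp]) (auto simp: inp_def dn_def)

lemma pc_dK [pci]: "pc dK"
 unfolding dK_def[abs_def]
proof (rule pc_Least[where B = hd0])
 have "pc (%h. of_bool (inp (dn h) (hd0 h) = 2 \<longrightarrow> hd0 (dn h) \<le> hd0 h))" by (intro pci pc_inp_dn)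
 then show "pc (%h. of_bool (inp (dn h) (hd0 h) \<noteq> 2 \<or> hd0 (dn h) \<le> hd0 h))" by (rule pc_cong) auto
qed (auto intro: pci)

lemma pc_dS [pci]: "pc dS"
 unfolding dS_def[abs_def]
proof (rule pc_Least[where B = hd0])
 have "pc (%h. of_bool (\<not> (dK (dn h) < hd0 h \<and> inp (dn h) (hd0 h) = 3) \<longrightarrow> hd0 (dn h) \<le> hd0 h))"
  by (intro pci pc_inp_dn pc_dK[THEN pcw])
 then show "pc (%h. of_bool ((dK (dn h) < hd0 h \<and> inp (dn h) (hd0 h) = 3) \<or> hd0 (dn h) \<le> hd0 h))" by (rule pc_cong) auto
qed (auto intro: pci)

lemma cs_dx: "cs dx"
 unfolding dx_def[abs_def] by (intro pci pc_inp_dn pc_dK[THEN pcw])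

lemma cs_ds: "pc m ==> cs (%h. ds h (m h))"
 unfolding ds_def by (intro pci pc_inp_dn pc_dS[THEN pcw])

lemma decode:
 assumes w: "w = enc_tuple [replicate k True, x, s]"
 shows "set w \<subseteq> {1, 2, 3}" "dK (w, [length w]) = k" "dx (w, [length w]) = x" "ds (w, [length w]) (length s) = s"
proof -
 let ?h = "(w, [length w])"
 have W: "w = (replicate k 2 @ [3]) @ (enc_bits x @ [3]) @ (enc_bits s @ [3])"
  unfolding w enc_tuple_def enc_bits_def by simp
 have len: "length w = k + length x + length s + 3" unfolding W enc_bits_def by simp
 show st: "set w \<subseteq> {1, 2, 3}" unfolding W enc_bits_def by (auto split: if_splits)
 have inpw: "inp ?h i = w ! i" if "i < length w" for i
 proof -
  have "w ! i \<in> {1, 2, 3}" using st nth_mem[OF that] by blast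
  then show ?thesis using that by (auto simp: inp_def)
 qed
 have hd: "hd0 ?h = length w" by (simp add: hd0_def vget_def)
 have k1: "inp ?h i = 2" if "i < k" for i using that by (subst inpw) (simp_all add: len W nth_append)
 have k2: "inp ?h k = 3" by (subst inpw) (simp_all add: len W nth_append)
 have x1: "inp ?h (k + 1 + j) = (if x ! j then 2 else 1)" if "j < length x" for j
  using that by (subst inpw) (simp_all add: len W nth_append enc_bits_def)
 have x2: "inp ?h (k + 1 + length x) = 3" by (subst inpw) (simp_all add: len W nth_append enc_bits_def)
 have s1: "inp ?h (k + 1 + length x + 1 + j) = (if s ! j then 2 else 1)" if j: "j < length s" for j
 proof (subst inpw)
  show "k + 1 + length x + 1 + j < length w" using j len by simp
  have "w = ((replicate k 2 @ [3]) @ (enc_bits x @ [3])) @ (enc_bits s @ [3])" unfolding W by simp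
  moreover have "length ((replicate k 2 @ [3]) @ (enc_bits x @ [3])) = k + 1 + length x + 1" by (simp add: enc_bits_def)
  ultimately have "w ! (k + 1 + length x + 1 + j) = (enc_bits s @ [3]) ! j" by (metis nth_append_length_plus)
  then show "w ! (k + 1 + length x + 1 + j) = (if s ! j then 2 else 1)" using j by (simp add: nth_append enc_bits_def)
 qed
 show K: "dK ?h = k" unfolding dK_def hd
 proof (rule Least_equality)
  show "inp ?h k \<noteq> 2 \<or> length w \<le> k" using k2 by simp
  show "k \<le> i" if "inp ?h i \<noteq> 2 \<or> length w \<le> i" for i using that k1[of i] len by (cases "i < k") auto
 qed
 have S: "dS ?h = k + 1 + length x" unfolding dS_def hd K
 proof (rule Least_equality)
  show "(k < k + 1 + length x \<and> inp ?h (k + 1 + length x) = 3) \<or> length w \<le> k + 1 + length x" using x2 by simp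
  fix i assume i: "(k < i \<and> inp ?h i = 3) \<or> length w \<le> i"
  show "k + 1 + length x \<le> i"
  proof (rule ccontr)
   assume n: "\<not> ?thesis"
   then have ki: "k < i" "inp ?h i = 3" using i len by auto
   then have "i - (k + 1) < length x" "k + 1 + (i - (k + 1)) = i" using n by auto
   then show False using x1[of "i - (k + 1)"] ki(2) by (auto split: if_splits)
  qed
 qed
 show "dx ?h = x" unfolding dx_def K S by (rule nth_equalityI) (use x1 in \<open>auto split: if_splits\<close>)
 show "ds ?h (length s) = s" unfolding ds_def S by (rule nth_equalityI) (use s1 in \<open>auto split: if_splits\<close>)
qed

section \<open>Hard-wired instances and the uniform machine\<close>

fun eqs :: "nat => nat list => mem => bool" where
 "eqs i [] h = True"
| "eqs i (a # as) h = (inp h i = a \<and> eqs (Suc i) as h)"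

lemma pc_eqs: "pc (%h. of_bool (eqs i as h))"
proof (induction as arbitrary: i)
 case Nil
 show ?case by (simp add: pc_const)
next
 case (Cons a as)
 show ?case unfolding eqs.simps by (intro pc_conj pc_eq pc_inp pc_const Cons)
qed

lemma eqs_iff: "eqs i as h \<longleftrightarrow> (\<forall>j<length as. inp h (i + j) = as ! j)"
proof (induction as arbitrary: i)
 case (Cons a as)
 show ?case unfolding eqs.simps Cons by (auto simp: less_Suc_eq_0_disj)
qed simp

lemma eqs_word:
 assumes "set w \<subseteq> {1, 2, 3}" "set v \<subseteq> {1, 2, 3}"
 shows "length w = length v \<and> eqs 0 v (w, e) \<longleftrightarrow> w = v"
proof -
 have "inp (w, e) i = w ! i" if "i < length w" for i
 proof -
  have "w ! i \<in> {1, 2, 3}" using assms(1) nth_mem[OF that] by blast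
  then show ?thesis using that by (auto simp: inp_def)
 qed
 then show ?thesis by (auto simp: eqs_iff list_eq_iff_nth_eq)
qed

fun tabl :: "(nat list \<times> bool list) list => (mem => bool list) => mem => bool list" where
 "tabl [] X h = X h"
| "tabl (p # ps) X h = (if hd0 h = length (fst p) \<and> eqs 0 (fst p) h then snd p else tabl ps X h)"

lemma cs_tabl: "cs X ==> cs (tabl ps X)"
proof (induction ps)
 case Nil
 then show ?case by (rule cs_cong) simp
next
 case (Cons p ps)
 have "cs (%h. if hd0 h = length (fst p) \<and> eqs 0 (fst p) h then snd p else tabl ps X h)"
  by (intro cs_if pc_conj pc_eq pc_hd0 pc_const pc_eqs cs_const Cons)
 then show ?case by (rule cs_cong) simp
qed

lemma tabl_hit:
 assumes "set w \<subseteq> {1, 2, 3}" "\<And>p. p \<in> set ps ==> set (fst p) \<subseteq> {1, 2, 3}"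
  "\<And>p. p \<in> set ps ==> fst p = w ==> snd p = v" "w \<in> fst ` set ps \<or> X (w, [length w]) = v"
 shows "tabl ps X (w, [length w]) = v"
 using assms(2-)
proof (induction ps)
 case (Cons p ps)
 have e: "hd0 (w, [length w]) = length (fst p) \<and> eqs 0 (fst p) (w, [length w]) \<longleftrightarrow> w = fst p"
  using eqs_word[OF assms(1) Cons.prems(1)[of p]] by (simp add: hd0_def vget_def)
 show ?case unfolding tabl.simps e using Cons.prems(2)[of p] Cons.prems Cons.IH by auto
qed simp

text \<open>From \<open>n0\<close> on the entropy bound is read off the input, so \<open>k\<close>
  may be any function; the finitely many instances below \<open>n0\<close> are built into the
  machine.\<close>

lemma explicit_of_pext:
 fixes G :: "nat => bool list => bool list => bool list"
 assumes d: "\<And>n. d n = (if n < n0 then dG n else r * rd c n)"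
  and E: "\<And>n. E n = (if n < n0 then G n else pext c n r (k n - crt (lg n)))"
 shows "explicit_family k d E"
proof -
 define X where "X h = pext c (length (dx h)) r (dK h - crt (lg (length (dx h)))) (dx h) (ds h (r * rd c (length (dx h))))" for h
 have n: "pc (%h. length (dx h))" by (intro pci cs_dx)
 have csX: "cs X" unfolding X_def[abs_def]
  by (intro cs_pext pci n cs_dx cs_ds pc_rd) (simp add: ds_def)
 define I where "I = (SIGMA n:{2..<n0}. bits n \<times> bits (d n))"
 have finI: "finite I" unfolding I_def by simp
 define f where "f = (%(n, x, s). (enc_tuple [replicate (k n) True, x, s], G n x s))"
 obtain ps where ps: "set ps = f ` I" using finite_list[OF finite_imageI[OF finI, of f]] by blast
 obtain M a e where M: "wf_tm M" "\<And>w. set w \<subseteq> {1, 2, 3} ==>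
   outputs_within M (a + a * length w ^ e) w (enc_bits (tabl ps X (w, [length w])))"
  using tm_of_cs[OF cs_tabl[OF csX]] by blast
 have main: "tabl ps X (w, [length w]) = E n x s"
  if w: "w = enc_tuple [replicate (k n) True, x, s]" and nxs: "2 \<le> n" "x \<in> bits n" "s \<in> bits (d n)" for w n x s
 proof (rule tabl_hit)
  note D = decode[OF w]
  show "set w \<subseteq> {1, 2, 3}" by (rule D)
  show "set (fst p) \<subseteq> {1, 2, 3}" if pp: "p \<in> set ps" for p
  proof -
   obtain n' x' s' where "p = f (n', x', s')" using pp unfolding ps by auto
   then have "fst p = enc_tuple [replicate (k n') True, x', s']" by (simp add: f_def)
   then show ?thesis by (rule decode(1))
  qed
  \<comment> \<open>The table is consistent: an input word determines x, hence n, and then also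
    s.\<close>
  show "snd p = E n x s" if p: "p \<in> set ps" "fst p = w" for p
  proof -
   obtain n' x' s' where i: "(n', x', s') \<in> I" "p = f (n', x', s')" using p(1) unfolding ps by auto
   have w': "w = enc_tuple [replicate (k n') True, x', s']" using p(2) i(2) by (simp add: f_def)
   have xx: "x' = x" using decode(3)[OF w'] D(3) by simp
   then have nn: "n' = n" using i(1) nxs by (simp add: I_def)
   have len: "length (enc_tuple [replicate k True, x, s]) = k + length x + length s + 3" for k x s
    by (simp add: enc_tuple_def enc_bits_def)
   have "k n + length x + length s + 3 = k n' + length x' + length s' + 3"
    unfolding len[symmetric] w[symmetric] w'[symmetric] ..
   then have "length s' = length s" using xx nn by simp
   then have ls: "length s' = length s" .
   have "s' = ds (w, [length w]) (length s')" by (rule decode(4)[OF w', symmetric])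
   also have "... = s" unfolding ls by (rule D(4))
   finally have ss: "s' = s" .
   have "n < n0" using i(1) nn by (simp add: I_def)
   then have "E n = G n" unfolding E by (rule if_P)
   moreover have "snd p = G n x s" unfolding i(2) f_def nn xx ss by simp
   ultimately show ?thesis by simp
  qed
  show "w \<in> fst ` set ps \<or> X (w, [length w]) = E n x s"
  proof (cases "n < n0")
   case True
   then have "(n, x, s) \<in> I" using nxs by (simp add: I_def)
   then have "f (n, x, s) \<in> set ps" unfolding ps by blast
   then have "fst (f (n, x, s)) \<in> fst ` set ps" by (rule imageI)
   moreover have "fst (f (n, x, s)) = w" unfolding f_def w by simp
   ultimately have "w \<in> fst ` set ps" by (simp only:)
   then show ?thesis ..
  next
   case False
   then have "length s = r * rd c n" using nxs d by simp
   then have "ds (w, [length w]) (r * rd c n) = s" using D(4) by simp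
   moreover have "length (dx (w, [length w])) = n" unfolding D(3) using nxs by simp
   moreover have "E n = pext c n r (k n - crt (lg n))" unfolding E by (rule if_not_P[OF False])
   ultimately have "X (w, [length w]) = E n x s" unfolding X_def D(2,3) by (simp only: D(3))
   then show ?thesis ..
  qed
 qed
 show ?thesis unfolding explicit_family_def poly_time_computable_def
 proof (rule exI[of _ M], rule exI[of _ a], rule exI[of _ e], intro conjI ballI)
  show "wf_tm M" by (rule M)
  fix i assume "i \<in> {(n, x, s). 2 \<le> n \<and> x \<in> bits n \<and> s \<in> bits (d n)}"
  then obtain n x s where i: "i = (n, x, s)" and nxs: "2 \<le> n" "x \<in> bits n" "s \<in> bits (d n)" by blast
  let ?w = "enc_tuple [replicate (k n) True, x, s]"
  have "outputs_within M (a + a * length ?w ^ e) ?w (enc_bits (tabl ps X (?w, [length ?w])))"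
   by (rule M(2)[OF decode(1)[OF refl]])
  then show "outputs_within M (a + a * length (enc_tuple (case i of (n, x, s) => [replicate (k n) True, x, s])) ^ e)
   (enc_tuple (case i of (n, x, s) => [replicate (k n) True, x, s])) (enc_bits (case i of (n, x, s) => E n x s))"
   unfolding i prod.case main[OF refl nxs] .
 qed
qed

subsection \<open>Growth of the parameters\<close>

lemma exp_beats_power: "\<exists>a0. \<forall>a\<ge>a0. (a::nat) ^ A \<le> 2 ^ a"
proof -
 have "(%x. real x ^ A / exp (ln 2 * real x)) \<longlonglongrightarrow> 0"
 proof -
  have "((%x. x ^ A / exp x) \<longlongrightarrow> (0::real)) at_top" by (rule tendsto_power_div_exp_0)
  moreover have "filterlim (%x. ln 2 * real x) at_top sequentially"
   by (rule filterlim_tendsto_pos_mult_at_top[OF tendsto_const _ filterlim_real_sequentially]) simp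
  ultimately have "(%x. (ln 2 * real x) ^ A / exp (ln 2 * real x)) \<longlonglongrightarrow> 0" by (rule filterlim_compose)
  then have "(%x. (1 / ln 2) ^ A * ((ln 2 * real x) ^ A / exp (ln 2 * real x))) \<longlonglongrightarrow> (1 / ln 2) ^ A * 0"
   by (intro tendsto_mult tendsto_const)
  then show ?thesis by (simp add: power_mult_distrib power_divide)
 qed
 then have "\<forall>\<^sub>F x in sequentially. real x ^ A / exp (ln 2 * real x) < 1" by (rule order_tendstoD) simp
 then obtain a0 where a0: "\<And>a. a \<ge> a0 ==> real a ^ A / exp (ln 2 * real a) < 1" unfolding eventually_sequentially by blast
 show ?thesis
 proof (intro exI[of _ a0] allI impI)
  fix a assume "a0 \<le> a"
  then have "real a ^ A < exp (ln 2 * real a)" using a0[of a] by simp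
  also have "exp (ln 2 * real a) = 2 powr real a" by (simp add: powr_def mult.commute)
  also have "... = 2 ^ a" by (rule powr_realpow) simp
  finally have "real (a ^ A) \<le> real (2 ^ a)" by simp
  then show "a ^ A \<le> 2 ^ a" by (simp only: of_nat_le_iff)
 qed
qed

lemma crt_ge: "(a + 1) ^ 3 \<le> l ==> a \<le> crt l"
proof (rule ccontr)
 assume a: "(a + 1) ^ 3 \<le> l" "\<not> a \<le> crt l"
 then have "(crt l + 1) ^ 3 \<le> (a + 1) ^ 3" by (intro power_mono) auto
 then show False using a crt_bounds(2)[of l] by linarith
qed

lemma lg_ge: "2 ^ a \<le> n ==> a \<le> lg n"
proof -
 assume "2 ^ a \<le> n"
 then have "(2::nat) ^ a < 2 ^ (lg n + 1)" using lg_bounds(2)[of n] by linarith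
 then have "a < lg n + 1" by (rule power_less_imp_less_exp[rotated]) simp
 then show ?thesis by simp
qed

text \<open>Dividing by \<lambda> four times divides by at least lg n; this is the origin of the
  factor 4 in the number of rounds.\<close>

lemma lam_pow4: "1000 \<le> crt l ==> l \<le> crt l ^ 4"
proof -
 assume a: "1000 \<le> crt l"
 have "l \<le> (crt l + 1) ^ 3" using crt_bounds(2)[of l] by simp
 also have "... \<le> (2 * crt l) ^ 3" using a by (intro power_mono) auto
 also have "... = 8 * crt l ^ 3" by (simp add: power3_eq_cube)
 also have "... \<le> crt l * crt l ^ 3" using a by (intro mult_right_mono) auto
 finally show ?thesis by (simp only: power_Suc[symmetric]) simp
qed

lemma eventually_big: "\<exists>n0. \<forall>n\<ge>n0. big n c \<and> B \<le> lg n"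
proof -
 obtain a0 where a0: "\<And>a. a0 \<le> a ==> (a::nat) ^ (4 * (564 + 48 * c)) \<le> 2 ^ a" using exp_beats_power by blast
 define a where "a = max 1000 a0"
 define n0 where "n0 = (2::nat) ^ ((a + 1) ^ 3 + B)"
 show ?thesis
 proof (intro exI[of _ n0] allI impI conjI)
  fix n assume "n0 \<le> n"
  then have l: "(a + 1) ^ 3 + B \<le> lg n" unfolding n0_def by (rule lg_ge)
  then have ac: "a \<le> crt (lg n)" by (intro crt_ge) linarith
  then have 1: "1000 \<le> crt (lg n)" "a0 \<le> crt (lg n)" unfolding a_def by auto
  have "lg n ^ (564 + 48 * c) \<le> (crt (lg n) ^ 4) ^ (564 + 48 * c)" by (intro power_mono lam_pow4 1) simp
  also have "... \<le> 2 ^ crt (lg n)" using a0[OF 1(2)] by (simp only: power_mult[symmetric])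
  finally show "big n c" using 1 by unfold_locales
  show "B \<le> lg n" using l by linarith
 qed
qed

lemma log_lg:
 assumes "2 \<le> n"
 shows "real (lg n) \<le> log 2 (real n)" "log 2 (real n) \<le> real (lg n) + 1" "1 \<le> log 2 (real n)"
proof -
 have n: "0 < n" using assms by simp
 have "real (2 ^ lg n) \<le> real n" using lg_bounds(1)[OF n] by (rule of_nat_mono)
 then show "real (lg n) \<le> log 2 (real n)" using n by (subst le_log_iff) (auto simp: powr_realpow)
 have "real n \<le> real (2 ^ (lg n + 1))" using lg_bounds(2)[of n] by (intro of_nat_mono) simp
 then have "log 2 (real n) \<le> log 2 (2 ^ (lg n + 1))" using n by (subst log_le_cancel_iff) auto
 also have "... = real (lg n + 1)" by (subst log_nat_power) auto
 finally show "log 2 (real n) \<le> real (lg n) + 1" by simp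
 show "1 \<le> log 2 (real n)" using assms by (subst le_log_iff) auto
qed

lemma le_two_powr: "0 \<le> x ==> x \<le> 2 powr (x::real)"
proof -
 assume x: "0 \<le> x"
 have "x < real (nat \<lfloor>x\<rfloor> + 1)" using x by linarith
 also have "... \<le> real (2 ^ nat \<lfloor>x\<rfloor>)" using less_exp[of "nat \<lfloor>x\<rfloor>"] by (intro of_nat_mono) linarith
 also have "... = 2 powr real (nat \<lfloor>x\<rfloor>)" by (simp add: powr_realpow)
 also have "... \<le> 2 powr x" using x by (intro powr_mono) auto
 finally show ?thesis by simp
qed

lemma small_instance:
 fixes c1 :: real
 assumes n: "2 \<le> n" and c1: "1 \<le> c1"
 shows "\<exists>d E. is_extractor n d k (real k) (2 / log 2 (real n) powr c1) E \<and> real d \<le> 13 * (c1 * log 2 (real n))"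
proof -
 define L where "L = log 2 (real n)"
 define j where "j = nat \<lceil>c1 * log 2 L\<rceil>"
 define eps where "eps = (1::real) / 2 ^ j"
 \<comment> \<open>Then 2^d * eps^2 is 64 * 2^(lg n) * 2^j, enough for \<open>exists_cext\<close>.
   With L = log n the seed has at most L + 6 + 3 (c1 * L + 1) bits, which is at most 13 * c1 *
   L.\<close>
 define d where "d = lg n + 6 + 3 * j"
 have L1: "1 \<le> L" "real (lg n) \<le> L" unfolding L_def using log_lg[OF n] by auto
 have lL: "0 \<le> log 2 L" using L1 by simp
 have cl: "0 \<le> c1 * log 2 L" using lL c1 by simp
 have j: "c1 * log 2 L \<le> real j" "real j \<le> c1 * log 2 L + 1" using cl unfolding j_def by linarith+
 have "L powr c1 = 2 powr (c1 * log 2 L)" using L1 by (simp add: powr_def log_def)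
 also have "... \<le> 2 powr real j" using j(1) by simp
 also have "... = 2 ^ j" by (rule powr_realpow) simp
 finally have Lj: "L powr c1 \<le> 2 ^ j" .
 have eps: "0 < eps" "eps \<le> 1" by (simp_all add: eps_def)
 have "4 * (real n + 1 / eps) < 2 ^ d * eps\<^sup>2"
 proof -
  have "real n \<le> real (2 ^ (lg n + 1))" using lg_bounds(2)[of n] by (intro of_nat_mono) simp
  then have 1: "real n \<le> 2 * 2 ^ lg n" by simp
  define A where "A = (2::real) ^ lg n"
  define B where "B = (2::real) ^ j"
  have AB: "1 \<le> A" "1 \<le> B" by (simp_all add: A_def B_def)
  have p3: "(2::real) ^ (3 * j) = B ^ 3" unfolding B_def by (simp only: power_mult[symmetric] mult.commute)
  have "(2::real) ^ d = A * 64 * B ^ 3" unfolding d_def power_add p3 A_def by simp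
  then have "2 ^ d * eps\<^sup>2 = 64 * (A * B)"
   using AB by (simp add: eps_def B_def[symmetric] power2_eq_square power3_eq_cube)
  moreover have "A * 1 \<le> A * B" "1 * B \<le> A * B" using AB by (intro mult_mono; simp)+
  moreover have "4 * (real n + 1 / eps) \<le> 8 * A + 4 * B" using 1 by (simp add: eps_def A_def B_def)
  moreover have "X < Y" if "Y = 64 * C" "A * 1 \<le> C" "1 * B \<le> C" "X \<le> 8 * A + 4 * B" for X Y C :: real
   using that AB by linarith
  ultimately show ?thesis by blast
 qed
 then obtain E where E: "\<And>x s. E x s \<in> bits k" "cext n d k (eps * 2 ^ k) eps E"
  using exists_cext[OF eps, of n d k] by blast
 have "is_extractor n d k (real k) (eps + eps) E"
  by (rule extractor_of_cext[OF E(2) E(1)]) (use eps in \<open>auto simp: powr_realpow\<close>)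
 moreover have "eps + eps \<le> 2 / L powr c1"
 proof -
  have "1 / 2 ^ j \<le> 1 / L powr c1" using Lj L1 by (intro divide_left_mono) auto
  then show ?thesis by (simp add: eps_def)
 qed
 ultimately have "is_extractor n d k (real k) (2 / L powr c1) E"
  unfolding is_extractor_def by (meson order_trans)
 moreover have "real d \<le> 13 * (c1 * L)"
 proof -
  have "log 2 L \<le> L"
  proof -
   have "L \<le> 2 powr L" by (rule le_two_powr) (use L1 in simp)
   then show ?thesis using L1 by (subst log_le_iff) auto
  qed
  then have "c1 * log 2 L \<le> c1 * L" using c1 by (intro mult_left_mono) auto
  moreover have "1 * L \<le> c1 * L" "1 * 1 \<le> c1 * L" using c1 L1 by (intro mult_mono; simp)+
  moreover have "real d = real (lg n) + 6 + 3 * real j" by (simp add: d_def)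
  ultimately show ?thesis using j(2) L1 by linarith
 qed
 ultimately show ?thesis unfolding L_def by blast
qed

lemma large_instance:
 assumes "big n c" and r: "r \<le> lg n" and k: "lg n ^ (r + 20) \<le> k" "k \<le> n"
 shows "is_extractor n (r * rd c n) (k - crt (lg n) - (k - crt (lg n)) div crt (lg n) ^ r) (real k)
  (real (10 * r + 1) / real (lg n ^ c)) (pext c n r (k - crt (lg n)))"
proof -
 interpret big n c by (rule assms)
 \<comment> \<open>\<lambda> bits of entropy are given up so that the r * e * 2^kp possible bad
   inputs have total probability at most 1 / e.\<close>
 let ?kp = "k - lm"
 have l0: "1 \<le> l" using l1000 by simp
 have e0: "0 < real e" using e1 l1000 by simp
 have lk: "2 * l ^ (13 + r) \<le> k"
 proof -
  have "2 * l ^ (13 + r) \<le> l * l ^ (13 + r)" using l1000 by (intro mult_right_mono) auto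
  also have "... = l ^ (14 + r)" by (simp only: power_Suc[symmetric]) simp
  also have "... \<le> l ^ (r + 20)" using l0 by (intro power_increasing) auto
  finally show ?thesis using k(1) by linarith
 qed
 have l1: "l \<le> l ^ (13 + r)" using l0 by (intro self_le_power) auto
 have lmk: "lm \<le> k" using lam1 l1 lk by linarith
 have bigkp: "l ^ (13 + r) \<le> ?kp" using lam1 l1 lk by linarith
 \<comment> \<open>Every round divides the remaining entropy by \<lambda>, which is at most l, so
   the growth of k leaves the l^13 that \<open>round_cext\<close> demands.\<close>
 have step: "l ^ 13 \<le> ?kp div lm ^ j" if "j < r" for j
 proof -
  have "l ^ 13 * lm ^ j \<le> l ^ 13 * l ^ r"
  proof (rule mult_left_mono)
   have "lm ^ j \<le> l ^ j" by (intro power_mono lam1) simp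
   also have "... \<le> l ^ r" using that l0 by (intro power_increasing) auto
   finally show "lm ^ j \<le> l ^ r" .
  qed simp
  also have "... \<le> ?kp" using bigkp by (simp only: power_add)
  finally have "l ^ 13 * lm ^ j \<le> ?kp" .
  moreover have "0 < lm ^ j" using lam by simp
  ultimately show ?thesis by (simp only: less_eq_div_iff_mult_less_eq)
 qed
 have kpn: "?kp \<le> n" using k(2) by simp
 note P = pext_cext[OF kpn step]
 have K: "real (r * e) * 2 ^ ?kp \<le> 1 / e * 2 powr real k"
 proof -
  have "r * e * e \<le> l * e * e" using r by (intro mult_right_mono) auto
  also have "... = l ^ (1 + c + c)" by (simp only: power_add power_one_right)
  also have "... \<le> 2 ^ lm" by (rule pw_le) simp
  finally have "real (r * e * e) \<le> real (2 ^ lm)" by (rule nat_le_real)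
  then have 1: "real (r * e) * real e \<le> 2 ^ lm" by (simp only: of_nat_mult of_nat_power of_nat_numeral)
  have "real (r * e) * 2 ^ ?kp * real e = real (r * e) * real e * 2 ^ ?kp" by (simp only: ac_simps)
  also have "... \<le> 2 ^ lm * 2 ^ ?kp" using 1 by (intro mult_right_mono) auto
  also have "... = 2 ^ k" using lmk by (simp only: power_add[symmetric]) simp
  also have "... = 2 powr real k" by (simp add: powr_realpow)
  finally have "real (r * e) * 2 ^ ?kp * real e \<le> 2 powr real k" .
  then show ?thesis using e0 unfolding times_divide_eq_left mult_1_left by (subst pos_le_divide_eq)
 qed
 have "is_extractor n (r * rd c n) (?kp - ?kp div lm ^ r) (real k) (real r * (10 / e) + 1 / e) (pext c n r ?kp)"
  by (rule extractor_of_cext[OF P[THEN conjunct1] _ K]) (use P[THEN conjunct2] in auto)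
 moreover have "real r * (10 / real e) + 1 / e = real (10 * r + 1) / real e" by (simp add: add_divide_distrib mult.commute)
 ultimately show ?thesis by simp
qed

text \<open>There are at most 12 * c2 rounds with seeds of at most 65 * lg n bits, which gives 780.
  Lost are the \<lambda> bits given up at the start and the entropy behind the last round, each at
  most k / log^c2 n. The additional power of lg n in the error absorbs 10 * r + 1 and the factor
  2^c1, rounded up, from log n \<le> 2 * lg n.\<close>

lemma large_bounds:
 fixes c1 c2 :: real
 assumes n: "2 \<le> n" and B: "big n (nat \<lceil>c1\<rceil> + 1)" and c1: "1 \<le> c1" and c2: "1 \<le> c2"
  and r: "r = 4 * (nat \<lceil>c2\<rceil> + 1)" and l: "(10 * r + 1) * 2 ^ nat \<lceil>c1\<rceil> \<le> lg n" "2 ^ nat \<lceil>c2\<rceil> \<le> lg n"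
  and k: "lg n ^ (r + 20) \<le> k"
 shows "real (r * rd (nat \<lceil>c1\<rceil> + 1) n) \<le> 800 * (c1 * c2 * log 2 (real n))"
  "\<bar>real k - real (k - crt (lg n) - (k - crt (lg n)) div crt (lg n) ^ r)\<bar> \<le> 800 * (real k / log 2 (real n) powr c2)"
  "real (10 * r + 1) / real (lg n ^ (nat \<lceil>c1\<rceil> + 1)) \<le> 1 / log 2 (real n) powr c1"
proof -
 define a1 where "a1 = nat \<lceil>c1\<rceil>"
 define a2 where "a2 = nat \<lceil>c2\<rceil>"
 interpret big n "nat \<lceil>c1\<rceil> + 1" by (rule B)
 define L where "L = log 2 (real n)"
 have L: "real l \<le> L" "L \<le> real l + 1" "1 \<le> L" unfolding L_def by (rule log_lg[OF n])+
 have l0: "1 \<le> real l" "0 < l" "1 \<le> l" using l1000 by simp_all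
 have a: "c1 \<le> real a1" "c2 \<le> real a2" "real a2 \<le> c2 + 1" using c1 c2 unfolding a1_def a2_def by linarith+
 have Lp: "L powr x \<le> 2 ^ y * real l ^ y" if "x \<le> real y" for x y
 proof -
  have "L powr x \<le> L powr real y" using that L by (intro powr_mono) auto
  also have "... = L ^ y" using L by (intro powr_realpow) simp
  also have "... \<le> (2 * real l) ^ y" using L l0 by (intro power_mono) auto
  finally show ?thesis by (simp only: power_mult_distrib)
 qed
 show "real (r * rd (nat \<lceil>c1\<rceil> + 1) n) \<le> 800 * (c1 * c2 * log 2 (real n))"
 proof -
  have "r * rd (nat \<lceil>c1\<rceil> + 1) n \<le> r * (65 * l)" by (intro mult_left_mono rd_le) simp
  then have "real (r * rd (nat \<lceil>c1\<rceil> + 1) n) \<le> real (r * (65 * l))" by (rule nat_le_real)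
  also have "... = real r * (65 * real l)" by simp
  also have "... \<le> (12 * c2) * (65 * L)"
  proof (rule mult_mono)
   have "real r = 4 * real a2 + 4" unfolding r a2_def by simp
   then show "real r \<le> 12 * c2" using a(3) c2 by linarith
  qed (use L c2 in auto)
  also have "... = 780 * (1 * c2 * L)" by simp
  also have "... \<le> 800 * (c1 * c2 * L)" using c1 c2 L by (intro mult_mono) auto
  finally show ?thesis unfolding L_def .
 qed
 have Lc2: "L powr c2 \<le> real l ^ (a2 + 1)"
 proof -
  have "L powr c2 \<le> 2 ^ a2 * real l ^ a2" by (rule Lp[OF a(2)])
  also have "... \<le> real l * real l ^ a2"
  proof (rule mult_right_mono)
   show "2 ^ a2 \<le> real l" using nat_le_real[OF l(2)] unfolding a2_def by simp
  qed simp
  finally show ?thesis by simp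
 qed
 have Lpos: "0 < L powr c2" using L by simp
 show "\<bar>real k - real (k - crt (lg n) - (k - crt (lg n)) div crt (lg n) ^ r)\<bar> \<le> 800 * (real k / log 2 (real n) powr c2)"
 proof -
  let ?kp = "k - lm"
  have kl: "l * l ^ (a2 + 1) \<le> k"
  proof -
   have "l * l ^ (a2 + 1) = l ^ (a2 + 2)" by simp
   also have "... \<le> l ^ (r + 20)"
   proof (rule power_increasing)
    have "x + 2 \<le> 4 * (x + 1) + 20" for x :: nat by simp
    then show "a2 + 2 \<le> r + 20" unfolding r a2_def .
   qed (rule l0)
   finally show ?thesis using k by linarith
  qed
  have "l * 1 \<le> l * l ^ (a2 + 1)" using l0 by (intro mult_left_mono) auto
  then have lmk: "lm \<le> k" using kl lam1 by linarith
  have "?kp div lm ^ r \<le> ?kp" by simp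
  moreover have "real k - real (k - x - y) = real x + real y" if "x \<le> k" "y \<le> k - x" for x y
   using that by (simp add: of_nat_diff)
  ultimately have "real k - real (?kp - ?kp div lm ^ r) = real lm + real (?kp div lm ^ r)" using lmk by blast
  moreover have "real lm \<le> real k / L powr c2"
  proof -
   have "real lm * L powr c2 \<le> real l * real l ^ (a2 + 1)" using lam1 Lc2 Lpos by (intro mult_mono) auto
   also have "... \<le> real k" using nat_le_real[OF kl] by simp
   finally show ?thesis using Lpos by (subst pos_le_divide_eq)
  qed
  moreover have "real (?kp div lm ^ r) \<le> real k / L powr c2"
  proof -
   have "0 < lm ^ r" using lam by simp
   then have "real (?kp div lm ^ r) \<le> real ?kp / real (lm ^ r)" by (rule nat_div_bounds)
   also have "... \<le> real k / L powr c2"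
   proof (rule frac_le)
    have "l ^ (a2 + 1) \<le> (lm ^ 4) ^ (a2 + 1)" by (intro power_mono lam_pow4 lam) simp
    also have "... = lm ^ r" unfolding r a2_def by (simp only: power_mult[symmetric])
    finally have "real (l ^ (a2 + 1)) \<le> real (lm ^ r)" by (rule nat_le_real)
    then show "L powr c2 \<le> real (lm ^ r)" using Lc2 by simp
   qed (use Lpos in auto)
   finally show ?thesis .
  qed
  moreover have "0 \<le> real k / L powr c2" by simp
  ultimately show ?thesis unfolding L_def[symmetric] by linarith
 qed
 show "real (10 * r + 1) / real (lg n ^ (nat \<lceil>c1\<rceil> + 1)) \<le> 1 / log 2 (real n) powr c1"
 proof -
  have "real (10 * r + 1) * L powr c1 \<le> real (10 * r + 1) * (2 ^ a1 * real l ^ a1)" by (intro mult_left_mono Lp a) simp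
  also have "... = real ((10 * r + 1) * 2 ^ a1) * real l ^ a1" by (simp only: of_nat_mult of_nat_power of_nat_numeral mult.assoc)
  also have "... \<le> real l * real l ^ a1" using nat_le_real[OF l(1)] unfolding a1_def by (intro mult_right_mono) auto
  finally have 1: "real (10 * r + 1) * L powr c1 \<le> real (l ^ (a1 + 1))" by simp
  have "0 < L powr c1" using L by simp
  then have "real (10 * r + 1) \<le> real (l ^ (a1 + 1)) / L powr c1" using 1 by (subst pos_le_divide_eq)
  then have 2: "real (10 * r + 1) \<le> 1 / L powr c1 * real (l ^ (a1 + 1))" by simp
  have "0 < real (l ^ (a1 + 1))" using l0 by simp
  then have "real (10 * r + 1) / real (l ^ (a1 + 1)) \<le> 1 / L powr c1" using 2 by (subst pos_divide_le_eq)
  then show ?thesis unfolding L_def a1_def .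
 qed
qed

theorem theorem28:
  shows "\<exists>C::real. C > 0 \<and>
    (\<forall>c1::real. \<forall>c2::real. \<forall>k::nat \<Rightarrow> nat.
       c1 \<ge> 1 \<longrightarrow> c2 \<ge> 1 \<longrightarrow>
       (\<forall>n\<ge>2. 0 < k n \<and> k n < n) \<longrightarrow> superpolylog k \<longrightarrow>
       (\<exists>(d::nat \<Rightarrow> nat) (m::nat \<Rightarrow> nat) (\<epsilon>::nat \<Rightarrow> real)
          (E::nat \<Rightarrow> bool list \<Rightarrow> bool list \<Rightarrow> bool list).
          explicit_family k d E \<and>
          (\<forall>n\<ge>2.
             is_extractor n (d n) (m n) (real (k n)) (\<epsilon> n) (E n) \<and>
             real (d n) \<le> C * (c1 * c2 * log 2 (real n)) \<and>
             \<bar>real (k n) - real (m n)\<bar> \<le> C * (real (k n) / log 2 (real n) powr c2) \<and>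
             \<bar>\<epsilon> n\<bar> \<le> C * (1 / log 2 (real n) powr c1))))"
proof (intro exI[of _ "800::real"] conjI allI impI)
 show "(0::real) < 800" by simp
 fix c1 c2 :: real and k :: "nat => nat"
 assume c: "1 \<le> c1" "1 \<le> c2" and kn: "\<forall>n\<ge>2. 0 < k n \<and> k n < n" and sp: "superpolylog k"
 define c' where "c' = nat \<lceil>c1\<rceil> + 1"
 define r where "r = 4 * (nat \<lceil>c2\<rceil> + 1)"
 obtain n1 where n1: "\<And>n. n1 \<le> n ==> big n c' \<and> (10 * r + 1) * 2 ^ nat \<lceil>c1\<rceil> + 2 ^ nat \<lceil>c2\<rceil> \<le> lg n"
  using eventually_big[of c' "(10 * r + 1) * 2 ^ nat \<lceil>c1\<rceil> + 2 ^ nat \<lceil>c2\<rceil>"] by blast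
 have "(%n. log 2 (real n) powr real (r + 20)) \<in> o(%n. real (k n))" using sp unfolding superpolylog_def by blast
 then have "\<forall>\<^sub>F n in sequentially. norm (log 2 (real n) powr real (r + 20)) \<le> 1 * norm (real (k n))"
  by (rule landau_o.smallD) simp
 then obtain n2 where n2: "\<And>n. n2 \<le> n ==> log 2 (real n) powr real (r + 20) \<le> real (k n)"
  unfolding eventually_sequentially by force
 \<comment> \<open>The threshold depends on c1, c2 and k, the constant 800 on none of them: shorter
   lengths are served by \<open>small_instance\<close>, whose constants are absolute as
   well.\<close>
 define n0 where "n0 = max n1 n2"
 have kb: "lg n ^ (r + 20) \<le> k n" if "n0 \<le> n" "2 \<le> n" for n
 proof -
  have L: "real (lg n) \<le> log 2 (real n)" "1 \<le> log 2 (real n)" using log_lg[OF that(2)] by auto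
  have "real (lg n) ^ (r + 20) \<le> log 2 (real n) ^ (r + 20)" using L by (intro power_mono) auto
  also have "... = log 2 (real n) powr real (r + 20)" using L by (intro powr_realpow[symmetric]) simp
  also have "... \<le> real (k n)" using n2 that unfolding n0_def by simp
  finally have "real (lg n ^ (r + 20)) \<le> real (k n)" by simp
  then show ?thesis by (simp only: of_nat_le_iff)
 qed
 have "\<forall>n. \<exists>d E. 2 \<le> n \<longrightarrow> is_extractor n d (k n) (real (k n)) (2 / log 2 (real n) powr c1) E \<and> real d \<le> 13 * (c1 * log 2 (real n))"
  using small_instance[OF _ c(1)] by blast
 then obtain dG G where G: "\<And>n. 2 \<le> n ==> is_extractor n (dG n) (k n) (real (k n)) (2 / log 2 (real n) powr c1) (G n)"
  "\<And>n. 2 \<le> n ==> real (dG n) \<le> 13 * (c1 * log 2 (real n))" by metis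
 define d where "d n = (if n < n0 then dG n else r * rd c' n)" for n
 define E where "E n = (if n < n0 then G n else pext c' n r (k n - crt (lg n)))" for n
 define m where "m n = (if n < n0 then k n else k n - crt (lg n) - (k n - crt (lg n)) div crt (lg n) ^ r)" for n
 define eps where "eps n = (if n < n0 then 2 / log 2 (real n) powr c1 else real (10 * r + 1) / real (lg n ^ c'))" for n
 have "explicit_family k d E" by (rule explicit_of_pext[OF d_def E_def])
 moreover have "is_extractor n (d n) (m n) (real (k n)) (eps n) (E n) \<and>
       real (d n) \<le> 800 * (c1 * c2 * log 2 (real n)) \<and>
       \<bar>real (k n) - real (m n)\<bar> \<le> 800 * (real (k n) / log 2 (real n) powr c2) \<and>
       \<bar>eps n\<bar> \<le> 800 * (1 / log 2 (real n) powr c1)" if n: "2 \<le> n" for n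
 proof (cases "n < n0")
  case True
  have L: "1 \<le> log 2 (real n)" by (rule log_lg[OF n])
  have "c1 * 1 * log 2 (real n) \<le> c1 * c2 * log 2 (real n)" using c L by (intro mult_mono) auto
  moreover have "0 \<le> c1 * log 2 (real n)" using c L by (intro mult_nonneg_nonneg) auto
  moreover have "real (d n) \<le> 13 * (c1 * log 2 (real n))" using G(2)[OF n] True by (simp add: d_def)
  moreover have "D \<le> 800 * Y" if "c1 * 1 * z \<le> Y" "0 \<le> c1 * z" "D \<le> 13 * (c1 * z)" for D Y z :: real
   using that by simp
  ultimately have "real (d n) \<le> 800 * (c1 * c2 * log 2 (real n))" by blast
  moreover have "2 / log 2 (real n) powr c1 \<le> 800 * (1 / log 2 (real n) powr c1)" by (simp add: divide_right_mono)
  ultimately show ?thesis using G(1)[OF n] True by (simp add: d_def E_def m_def eps_def)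
 next
  case False
  then have n0: "n0 \<le> n" by simp
  then have b: "big n c'" "(10 * r + 1) * 2 ^ nat \<lceil>c1\<rceil> \<le> lg n" "2 ^ nat \<lceil>c2\<rceil> \<le> lg n"
   using n1[of n] unfolding n0_def by auto
  have "r * 1 \<le> (10 * r + 1) * 2 ^ nat \<lceil>c1\<rceil>" by (intro mult_mono) auto
  then have rl: "r \<le> lg n" using b(2) by linarith
  have kn': "k n \<le> n" using kn n by (simp add: less_imp_le)
  note bounds = large_bounds[OF n b(1)[unfolded c'_def] c r_def b(2,3) kb[OF n0 n], folded c'_def]
  have "\<bar>eps n\<bar> = real (10 * r + 1) / real (lg n ^ c')" unfolding eps_def using False by simp
  also have "... \<le> 1 * (1 / log 2 (real n) powr c1)" using bounds(3) by simp
  also have "... \<le> 800 * (1 / log 2 (real n) powr c1)" by (intro mult_right_mono) auto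
  finally have e: "\<bar>eps n\<bar> \<le> 800 * (1 / log 2 (real n) powr c1)" .
  have X: "is_extractor n (d n) (m n) (real (k n)) (eps n) (E n)"
   unfolding d_def m_def eps_def E_def if_not_P[OF False] by (rule large_instance[OF b(1) rl kb[OF n0 n] kn'])
  show ?thesis using X e bounds(1,2) unfolding d_def m_def if_not_P[OF False] by blast
 qed
 ultimately show "\<exists>d m eps E. explicit_family k d E \<and>
     (\<forall>n\<ge>2.
       is_extractor n (d n) (m n) (real (k n)) (eps n) (E n) \<and>
       real (d n) \<le> 800 * (c1 * c2 * log 2 (real n)) \<and>
       \<bar>real (k n) - real (m n)\<bar> \<le> 800 * (real (k n) / log 2 (real n) powr c2) \<and>
       \<bar>eps n\<bar> \<le> 800 * (1 / log 2 (real n) powr c1))" by blast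
qed

end
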